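(* Let $\mathcal{M}$ be a $\sigma$-finite infinite factor, let $A\in\mathcal{M}^+$ and let $\{B_j\}_{j=1}^\infty\subseteq\mathcal{M}^+$ with $\alpha:=\sup_{j\ge1}\|B_j\|<\infty$. Assume that for all $j$, $N_A\prec N_{B_j}$ and $0\in\sigma_e(B_j)$ when $\mathcal{M}$ is semifinite (resp., $0\in\sigma(B_j)$ when $\mathcal{M}$ is of type III). Each of the following two conditions is sufficient for the existence of operators $C_j\cong B_j$ such that $A=\sum_{j=1}^\infty C_j$: (i) $\|A\|_e>\alpha$ when $\mathcal{M}$ is semifinite (resp., $\|A\|>\alpha$ when $\mathcal{M}$ is of type III), and there are a $\beta>0$ and a non-zero projection $P\in\mathcal{M}$ for which $P\prec\chi_{(\beta,\infty)}(B_j)$ for infinitely many integers $j$. (ii) $\|A\|_e\ge\alpha$ when $\mathcal{M}$ is semifinite (resp., $\|A\|\ge\alpha$ when $\mathcal{M}$ is of type III), $\chi_{\{\alpha\}}(B_j)=0$ for every $j$, and there are $0<\beta<\gamma<\alpha$ and a non-zero projection $P\in\mathcal{M}$ for which $P\prec\chi_{(\beta,\gamma]}(B_j)$ for infinitely many integers $j$.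
   Context: $\mathcal{M}$ acts on a Hilbert space; $\mathcal{M}^+$ is its set of positive elements. A $\sigma$-finite infinite factor is either semifinite (type I$_\infty$ or II$_\infty$) or of type III. When $\mathcal{M}$ is semifinite, $\mathcal{J}$ is the norm-closed two-sided ideal generated by the finite projections of $\mathcal{M}$, $\pi:\mathcal{M}\to\mathcal{M}/\mathcal{J}$ is the quotient map, $\|A\|_e=\|\pi(A)\|$ and $\sigma_e(A)=\sigma(\pi(A))$. $C\cong B$ means $C=UBU^*$ for some unitary $U\in\mathcal{M}$. For projections, $P\prec Q$ means $P$ is Murray-von Neumann equivalent in $\mathcal{M}$ to a subprojection of $Q$. $N_A$ is the projection on the null space of $A$, and $\chi_S(B)$ is the spectral projection of $B$ for the Borel set $S$. Infinite sums of operators converge in the strong operator topology. *)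

theory Defs
  imports "HOL-Analysis.Analysis" "HOL-Algebra.QuotRing"
begin

section \<open>Complex Hilbert spaces and their bounded operators\<close>

text \<open>The inner product is linear in its first argument. Positive definiteness of \<open>cinner\<close> follows
  from the last axiom, because \<open>norm\<close> is a norm and \<open>sqrt\<close> of a negative real number is negative.\<close>

class complex_hilbert_space = banach +
  fixes scaleC :: "complex \<Rightarrow> 'a \<Rightarrow> 'a" (infixr \<open>*\<^sub>C\<close> 75)
    and cinner :: "'a \<Rightarrow> 'a \<Rightarrow> complex"
  assumes scaleC_add_right: "c *\<^sub>C (x + y) = c *\<^sub>C x + c *\<^sub>C y"
    and scaleC_add_left: "(c + d) *\<^sub>C x = c *\<^sub>C x + d *\<^sub>C x"
    and scaleC_scaleC: "c *\<^sub>C (d *\<^sub>C x) = (c * d) *\<^sub>C x"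
    and scaleC_of_real: "complex_of_real r *\<^sub>C x = r *\<^sub>R x"
    and cinner_commute: "cinner x y = cnj (cinner y x)"
    and cinner_add_left: "cinner (x + y) z = cinner x z + cinner y z"
    and cinner_scaleC_left: "cinner (c *\<^sub>C x) y = c * cinner x y"
    and norm_eq_sqrt_cinner: "norm x = sqrt (Re (cinner x x))"

lemma norm_scaleC: "norm (c *\<^sub>C x) = cmod c * norm (x :: 'a :: complex_hilbert_space)"
proof -
  have "cinner (c *\<^sub>C x) (c *\<^sub>C x) = c * cnj c * cinner x x"
    by (metis cinner_commute cinner_scaleC_left complex_cnj_mult mult.assoc)
  then show ?thesis
    by (simp add: norm_eq_sqrt_cinner complex_mult_cnj real_sqrt_mult cmod_def)
qed

text \<open>The type of bounded operators of the library consists of the bounded \<^emph>\<open>real\<close>-linear maps;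
  \<open>complex_linear\<close> singles out the operators on the complex Hilbert space.\<close>

definition complex_linear :: "('a :: complex_hilbert_space \<Rightarrow>\<^sub>L 'a) \<Rightarrow> bool" where
  "complex_linear T \<longleftrightarrow> (\<forall>c x. blinfun_apply T (c *\<^sub>C x) = c *\<^sub>C blinfun_apply T x)"

lift_definition scalar_op :: "complex \<Rightarrow> ('a :: complex_hilbert_space \<Rightarrow>\<^sub>L 'a)"
  is "\<lambda>c x. c *\<^sub>C x"
proof
  fix c :: complex
  show "c *\<^sub>C (x + y) = c *\<^sub>C x + c *\<^sub>C y" for x y :: 'a
    by (rule scaleC_add_right)
  show "c *\<^sub>C (r *\<^sub>R x) = r *\<^sub>R (c *\<^sub>C x)" for r and x :: 'a
    by (simp add: scaleC_scaleC mult.commute flip: scaleC_of_real)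
  show "\<exists>K. \<forall>x :: 'a. norm (c *\<^sub>C x) \<le> norm x * K"
    by (metis norm_scaleC mult.commute order_refl)
qed

definition adj :: "('a :: complex_hilbert_space \<Rightarrow>\<^sub>L 'a) \<Rightarrow> ('a \<Rightarrow>\<^sub>L 'a)" where
  "adj T = (THE S. \<forall>x y. cinner (blinfun_apply T x) y = cinner x (blinfun_apply S y))"

definition positive_op :: "('a :: complex_hilbert_space \<Rightarrow>\<^sub>L 'a) \<Rightarrow> bool" where
  "positive_op T \<longleftrightarrow> complex_linear T \<and> (\<forall>x. cinner (blinfun_apply T x) x \<in> \<real>\<^sub>\<ge>\<^sub>0)"

definition projection :: "('a :: complex_hilbert_space \<Rightarrow>\<^sub>L 'a) \<Rightarrow> bool" where
  "projection P \<longleftrightarrow> complex_linear P \<and> P o\<^sub>L P = P \<and> adj P = P"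

definition subprojection :: "('a :: complex_hilbert_space \<Rightarrow>\<^sub>L 'a) \<Rightarrow> ('a \<Rightarrow>\<^sub>L 'a) \<Rightarrow> bool" where
  "subprojection P Q \<longleftrightarrow> projection P \<and> projection Q \<and> Q o\<^sub>L P = P"

definition null_projection :: "('a :: complex_hilbert_space \<Rightarrow>\<^sub>L 'a) \<Rightarrow> ('a \<Rightarrow>\<^sub>L 'a)" where
  "null_projection T =
     (THE P. projection P \<and> range (blinfun_apply P) = {x. blinfun_apply T x = 0})"


section \<open>Spectral projections of self-adjoint operators\<close>

text \<open>\<open>E\<close> is a projection-valued measure on the Borel sets of the real line, countably additive in
  the strong operator topology and with bounded support, and \<open>T\<close> is the integral of \<open>t\<close> with
  respect to \<open>E\<close>. The integral is taken weakly: by polarization \<open>T\<close> is determined by its quadratic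
  form.\<close>

definition spectral_scalar_measure ::
    "(real set \<Rightarrow> ('a :: complex_hilbert_space \<Rightarrow>\<^sub>L 'a)) \<Rightarrow> 'a \<Rightarrow> real measure" where
  "spectral_scalar_measure E x =
     measure_of UNIV (sets borel) (\<lambda>S. ennreal (Re (cinner (blinfun_apply (E S) x) x)))"

definition spectral_measure_of ::
    "('a :: complex_hilbert_space \<Rightarrow>\<^sub>L 'a) \<Rightarrow> (real set \<Rightarrow> ('a \<Rightarrow>\<^sub>L 'a)) \<Rightarrow> bool" where
  "spectral_measure_of T E \<longleftrightarrow>
     (\<forall>S \<in> sets borel. projection (E S)) \<and>
     E UNIV = id_blinfun \<and>
     (\<forall>S. range S \<subseteq> sets borel \<and> disjoint_family S \<longrightarrow>
        (\<forall>x. (\<lambda>n::nat. blinfun_apply (E (S n)) x) sums blinfun_apply (E (\<Union>n. S n)) x)) \<and>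
     (\<exists>r. E {-r..r} = id_blinfun) \<and>
     (\<forall>x. cinner (blinfun_apply T x) x =
        complex_of_real (\<integral>t. t \<partial>spectral_scalar_measure E x))"

text \<open>Only meaningful for Borel sets \<open>S\<close>, on which the spectral measure of \<open>T\<close> is unique.\<close>

definition spectral_projection ::
    "real set \<Rightarrow> ('a :: complex_hilbert_space \<Rightarrow>\<^sub>L 'a) \<Rightarrow> ('a \<Rightarrow>\<^sub>L 'a)" where
  "spectral_projection S T = (THE P. \<exists>E. spectral_measure_of T E \<and> P = E S)"


section \<open>Von Neumann algebras\<close>

definition commutant ::
    "('a :: complex_hilbert_space \<Rightarrow>\<^sub>L 'a) set \<Rightarrow> ('a \<Rightarrow>\<^sub>L 'a) set" where
  "commutant M = {T. complex_linear T \<and> (\<forall>A \<in> M. T o\<^sub>L A = A o\<^sub>L T)}"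

definition von_neumann_algebra :: "('a :: complex_hilbert_space \<Rightarrow>\<^sub>L 'a) set \<Rightarrow> bool" where
  "von_neumann_algebra M \<longleftrightarrow>
     (\<forall>T \<in> M. complex_linear T \<and> adj T \<in> M) \<and> commutant (commutant M) = M"

definition factor :: "('a :: complex_hilbert_space \<Rightarrow>\<^sub>L 'a) set \<Rightarrow> bool" where
  "factor M \<longleftrightarrow> von_neumann_algebra M \<and> M \<inter> commutant M = range scalar_op"

definition mvn_equivalent ::
    "('a :: complex_hilbert_space \<Rightarrow>\<^sub>L 'a) set \<Rightarrow> ('a \<Rightarrow>\<^sub>L 'a) \<Rightarrow> ('a \<Rightarrow>\<^sub>L 'a) \<Rightarrow> bool" where
  "mvn_equivalent M P Q \<longleftrightarrow> (\<exists>V \<in> M. adj V o\<^sub>L V = P \<and> V o\<^sub>L adj V = Q)"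

definition mvn_subequivalent ::
    "('a :: complex_hilbert_space \<Rightarrow>\<^sub>L 'a) set \<Rightarrow> ('a \<Rightarrow>\<^sub>L 'a) \<Rightarrow> ('a \<Rightarrow>\<^sub>L 'a) \<Rightarrow> bool" where
  "mvn_subequivalent M P Q \<longleftrightarrow> (\<exists>R \<in> M. subprojection R Q \<and> mvn_equivalent M P R)"

definition finite_projection ::
    "('a :: complex_hilbert_space \<Rightarrow>\<^sub>L 'a) set \<Rightarrow> ('a \<Rightarrow>\<^sub>L 'a) \<Rightarrow> bool" where
  "finite_projection M P \<longleftrightarrow> P \<in> M \<and> projection P \<and>
     (\<forall>Q \<in> M. subprojection Q P \<and> mvn_equivalent M Q P \<longrightarrow> Q = P)"

definition infinite_algebra :: "('a :: complex_hilbert_space \<Rightarrow>\<^sub>L 'a) set \<Rightarrow> bool" where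
  "infinite_algebra M \<longleftrightarrow> \<not> finite_projection M id_blinfun"

definition sigma_finite_algebra :: "('a :: complex_hilbert_space \<Rightarrow>\<^sub>L 'a) set \<Rightarrow> bool" where
  "sigma_finite_algebra M \<longleftrightarrow>
     (\<forall>F. (\<forall>P \<in> F. P \<in> M \<and> projection P \<and> P \<noteq> 0) \<and> pairwise (\<lambda>P Q. P o\<^sub>L Q = 0) F
        \<longrightarrow> countable F)"

definition semifinite_algebra :: "('a :: complex_hilbert_space \<Rightarrow>\<^sub>L 'a) set \<Rightarrow> bool" where
  "semifinite_algebra M \<longleftrightarrow>
     (\<forall>Z \<in> M \<inter> commutant M. projection Z \<and> Z \<noteq> 0 \<longrightarrow>
        (\<exists>F. finite_projection M F \<and> F \<noteq> 0 \<and> subprojection F Z))"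

definition type_III :: "('a :: complex_hilbert_space \<Rightarrow>\<^sub>L 'a) set \<Rightarrow> bool" where
  "type_III M \<longleftrightarrow> (\<forall>F. finite_projection M F \<longrightarrow> F = 0)"

definition unitary_in ::
    "('a :: complex_hilbert_space \<Rightarrow>\<^sub>L 'a) set \<Rightarrow> ('a \<Rightarrow>\<^sub>L 'a) \<Rightarrow> bool" where
  "unitary_in M U \<longleftrightarrow> U \<in> M \<and> adj U o\<^sub>L U = id_blinfun \<and> U o\<^sub>L adj U = id_blinfun"

definition unitarily_equivalent ::
    "('a :: complex_hilbert_space \<Rightarrow>\<^sub>L 'a) set \<Rightarrow> ('a \<Rightarrow>\<^sub>L 'a) \<Rightarrow> ('a \<Rightarrow>\<^sub>L 'a) \<Rightarrow> bool" where
  "unitarily_equivalent M C B \<longleftrightarrow> (\<exists>U. unitary_in M U \<and> C = U o\<^sub>L B o\<^sub>L adj U)"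

text \<open>Strong operator convergence of the partial sums to \<open>A\<close>.\<close>

definition sot_sums ::
    "(nat \<Rightarrow> ('a :: complex_hilbert_space \<Rightarrow>\<^sub>L 'a)) \<Rightarrow> ('a \<Rightarrow>\<^sub>L 'a) \<Rightarrow> bool" where
  "sot_sums C A \<longleftrightarrow> (\<forall>x. (\<lambda>j. blinfun_apply (C j) x) sums blinfun_apply A x)"


section \<open>Spectrum, essential norm and essential spectrum\<close>

definition operator_ring ::
    "('a :: complex_hilbert_space \<Rightarrow>\<^sub>L 'a) set \<Rightarrow> ('a \<Rightarrow>\<^sub>L 'a) ring" where
  "operator_ring M =
     \<lparr>carrier = M, mult = (o\<^sub>L), one = id_blinfun, zero = 0, add = (+)\<rparr>"

text \<open>Ring ideals of a von Neumann algebra are complex subspaces, since the algebra contains all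
  scalar operators.\<close>

definition finite_projection_ideal ::
    "('a :: complex_hilbert_space \<Rightarrow>\<^sub>L 'a) set \<Rightarrow> ('a \<Rightarrow>\<^sub>L 'a) set" where
  "finite_projection_ideal M =
     \<Inter> {I. ideal I (operator_ring M) \<and> closed I \<and> {P. finite_projection M P} \<subseteq> I}"

definition quotient_algebra ::
    "('a :: complex_hilbert_space \<Rightarrow>\<^sub>L 'a) set \<Rightarrow> ('a \<Rightarrow>\<^sub>L 'a) set ring" where
  "quotient_algebra M = operator_ring M Quot finite_projection_ideal M"

definition quotient_map ::
    "('a :: complex_hilbert_space \<Rightarrow>\<^sub>L 'a) set \<Rightarrow> ('a \<Rightarrow>\<^sub>L 'a) \<Rightarrow> ('a \<Rightarrow>\<^sub>L 'a) set" where
  "quotient_map M T = finite_projection_ideal M +>\<^bsub>operator_ring M\<^esub> T"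

definition quotient_norm :: "('a :: complex_hilbert_space \<Rightarrow>\<^sub>L 'a) set \<Rightarrow> real" where
  "quotient_norm X = (INF T\<in>X. norm T)"

text \<open>The spectrum of \<open>a\<close> in a complex unital algebra \<open>R\<close>; the complex structure enters through
  the map \<open>s\<close> sending \<open>c\<close> to the scalar multiple \<open>c\<close> of the unit of \<open>R\<close>.\<close>

definition algebra_spectrum :: "('b, 'm) ring_scheme \<Rightarrow> (complex \<Rightarrow> 'b) \<Rightarrow> 'b \<Rightarrow> complex set" where
  "algebra_spectrum R s a = {c. a \<ominus>\<^bsub>R\<^esub> s c \<notin> Units R}"

definition spectrum ::
    "('a :: complex_hilbert_space \<Rightarrow>\<^sub>L 'a) set \<Rightarrow> ('a \<Rightarrow>\<^sub>L 'a) \<Rightarrow> complex set" where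
  "spectrum M T = algebra_spectrum (operator_ring M) scalar_op T"

definition essential_norm ::
    "('a :: complex_hilbert_space \<Rightarrow>\<^sub>L 'a) set \<Rightarrow> ('a \<Rightarrow>\<^sub>L 'a) \<Rightarrow> real" where
  "essential_norm M T = quotient_norm (quotient_map M T)"

definition essential_spectrum ::
    "('a :: complex_hilbert_space \<Rightarrow>\<^sub>L 'a) set \<Rightarrow> ('a \<Rightarrow>\<^sub>L 'a) \<Rightarrow> complex set" where
  "essential_spectrum M T =
     algebra_spectrum (quotient_algebra M) (\<lambda>c. quotient_map M (scalar_op c)) (quotient_map M T)"

end

theory Submission
  imports Defs "HOL-Probability.Distribution_Functions"
begin

text \<open>The arguments use only the real inner product \<open>Re \<langle>x, y\<rangle>\<close>, for which every bounded operator has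
  an adjoint. A projection is called large if the identity is subequivalent to it; in a
  \<open>\<sigma>\<close>-finite infinite factor these are the infinite projections.

  Let \<open>G\<^sub>j\<close> be the spectral projection of \<open>B\<^sub>j\<close> for \<open>(\<beta>, \<gamma>]\<close>, with \<open>\<gamma> = \<alpha>\<close> in case (i). The
  hypothesis on the (essential) norm of \<open>A\<close> provides a reserve: orthogonal large projections
  \<open>Q\<^sub>n\<close> commuting with \<open>A\<close> on which \<open>A\<close> exceeds a bound \<open>o\<^sub>n\<close>, where the spectral projections
  of every \<open>B\<^sub>j\<close> for \<open>(-\<infinity>, o\<^sub>n]\<close> increase to the identity. Unitary copies \<open>C\<^sub>j\<close> of the \<open>B\<^sub>j\<close> are
  subtracted one after the other from \<open>A\<close>, such that each remainder \<open>R\<close> is positive, has the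
  kernel of \<open>A\<close> and keeps every third \<open>Q\<^sub>n\<close> as its reserve. The part of \<open>B\<^sub>j\<close> on \<open>G\<^sub>j\<close> is obtained
  by rotating a small operator \<open>\<kappa>Rk\<close> into \<open>Q\<^sub>0\<close>, which makes \<open>\<langle>C\<^sub>j x, x\<rangle>\<close> dominate a multiple of
  \<open>\<parallel>k\<^sup>*Rx\<parallel>\<^sup>2\<close> off the reserve; the other part of \<open>B\<^sub>j\<close> is spread over the remaining \<open>Q\<^sub>n\<close> and, in
  small pieces, over their complement. As \<open>P\<close> is subequivalent to \<open>G\<^sub>j\<close> for infinitely many \<open>j\<close>,
  the contractions \<open>k\<close> can be chosen so that copies of \<open>P\<close> exhausting the space are each met
  infinitely often. The series of the \<open>\<langle>C\<^sub>j x, x\<rangle>\<close> converges, so the remainders tend strongly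
  to zero.\<close>

section \<open>The underlying real Hilbert space\<close>

text \<open>Since 0 \<le> C \<le> R forces C to vanish on the kernel of R, a kernel that grew during
  the subtraction could outgrow the kernel of some later B_j. So each step has to keep the kernel
  unchanged and still make definite progress on vectors outside the reserve. Progress cannot come
  from the small spectral part of B_j, whose weights are not controlled from below. It comes from
  the part on G_j, which lies between two positive constants and need not fit under R as it stands;
  the dilation in \<open>rotation\<close> lets a small prescribed operator act as its corner and
  sends the excess into the reserve. The rest splits: since 0 is in the (essential) spectrum, B_j is
  below any \<delta> > 0 on a large projection, so pieces of it can be given weights as small as
  needed; pieces of size up to o_n need room where R exceeds o_n. Every step spends reserve and
  hands on a subsequence with the same bounds, which works because o_n never decreases. In case (i)
  o_n is a constant strictly between \<alpha> and the (essential) norm of A. In case (ii) it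
  increases to \<alpha>, and the missing atom at \<alpha> makes the spectral projections exhaust the
  identity.\<close>

definition ip :: "'a::complex_hilbert_space \<Rightarrow> 'a \<Rightarrow> real" where
  "ip x y = Re (cinner x y)"

lemma ip_commute: "ip x y = ip y x"
  unfolding ip_def by (subst cinner_commute) simp

lemma cinner_scaleR_left: "cinner (r *\<^sub>R x) y = of_real r * cinner x y"
  by (simp add: cinner_scaleC_left flip: scaleC_of_real)

lemma ip_add_left: "ip (x + y) z = ip x z + ip y z"
  by (simp add: ip_def cinner_add_left)

lemma ip_scaleR_left: "ip (r *\<^sub>R x) y = r * ip x y"
  by (simp add: ip_def cinner_scaleR_left)

lemma ip_self: "ip x x = (norm x)\<^sup>2"
proof -
  have n: "norm x = sqrt (ip x x)"
    by (simp add: ip_def norm_eq_sqrt_cinner)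
  then have "0 \<le> ip x x"
    by (metis norm_ge_zero real_sqrt_ge_0_iff)
  then show ?thesis by (simp add: n)
qed

lemma ip_add_right: "ip x (y + z) = ip x y + ip x z"
  by (metis ip_add_left ip_commute)

lemma ip_scaleR_right: "ip x (r *\<^sub>R y) = r * ip x y"
  by (metis ip_scaleR_left ip_commute)

lemma norm_add_sq: "(norm (x + y))\<^sup>2 = (norm x)\<^sup>2 + 2 * ip x y + (norm y)\<^sup>2"
  by (simp add: ip_add_left ip_add_right ip_commute[of y x] flip: ip_self)

lemma Cauchy_Schwarz_ip: "\<bar>ip x y\<bar> \<le> norm x * norm y"
proof (cases "y = 0")
  case True
  then show ?thesis using ip_scaleR_right[of x 0 y] by simp
next
  case False
  define t where "t = - ip x y / (norm y)\<^sup>2"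
  have "0 \<le> (norm (x + t *\<^sub>R y))\<^sup>2" by simp
  also have "\<dots> = (norm x)\<^sup>2 - (ip x y)\<^sup>2 / (norm y)\<^sup>2"
    unfolding norm_add_sq ip_scaleR_right using False
    by (simp add: t_def field_simps power2_eq_square)
  finally have "(ip x y)\<^sup>2 \<le> (norm x * norm y)\<^sup>2"
    using False by (simp add: field_simps power2_eq_square)
  then show ?thesis
    by (metis abs_le_square_iff abs_of_nonneg mult_nonneg_nonneg norm_ge_zero)
qed

lemma bounded_bilinear_ip: "bounded_bilinear ip"
proof
  show "\<exists>K. \<forall>a b. norm (ip a b) \<le> norm a * norm b * K"
    using Cauchy_Schwarz_ip by (auto intro!: exI[of _ 1])
qed (simp_all add: ip_add_left ip_add_right ip_scaleR_left ip_scaleR_right)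

interpretation ip: bounded_bilinear ip
  by (rule bounded_bilinear_ip)

lemmas ip_simps = ip.add_left ip.add_right ip.diff_left ip.diff_right ip.minus_left ip.minus_right
  ip.zero_left ip.zero_right ip.scaleR_left ip.scaleR_right

lemma norm_diff_sq: "(norm (x - y))\<^sup>2 = (norm x)\<^sup>2 - 2 * ip x y + (norm y)\<^sup>2"
  using norm_add_sq[of x "-y"] by (simp add: ip_simps)

lemma parallelogram: "(norm (x - y :: 'a::complex_hilbert_space))\<^sup>2 = 2 * (norm x)\<^sup>2 + 2 * (norm y)\<^sup>2 - (norm (x + y))\<^sup>2"
  by (simp add: norm_add_sq norm_diff_sq)

lemma ip_eqI: "(\<And>y. ip x y = ip x' y) \<Longrightarrow> x = x'"
  using ip_self[of "x - x'"] by (simp add: ip_simps)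

lemma ip_eqI': "(\<And>y. ip y x = ip y x') \<Longrightarrow> x = x'"
  by (metis ip_eqI ip_commute)

lemma tendsto_apply [tendsto_intros]:
  "(f \<longlongrightarrow> a) F \<Longrightarrow> ((\<lambda>n. blinfun_apply T (f n)) \<longlongrightarrow> blinfun_apply T a) F"
  by (intro tendsto_intros)

lemma ip_apply_le: "\<bar>ip (blinfun_apply T x) x\<bar> \<le> norm T * (norm x)\<^sup>2"
proof -
  have "\<bar>ip (blinfun_apply T x) x\<bar> \<le> norm (blinfun_apply T x) * norm x"
    by (rule Cauchy_Schwarz_ip)
  also have "\<dots> \<le> (norm T * norm x) * norm x"
    by (intro mult_right_mono norm_blinfun) auto
  finally show ?thesis by (simp add: power2_eq_square mult.assoc)
qed

section \<open>Nearest points, Riesz representation and real adjoints\<close>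

lemma nearest_point_orthogonal:
  fixes K :: "'a::complex_hilbert_space set"
  assumes K: "subspace K" "closed K"
  shows "\<exists>y\<in>K. \<forall>z\<in>K. ip (x - y) z = 0"
proof -
  define d where "d = (INF k\<in>K. (norm (x - k))\<^sup>2)"
  have ne: "K \<noteq> {}" using K(1) subspace_0 by blast
  have bdd: "bdd_below ((\<lambda>k. (norm (x - k))\<^sup>2) ` K)"
    by (rule bdd_belowI[of _ 0]) auto
  have dle: "d \<le> (norm (x - k))\<^sup>2" if "k \<in> K" for k
    unfolding d_def by (rule cINF_lower[OF bdd that])
  have "\<exists>k\<in>K. (norm (x - k))\<^sup>2 < d + 1 / (real n + 1)" for n
    using cINF_less_iff[OF ne bdd, of "d + 1 / (real n + 1)"] by (simp add: d_def)
  then obtain k where k: "\<And>n. k n \<in> K" "\<And>n. (norm (x - k n))\<^sup>2 < d + 1 / (real n + 1)"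
    by metis
  \<comment> \<open>The midpoint of \<open>k m\<close> and \<open>k n\<close> stays in K, so its
    distance from x is at least the infimum; the parallelogram law then bounds the distance of the
    two points.\<close>
  have est: "(norm (k m - k n))\<^sup>2 \<le> 2 / (real m + 1) + 2 / (real n + 1)" for m n
  proof -
    have mid: "(1/2) *\<^sub>R (k m + k n) \<in> K"
      using k(1) K(1) by (simp add: subspace_add subspace_scale)
    have "(norm (k m - k n))\<^sup>2 = (norm ((x - k n) - (x - k m)))\<^sup>2" by simp
    also have "\<dots> = 2 * (norm (x - k n))\<^sup>2 + 2 * (norm (x - k m))\<^sup>2
        - (norm ((x - k n) + (x - k m)))\<^sup>2" by (rule parallelogram)
    also have "(x - k n) + (x - k m) = 2 *\<^sub>R (x - (1/2) *\<^sub>R (k m + k n))"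
      by (simp add: algebra_simps scaleR_2)
    also have "(norm \<dots>)\<^sup>2 = 4 * (norm (x - (1/2) *\<^sub>R (k m + k n)))\<^sup>2"
      by (simp add: power_mult_distrib)
    finally show ?thesis using dle[OF mid] k(2)[of m] k(2)[of n] by simp
  qed
  have "Cauchy k"
  proof (rule metric_CauchyI)
    fix e :: real assume e: "0 < e"
    obtain N :: nat where N: "4 / e\<^sup>2 < real N" using reals_Archimedean2 by blast
    have "dist (k m) (k n) < e" if "m \<ge> N" "n \<ge> N" for m n
    proof -
      have le: "2 / (real j + 1) \<le> 2 / (real N + 1)" if "j \<ge> N" for j
        using that by (intro divide_left_mono) auto
      have "(norm (k m - k n))\<^sup>2 \<le> 4 / (real N + 1)"
        using est[of m n] le[OF that(1)] le[OF that(2)] by simp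
      also have "\<dots> < e\<^sup>2" using N e by (simp add: field_simps add_strict_increasing2)
      finally show ?thesis using e by (simp add: dist_norm power_less_imp_less_base)
    qed
    then show "\<exists>M. \<forall>m\<ge>M. \<forall>n\<ge>M. dist (k m) (k n) < e" by blast
  qed
  then obtain y where y: "k \<longlonglongrightarrow> y" by (auto simp: Cauchy_convergent_iff convergent_def)
  then have yK: "y \<in> K" using K(2) k(1) closed_sequentially by blast
  have "(\<lambda>n. (norm (x - k n))\<^sup>2) \<longlonglongrightarrow> (norm (x - y))\<^sup>2" by (intro tendsto_intros y)
  moreover have "(\<lambda>n. d + 1 / (real n + 1)) \<longlonglongrightarrow> d + 0"
    by (intro tendsto_intros) (use LIMSEQ_inverse_real_of_nat in \<open>simp add: inverse_eq_divide add.commute\<close>)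
  ultimately have yd: "(norm (x - y))\<^sup>2 \<le> d"
    using LIMSEQ_le k(2) by (metis (no_types, lifting) add.right_neutral less_imp_le)
  have "ip (x - y) z = 0" if z: "z \<in> K" for z
  proof (rule ccontr)
    assume ne0: "ip (x - y) z \<noteq> 0"
    then have z0: "z \<noteq> 0" by (auto simp: ip_simps)
    \<comment> \<open>The minimiser of the quadratic polynomial giving the squared distance of x
      from \<open>y + t *\<^sub>R z\<close>.\<close>
    define t where "t = ip (x - y) z / (norm z)\<^sup>2"
    have "y + t *\<^sub>R z \<in> K" using yK z K(1) by (simp add: subspace_add subspace_scale)
    then have "d \<le> (norm (x - y - t *\<^sub>R z))\<^sup>2" using dle by (metis diff_diff_eq)
    also have "\<dots> = (norm (x - y))\<^sup>2 - (ip (x - y) z)\<^sup>2 / (norm z)\<^sup>2"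
      unfolding norm_diff_sq ip_scaleR_right using z0
      by (simp add: t_def field_simps power2_eq_square)
    also have "\<dots> < (norm (x - y))\<^sup>2" using ne0 z0 by simp
    finally show False using yd by simp
  qed
  then show ?thesis using yK by blast
qed

lemma riesz_representation:
  fixes f :: "'a::complex_hilbert_space \<Rightarrow> real"
  assumes "bounded_linear f"
  shows "\<exists>z. \<forall>x. f x = ip x z"
proof (cases "\<forall>x. f x = 0")
  case True then show ?thesis by (auto simp: ip_simps intro!: exI[of _ 0])
next
  case False
  then obtain a where a: "f a \<noteq> 0" by blast
  interpret f: bounded_linear f by fact
  have "subspace {x. f x = 0}"
    by (auto simp: subspace_def f.add f.scaleR f.zero)
  moreover have "closed {x. f x = 0}"
    using closed_Collect_eq[of f "\<lambda>_. 0"] linear_continuous_on[OF assms, of UNIV] by simp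
  ultimately obtain y where y: "f y = 0" "\<And>z. f z = 0 \<Longrightarrow> ip (a - y) z = 0"
    using nearest_point_orthogonal[of "{x. f x = 0}" a] by auto
  define b where "b = a - y"
  have fb: "f b \<noteq> 0" using a y by (simp add: b_def f.diff)
  then have b0: "b \<noteq> 0" by (auto simp: f.zero)
  have "f x = ip x ((f b / (norm b)\<^sup>2) *\<^sub>R b)" for x
  proof -
    have "f (x - (f x / f b) *\<^sub>R b) = 0" using fb by (simp add: f.diff f.scaleR)
    then have "ip b (x - (f x / f b) *\<^sub>R b) = 0" using y(2) by (simp add: b_def)
    then have "ip x b = (f x / f b) * (norm b)\<^sup>2" by (simp add: ip_simps ip_self ip_commute)
    then show ?thesis using fb b0 by (simp add: ip_simps)
  qed
  then show ?thesis by blast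
qed

lemma real_adjoint_exists: "\<exists>S. \<forall>x y. ip (blinfun_apply T x) y = ip x (blinfun_apply S y)"
proof -
  have "\<exists>z. \<forall>x. ip (blinfun_apply T x) y = ip x z" for y
    by (rule riesz_representation)
      (intro bounded_linear_compose[OF ip.bounded_linear_left] blinfun.bounded_linear_right)
  then obtain g where g: "\<And>x y. ip (blinfun_apply T x) y = ip x (g y)" by metis
  have "bounded_linear g"
  proof (rule bounded_linear_intro[where K = "norm T"])
    show "g (x + y) = g x + g y" for x y
      by (rule ip_eqI') (simp add: ip_simps flip: g)
    show "g (r *\<^sub>R x) = r *\<^sub>R g x" for r x
      by (rule ip_eqI') (simp add: ip_simps flip: g)
    show "norm (g y) \<le> norm y * norm T" for y
    proof -
      have "norm (g y) * norm (g y) = ip (blinfun_apply T (g y)) y"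
        by (simp add: g ip_self power2_eq_square)
      also have "\<dots> \<le> norm (blinfun_apply T (g y)) * norm y"
        using Cauchy_Schwarz_ip[of "blinfun_apply T (g y)" y] by simp
      also have "\<dots> \<le> (norm T * norm (g y)) * norm y"
        by (intro mult_right_mono norm_blinfun) auto
      finally have "norm (g y) * norm (g y) \<le> (norm T * norm y) * norm (g y)"
        by (simp add: algebra_simps)
      then show ?thesis
        by (cases "norm (g y) = 0") (auto simp: mult.commute)
    qed
  qed
  then show ?thesis using g by (metis bounded_linear_Blinfun_apply)
qed

text \<open>The adjoint for \<open>ip\<close> exists for every bounded real-linear operator, so its
  algebraic laws carry no linearity hypotheses; \<open>adj_eq_radj\<close> identifies it with
  \<open>adj\<close> on complex-linear operators.\<close>

definition radj :: "('a::complex_hilbert_space \<Rightarrow>\<^sub>L 'a) \<Rightarrow> 'a \<Rightarrow>\<^sub>L 'a" where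
  "radj T = (SOME S. \<forall>x y. ip (blinfun_apply T x) y = ip x (blinfun_apply S y))"

lemma radj_ip: "ip (blinfun_apply T x) y = ip x (blinfun_apply (radj T) y)"
  unfolding radj_def using someI_ex[OF real_adjoint_exists] by blast

lemma radj_ip': "ip x (blinfun_apply T y) = ip (blinfun_apply (radj T) x) y"
  by (metis radj_ip ip_commute)

lemma radjI: "(\<And>x y. ip (blinfun_apply T x) y = ip x (blinfun_apply S y)) \<Longrightarrow> radj T = S"
  by (rule blinfun_eqI, rule ip_eqI') (metis radj_ip)

lemma radj_radj [simp]: "radj (radj T) = T"
  by (rule radjI) (metis radj_ip ip_commute)

lemma radj_compose [simp]: "radj (S o\<^sub>L T) = radj T o\<^sub>L radj S"
  by (rule radjI) (simp add: radj_ip)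

lemma radj_add [simp]: "radj (S + T) = radj S + radj T"
  by (rule radjI) (simp add: blinfun.bilinear_simps ip_simps radj_ip)

lemma radj_diff [simp]: "radj (S - T) = radj S - radj T"
  by (rule radjI) (simp add: blinfun.bilinear_simps ip_simps radj_ip)

lemma radj_minus [simp]: "radj (- T) = - radj T"
  by (rule radjI) (simp add: blinfun.bilinear_simps ip_simps radj_ip)

lemma radj_scaleR [simp]: "radj (r *\<^sub>R T) = r *\<^sub>R radj T"
  by (rule radjI) (simp add: blinfun.bilinear_simps ip_simps radj_ip)

lemma radj_id [simp]: "radj id_blinfun = id_blinfun"
  by (rule radjI) simp

lemma radj_zero [simp]: "radj 0 = 0"
  by (rule radjI) (simp add: ip_simps)

lemma radj_sum [simp]: "radj (\<Sum>i\<in>I. T i) = (\<Sum>i\<in>I. radj (T i))"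
  by (induction I rule: infinite_finite_induct) auto

lemma norm_radj_le: "norm (radj T) \<le> norm T"
proof (rule norm_blinfun_bound)
  fix y
  have "norm (radj T y) * norm (radj T y) = ip (T (radj T y)) y"
    by (simp add: radj_ip ip_self power2_eq_square)
  also have "\<dots> \<le> norm (T (radj T y)) * norm y"
    using Cauchy_Schwarz_ip[of "T (radj T y)" y] by simp
  also have "\<dots> \<le> (norm T * norm (radj T y)) * norm y"
    by (intro mult_right_mono norm_blinfun) auto
  finally have "norm (radj T y) * norm (radj T y) \<le> (norm T * norm y) * norm (radj T y)"
    by (simp add: algebra_simps)
  then show "norm (radj T y) \<le> norm T * norm y"
    by (cases "norm (radj T y) = 0") auto
qed simp

lemma norm_radj [simp]: "norm (radj T) = norm T"
  by (metis norm_radj_le radj_radj order_antisym)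

lemma compose_simps:
  "(S o\<^sub>L T) o\<^sub>L U = S o\<^sub>L (T o\<^sub>L U)"
  "S o\<^sub>L (T + U) = (S o\<^sub>L T) + (S o\<^sub>L U)" "(S + T) o\<^sub>L U = (S o\<^sub>L U) + (T o\<^sub>L U)"
  "S o\<^sub>L (T - U) = (S o\<^sub>L T) - (S o\<^sub>L U)" "(S - T) o\<^sub>L U = (S o\<^sub>L U) - (T o\<^sub>L U)"
  "S o\<^sub>L (- T) = - (S o\<^sub>L T)" "(- S) o\<^sub>L T = - (S o\<^sub>L T)"
  "S o\<^sub>L (r *\<^sub>R T) = r *\<^sub>R (S o\<^sub>L T)" "(r *\<^sub>R S) o\<^sub>L T = r *\<^sub>R (S o\<^sub>L T)"
  "id_blinfun o\<^sub>L T = T" "T o\<^sub>L id_blinfun = T" "0 o\<^sub>L T = 0" "T o\<^sub>L 0 = 0"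
  for S T U :: "'a::complex_hilbert_space \<Rightarrow>\<^sub>L 'a"
  by (auto intro!: blinfun_eqI simp: blinfun.bilinear_simps)

lemma sum_compose:
  "(\<Sum>i\<in>I. S i) o\<^sub>L T = (\<Sum>i\<in>I. S i o\<^sub>L T)" "T o\<^sub>L (\<Sum>i\<in>I. S i) = (\<Sum>i\<in>I. T o\<^sub>L S i)"
  for T :: "'a::complex_hilbert_space \<Rightarrow>\<^sub>L 'a"
  by (auto intro!: blinfun_eqI simp: blinfun.bilinear_simps blinfun.sum_left blinfun.sum_right)

section \<open>Projections\<close>

definition proj :: "('a::complex_hilbert_space \<Rightarrow>\<^sub>L 'a) \<Rightarrow> bool" where
  "proj P \<longleftrightarrow> P o\<^sub>L P = P \<and> radj P = P"

lemma proj_idem: "proj P \<Longrightarrow> P o\<^sub>L P = P"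
  and proj_radj: "proj P \<Longrightarrow> radj P = P"
  by (simp_all add: proj_def)

lemma proj_apply: "proj P \<Longrightarrow> P (P x) = P x"
  by (metis proj_def blinfun_apply_blinfun_compose)

lemma proj_ip: "proj P \<Longrightarrow> ip (P x) y = ip x (P y)"
  by (metis proj_def radj_ip)

lemma proj_ip_self: "proj P \<Longrightarrow> ip (P x) x = (norm (P x))\<^sup>2"
  by (metis proj_apply proj_ip ip_self)

lemma proj_0 [simp]: "proj 0" and proj_id [simp]: "proj id_blinfun"
  by (simp_all add: proj_def compose_simps)

lemma proj_norm_le: "proj P \<Longrightarrow> norm (P x) \<le> norm x"
proof -
  assume P: "proj P"
  have "norm (P x) * norm (P x) \<le> norm (P x) * norm x"
    using proj_ip_self[OF P, of x] Cauchy_Schwarz_ip[of "P x" x] by (simp add: power2_eq_square)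
  then show ?thesis by (cases "norm (P x) = 0") auto
qed

lemma proj_norm_sq: "proj P \<Longrightarrow> (norm x)\<^sup>2 = (norm (P x))\<^sup>2 + (norm (x - P x))\<^sup>2"
  by (simp add: norm_diff_sq ip_commute[of x] proj_ip_self)

lemma proj_compl: "proj P \<Longrightarrow> proj (id_blinfun - P)"
  by (simp add: proj_def compose_simps)

lemma proj_add: "proj P \<Longrightarrow> proj Q \<Longrightarrow> P o\<^sub>L Q = 0 \<Longrightarrow> proj (P + Q)"
proof -
  assume a: "proj P" "proj Q" "P o\<^sub>L Q = 0"
  then have "Q o\<^sub>L P = 0" by (metis proj_radj radj_compose radj_zero)
  with a show ?thesis by (simp add: proj_def compose_simps)
qed

lemma proj_orth_commute: "proj P \<Longrightarrow> proj Q \<Longrightarrow> P o\<^sub>L Q = 0 \<Longrightarrow> Q o\<^sub>L P = 0"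
  by (metis proj_radj radj_compose radj_zero)

lemma proj_le_commute: "proj P \<Longrightarrow> proj Q \<Longrightarrow> Q o\<^sub>L P = P \<Longrightarrow> P o\<^sub>L Q = P"
  by (metis proj_radj radj_compose)

lemma proj_diff:
  assumes "proj P" "proj Q" "Q o\<^sub>L P = P" shows "proj (Q - P)"
  using assms proj_le_commute[OF assms] by (simp add: proj_def compose_simps)

lemma proj_compose: "proj P \<Longrightarrow> proj Q \<Longrightarrow> P o\<^sub>L Q = Q o\<^sub>L P \<Longrightarrow> proj (P o\<^sub>L Q)"
proof -
  assume a: "proj P" "proj Q" "P o\<^sub>L Q = Q o\<^sub>L P"
  have "(P o\<^sub>L Q) o\<^sub>L (P o\<^sub>L Q) = P o\<^sub>L (Q o\<^sub>L P) o\<^sub>L Q"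
    by (simp only: compose_simps(1))
  also have "\<dots> = (P o\<^sub>L P) o\<^sub>L (Q o\<^sub>L Q)"
    by (simp only: a(3)[symmetric] compose_simps(1))
  finally show ?thesis using a by (simp add: proj_def)
qed

lemma proj_onto_closed_subspace:
  fixes K :: "'a::complex_hilbert_space set"
  assumes K: "subspace K" "closed K"
  shows "\<exists>P. proj P \<and> range (blinfun_apply P) = K"
proof -
  obtain g where g: "\<And>x. g x \<in> K" "\<And>x z. z \<in> K \<Longrightarrow> ip (x - g x) z = 0"
    using nearest_point_orthogonal[OF K] by metis
  have uniq: "g x = y" if "y \<in> K" "\<And>z. z \<in> K \<Longrightarrow> ip (x - y) z = 0" for x y
  proof -
    have k: "g x - y \<in> K" using K(1) g(1) that(1) by (simp add: subspace_diff)
    have "ip (g x - y) (g x - y) = ip (x - y) (g x - y) - ip (x - g x) (g x - y)"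
      by (simp add: ip_simps)
    also have "\<dots> = 0" using g(2)[OF k, of x] that(2)[OF k] by simp
    finally show ?thesis by (simp add: ip_self)
  qed
  have gK: "g x = x" if "x \<in> K" for x using uniq[of x x] that by (simp add: ip_simps)
  have gn: "norm (g x) \<le> norm x" for x
  proof -
    have "ip x (g x) = (norm (g x))\<^sup>2" using g(2)[OF g(1), of x x] by (simp add: ip_simps ip_self)
    then have "norm (g x) * norm (g x) \<le> norm x * norm (g x)"
      using Cauchy_Schwarz_ip[of x "g x"] by (simp add: power2_eq_square)
    then show ?thesis by (cases "norm (g x) = 0") auto
  qed
  have "bounded_linear g"
  proof (rule bounded_linear_intro[where K = 1])
    show "g (x + y) = g x + g y" for x y
      using g(2)[of _ x] g(2)[of _ y]
      by (intro uniq) (auto simp: K(1) g(1) subspace_add ip_simps algebra_simps)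
    show "g (r *\<^sub>R x) = r *\<^sub>R g x" for r x
      using g(2)[of _ x]
      by (intro uniq) (auto simp: K(1) g(1) subspace_scale ip_simps simp flip: scaleR_diff_right)
  qed (use gn in auto)
  then have P: "blinfun_apply (Blinfun g) = g" by (rule bounded_linear_Blinfun_apply)
  have sym: "ip (g x) y = ip x (g y)" for x y
    using g(2)[OF g(1), of x y] g(2)[OF g(1), of y x] by (simp add: ip_simps ip_commute)
  have "proj (Blinfun g)"
    unfolding proj_def by (auto intro!: blinfun_eqI radjI simp: P gK g(1) sym)
  moreover have "range g = K"
  proof
    show "K \<subseteq> range g" using gK by (metis rangeI subsetI)
  qed (use g(1) in blast)
  ultimately show ?thesis using P by metis
qed

lemma proj_range_eqI:
  assumes P: "proj P" and Q: "proj Q" and r: "range (blinfun_apply P) = range (blinfun_apply Q)"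
  shows "P = Q"
proof -
  have PQ: "Q o\<^sub>L P = P"
    by (rule blinfun_eqI) (metis Q r blinfun_apply_blinfun_compose proj_apply rangeE rangeI)
  have "P o\<^sub>L Q = Q"
    by (rule blinfun_eqI) (metis P r blinfun_apply_blinfun_compose proj_apply rangeE rangeI)
  then show ?thesis using PQ P Q proj_le_commute by metis
qed

lemma proj_eqI: "proj P \<Longrightarrow> proj Q \<Longrightarrow> (\<And>x. P x = x \<longleftrightarrow> Q x = x) \<Longrightarrow> P = Q"
  by (rule proj_range_eqI) (auto simp: image_iff, metis proj_apply, metis proj_apply)

lemma subspace_kernel: "subspace {x. blinfun_apply T x = 0}"
  by (auto simp: subspace_def blinfun.bilinear_simps)

lemma closed_kernel: "closed {x. blinfun_apply T x = 0}"
  by (intro closed_Collect_eq continuous_intros)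

text \<open>Unlike \<open>null_projection\<close>, this denotes the kernel projection of every
  bounded real-linear operator; \<open>null_projection_eq\<close> gives the agreement on
  self-adjoint complex-linear ones.\<close>

definition kerp :: "('a::complex_hilbert_space \<Rightarrow>\<^sub>L 'a) \<Rightarrow> 'a \<Rightarrow>\<^sub>L 'a" where
  "kerp T = (SOME P. proj P \<and> range (blinfun_apply P) = {x. T x = 0})"

lemma kerp: "proj (kerp T)" "range (blinfun_apply (kerp T)) = {x. T x = 0}"
  using someI_ex[OF proj_onto_closed_subspace[OF subspace_kernel closed_kernel, of T]]
  unfolding kerp_def by blast+

lemma apply_kerp: "T (kerp T x) = 0"
  using kerp(2)[of T] by auto

lemma kerp_apply_iff: "kerp T x = x \<longleftrightarrow> T x = 0"
proof
  show "T x = 0" if "kerp T x = x" using apply_kerp[of T x] that by simp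
next
  assume "T x = 0"
  then obtain y where "x = kerp T y" using kerp(2)[of T] by blast
  then show "kerp T x = x" by (simp add: proj_apply[OF kerp(1)])
qed

section \<open>Positive operators, square roots and inverses\<close>

definition psd :: "('a::complex_hilbert_space \<Rightarrow>\<^sub>L 'a) \<Rightarrow> bool" where
  "psd T \<longleftrightarrow> radj T = T \<and> (\<forall>x. 0 \<le> ip (T x) x)"

lemma psd_radj: "psd T \<Longrightarrow> radj T = T"
  and psd_ge0: "psd T \<Longrightarrow> 0 \<le> ip (T x) x"
  by (auto simp: psd_def)

lemma sa_ip: "radj T = T \<Longrightarrow> ip (T x) y = ip x (T y)"
  by (metis radj_ip)

lemma psd_add: "psd S \<Longrightarrow> psd T \<Longrightarrow> psd (S + T)"
  by (simp add: psd_def blinfun.bilinear_simps ip_simps)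

lemma psd_scaleR: "0 \<le> r \<Longrightarrow> psd T \<Longrightarrow> psd (r *\<^sub>R T)"
  by (simp add: psd_def blinfun.bilinear_simps ip_simps)

lemma psd_0 [simp]: "psd 0" and psd_id [simp]: "psd id_blinfun"
  by (simp_all add: psd_def ip_simps ip_self)

lemma psd_conj: "psd T \<Longrightarrow> psd (radj S o\<^sub>L (T o\<^sub>L S))"
  by (simp add: psd_def compose_simps radj_ip[of "radj S"])

lemma psd_conj': "psd T \<Longrightarrow> psd (S o\<^sub>L (T o\<^sub>L radj S))"
  using psd_conj[of T "radj S"] by simp

lemma psd_gram: "psd (radj S o\<^sub>L S)"
  using psd_conj[OF psd_id, of S] by (simp add: compose_simps)

lemma psd_proj: "proj P \<Longrightarrow> psd P"
  by (simp add: psd_def proj_radj proj_ip_self)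

lemma psd_sq: "radj T = T \<Longrightarrow> psd (T o\<^sub>L T)"
  using psd_gram[of T] by simp

lemma psd_CS:
  assumes T: "psd T"
  shows "(ip (T x) y)\<^sup>2 \<le> ip (T x) x * ip (T y) y"
proof -
  have q: "0 \<le> ip (T x) x + 2 * t * ip (T x) y + t\<^sup>2 * ip (T y) y" for t
  proof -
    have "ip (T y) x = ip (T x) y" using sa_ip[OF psd_radj[OF T], of y x] by (simp add: ip_commute)
    then show ?thesis using psd_ge0[OF T, of "x + t *\<^sub>R y"]
      by (simp add: blinfun.bilinear_simps ip_simps power2_eq_square algebra_simps)
  qed
  show ?thesis
  proof (cases "ip (T y) y = 0")
    case True
    have "ip (T x) y = 0"
    proof (rule ccontr)
      assume n: "ip (T x) y \<noteq> 0"
      \<comment> \<open>When the quadratic term vanishes, this parameter gives the polynomial the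
        value -1.\<close>
      show False using q[of "- (ip (T x) x + 1) / (2 * ip (T x) y)"] n True by (simp add: field_simps)
    qed
    then show ?thesis using True by simp
  next
    case False
    then have p: "0 < ip (T y) y" using psd_ge0[OF T, of y] by linarith
    have "0 \<le> ip (T x) x - (ip (T x) y)\<^sup>2 / ip (T y) y"
      using q[of "- ip (T x) y / ip (T y) y"] p by (simp add: field_simps power2_eq_square)
    then show ?thesis using p by (simp add: field_simps)
  qed
qed

lemma psd_kernel: "psd T \<Longrightarrow> ip (T x) x = 0 \<Longrightarrow> T x = 0"
  using psd_CS[of T x "T x"] by (simp add: ip_self)

text \<open>The Cauchy-Schwarz inequality of the form T with second vector \<open>T x\<close>, from
  which one factor \<open>(norm (T x))\<^sup>2\<close> cancels. It turns convergence of quadratic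
  forms into strong convergence.\<close>

lemma psd_norm_sq:
  assumes T: "psd T" and K: "norm T \<le> K"
  shows "(norm (T x))\<^sup>2 \<le> K * ip (T x) x"
proof (cases "T x = 0")
  case True
  then show ?thesis by (simp add: ip_simps)
next
  case False
  have "((norm (T x))\<^sup>2)\<^sup>2 \<le> ip (T x) x * ip (T (T x)) (T x)"
    using psd_CS[OF T, of x "T x"] by (simp add: ip_self)
  also have "\<dots> \<le> ip (T x) x * (K * (norm (T x))\<^sup>2)"
  proof (intro mult_left_mono psd_ge0[OF T])
    have "ip (T (T x)) (T x) \<le> norm T * (norm (T x))\<^sup>2" using ip_apply_le[of T "T x"] by simp
    also have "\<dots> \<le> K * (norm (T x))\<^sup>2" by (intro mult_right_mono K) simp
    finally show "ip (T (T x)) (T x) \<le> K * (norm (T x))\<^sup>2" .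
  qed
  finally have "(norm (T x))\<^sup>2 * (norm (T x))\<^sup>2 \<le> (K * ip (T x) x) * (norm (T x))\<^sup>2"
    by (simp add: power2_eq_square algebra_simps)
  then show ?thesis by (rule mult_right_le_imp_le) (use False in simp)
qed

lemma psd_norm_le:
  assumes T: "psd T" and K: "0 \<le> K" "\<And>x. ip (T x) x \<le> K * (norm x)\<^sup>2"
  shows "norm T \<le> K"
proof (rule norm_blinfun_bound[OF K(1)])
  fix x
  have "((norm (T x))\<^sup>2)\<^sup>2 \<le> ip (T x) x * ip (T (T x)) (T x)"
    using psd_CS[OF T, of x "T x"] by (simp add: ip_self)
  also have "\<dots> \<le> (K * (norm x)\<^sup>2) * (K * (norm (T x))\<^sup>2)"
    by (intro mult_mono K psd_ge0[OF T] mult_nonneg_nonneg) auto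
  finally have h: "(norm (T x))\<^sup>2 * (norm (T x))\<^sup>2 \<le> (K * norm x)\<^sup>2 * (norm (T x))\<^sup>2"
    by (simp add: power2_eq_square algebra_simps)
  have "(norm (T x))\<^sup>2 \<le> (K * norm x)\<^sup>2"
  proof (cases "T x = 0")
    case False
    with h show ?thesis by (intro mult_right_le_imp_le[OF h]) simp
  qed simp
  then show "norm (T x) \<le> K * norm x"
    by (rule power2_le_imp_le) (simp add: K)
qed

lemma psd_antisym: "psd T \<Longrightarrow> psd (- T) \<Longrightarrow> T = 0"
proof (rule blinfun_eqI)
  fix x assume "psd T" "psd (- T)"
  then have "ip (T x) x = 0" using psd_ge0[of T x] psd_ge0[of "-T" x]
    by (simp add: blinfun.bilinear_simps ip_simps)
  then show "T x = blinfun_apply 0 x" using psd_kernel[OF \<open>psd T\<close>] by simp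
qed

subsection \<open>Strong limits\<close>

lemma strong_limit_exists:
  fixes X :: "nat \<Rightarrow> 'a::complex_hilbert_space \<Rightarrow>\<^sub>L 'a"
  assumes K: "\<And>n. norm (X n) \<le> K" and c: "\<And>x. convergent (\<lambda>n. X n x)"
  shows "\<exists>L. \<forall>x. (\<lambda>n. X n x) \<longlonglongrightarrow> blinfun_apply L x"
proof -
  define l where "l x = lim (\<lambda>n. X n x)" for x
  have l: "(\<lambda>n. X n x) \<longlonglongrightarrow> l x" for x
    unfolding l_def using c by (simp add: convergent_LIMSEQ_iff)
  have "bounded_linear l"
  proof (rule bounded_linear_intro[where K = K])
    show "l (x + y) = l x + l y" for x y
    proof (rule LIMSEQ_unique[OF l])
      show "(\<lambda>n. X n (x + y)) \<longlonglongrightarrow> l x + l y"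
        unfolding blinfun.add_right by (intro tendsto_intros l)
    qed
    show "l (r *\<^sub>R x) = r *\<^sub>R l x" for r x
    proof (rule LIMSEQ_unique[OF l])
      show "(\<lambda>n. X n (r *\<^sub>R x)) \<longlonglongrightarrow> r *\<^sub>R l x"
        unfolding blinfun.scaleR_right by (intro tendsto_intros l)
    qed
    show "norm (l x) \<le> norm x * K" for x
    proof (rule LIMSEQ_le_const2[OF tendsto_norm[OF l]], intro exI allI impI)
      fix n
      have "norm (X n x) \<le> norm (X n) * norm x" by (rule norm_blinfun)
      also have "\<dots> \<le> K * norm x" by (intro mult_right_mono K) simp
      finally show "norm (X n x) \<le> norm x * K" by (simp add: mult.commute)
    qed
  qed
  then have "blinfun_apply (Blinfun l) = l" by (rule bounded_linear_Blinfun_apply)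
  then show ?thesis using l by metis
qed

lemma strong_limit_unique:
  "(\<And>x. (\<lambda>n. X n x) \<longlonglongrightarrow> blinfun_apply L x) \<Longrightarrow> (\<And>x. (\<lambda>n. X n x) \<longlonglongrightarrow> blinfun_apply L' x) \<Longrightarrow> L = L'"
  by (rule blinfun_eqI) (metis LIMSEQ_unique)

lemma strong_limit_radj:
  fixes X :: "nat \<Rightarrow> 'a::complex_hilbert_space \<Rightarrow>\<^sub>L 'a"
  assumes "\<And>n. radj (X n) = X n" "\<And>x. (\<lambda>n. X n x) \<longlonglongrightarrow> blinfun_apply L x"
  shows "radj L = L"
proof (rule radjI)
  fix x y
  have "(\<lambda>n. ip (X n x) y) \<longlonglongrightarrow> ip (L x) y" by (intro ip.tendsto tendsto_const assms)
  moreover have "(\<lambda>n. ip (X n x) y) \<longlonglongrightarrow> ip x (L y)"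
    unfolding sa_ip[OF assms(1)] by (intro ip.tendsto tendsto_const assms)
  ultimately show "ip (L x) y = ip x (L y)" by (rule LIMSEQ_unique)
qed

lemma strong_limit_compose:
  fixes X Z :: "nat \<Rightarrow> 'a::complex_hilbert_space \<Rightarrow>\<^sub>L 'a"
  assumes K: "\<And>n. norm (X n) \<le> K"
    and X: "\<And>x. (\<lambda>n. X n x) \<longlonglongrightarrow> blinfun_apply L x" and Z: "(\<lambda>n. z n) \<longlonglongrightarrow> w"
  shows "(\<lambda>n. X n (z n)) \<longlonglongrightarrow> L w"
proof -
  have "(\<lambda>n. X n (z n - w)) \<longlonglongrightarrow> 0"
  proof (rule Lim_null_comparison)
    show "\<forall>\<^sub>F n in sequentially. norm (X n (z n - w)) \<le> K * norm (z n - w)"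
      by (intro always_eventually allI order_trans[OF norm_blinfun] mult_right_mono K norm_ge_zero)
    have "(\<lambda>n. K * norm (z n - w)) \<longlonglongrightarrow> K * norm (w - w)" by (intro tendsto_intros Z)
    then show "(\<lambda>n. K * norm (z n - w)) \<longlonglongrightarrow> 0" by simp
  qed
  then have "(\<lambda>n. X n (z n - w) + X n w) \<longlonglongrightarrow> 0 + L w" by (intro tendsto_intros X)
  then show ?thesis by (simp add: blinfun.bilinear_simps)
qed

text \<open>Bounded monotone forms converge, and \<open>psd_norm_sq\<close> applied to the
  differences \<open>X n - X m\<close> makes the vectors \<open>X n x\<close> a Cauchy
  sequence.\<close>

lemma monotone_strong_limit:
  fixes X :: "nat \<Rightarrow> 'a::complex_hilbert_space \<Rightarrow>\<^sub>L 'a"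
  assumes sa: "\<And>n. radj (X n) = X n" and mono: "\<And>n. psd (X (Suc n) - X n)"
    and bd: "\<And>n x. ip (X n x) x \<le> K * (norm x)\<^sup>2" and K: "0 \<le> K"
  shows "\<exists>L. radj L = L \<and> (\<forall>x. (\<lambda>n. X n x) \<longlonglongrightarrow> L x)"
proof -
  \<comment> \<open>The hypothesis bounds the forms only from above; \<open>norm (X 0)\<close>
    supplies the lower bound, so that \<open>K'\<close> dominates all differences.\<close>
  define K' where "K' = K + norm (X 0)"
  have K': "0 \<le> K'" using K by (simp add: K'_def)
  have mn: "psd (X n - X m)" if "m \<le> n" for m n
    using that
  proof (induction rule: dec_induct)
    case (step n)
    show ?case using psd_add[OF mono[of n] step(3)] by simp
  qed simp
  have nb: "norm (X n - X m) \<le> K'" if "m \<le> n" for m n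
  proof (rule psd_norm_le[OF mn[OF that] K'])
    fix x
    have "ip (X 0 x) x \<le> ip (X m x) x"
      using psd_ge0[OF mn[of 0 m], of x] by (simp add: blinfun.bilinear_simps ip_simps)
    moreover have "- (norm (X 0) * (norm x)\<^sup>2) \<le> ip (X 0 x) x" using ip_apply_le[of "X 0" x] by simp
    ultimately show "ip ((X n - X m) x) x \<le> K' * (norm x)\<^sup>2"
      using bd[of n x] by (simp add: blinfun.bilinear_simps ip_simps K'_def algebra_simps)
  qed
  have est: "(norm (X n x - X m x))\<^sup>2 \<le> K' * (ip (X n x) x - ip (X m x) x)" if "m \<le> n" for m n x
    using psd_norm_sq[OF mn[OF that] nb[OF that], of x] by (simp add: blinfun.bilinear_simps ip_simps)
  have conv: "convergent (\<lambda>n. X n x)" for x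
  proof -
    have "incseq (\<lambda>n. ip (X n x) x)"
      using psd_ge0[OF mono] by (intro incseq_SucI) (simp add: blinfun.bilinear_simps ip_simps)
    then have "convergent (\<lambda>n. ip (X n x) x)"
      using bd[of _ x] by (metis incseq_convergent convergent_def)
    then have C: "Cauchy (\<lambda>n. ip (X n x) x)" by (rule convergent_Cauchy)
    have "Cauchy (\<lambda>n. X n x)"
    proof (rule CauchyI')
      fix e :: real assume e: "0 < e"
      have "0 < e\<^sup>2 / (K' + 1)" using e K' by simp
      then obtain M where M: "\<And>m n. m \<ge> M \<Longrightarrow> n > m \<Longrightarrow> dist (ip (X m x) x) (ip (X n x) x) < e\<^sup>2 / (K' + 1)"
        using C unfolding Cauchy_altdef by blast
      have "dist (X m x) (X n x) < e" if "m \<ge> M" "n > m" for m n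
      proof -
        have "ip (X n x) x - ip (X m x) x < e\<^sup>2 / (K' + 1)"
          using M[OF that] by (simp add: dist_real_def)
        then have "(norm (X n x - X m x))\<^sup>2 \<le> K' * (e\<^sup>2 / (K' + 1))"
          using est[of m n x] that(2) K' by (meson less_imp_le mult_left_mono order_trans)
        also have "\<dots> < e\<^sup>2" using e K' by (simp add: field_simps)
        finally show ?thesis
          using e by (simp add: dist_norm norm_minus_commute power_less_imp_less_base)
      qed
      then show "\<exists>M. \<forall>m\<ge>M. \<forall>n>m. dist (X m x) (X n x) < e" by blast
    qed
    then show ?thesis by (simp add: Cauchy_convergent_iff)
  qed
  have nX: "norm (X n) \<le> K' + norm (X 0)" for n
    using nb[of 0 n] norm_triangle_ineq[of "X n - X 0" "X 0"] by simp
  then obtain L :: "'a \<Rightarrow>\<^sub>L 'a" where L: "\<And>x. (\<lambda>n. X n x) \<longlonglongrightarrow> L x"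
    using strong_limit_exists[of X, OF nX conv] by blast
  then show ?thesis using strong_limit_radj[OF sa L] by blast
qed

subsection \<open>The bicommutant of an operator\<close>

text \<open>X ranges over all bounded real-linear operators. Taking scalar operators for X gives
  complex linearity of S, and taking elements of the commutant gives membership of S in every von
  Neumann algebra that contains T. One relation thus transfers both properties to all functions of
  T.\<close>

definition bicom :: "('a::complex_hilbert_space \<Rightarrow>\<^sub>L 'a) \<Rightarrow> ('a \<Rightarrow>\<^sub>L 'a) \<Rightarrow> bool" where
  "bicom T S \<longleftrightarrow> (\<forall>X. X o\<^sub>L T = T o\<^sub>L X \<longrightarrow> X o\<^sub>L S = S o\<^sub>L X)"

lemma bicomD: "bicom T S \<Longrightarrow> X o\<^sub>L T = T o\<^sub>L X \<Longrightarrow> X o\<^sub>L S = S o\<^sub>L X"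
  by (auto simp: bicom_def)

lemma bicom_refl: "bicom T T" and bicom_id: "bicom T id_blinfun" and bicom_0: "bicom T 0"
  by (auto simp: bicom_def compose_simps)

lemma bicomI: "(\<And>X. X o\<^sub>L T = T o\<^sub>L X \<Longrightarrow> X o\<^sub>L S = S o\<^sub>L X) \<Longrightarrow> bicom T S"
  by (auto simp: bicom_def)

lemma bicom_add: "bicom T S \<Longrightarrow> bicom T S' \<Longrightarrow> bicom T (S + S')"
  by (rule bicomI) (simp add: compose_simps(2,3) bicomD[of T S] bicomD[of T S'])

lemma bicom_diff: "bicom T S \<Longrightarrow> bicom T S' \<Longrightarrow> bicom T (S - S')"
  by (rule bicomI) (simp add: compose_simps(4,5) bicomD[of T S] bicomD[of T S'])

lemma bicom_scaleR: "bicom T S \<Longrightarrow> bicom T (r *\<^sub>R S)"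
  by (rule bicomI) (simp add: compose_simps(8,9) bicomD[of T S])

lemma commute_compose:
  fixes X S S' :: "'a::complex_hilbert_space \<Rightarrow>\<^sub>L 'a"
  assumes "X o\<^sub>L S = S o\<^sub>L X" "X o\<^sub>L S' = S' o\<^sub>L X"
  shows "X o\<^sub>L (S o\<^sub>L S') = (S o\<^sub>L S') o\<^sub>L X"
proof -
  have "X o\<^sub>L (S o\<^sub>L S') = (X o\<^sub>L S) o\<^sub>L S'" by (simp only: compose_simps(1))
  also have "\<dots> = S o\<^sub>L (X o\<^sub>L S')" by (simp only: compose_simps(1) assms(1))
  also have "\<dots> = S o\<^sub>L (S' o\<^sub>L X)" by (simp only: compose_simps(1) assms(2))
  finally show ?thesis by (simp only: compose_simps(1))
qed

lemma bicom_compose: "bicom T S \<Longrightarrow> bicom T S' \<Longrightarrow> bicom T (S o\<^sub>L S')"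
  unfolding bicom_def using commute_compose by blast

lemma bicom_trans: "bicom T S \<Longrightarrow> bicom S U \<Longrightarrow> bicom T U"
  by (auto simp: bicom_def)

lemma bicom_commute: "bicom T S \<Longrightarrow> T o\<^sub>L S = S o\<^sub>L T"
  by (auto simp: bicom_def)

lemma bicom_commute2: "bicom T S \<Longrightarrow> bicom T S' \<Longrightarrow> S o\<^sub>L S' = S' o\<^sub>L S"
  unfolding bicom_def by metis

lemma commute_strong_limit:
  fixes X :: "nat \<Rightarrow> 'a::complex_hilbert_space \<Rightarrow>\<^sub>L 'a"
  assumes "\<And>n. Y o\<^sub>L X n = X n o\<^sub>L Y" "\<And>x. (\<lambda>n. X n x) \<longlonglongrightarrow> blinfun_apply L x"
  shows "Y o\<^sub>L L = L o\<^sub>L Y"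
proof (rule blinfun_eqI)
  fix x
  have "(\<lambda>n. Y (X n x)) \<longlonglongrightarrow> Y (L x)" by (intro tendsto_intros assms)
  moreover have "(\<lambda>n. Y (X n x)) = (\<lambda>n. X n (Y x))"
    using assms(1) by (metis blinfun_apply_blinfun_compose)
  ultimately show "(Y o\<^sub>L L) x = (L o\<^sub>L Y) x"
    using assms(2)[of "Y x"] LIMSEQ_unique by auto
qed

lemma bicom_strong_limit:
  fixes X :: "nat \<Rightarrow> 'a::complex_hilbert_space \<Rightarrow>\<^sub>L 'a"
  assumes "\<And>n. bicom T (X n)" "\<And>x. (\<lambda>n. X n x) \<longlonglongrightarrow> blinfun_apply L x"
  shows "bicom T L"
  unfolding bicom_def using commute_strong_limit[OF _ assms(2)] assms(1) by (auto simp: bicom_def)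

text \<open>The range of P is invariant under X and under its adjoint; the adjoint of the second
  invariance is the missing half of the commutation.\<close>

lemma proj_invariant_commute:
  assumes P: "proj P" and "X o\<^sub>L P = P o\<^sub>L (X o\<^sub>L P)" "radj X o\<^sub>L P = P o\<^sub>L (radj X o\<^sub>L P)"
  shows "X o\<^sub>L P = P o\<^sub>L X"
proof -
  have "radj (radj X o\<^sub>L P) = radj (P o\<^sub>L (radj X o\<^sub>L P))" by (rule arg_cong[OF assms(3)])
  then have "P o\<^sub>L X = P o\<^sub>L (X o\<^sub>L P)" by (simp add: proj_radj[OF P] compose_simps)
  then show ?thesis using assms(2) by simp
qed

lemma bicom_kerp:
  assumes T: "radj T = T"
  shows "bicom T (kerp T)"
  unfolding bicom_def
proof (intro allI impI)
  fix X assume X: "X o\<^sub>L T = T o\<^sub>L X"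
  have inv: "Y o\<^sub>L kerp T = kerp T o\<^sub>L (Y o\<^sub>L kerp T)" if "Y o\<^sub>L T = T o\<^sub>L Y" for Y
  proof (rule blinfun_eqI)
    fix x
    have "T (Y (kerp T x)) = Y (T (kerp T x))" using that by (metis blinfun_apply_blinfun_compose)
    also have "\<dots> = 0" by (simp add: apply_kerp blinfun.bilinear_simps)
    finally show "(Y o\<^sub>L kerp T) x = (kerp T o\<^sub>L (Y o\<^sub>L kerp T)) x"
      using kerp_apply_iff[of T "Y (kerp T x)"] by simp
  qed
  have "radj X o\<^sub>L T = T o\<^sub>L radj X"
    using arg_cong[OF X, of radj] by (simp add: T)
  then show "X o\<^sub>L kerp T = kerp T o\<^sub>L X"
    by (rule proj_invariant_commute[OF kerp(1) inv[OF X] inv])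
qed

subsection \<open>Square roots\<close>

primrec opow :: "('a::complex_hilbert_space \<Rightarrow>\<^sub>L 'a) \<Rightarrow> nat \<Rightarrow> ('a \<Rightarrow>\<^sub>L 'a)" where
  "opow S 0 = id_blinfun"
| "opow S (Suc n) = S o\<^sub>L opow S n"

lemma opow_add: "opow S (m + n) = opow S m o\<^sub>L opow S n"
  by (induction m) (simp_all add: compose_simps)

lemma opow_radj: "radj S = S \<Longrightarrow> radj (opow S n) = opow S n"
proof (induction n)
  case (Suc n)
  have "opow S n o\<^sub>L S = opow S (n + 1)" unfolding opow_add by (simp add: compose_simps)
  then show ?case using Suc by simp
qed simp

lemma psd_opow: "psd S \<Longrightarrow> psd (opow S n)"
proof -
  assume S: "psd S"
  define m where "m = n div 2"
  have r: "radj (opow S m) = opow S m" by (rule opow_radj[OF psd_radj[OF S]])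
  show ?thesis
  proof (cases "even n")
    case True
    then have "opow S n = opow S m o\<^sub>L opow S m"
      unfolding opow_add[symmetric] by (simp add: m_def mult_2[symmetric])
    then show ?thesis using psd_sq[OF r] by simp
  next
    case False
    then have n: "n = m + Suc m" by (simp add: m_def) presburger
    have "opow S n = opow S m o\<^sub>L (S o\<^sub>L opow S m)"
      unfolding n opow_add by simp
    then show ?thesis using psd_conj[OF S, of "opow S m"] r by simp
  qed
qed

text \<open>Polynomials in \<open>S\<close> with nonnegative coefficients: the iteration for the square root stays in
  this cone, which yields monotonicity without a theory of products of positive operators.\<close>

inductive pcone :: "('a::complex_hilbert_space \<Rightarrow>\<^sub>L 'a) \<Rightarrow> ('a \<Rightarrow>\<^sub>L 'a) \<Rightarrow> bool" for S where
  zero: "pcone S 0"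
| pow: "pcone S (opow S n)"
| add: "pcone S a \<Longrightarrow> pcone S b \<Longrightarrow> pcone S (a + b)"
| scale: "0 \<le> r \<Longrightarrow> pcone S a \<Longrightarrow> pcone S (r *\<^sub>R a)"

lemma pcone_mult: "pcone S a \<Longrightarrow> pcone S b \<Longrightarrow> pcone S (a o\<^sub>L b)"
proof (induction rule: pcone.induct)
  case (pow n)
  then show ?case
  proof (induction rule: pcone.induct)
    case (pow m)
    show ?case unfolding opow_add[symmetric] by (rule pcone.pow)
  qed (auto simp: compose_simps intro: pcone.intros)
qed (auto simp: compose_simps intro: pcone.intros)

lemma pcone_psd: "pcone S a \<Longrightarrow> psd S \<Longrightarrow> psd a"
  by (induction rule: pcone.induct) (auto intro: psd_opow psd_add psd_scaleR)

lemma pcone_bicom: "pcone S a \<Longrightarrow> bicom S a"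
proof (induction rule: pcone.induct)
  case (pow n)
  show ?case by (induction n) (auto intro: bicom_id bicom_compose bicom_refl)
qed (auto intro: bicom_0 bicom_add bicom_scaleR)

text \<open>With \<open>S = id_blinfun - T\<close>, the iteration y \<rightarrow> (S + y^2) / 2 from
  0 increases to a fixed point L with 2 L = S + L^2, which says that (1 - L)^2 = T.\<close>

lemma sqrt_exists_contraction:
  assumes T: "psd T" "\<And>x. ip (T x) x \<le> (norm x)\<^sup>2"
  shows "\<exists>R. psd R \<and> R o\<^sub>L R = T \<and> bicom T R"
proof -
  define S where "S = id_blinfun - T"
  have S: "psd S" using T by (simp add: psd_def S_def blinfun.bilinear_simps ip_simps ip_self)
  have S1: "norm S \<le> 1"
    by (rule psd_norm_le[OF S]) (use psd_ge0[OF T(1)] in \<open>auto simp: S_def blinfun.bilinear_simps ip_simps ip_self\<close>)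
  define Y where "Y = rec_nat 0 (\<lambda>_ y. (1/2) *\<^sub>R (S + (y o\<^sub>L y)))"
  have Y0: "Y 0 = 0" and YS: "Y (Suc n) = (1/2) *\<^sub>R (S + (Y n o\<^sub>L Y n))" for n
    by (simp_all add: Y_def)
  have pS: "pcone S S" using pcone.pow[of S 1] by (simp add: compose_simps)
  have Yp: "pcone S (Y n)" for n
  proof (induction n)
    case (Suc n) then show ?case
      unfolding YS by (auto intro!: pcone.scale pcone.add pS pcone_mult)
  qed (simp add: Y0 pcone.zero)
  have Yb: "bicom S (Y n)" for n by (rule pcone_bicom[OF Yp])
  have Ypsd: "psd (Y n)" for n by (rule pcone_psd[OF Yp S])
  have Yd: "pcone S (Y (Suc n) - Y n)" for n
  proof (induction n)
    case 0
    then show ?case by (simp add: Y0 YS pcone.scale pS compose_simps)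
  next
    case (Suc n)
    \<comment> \<open>Commutation lets the difference of squares factor, so an increment is half the
      product of the previous increment with a sum of iterates and stays in the cone.\<close>
    have "Y n o\<^sub>L Y (Suc n) = Y (Suc n) o\<^sub>L Y n" by (rule bicom_commute2[OF Yb Yb])
    then have "Y (Suc (Suc n)) - Y (Suc n) = (1/2) *\<^sub>R ((Y (Suc n) - Y n) o\<^sub>L (Y (Suc n) + Y n))"
      by (subst YS, subst (3) YS) (simp only: compose_simps, simp add: algebra_simps)
    then show ?case by (simp add: pcone.scale pcone_mult pcone.add Suc Yp)
  qed
  have Yn: "norm (Y n) \<le> 1" for n
  proof (induction n)
    case (Suc n)
    have "norm (Y n o\<^sub>L Y n) \<le> norm (Y n) * norm (Y n)" by (rule norm_blinfun_compose)
    also have "\<dots> \<le> 1" using Suc by (simp add: mult_le_one)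
    finally have "norm (S + (Y n o\<^sub>L Y n)) \<le> 2"
      using S1 norm_triangle_ineq[of S "Y n o\<^sub>L Y n"] by linarith
    then show ?case by (simp add: YS)
  qed (simp add: Y0)
  have Yq: "ip (Y n x) x \<le> 1 * (norm x)\<^sup>2" for n x
    using ip_apply_le[of "Y n" x] Yn[of n] mult_right_mono[OF Yn[of n], of "(norm x)\<^sup>2"] by simp
  obtain L where L: "radj L = L" "\<And>x. (\<lambda>n. Y n x) \<longlonglongrightarrow> L x"
    using monotone_strong_limit[of Y 1, OF psd_radj[OF Ypsd] pcone_psd[OF Yd S] Yq] by auto
  have Lq: "ip (L x) x \<le> (norm x)\<^sup>2" for x
    by (rule LIMSEQ_le_const2[OF ip.tendsto[OF L(2) tendsto_const]]) (use Yq in auto)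
  have "L = (1/2) *\<^sub>R (S + (L o\<^sub>L L))"
  proof (rule strong_limit_unique)
    show "(\<lambda>n. Y (Suc n) x) \<longlonglongrightarrow> L x" for x using L(2) by (rule LIMSEQ_Suc)
    have "(\<lambda>n. Y n (Y n x)) \<longlonglongrightarrow> L (L x)" for x
      by (rule strong_limit_compose[OF Yn L(2) L(2)])
    then show "(\<lambda>n. Y (Suc n) x) \<longlonglongrightarrow> ((1/2) *\<^sub>R (S + (L o\<^sub>L L))) x" for x
      using tendsto_scaleR[OF tendsto_const tendsto_add[OF tendsto_const], of "\<lambda>n. Y n (Y n x)" "L (L x)"]
      by (simp add: YS blinfun.bilinear_simps)
  qed
  then have LL: "2 *\<^sub>R L = S + (L o\<^sub>L L)"
    by (metis (no_types, lifting) div_by_1 divide_divide_eq_right scaleR_one scaleR_scaleR times_divide_eq_right mult.right_neutral nonzero_mult_div_cancel_left zero_neq_numeral mult_2_right)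
  define R where "R = id_blinfun - L"
  have "psd R" using Lq L(1) by (simp add: psd_def R_def blinfun.bilinear_simps ip_simps ip_self)
  moreover have "R o\<^sub>L R = T"
    using LL by (simp add: R_def compose_simps S_def scaleR_2 algebra_simps)
  moreover have "bicom T R"
  proof -
    have "bicom S L" by (rule bicom_strong_limit[OF Yb L(2)])
    moreover have "bicom T S" unfolding S_def by (intro bicom_diff bicom_id bicom_refl)
    ultimately show ?thesis unfolding R_def by (intro bicom_diff bicom_id) (rule bicom_trans)
  qed
  ultimately show ?thesis by blast
qed

lemma sqrt_exists:
  assumes T: "psd T"
  shows "\<exists>R. psd R \<and> R o\<^sub>L R = T \<and> bicom T R"
proof -
  define k where "k = norm T + 1"
  have k: "k > 0" by (simp add: k_def add_nonneg_pos)
  have "psd ((1/k) *\<^sub>R T)" using T k by (intro psd_scaleR) auto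
  moreover have "ip (((1/k) *\<^sub>R T) x) x \<le> (norm x)\<^sup>2" for x
  proof -
    have "ip (T x) x \<le> norm T * (norm x)\<^sup>2" using ip_apply_le[of T x] by linarith
    also have "\<dots> \<le> k * (norm x)\<^sup>2" by (intro mult_right_mono) (auto simp: k_def)
    finally show ?thesis using k by (simp add: blinfun.bilinear_simps ip_simps field_simps)
  qed
  ultimately obtain R where R: "psd R" "R o\<^sub>L R = (1/k) *\<^sub>R T" "bicom ((1/k) *\<^sub>R T) R"
    using sqrt_exists_contraction by blast
  have "psd (sqrt k *\<^sub>R R)" using R k by (intro psd_scaleR) auto
  moreover have "(sqrt k *\<^sub>R R) o\<^sub>L (sqrt k *\<^sub>R R) = T"
    using k R(2) by (simp add: compose_simps)
  moreover have "bicom T (sqrt k *\<^sub>R R)"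
    by (intro bicom_scaleR bicom_trans[OF _ R(3)] bicom_refl)
  ultimately show ?thesis by blast
qed

definition sqop :: "('a::complex_hilbert_space \<Rightarrow>\<^sub>L 'a) \<Rightarrow> 'a \<Rightarrow>\<^sub>L 'a" where
  "sqop T = (SOME R. psd R \<and> R o\<^sub>L R = T \<and> bicom T R)"

lemma sqop: "psd T \<Longrightarrow> psd (sqop T)" "psd T \<Longrightarrow> sqop T o\<^sub>L sqop T = T" "psd T \<Longrightarrow> bicom T (sqop T)"
  using someI_ex[OF sqrt_exists, of T] unfolding sqop_def by blast+

lemma norm_sqop: "psd T \<Longrightarrow> (norm (sqop T x))\<^sup>2 = ip (T x) x"
  by (metis sqop(1,2) psd_radj radj_ip ip_self blinfun_apply_blinfun_compose)

subsection \<open>Inverses\<close>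

text \<open>The lower bound makes T injective with closed range. If \<open>y - T x\<close> is
  orthogonal to the range, the form of T at \<open>y - T x\<close> vanishes, so
  \<open>y = T x\<close> and T is onto.\<close>

lemma inverse_exists:
  assumes T: "psd T" and e: "0 < e" "\<And>x. e * (norm x)\<^sup>2 \<le> ip (T x) x"
  shows "\<exists>R. T o\<^sub>L R = id_blinfun \<and> R o\<^sub>L T = id_blinfun \<and> psd R \<and> bicom T R"
proof -
  have lower: "e * norm x \<le> norm (T x)" for x
  proof -
    have "(e * norm x) * norm x \<le> norm (T x) * norm x"
      using e(2)[of x] Cauchy_Schwarz_ip[of "T x" x] by (simp add: power2_eq_square)
    then show ?thesis by (cases "norm x = 0") auto
  qed
  have inj: "x = y" if "T x = T y" for x y
    using lower[of "x - y"] that e(1) by (simp add: blinfun.bilinear_simps mult_le_0_iff)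
  have sub: "subspace (range (blinfun_apply T))"
    by (auto simp: subspace_def image_iff) (metis blinfun.zero_right, metis blinfun.add_right, metis blinfun.scaleR_right)
  have "complete (range (blinfun_apply T))"
    by (rule complete_isometric_image[OF e(1) subspace_UNIV blinfun.bounded_linear_right])
      (use lower in \<open>auto simp: complete_UNIV\<close>)
  then have cl: "closed (range (blinfun_apply T))" by (rule complete_imp_closed)
  have "\<exists>x. T x = y" for y
  proof -
    obtain x where x: "ip (y - T x) (T z) = 0" for z
      using nearest_point_orthogonal[OF sub cl, of y] by blast
    have "ip (T (y - T x)) (y - T x) = 0" using x[of "y - T x"] by (subst ip_commute)
    then have "y - T x = 0" using e(1) e(2)[of "y - T x"] by (simp add: mult_le_0_iff)
    then show ?thesis by (auto intro: sym)
  qed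
  then obtain g where g: "\<And>y. T (g y) = y" by metis
  have gT: "g (T x) = x" for x using inj g by blast
  have "bounded_linear g"
  proof (rule bounded_linear_intro[where K = "1/e"])
    show "g (x + y) = g x + g y" for x y by (rule inj) (simp add: g blinfun.bilinear_simps)
    show "g (r *\<^sub>R x) = r *\<^sub>R g x" for r x by (rule inj) (simp add: g blinfun.bilinear_simps)
    show "norm (g x) \<le> norm x * (1/e)" for x
      using lower[of "g x"] e(1) by (simp add: g field_simps)
  qed
  then have G: "blinfun_apply (Blinfun g) = g" by (rule bounded_linear_Blinfun_apply)
  define R where "R = Blinfun g"
  have TR: "T o\<^sub>L R = id_blinfun" and RT: "R o\<^sub>L T = id_blinfun"
    by (auto intro!: blinfun_eqI simp: R_def G g gT)
  have "radj R = R"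
    by (rule radjI) (metis R_def G g psd_radj[OF T] radj_ip)
  moreover have "0 \<le> ip (R x) x" for x
    using psd_ge0[OF T, of "g x"] by (simp add: R_def G g ip_commute)
  ultimately have "psd R" by (simp add: psd_def)
  moreover have "bicom T R"
    unfolding bicom_def
  proof (intro allI impI)
    fix X assume X: "X o\<^sub>L T = T o\<^sub>L X"
    have "R o\<^sub>L X = R o\<^sub>L ((X o\<^sub>L T) o\<^sub>L R)" by (simp add: compose_simps TR)
    also have "\<dots> = (R o\<^sub>L T) o\<^sub>L (X o\<^sub>L R)" by (simp add: X compose_simps(1))
    finally show "X o\<^sub>L R = R o\<^sub>L X" by (simp add: RT compose_simps)
  qed
  ultimately show ?thesis using TR RT by blast
qed

definition invop :: "('a::complex_hilbert_space \<Rightarrow>\<^sub>L 'a) \<Rightarrow> 'a \<Rightarrow>\<^sub>L 'a" where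
  "invop T = (SOME R. T o\<^sub>L R = id_blinfun \<and> R o\<^sub>L T = id_blinfun \<and> psd R \<and> bicom T R)"

lemma invop:
  assumes "psd T" "0 < e" "\<And>x. e * (norm x)\<^sup>2 \<le> ip (T x) x"
  shows "T o\<^sub>L invop T = id_blinfun" "invop T o\<^sub>L T = id_blinfun" "psd (invop T)" "bicom T (invop T)"
    and "e * ip (invop T x) x \<le> (norm x)\<^sup>2"
proof -
  show i: "T o\<^sub>L invop T = id_blinfun" "invop T o\<^sub>L T = id_blinfun" "psd (invop T)" "bicom T (invop T)"
    using someI_ex[OF inverse_exists[OF assms]] unfolding invop_def by blast+
  define y where "y = invop T x"
  have Ty: "T y = x" using i(1) by (metis y_def blinfun_apply_blinfun_compose blinfun_apply_id_blinfun)
  have q: "e * (norm y)\<^sup>2 \<le> ip x y" using assms(3)[of y] Ty by simp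
  have c: "ip x y \<le> norm x * norm y" using Cauchy_Schwarz_ip[of x y] by simp
  have "(e * norm y) * norm y \<le> norm x * norm y" using q c by (simp add: power2_eq_square mult.assoc)
  then have "e * norm y \<le> norm x" by (cases "norm y = 0") auto
  then have "e * ip x y \<le> norm x * norm x"
    using c assms(2) by (smt (verit, best) mult.assoc mult.commute mult_left_mono norm_ge_zero)
  then show "e * ip (invop T x) x \<le> (norm x)\<^sup>2" by (simp add: y_def ip_commute power2_eq_square)
qed

section \<open>Spectral resolution of a self-adjoint operator\<close>

text \<open>With \<open>D = T - t\<close>, the projection onto the kernel of \<open>|D| + D\<close> is the spectral projection of
  \<open>T\<close> for \<open>(-\<infinity>, t]\<close>.\<close>

lemma spectral_resolution_exists:
  fixes T :: "'a::complex_hilbert_space \<Rightarrow>\<^sub>L 'a"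
  assumes T: "radj T = T"
  shows "\<exists>P. proj P \<and> bicom T P \<and> (\<forall>x. P x = x \<longrightarrow> ip (T x) x \<le> t * (norm x)\<^sup>2) \<and>
    (\<forall>x. P x = 0 \<longrightarrow> x \<noteq> 0 \<longrightarrow> t * (norm x)\<^sup>2 < ip (T x) x)"
proof -
  define D where "D = T - t *\<^sub>R id_blinfun"
  have D: "radj D = D" by (simp add: D_def T)
  have Dq: "ip (D x) x = ip (T x) x - t * (norm x)\<^sup>2" for x
    by (simp add: D_def blinfun.bilinear_simps ip_simps ip_self)
  have bD: "bicom T D" unfolding D_def by (intro bicom_diff bicom_refl bicom_scaleR bicom_id)
  have DD: "psd (D o\<^sub>L D)" by (rule psd_sq[OF D])
  define A where "A = sqop (D o\<^sub>L D)"
  have A: "psd A" "A o\<^sub>L A = D o\<^sub>L D" "bicom (D o\<^sub>L D) A" using sqop[OF DD] by (simp_all add: A_def)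
  have bA: "bicom D A" by (rule bicom_trans[OF bicom_compose A(3)]) (rule bicom_refl)+
  have AD: "D o\<^sub>L A = A o\<^sub>L D" by (rule bicom_commute[OF bA])
  define b where "b = A + D"
  define a where "a = A - D"
  have b: "radj b = b" and a: "radj a = a" by (simp_all add: a_def b_def D psd_radj[OF A(1)])
  have ba: "b o\<^sub>L a = 0" by (simp add: a_def b_def compose_simps AD A(2))
  define P where "P = kerp b"
  have P: "proj P" "\<And>x. P x = x \<longleftrightarrow> b x = 0" using kerp(1) kerp_apply_iff by (auto simp: P_def)
  have "bicom T b" unfolding b_def by (intro bicom_add bD bicom_trans[OF bD bA])
  then have "bicom T P" unfolding P_def by (rule bicom_trans) (rule bicom_kerp[OF b])
  moreover have "ip (T x) x \<le> t * (norm x)\<^sup>2" if "P x = x" for x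
  proof -
    have "D x = - A x" using that P(2) by (simp add: b_def blinfun.bilinear_simps add_eq_0_iff)
    then have "ip (D x) x \<le> 0" using psd_ge0[OF A(1), of x] by (simp add: ip_simps)
    then show ?thesis by (simp add: Dq)
  qed
  moreover have "t * (norm x)\<^sup>2 < ip (T x) x" if x: "P x = 0" "x \<noteq> 0" for x
  proof -
    \<comment> \<open>As b a = 0, the range of a lies in the kernel of b, to which x is
      orthogonal.\<close>
    have "ip (a x) y = 0" for y
    proof -
      have "P (a y) = a y" using ba P(2) by (metis blinfun_apply_blinfun_compose zero_blinfun.rep_eq)
      then have "ip (a x) y = ip (P x) (a y)" by (metis P(1) proj_ip sa_ip[OF a])
      then show ?thesis by (simp add: x ip_simps)
    qed
    then have "a x = 0" using ip_eqI[of "a x" 0] by (simp add: ip_simps)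
    then have DA: "D x = A x" by (simp add: a_def blinfun.bilinear_simps)
    have "ip (A x) x \<noteq> 0"
    proof
      assume "ip (A x) x = 0"
      then have "A x = 0" by (rule psd_kernel[OF A(1)])
      then have "b x = 0" using DA by (simp add: b_def blinfun.bilinear_simps)
      then show False using x P(2) by metis
    qed
    then show ?thesis using psd_ge0[OF A(1), of x] DA Dq[of x] by simp
  qed
  ultimately show ?thesis using P(1) by blast
qed

text \<open>The spectral projection for \<open>{..t}\<close>, described by the quadratic form alone.
  The strict inequality on the orthogonal complement puts the eigenvectors for t inside the
  projection and makes the description unique (\<open>sres_unique\<close>).\<close>

definition sres :: "('a::complex_hilbert_space \<Rightarrow>\<^sub>L 'a) \<Rightarrow> real \<Rightarrow> ('a \<Rightarrow>\<^sub>L 'a)" where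
  "sres T t = (SOME P. proj P \<and> bicom T P \<and> (\<forall>x. P x = x \<longrightarrow> ip (T x) x \<le> t * (norm x)\<^sup>2) \<and>
    (\<forall>x. P x = 0 \<longrightarrow> x \<noteq> 0 \<longrightarrow> t * (norm x)\<^sup>2 < ip (T x) x))"

lemma sres:
  assumes "radj T = T"
  shows "proj (sres T t)" "bicom T (sres T t)"
    "sres T t x = x \<Longrightarrow> ip (T x) x \<le> t * (norm x)\<^sup>2"
    "sres T t x = 0 \<Longrightarrow> x \<noteq> 0 \<Longrightarrow> t * (norm x)\<^sup>2 < ip (T x) x"
  using someI_ex[OF spectral_resolution_exists[OF assms, of t]] unfolding sres_def by blast+

lemma sres_ge:
  assumes "radj T = T" "sres T t x = 0" shows "t * (norm x)\<^sup>2 \<le> ip (T x) x"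
  using sres(4)[OF assms] by (cases "x = 0") (auto simp: ip_simps blinfun.zero_right)

lemma sres_commute: "radj T = T \<Longrightarrow> X o\<^sub>L T = T o\<^sub>L X \<Longrightarrow> X o\<^sub>L sres T t = sres T t o\<^sub>L X"
  using bicomD[OF sres(2)] by blast

text \<open>The part of \<open>p x\<close> outside \<open>sres T t\<close> lies both in the range of
  p and in the kernel of \<open>sres T t\<close>; the weak and the strict inequality for the form
  there contradict each other unless it is zero.\<close>

lemma sres_absorb:
  assumes T: "radj T = T" and p: "proj p" "p o\<^sub>L T = T o\<^sub>L p"
    and q: "\<And>x. p x = x \<Longrightarrow> ip (T x) x \<le> t * (norm x)\<^sup>2"
  shows "sres T t o\<^sub>L p = p"
proof (rule blinfun_eqI)
  fix x
  have c: "p o\<^sub>L sres T t = sres T t o\<^sub>L p" by (rule sres_commute[OF T p(2)])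
  define y where "y = p x - sres T t (p x)"
  have py: "p y = y"
    using c by (simp add: y_def blinfun.bilinear_simps proj_apply[OF p(1)])
      (metis blinfun_apply_blinfun_compose proj_apply[OF p(1)])
  have sy: "sres T t y = 0" by (simp add: y_def blinfun.bilinear_simps proj_apply[OF sres(1)[OF T]])
  have "y = 0" using q[OF py] sres(4)[OF T sy] by fastforce
  then show "(sres T t o\<^sub>L p) x = p x" by (simp add: y_def)
qed

lemma sres_disjoint:
  assumes T: "radj T = T" and p: "proj p" "p o\<^sub>L T = T o\<^sub>L p"
    and q: "\<And>x. p x = x \<Longrightarrow> x \<noteq> 0 \<Longrightarrow> t * (norm x)\<^sup>2 < ip (T x) x"
  shows "sres T t o\<^sub>L p = 0"
proof (rule blinfun_eqI)
  fix x
  have c: "p o\<^sub>L sres T t = sres T t o\<^sub>L p" by (rule sres_commute[OF T p(2)])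
  define y where "y = sres T t (p x)"
  have py: "p y = y" using c by (metis y_def blinfun_apply_blinfun_compose proj_apply[OF p(1)])
  have sy: "sres T t y = y" by (simp add: y_def proj_apply[OF sres(1)[OF T]])
  have "y = 0" using q[OF py] sres(3)[OF T sy] by fastforce
  then show "(sres T t o\<^sub>L p) x = blinfun_apply 0 x" by (simp add: y_def)
qed

lemma sres_unique:
  assumes T: "radj T = T" and p: "proj p" "p o\<^sub>L T = T o\<^sub>L p"
    and "\<And>x. p x = x \<Longrightarrow> ip (T x) x \<le> t * (norm x)\<^sup>2"
    and q: "\<And>x. p x = 0 \<Longrightarrow> x \<noteq> 0 \<Longrightarrow> t * (norm x)\<^sup>2 < ip (T x) x"
  shows "sres T t = p"
proof -
  have a: "sres T t o\<^sub>L p = p" by (rule sres_absorb) fact+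
  have "sres T t o\<^sub>L (id_blinfun - p) = 0"
  proof (rule sres_disjoint[OF T proj_compl[OF p(1)]])
    show "(id_blinfun - p) o\<^sub>L T = T o\<^sub>L (id_blinfun - p)" by (simp add: compose_simps p(2))
    show "t * (norm x)\<^sup>2 < ip (T x) x" if "(id_blinfun - p) x = x" "x \<noteq> 0" for x
      using q[of x] that by (simp add: blinfun.bilinear_simps)
  qed
  then show ?thesis using a by (simp add: compose_simps)
qed

lemma sres_mono:
  assumes T: "radj T = T" and "s \<le> t"
  shows "sres T t o\<^sub>L sres T s = sres T s"
proof (rule sres_absorb[OF T sres(1)[OF T]])
  show "sres T s o\<^sub>L T = T o\<^sub>L sres T s" using bicom_commute[OF sres(2)[OF T]] by metis
  show "ip (T x) x \<le> t * (norm x)\<^sup>2" if "sres T s x = x" for x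
    using sres(3)[OF T that] mult_right_mono[OF \<open>s \<le> t\<close>, of "(norm x)\<^sup>2"] by simp
qed

lemma sres_mono': "radj T = T \<Longrightarrow> s \<le> t \<Longrightarrow> sres T s o\<^sub>L sres T t = sres T s"
  by (rule proj_le_commute) (auto simp: sres sres_mono)

lemma sres_eq_id:
  assumes "radj T = T" "\<And>x. ip (T x) x \<le> t * (norm x)\<^sup>2"
  shows "sres T t = id_blinfun"
  by (rule sres_unique) (use assms in \<open>auto simp: compose_simps ip_simps\<close>)

lemma sres_eq_0:
  assumes "radj T = T" "\<And>x. x \<noteq> 0 \<Longrightarrow> t * (norm x)\<^sup>2 < ip (T x) x"
  shows "sres T t = 0"
  by (rule sres_unique) (use assms in \<open>auto simp: compose_simps ip_simps\<close>)

lemma sres_0_psd: "psd T \<Longrightarrow> sres T 0 = kerp T"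
proof (rule sres_unique)
  assume T: "psd T"
  show "kerp T o\<^sub>L T = T o\<^sub>L kerp T" using bicom_commute[OF bicom_kerp[OF psd_radj[OF T]]] by simp
  show "ip (T x) x \<le> 0 * (norm x)\<^sup>2" if "kerp T x = x" for x
    using that kerp_apply_iff[of T x] by (simp add: ip_simps)
  show "0 * (norm x)\<^sup>2 < ip (T x) x" if "kerp T x = 0" "x \<noteq> 0" for x
    using that kerp_apply_iff[of T x] psd_kernel[OF T, of x] psd_ge0[OF T, of x] by fastforce
qed (auto simp: psd_radj kerp)

section \<open>Monotone limits of projections and right continuity\<close>

lemma incseq_proj_limit:
  fixes E :: "nat \<Rightarrow> 'a::complex_hilbert_space \<Rightarrow>\<^sub>L 'a"
  assumes E: "\<And>n. proj (E n)" and m: "\<And>n. E (Suc n) o\<^sub>L E n = E n"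
  shows "\<exists>L. proj L \<and> (\<forall>x. (\<lambda>n. E n x) \<longlonglongrightarrow> L x) \<and> (\<forall>n. L o\<^sub>L E n = E n)"
proof -
  have mm: "E n o\<^sub>L E k = E k" if "k \<le> n" for k n
    using that
  proof (induction rule: dec_induct)
    case (step n)
    then show ?case by (metis m compose_simps(1))
  qed (simp add: proj_idem E)
  have "ip (E n x) x \<le> 1 * (norm x)\<^sup>2" for n x
    using proj_ip_self[OF E, of n x] proj_norm_le[OF E, of n x] by (simp add: power_mono)
  then obtain L where L: "radj L = L" "\<And>x. (\<lambda>n. E n x) \<longlonglongrightarrow> L x"
    using monotone_strong_limit[of E 1, OF proj_radj[OF E] psd_proj[OF proj_diff[OF E E m]]] by auto
  have LE: "L o\<^sub>L E k = E k" for k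
  proof (rule blinfun_eqI)
    fix x
    have "(\<lambda>n. E n (E k x)) \<longlonglongrightarrow> E k x"
      by (rule tendsto_eventually, rule eventually_sequentiallyI[of k])
        (metis mm blinfun_apply_blinfun_compose)
    then show "(L o\<^sub>L E k) x = E k x" using L(2) LIMSEQ_unique by auto
  qed
  have "L o\<^sub>L L = L"
  proof (rule strong_limit_unique)
    show "(\<lambda>n. E n x) \<longlonglongrightarrow> L x" for x by (rule L)
    have "(\<lambda>n. L (E n x)) \<longlonglongrightarrow> L (L x)" for x by (intro tendsto_intros L)
    then show "(\<lambda>n. E n x) \<longlonglongrightarrow> (L o\<^sub>L L) x" for x
      unfolding blinfun_apply_blinfun_compose blinfun_apply_blinfun_compose[of L "E _", symmetric] LE .
  qed
  then show ?thesis using L LE by (auto simp: proj_def)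
qed

lemma decseq_proj_limit:
  fixes E :: "nat \<Rightarrow> 'a::complex_hilbert_space \<Rightarrow>\<^sub>L 'a"
  assumes E: "\<And>n. proj (E n)" and m: "\<And>n. E n o\<^sub>L E (Suc n) = E (Suc n)"
  shows "\<exists>L. proj L \<and> (\<forall>x. (\<lambda>n. E n x) \<longlonglongrightarrow> L x) \<and> (\<forall>n. E n o\<^sub>L L = L)"
proof -
  have m': "(id_blinfun - E (Suc n)) o\<^sub>L (id_blinfun - E n) = id_blinfun - E n" for n
    using proj_le_commute[OF E E m, of n] by (simp add: compose_simps)
  obtain L where L: "proj L" "\<And>x. (\<lambda>n. (id_blinfun - E n) x) \<longlonglongrightarrow> L x"
      "\<And>n. L o\<^sub>L (id_blinfun - E n) = id_blinfun - E n"
    using incseq_proj_limit[of "\<lambda>n. id_blinfun - E n", OF proj_compl[OF E] m'] by blast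
  have "(\<lambda>n. E n x) \<longlonglongrightarrow> (id_blinfun - L) x" for x
    using tendsto_diff[OF tendsto_const[of x] L(2)[of x]] by (simp add: blinfun.bilinear_simps)
  moreover have "E n o\<^sub>L (id_blinfun - L) = id_blinfun - L" for n
    using proj_le_commute[OF proj_compl[OF E] L(1) L(3), of n] by (simp add: compose_simps algebra_simps)
  ultimately show ?thesis using proj_compl[OF L(1)] by blast
qed

text \<open>The decreasing limit L satisfies the conditions of \<open>sres_unique\<close>: the upper
  bound passes to the limit, and since \<open>sres T t\<close> lies below L, a vector killed by L is
  killed by \<open>sres T t\<close> and obeys the strict lower bound.\<close>

lemma sres_right_continuous:
  assumes T: "radj T = T" and s: "\<And>n. t < s n" "decseq s" "s \<longlonglongrightarrow> t"
  shows "(\<lambda>n. sres T (s n) x) \<longlonglongrightarrow> sres T t x"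
proof -
  have m: "sres T (s n) o\<^sub>L sres T (s (Suc n)) = sres T (s (Suc n))" for n
    using s(2) by (intro sres_mono[OF T]) (simp add: decseq_Suc_iff)
  obtain L where L: "proj L" "\<And>x. (\<lambda>n. sres T (s n) x) \<longlonglongrightarrow> L x" "\<And>n. sres T (s n) o\<^sub>L L = L"
    using decseq_proj_limit[of "\<lambda>n. sres T (s n)", OF sres(1)[OF T] m] by blast
  have "bicom T L" by (rule bicom_strong_limit[OF sres(2)[OF T] L(2)])
  have "sres T t = L"
  proof (rule sres_unique[OF T L(1)])
    show "L o\<^sub>L T = T o\<^sub>L L" using bicom_commute[OF \<open>bicom T L\<close>] by simp
    show "ip (T x) x \<le> t * (norm x)\<^sup>2" if x: "L x = x" for x
    proof (rule LIMSEQ_le_const[OF tendsto_mult_right[OF s(3)]], intro exI allI impI)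
      fix n
      have "sres T (s n) x = x" using L(3)[of n] x by (metis blinfun_apply_blinfun_compose)
      then show "ip (T x) x \<le> s n * (norm x)\<^sup>2" by (rule sres(3)[OF T])
    qed
    show "t * (norm x)\<^sup>2 < ip (T x) x" if x: "L x = 0" "x \<noteq> 0" for x
    proof (rule sres(4)[OF T _ x(2)])
      have "L o\<^sub>L sres T t = sres T t"
      proof (rule blinfun_eqI)
        fix y
        have "(\<lambda>n. sres T (s n) (sres T t y)) = (\<lambda>n. sres T t y)"
          using sres_mono[OF T, of t "s _"] s(1) by (metis blinfun_apply_blinfun_compose less_imp_le)
        then show "(L o\<^sub>L sres T t) y = sres T t y"
          using L(2)[of "sres T t y"] LIMSEQ_unique by auto
      qed
      then have "sres T t o\<^sub>L L = sres T t" by (rule proj_le_commute[OF sres(1)[OF T] L(1)])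
      then show "sres T t x = 0" using x by (metis blinfun_apply_blinfun_compose blinfun.zero_right)
    qed
  qed
  then show ?thesis using L(2) by simp
qed

section \<open>Strongly convergent orthogonal sums\<close>

definition orth :: "(nat \<Rightarrow> ('a::complex_hilbert_space \<Rightarrow>\<^sub>L 'a)) \<Rightarrow> bool" where
  "orth p \<longleftrightarrow> (\<forall>i. proj (p i)) \<and> (\<forall>i j. i \<noteq> j \<longrightarrow> p i o\<^sub>L p j = 0)"

text \<open>The strong sum where it exists, an arbitrary operator otherwise; \<open>ssum_eqI\<close>
  and \<open>orth_ssum\<close> are the entry points.\<close>

definition ssum :: "(nat \<Rightarrow> ('a::complex_hilbert_space \<Rightarrow>\<^sub>L 'a)) \<Rightarrow> ('a \<Rightarrow>\<^sub>L 'a)" where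
  "ssum V = (SOME W. sot_sums V W)"

lemma orth_proj: "orth p \<Longrightarrow> proj (p i)"
  and orth_zero: "orth p \<Longrightarrow> i \<noteq> j \<Longrightarrow> p i o\<^sub>L p j = 0"
  by (auto simp: orth_def)

lemma sot_sumsD: "sot_sums V W \<Longrightarrow> (\<lambda>i. V i x) sums W x"
  by (auto simp: sot_sums_def)

lemma sot_sums_unique: "sot_sums V W \<Longrightarrow> sot_sums V W' \<Longrightarrow> W = W'"
  unfolding sot_sums_def by (rule blinfun_eqI) (metis sums_unique2)

lemma ssum_sums: "sot_sums V W \<Longrightarrow> sot_sums V (ssum V)"
  unfolding ssum_def by (rule someI)

lemma ssum_eqI: "sot_sums V W \<Longrightarrow> ssum V = W"
  using ssum_sums sot_sums_unique by blast

lemma sot_sums_compose_left: fixes X :: "'a::complex_hilbert_space \<Rightarrow>\<^sub>L 'a"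
  shows "sot_sums V W \<Longrightarrow> sot_sums (\<lambda>i. X o\<^sub>L V i) (X o\<^sub>L W)"
  unfolding sot_sums_def
  by (auto intro: bounded_linear.sums[OF blinfun.bounded_linear_right])

lemma sot_sums_compose_right: fixes X :: "'a::complex_hilbert_space \<Rightarrow>\<^sub>L 'a"
  shows "sot_sums V W \<Longrightarrow> sot_sums (\<lambda>i. V i o\<^sub>L X) (W o\<^sub>L X)"
  unfolding sot_sums_def by auto

lemma sot_sums_add: "sot_sums V W \<Longrightarrow> sot_sums V' W' \<Longrightarrow> sot_sums (\<lambda>i. V i + V' i) (W + W')"
  unfolding sot_sums_def by (auto simp: blinfun.bilinear_simps intro: sums_add)

lemma sot_sums_0: "sot_sums (\<lambda>i. 0) 0"
  by (simp add: sot_sums_def)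

lemma sot_sums_single:
  assumes "\<And>i. i \<noteq> k \<Longrightarrow> V i = 0" shows "sot_sums V (V k)"
  unfolding sot_sums_def
proof
  fix x
  have "(\<lambda>i. if i = k then V k x else 0) = (\<lambda>i. V i x)" using assms by auto
  then show "(\<lambda>i. V i x) sums V k x"
    using sums_single[of k "\<lambda>i. V k x"] by simp
qed

lemma sot_sums_commute:
  fixes X :: "'a::complex_hilbert_space \<Rightarrow>\<^sub>L 'a"
  assumes "sot_sums V W" "\<And>i. X o\<^sub>L V i = V i o\<^sub>L X" shows "X o\<^sub>L W = W o\<^sub>L X"
  using sot_sums_unique[OF sot_sums_compose_left[OF assms(1), of X]]
    sot_sums_compose_right[OF assms(1), of X] by (simp add: assms(2))

lemma orth_finite_sum_proj: "orth p \<Longrightarrow> proj (\<Sum>i<n. p i)"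
proof (induction n)
  case (Suc n)
  have "(\<Sum>i<n. p i) o\<^sub>L p n = 0"
    unfolding sum_compose by (rule sum.neutral) (auto intro!: orth_zero[OF Suc.prems])
  then show ?case using Suc by (auto intro: proj_add orth_proj)
qed simp

lemma orth_finite_sum_absorb: "orth p \<Longrightarrow> i < n \<Longrightarrow> (\<Sum>i<n. p i) o\<^sub>L p i = p i"
proof -
  assume p: "orth p" and i: "i < n"
  have "(\<Sum>i<n. p i) o\<^sub>L p i = (\<Sum>j<n. if j = i then p i else 0)"
    unfolding sum_compose using orth_zero[OF p] orth_proj[OF p]
    by (intro sum.cong) (auto simp: proj_idem)
  then show ?thesis using i by simp
qed

lemma orth_ssum:
  assumes p: "orth p"
  shows "proj (ssum p)" "sot_sums p (ssum p)" "ssum p o\<^sub>L p i = p i" "p i o\<^sub>L ssum p = p i"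
proof -
  have "(\<Sum>i<Suc n. p i) o\<^sub>L (\<Sum>i<n. p i) = (\<Sum>i<n. p i)" for n
    unfolding sum_compose(2)
    by (rule sum.cong[OF refl]) (use orth_finite_sum_absorb[OF p, of _ "Suc n"] in simp)
  then obtain L where L: "proj L" "\<And>x. (\<lambda>n. (\<Sum>i<n. p i) x) \<longlonglongrightarrow> L x"
    using incseq_proj_limit[of "\<lambda>n. \<Sum>i<n. p i", OF orth_finite_sum_proj[OF p]] by blast
  have s: "sot_sums p L" using L(2) by (simp add: sot_sums_def sums_def blinfun.sum_left)
  then have e: "ssum p = L" by (rule ssum_eqI)
  show "proj (ssum p)" and "sot_sums p (ssum p)" using e s L by auto
  have "sot_sums (\<lambda>j. p i o\<^sub>L p j) (p i o\<^sub>L p i)"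
    by (rule sot_sums_single) (metis orth_zero[OF p])
  then show a: "p i o\<^sub>L ssum p = p i"
    using sot_sums_unique sot_sums_compose_left[OF s, of "p i"] e proj_idem[OF orth_proj[OF p]] by metis
  show "ssum p o\<^sub>L p i = p i"
    using arg_cong[OF a, of radj] by (simp add: proj_radj orth_proj[OF p] \<open>proj (ssum p)\<close>)
qed

lemma ssum_least:
  fixes q :: "'a::complex_hilbert_space \<Rightarrow>\<^sub>L 'a"
  assumes p: "orth p" and q: "\<And>i. q o\<^sub>L p i = p i" shows "q o\<^sub>L ssum p = ssum p"
  using sot_sums_unique[OF sot_sums_compose_left[OF orth_ssum(2)[OF p], of q]] orth_ssum(2)[OF p]
  by (simp add: q)

lemma ssum_zero:
  fixes q :: "'a::complex_hilbert_space \<Rightarrow>\<^sub>L 'a"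
  assumes p: "orth p" and q: "\<And>i. q o\<^sub>L p i = 0" shows "q o\<^sub>L ssum p = 0"
  using sot_sums_unique[OF sot_sums_compose_left[OF orth_ssum(2)[OF p], of q]] sot_sums_0
  by (simp add: q)

lemma ssum_commute:
  fixes X :: "'a::complex_hilbert_space \<Rightarrow>\<^sub>L 'a"
  assumes p: "orth p" and q: "\<And>i. X o\<^sub>L p i = p i o\<^sub>L X" shows "X o\<^sub>L ssum p = ssum p o\<^sub>L X"
  using sot_sums_commute[OF orth_ssum(2)[OF p]] q by blast

lemma ssum_norm_sums:
  assumes p: "orth p" shows "(\<lambda>i. (norm (p i x))\<^sup>2) sums (norm (ssum p x))\<^sup>2"
proof -
  have "(\<lambda>i. ip (p i x) x) sums ip (ssum p x) x"
    by (intro bounded_linear.sums[OF ip.bounded_linear_left] sot_sumsD orth_ssum p)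
  then show ?thesis by (simp add: proj_ip_self orth_proj[OF p] orth_ssum[OF p])
qed

lemma orth_reindex: "orth p \<Longrightarrow> inj f \<Longrightarrow> orth (\<lambda>i. p (f i))"
  by (auto simp: orth_def inj_eq)

lemma orth_ssum_disjoint:
  assumes p: "orth p" and fg: "inj f" "inj g" "range f \<inter> range g = {}"
  shows "ssum (\<lambda>i. p (f i)) o\<^sub>L ssum (\<lambda>i. p (g i)) = 0"
proof (rule ssum_zero[OF orth_reindex[OF p fg(2)]])
  fix j
  have "p (g j) o\<^sub>L p (f i) = 0" for i using fg(3) by (intro orth_zero[OF p]) auto
  then have "p (g j) o\<^sub>L ssum (\<lambda>i. p (f i)) = 0" by (rule ssum_zero[OF orth_reindex[OF p fg(1)]])
  then show "ssum (\<lambda>i. p (f i)) o\<^sub>L p (g j) = 0"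
    by (rule proj_orth_commute[OF orth_proj[OF p] orth_ssum(1)[OF orth_reindex[OF p fg(1)]]])
qed

subsection \<open>Partial isometries\<close>

text \<open>A partial isometry with initial projection p and final projection q, taken with respect
  to the real adjoint.\<close>

definition pis :: "('a::complex_hilbert_space \<Rightarrow>\<^sub>L 'a) \<Rightarrow> ('a \<Rightarrow>\<^sub>L 'a) \<Rightarrow> ('a \<Rightarrow>\<^sub>L 'a) \<Rightarrow> bool" where
  "pis V p q \<longleftrightarrow> proj p \<and> proj q \<and> radj V o\<^sub>L V = p \<and> V o\<^sub>L radj V = q"

lemma gram_eq_0: "radj V o\<^sub>L V = 0 \<Longrightarrow> V = 0"
proof (rule blinfun_eqI)
  fix x assume "radj V o\<^sub>L V = 0"
  then have "ip (V x) (V x) = 0"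
    by (metis radj_ip blinfun_apply_blinfun_compose ip.zero_right zero_blinfun.rep_eq)
  then show "V x = blinfun_apply 0 x" by (simp add: ip_self)
qed

lemma norm_gram: "(norm (blinfun_apply V x))\<^sup>2 = ip ((radj V o\<^sub>L V) x) x"
  by (simp add: ip_self[symmetric] radj_ip ip_commute)

text \<open>With p the Gram operator of V, the Gram operator of V - V p is p - p - p + p =
  0.\<close>

lemma gram_proj_right:
  assumes "proj (radj V o\<^sub>L V)" shows "V o\<^sub>L (radj V o\<^sub>L V) = V"
proof -
  define p where "p = radj V o\<^sub>L V"
  have p: "proj p" using assms p_def by simp
  have "radj (V - (V o\<^sub>L p)) o\<^sub>L (V - (V o\<^sub>L p)) = 0"
    by (simp add: compose_simps proj_radj[OF p] proj_idem[OF p] flip: p_def)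
      (simp add: p_def[symmetric] compose_simps(1)[symmetric] proj_idem[OF p])
  then show ?thesis using gram_eq_0 by (fastforce simp: p_def)
qed

lemma pisI: "proj (radj V o\<^sub>L V) \<Longrightarrow> pis V (radj V o\<^sub>L V) (V o\<^sub>L radj V)"
  unfolding pis_def
proof (intro conjI refl)
  assume p: "proj (radj V o\<^sub>L V)"
  have "(V o\<^sub>L radj V) o\<^sub>L (V o\<^sub>L radj V) = (V o\<^sub>L (radj V o\<^sub>L V)) o\<^sub>L radj V"
    by (simp only: compose_simps(1))
  then show "proj (V o\<^sub>L radj V)" by (simp add: proj_def gram_proj_right[OF p])
qed

lemma pis_radj: "pis V p q \<Longrightarrow> pis (radj V) q p"
  by (auto simp: pis_def)

lemma pis_proj: "pis V p q \<Longrightarrow> proj p" "pis V p q \<Longrightarrow> proj q"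
  by (auto simp: pis_def)

lemma pis_eq: "pis V p q \<Longrightarrow> radj V o\<^sub>L V = p" "pis V p q \<Longrightarrow> V o\<^sub>L radj V = q"
  by (auto simp: pis_def)

lemma pis_right: "pis V p q \<Longrightarrow> V o\<^sub>L p = V"
  using gram_proj_right by (auto simp: pis_def)

lemma pis_left: "pis V p q \<Longrightarrow> q o\<^sub>L V = V"
  using pis_right[OF pis_radj, of V p q] proj_radj[OF pis_proj(2), of V p q]
  by (metis radj_compose radj_radj)

lemma pis_refl: "proj p \<Longrightarrow> pis p p p"
  by (simp add: pis_def proj_radj proj_idem)

lemma pis_compose:
  assumes "pis V p q" "pis W q r" shows "pis (W o\<^sub>L V) p r"
proof -
  have "radj (W o\<^sub>L V) o\<^sub>L (W o\<^sub>L V) = radj V o\<^sub>L ((radj W o\<^sub>L W) o\<^sub>L V)" by (simp add: compose_simps)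
  also have "\<dots> = p" using assms pis_left[OF assms(1)] pis_eq by metis
  finally have 1: "radj (W o\<^sub>L V) o\<^sub>L (W o\<^sub>L V) = p" .
  have "(W o\<^sub>L V) o\<^sub>L radj (W o\<^sub>L V) = W o\<^sub>L ((V o\<^sub>L radj V) o\<^sub>L radj W)" by (simp add: compose_simps)
  also have "\<dots> = (W o\<^sub>L q) o\<^sub>L radj W" by (simp add: pis_eq(2)[OF assms(1)] compose_simps)
  also have "\<dots> = r" using pis_right[OF assms(2)] pis_eq[OF assms(2)] by simp
  finally show ?thesis using 1 assms by (auto simp: pis_def)
qed

lemma pis_restrict:
  assumes V: "pis V p q" and r: "proj r" "p o\<^sub>L r = r"
  shows "pis (V o\<^sub>L r) r (V o\<^sub>L (r o\<^sub>L radj V))"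
proof -
  have "radj (V o\<^sub>L r) o\<^sub>L (V o\<^sub>L r) = r o\<^sub>L ((radj V o\<^sub>L V) o\<^sub>L r)"
    by (simp add: compose_simps proj_radj[OF r(1)])
  also have "\<dots> = r" by (simp add: pis_eq[OF V] r proj_idem)
  finally have e: "radj (V o\<^sub>L r) o\<^sub>L (V o\<^sub>L r) = r" .
  have "(V o\<^sub>L r) o\<^sub>L radj (V o\<^sub>L r) = V o\<^sub>L ((r o\<^sub>L r) o\<^sub>L radj V)"
    by (simp add: compose_simps proj_radj[OF r(1)])
  then show ?thesis using pisI[of "V o\<^sub>L r"] e r(1) by (simp add: proj_idem)
qed

lemma pis_norm: "pis V p q \<Longrightarrow> norm (blinfun_apply V x) = norm (blinfun_apply p x)"
proof -
  assume V: "pis V p q"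
  have "(norm (V x))\<^sup>2 = (norm (p x))\<^sup>2"
    by (simp add: norm_gram pis_eq[OF V] proj_ip_self pis_proj[OF V])
  then show ?thesis by simp
qed

text \<open>Orthogonality of the \<open>q i\<close> makes the Gram operator of a finite sum of the
  \<open>V i\<close> equal to the sum of the \<open>p i\<close>. Hence partial sums of the
  \<open>V i x\<close> have the same mutual distances as those of the \<open>p i x\<close>, which
  converge. The same applies to the adjoints.\<close>

lemma pis_sums:
  assumes V: "\<And>i. pis (V i) (p i) (q i)" and p: "orth p" and q: "orth q"
  shows "sot_sums V (ssum V)" "pis (ssum V) (ssum p) (ssum q)"
    "ssum V o\<^sub>L p i = V i" "q i o\<^sub>L ssum V = V i" "sot_sums (\<lambda>i. radj (V i)) (radj (ssum V))"
proof -
  have VV: "radj (V i) o\<^sub>L V j = (if i = j then p i else 0)"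
    if V: "\<And>i. pis (V i) (p i) (q i)" and q: "orth q" for V p q :: "nat \<Rightarrow> 'a \<Rightarrow>\<^sub>L 'a" and i j
  proof (cases "i = j")
    case False
    have "radj (V i) o\<^sub>L V j = radj (q i o\<^sub>L V i) o\<^sub>L (q j o\<^sub>L V j)" by (simp add: pis_left[OF V])
    also have "\<dots> = radj (V i) o\<^sub>L ((q i o\<^sub>L q j) o\<^sub>L V j)"
      by (simp add: compose_simps proj_radj[OF orth_proj[OF q]])
    finally show ?thesis using False orth_zero[OF q] by (simp add: compose_simps)
  qed (simp add: pis_eq[OF V])
  have lim: "\<exists>W. sot_sums V W" if V: "\<And>i. pis (V i) (p i) (q i)" and p: "orth p" and q: "orth q"
    for V p q :: "nat \<Rightarrow> 'a \<Rightarrow>\<^sub>L 'a"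
  proof -
    have gram: "radj (\<Sum>i\<in>F. V i) o\<^sub>L (\<Sum>i\<in>F. V i) = (\<Sum>i\<in>F. p i)" if "finite F" for F
      using that by (simp add: sum_compose VV[OF V q])
    have normV: "norm ((\<Sum>i\<in>F. V i) x) = norm ((\<Sum>i\<in>F. p i) x)" if F: "finite F" for F x
    proof -
      have "radj (\<Sum>i\<in>F. p i) o\<^sub>L (\<Sum>i\<in>F. p i) = (\<Sum>i\<in>F. p i)"
        using F by (simp add: sum_compose VV[OF pis_refl[OF orth_proj[OF p]] p])
      then have "(norm ((\<Sum>i\<in>F. V i) x))\<^sup>2 = (norm ((\<Sum>i\<in>F. p i) x))\<^sup>2"
        unfolding norm_gram[of "\<Sum>i\<in>F. V i"] norm_gram[of "\<Sum>i\<in>F. p i"] by (simp only: gram[OF F])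
      then show ?thesis by simp
    qed
    have "convergent (\<lambda>n. (\<Sum>i<n. V i) x)" for x
    proof -
      have diff: "norm ((\<Sum>i<n. V i) x - (\<Sum>i<m. V i) x) = norm ((\<Sum>i<n. p i) x - (\<Sum>i<m. p i) x)"
        if "m \<le> n" for m n
      proof -
        have s: "(\<Sum>i<n. f i) x - (\<Sum>i<m. f i) x = (\<Sum>i\<in>{m..<n}. f i) x" for f :: "nat \<Rightarrow> 'a \<Rightarrow>\<^sub>L 'a"
          using sum_diff_nat_ivl[of 0 m n f] that
          by (simp add: lessThan_atLeast0 flip: blinfun.diff_left)
        show ?thesis unfolding s by (rule normV) simp
      qed
      then have d: "dist ((\<Sum>i<n. V i) x) ((\<Sum>i<m. V i) x) = dist ((\<Sum>i<n. p i) x) ((\<Sum>i<m. p i) x)" for m n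
        unfolding dist_norm by (cases "m \<le> n") (auto, metis nat_le_linear norm_minus_commute)
      have "(\<lambda>n. (\<Sum>i<n. p i) x) \<longlonglongrightarrow> ssum p x"
        using sot_sumsD[OF orth_ssum(2)[OF p], of x] by (simp add: sums_def blinfun.sum_left)
      then have "Cauchy (\<lambda>n. (\<Sum>i<n. p i) x)" by (rule LIMSEQ_imp_Cauchy)
      then have "Cauchy (\<lambda>n. (\<Sum>i<n. V i) x)" unfolding Cauchy_def d .
      then show ?thesis by (simp add: Cauchy_convergent_iff)
    qed
    moreover have "norm (\<Sum>i<n. V i) \<le> 1" for n
    proof (rule norm_blinfun_bound)
      show "norm ((\<Sum>i<n. V i) x) \<le> 1 * norm x" for x
        using normV[of "{..<n}" x] proj_norm_le[OF orth_finite_sum_proj[OF p], of n x] by simp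
    qed simp
    ultimately obtain W where "\<And>x. (\<lambda>n. (\<Sum>i<n. V i) x) \<longlonglongrightarrow> blinfun_apply W x"
      using strong_limit_exists[of "\<lambda>n. \<Sum>i<n. V i" 1] by blast
    then show ?thesis by (auto simp: sot_sums_def sums_def blinfun.sum_left)
  qed
  define W where "W = ssum V"
  have W: "sot_sums V W" unfolding W_def using lim[OF V p q] ssum_sums by blast
  show "sot_sums V (ssum V)" using W W_def by simp
  obtain W' where W': "sot_sums (\<lambda>i. radj (V i)) W'"
    using lim[of "\<lambda>i. radj (V i)", OF pis_radj[OF V] q p] by blast
  have "radj W = W'"
  proof (rule radjI)
    fix x y
    have "(\<lambda>i. ip (V i x) y) sums ip (W x) y"
      by (intro bounded_linear.sums[OF ip.bounded_linear_left] sot_sumsD W)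
    moreover have "(\<lambda>i. ip x (radj (V i) y)) sums ip x (W' y)"
      by (intro bounded_linear.sums[OF ip.bounded_linear_right] sot_sumsD W')
    ultimately show "ip (W x) y = ip x (W' y)" by (simp add: radj_ip sums_unique2)
  qed
  then show r: "sot_sums (\<lambda>i. radj (V i)) (radj (ssum V))" using W' W_def by simp
  have Vp: "V j o\<^sub>L p i = (if j = i then V i else 0)" for i j
  proof -
    have "V j o\<^sub>L p i = V j o\<^sub>L (p j o\<^sub>L p i)" by (simp add: pis_right[OF V] flip: compose_simps(1))
    then show ?thesis using orth_zero[OF p, of j i] pis_right[OF V]
      by (auto simp: proj_idem[OF orth_proj[OF p]])
  qed
  have qV: "q i o\<^sub>L V j = (if j = i then V i else 0)" for i j
  proof -
    have e: "q i o\<^sub>L V j = (q i o\<^sub>L q j) o\<^sub>L V j" by (simp add: pis_left[OF V] compose_simps)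
    show ?thesis
    proof (cases "j = i")
      case False
      then have "q i o\<^sub>L q j = 0" by (intro orth_zero[OF q]) auto
      then show ?thesis using e False by (simp add: compose_simps(12) del: blinfun_compose_zero)
    qed (simp add: pis_left[OF V])
  qed
  have Wp: "W o\<^sub>L p i = V i" for i
    using sot_sums_unique[OF sot_sums_compose_right[OF W, of "p i"] sot_sums_single[of i]] Vp by auto
  then show "ssum V o\<^sub>L p i = V i" by (simp add: W_def)
  have qW: "q i o\<^sub>L W = V i" for i
    using sot_sums_unique[OF sot_sums_compose_left[OF W, of "q i"] sot_sums_single[of i]] qV by auto
  then show "q i o\<^sub>L ssum V = V i" by (simp add: W_def)
  have "radj W o\<^sub>L W = ssum p"
  proof (rule sot_sums_unique[OF sot_sums_compose_left[OF W]])
    have "radj W o\<^sub>L V i = p i" for i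
    proof -
      have "radj W o\<^sub>L V i = radj (q i o\<^sub>L W) o\<^sub>L V i"
        by (simp add: compose_simps proj_radj[OF orth_proj[OF q]] pis_left[OF V])
      then show ?thesis by (simp add: qW pis_eq[OF V])
    qed
    then show "sot_sums (\<lambda>i. radj W o\<^sub>L V i) (ssum p)" using orth_ssum(2)[OF p] by simp
  qed
  moreover have "W o\<^sub>L radj W = ssum q"
  proof (rule sot_sums_unique[OF sot_sums_compose_right[OF W]])
    have "V i o\<^sub>L radj W = q i" for i
    proof -
      have "V i o\<^sub>L radj W = V i o\<^sub>L radj (W o\<^sub>L p i)"
        by (simp add: compose_simps(1)[symmetric] proj_radj[OF orth_proj[OF p]] pis_right[OF V])
      then show ?thesis by (simp add: Wp pis_eq[OF V])
    qed
    then show "sot_sums (\<lambda>i. V i o\<^sub>L radj W) (ssum q)" using orth_ssum(2)[OF q] by simp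
  qed
  ultimately show "pis (ssum V) (ssum p) (ssum q)"
    by (simp add: pis_def W_def orth_ssum[OF p] orth_ssum[OF q])
qed

lemma pis_add:
  assumes V: "pis V p q" and W: "pis W p' q'" and p: "p o\<^sub>L p' = 0" and q: "q o\<^sub>L q' = 0"
  shows "pis (V + W) (p + p') (q + q')"
proof -
  have vw: "radj V o\<^sub>L W = 0" if V: "pis V p q" and W: "pis W p' q'" and q: "q o\<^sub>L q' = 0"
    for V W p p' q q' :: "'a \<Rightarrow>\<^sub>L 'a"
  proof -
    have "radj V o\<^sub>L W = radj (q o\<^sub>L V) o\<^sub>L (q' o\<^sub>L W)" by (simp add: pis_left[OF V] pis_left[OF W])
    also have "\<dots> = radj V o\<^sub>L ((q o\<^sub>L q') o\<^sub>L W)" by (simp add: compose_simps proj_radj[OF pis_proj(2)[OF V]])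
    finally show ?thesis by (simp add: q compose_simps)
  qed
  have 1: "radj V o\<^sub>L W = 0" by (rule vw[OF V W q])
  have 2: "V o\<^sub>L radj W = 0" using vw[OF pis_radj[OF V] pis_radj[OF W] p] by simp
  have 3: "radj W o\<^sub>L V = 0" using arg_cong[OF 1, of radj] by simp
  have 4: "W o\<^sub>L radj V = 0" using arg_cong[OF 2, of radj] by simp
  show ?thesis
    using V W proj_add[OF pis_proj(1)[OF V] pis_proj(1)[OF W] p] proj_add[OF pis_proj(2)[OF V] pis_proj(2)[OF W] q]
    by (simp add: pis_def compose_simps 1 2 3 4)
qed

section \<open>Operators on the complex Hilbert space\<close>

lemma cinner_scaleC_right: "cinner x (c *\<^sub>C y) = cnj c * cinner x y"
  by (metis cinner_commute cinner_scaleC_left complex_cnj_mult)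

lemma ip_scaleC: "ip x (c *\<^sub>C y) = ip (cnj c *\<^sub>C x) y"
  by (simp add: ip_def cinner_scaleC_left cinner_scaleC_right)

lemma Im_cinner: "Im (cinner x y) = ip x (\<i> *\<^sub>C y)"
  by (simp add: ip_def cinner_scaleC_right)

lemma complex_linear_scalar_op: "complex_linear T \<longleftrightarrow> (\<forall>c. scalar_op c o\<^sub>L T = T o\<^sub>L scalar_op c)"
  unfolding complex_linear_def
proof (intro iffI allI blinfun_eqI)
  show "(scalar_op c o\<^sub>L T) x = (T o\<^sub>L scalar_op c) x" if "\<forall>c x. T (c *\<^sub>C x) = c *\<^sub>C T x" for c x
    using that by (simp add: scalar_op.rep_eq)
  show "T (c *\<^sub>C x) = c *\<^sub>C T x" if "\<forall>c. scalar_op c o\<^sub>L T = T o\<^sub>L scalar_op c" for c x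
    using that[rule_format, of c] blinfun_apply_blinfun_compose[of "scalar_op c" T x]
      blinfun_apply_blinfun_compose[of T "scalar_op c" x] by (simp add: scalar_op.rep_eq)
qed

lemma bicom_complex_linear: "bicom T S \<Longrightarrow> complex_linear T \<Longrightarrow> complex_linear S"
  by (auto simp: complex_linear_scalar_op bicom_def)

lemma complex_linear_radj: "complex_linear T \<Longrightarrow> complex_linear (radj T)"
  unfolding complex_linear_def
proof (intro allI ip_eqI')
  fix c x y assume T: "\<forall>c x. T (c *\<^sub>C x) = c *\<^sub>C T x"
  have "ip y (radj T (c *\<^sub>C x)) = ip (cnj c *\<^sub>C T y) x" by (simp only: radj_ip[symmetric] ip_scaleC)
  also have "\<dots> = ip (T (cnj c *\<^sub>C y)) x" by (simp only: T)
  also have "\<dots> = ip y (c *\<^sub>C radj T x)" by (simp only: radj_ip ip_scaleC)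
  finally show "ip y (radj T (c *\<^sub>C x)) = ip y (c *\<^sub>C radj T x)" .
qed

lemma adj_eq_radj:
  assumes T: "complex_linear T" shows "adj T = radj T"
  unfolding adj_def
proof (rule the_equality)
  have R: "complex_linear (radj T)" by (rule complex_linear_radj[OF T])
  show "\<forall>x y. cinner (T x) y = cinner x (radj T y)"
  proof (intro allI complex_eqI)
    fix x y
    show "Re (cinner (T x) y) = Re (cinner x (radj T y))" using radj_ip[of T x y] by (simp add: ip_def)
    show "Im (cinner (T x) y) = Im (cinner x (radj T y))"
      using R by (simp add: Im_cinner radj_ip complex_linear_def)
  qed
next
  fix S assume "\<forall>x y. cinner (T x) y = cinner x (blinfun_apply S y)"
  then show "S = radj T" using radjI[of T S] by (simp add: ip_def)
qed

lemma projection_iff: "projection P \<longleftrightarrow> complex_linear P \<and> proj P"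
  unfolding projection_def proj_def using adj_eq_radj by metis

text \<open>Reality of the form gives, by polarization, a skew relation for the imaginary part of
  the inner product; replacing y by -i y turns it into symmetry of the real part.\<close>

lemma positive_op_psd:
  assumes "positive_op T" shows "complex_linear T" "psd T"
proof -
  show cl: "complex_linear T" using assms by (simp add: positive_op_def)
  have r: "cinner (T x) x \<in> \<real>\<^sub>\<ge>\<^sub>0" for x using assms by (simp add: positive_op_def)
  have b0: "ip (T x) (\<i> *\<^sub>C x) = 0" for x
    using r[of x] by (auto simp: nonneg_Reals_def simp flip: Im_cinner)
  have anti: "ip (T x) (\<i> *\<^sub>C y) = - ip (T y) (\<i> *\<^sub>C x)" for x y
    using b0[of "x + y"] b0[of x] b0[of y]
    by (simp add: blinfun.bilinear_simps scaleC_add_right ip_simps)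
  have ii: "\<i> *\<^sub>C (- \<i> *\<^sub>C y) = y" for y :: 'a
    using scaleC_of_real[of 1 y] by (simp add: scaleC_scaleC)
  have "radj T = T"
  proof (rule radjI)
    fix x y
    have "ip (T x) y = - ip (T (- \<i> *\<^sub>C y)) (\<i> *\<^sub>C x)"
      using anti[of x "- \<i> *\<^sub>C y"] by (simp only: ii)
    also have "T (- \<i> *\<^sub>C y) = - \<i> *\<^sub>C T y" using cl unfolding complex_linear_def by blast
    also have "- ip (- \<i> *\<^sub>C T y) (\<i> *\<^sub>C x) = - ip (cnj \<i> *\<^sub>C (- \<i> *\<^sub>C T y)) x" by (simp only: ip_scaleC)
    also have "cnj \<i> *\<^sub>C (- \<i> *\<^sub>C T y) = (-1) *\<^sub>R T y"
      using scaleC_of_real[of "-1" "T y"] by (simp add: scaleC_scaleC)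
    finally show "ip (T x) y = ip x (T y)" by (simp add: ip_simps ip_commute)
  qed
  moreover have "0 \<le> ip (T x) x" for x using r[of x] by (auto simp: ip_def nonneg_Reals_def)
  ultimately show "psd T" by (simp add: psd_def)
qed

lemma null_projection_eq:
  assumes "complex_linear T" "radj T = T" shows "null_projection T = kerp T"
  unfolding null_projection_def
proof (rule the_equality)
  show "projection (kerp T) \<and> range (blinfun_apply (kerp T)) = {x. T x = 0}"
    using bicom_complex_linear[OF bicom_kerp[OF assms(2)] assms(1)] kerp[of T] by (simp add: projection_iff)
  show "P = kerp T" if "projection P \<and> range (blinfun_apply P) = {x. T x = 0}" for P
    using that kerp[of T] by (intro proj_range_eqI) (auto simp: projection_iff)
qed

section \<open>Von Neumann algebras\<close>

locale vN =
  fixes M :: "('a::complex_hilbert_space \<Rightarrow>\<^sub>L 'a) set"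
  assumes vN: "von_neumann_algebra M"
begin

lemma cl: "T \<in> M \<Longrightarrow> complex_linear T"
  and radj_in: "T \<in> M \<Longrightarrow> radj T \<in> M"
  using vN adj_eq_radj by (fastforce simp: von_neumann_algebra_def)+

lemma mem_iff: "T \<in> M \<longleftrightarrow> complex_linear T \<and> (\<forall>S\<in>commutant M. T o\<^sub>L S = S o\<^sub>L T)"
proof -
  have "commutant (commutant M) = M" using vN by (simp add: von_neumann_algebra_def)
  then show ?thesis unfolding commutant_def[of "commutant M"] by blast
qed

lemma commutantD: "S \<in> commutant M \<Longrightarrow> T \<in> M \<Longrightarrow> S o\<^sub>L T = T o\<^sub>L S"
  by (auto simp: commutant_def)

lemma commutant_radj: "S \<in> commutant M \<Longrightarrow> radj S \<in> commutant M"
  unfolding commutant_def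
proof (safe)
  assume S: "complex_linear S" "\<forall>A\<in>M. S o\<^sub>L A = A o\<^sub>L S"
  show "complex_linear (radj S)" by (rule complex_linear_radj[OF S(1)])
  fix A assume "A \<in> M"
  then have "S o\<^sub>L radj A = radj A o\<^sub>L S" using S(2) radj_in by blast
  from arg_cong[OF this, of radj] show "radj S o\<^sub>L A = A o\<^sub>L radj S" by simp
qed

lemma scalar_op_in: "scalar_op c \<in> M"
  unfolding mem_iff
proof
  show "complex_linear (scalar_op c)"
    by (simp add: complex_linear_def scalar_op.rep_eq scaleC_scaleC mult.commute)
  show "\<forall>S\<in>commutant M. scalar_op c o\<^sub>L S = S o\<^sub>L scalar_op c"
    by (auto simp: commutant_def complex_linear_scalar_op)
qed

lemma add_in: "S \<in> M \<Longrightarrow> T \<in> M \<Longrightarrow> S + T \<in> M"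
  unfolding mem_iff
  by (auto simp: compose_simps complex_linear_def blinfun.bilinear_simps scaleC_add_right)

lemma scaleR_in: "T \<in> M \<Longrightarrow> r *\<^sub>R T \<in> M"
  unfolding mem_iff
  by (auto simp: compose_simps complex_linear_def blinfun.bilinear_simps scaleC_scaleC mult.commute
      simp flip: scaleC_of_real)

lemma diff_in: "S \<in> M \<Longrightarrow> T \<in> M \<Longrightarrow> S - T \<in> M"
  using add_in[of S "(-1) *\<^sub>R T"] scaleR_in[of T "-1"] by simp

lemma id_in: "id_blinfun \<in> M"
  unfolding mem_iff by (auto simp: compose_simps complex_linear_def)

lemma zero_in: "0 \<in> M"
  using scaleR_in[OF id_in, of 0] by simp

lemma compose_in:
  assumes "S \<in> M" "T \<in> M" shows "S o\<^sub>L T \<in> M"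
  unfolding mem_iff
proof (intro conjI ballI)
  show "complex_linear (S o\<^sub>L T)" using assms[THEN cl] by (simp add: complex_linear_def)
  show "(S o\<^sub>L T) o\<^sub>L X = X o\<^sub>L (S o\<^sub>L T)" if "X \<in> commutant M" for X
    by (rule commute_compose[symmetric]) (use commutantD[OF that] assms in auto)
qed

lemma bicom_in: "T \<in> M \<Longrightarrow> bicom T S \<Longrightarrow> S \<in> M"
  unfolding mem_iff using bicom_complex_linear by (auto simp: bicom_def)

lemma sum_in: "(\<And>i. i \<in> I \<Longrightarrow> f i \<in> M) \<Longrightarrow> sum f I \<in> M"
  by (induction I rule: infinite_finite_induct) (auto intro: zero_in add_in)

lemma strong_limit_in:
  assumes X: "\<And>n::nat. X n \<in> M" "\<And>x. (\<lambda>n. X n x) \<longlonglongrightarrow> blinfun_apply L x"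
  shows "L \<in> M"
  unfolding mem_iff complex_linear_scalar_op
proof (intro conjI ballI allI)
  show "scalar_op c o\<^sub>L L = L o\<^sub>L scalar_op c" for c
    by (rule commute_strong_limit[OF _ X(2)]) (use X(1)[THEN cl] complex_linear_scalar_op in blast)
  show "L o\<^sub>L S = S o\<^sub>L L" if "S \<in> commutant M" for S
    by (rule commute_strong_limit[OF _ X(2), symmetric]) (rule commutantD[OF that X(1)])
qed

lemma sot_sums_in: "sot_sums V W \<Longrightarrow> (\<And>i. V i \<in> M) \<Longrightarrow> W \<in> M"
  by (rule strong_limit_in[of "\<lambda>n. \<Sum>i<n. V i"])
    (auto simp: sot_sums_def sums_def blinfun.sum_left intro: sum_in)

lemma sqop_in: "psd T \<Longrightarrow> T \<in> M \<Longrightarrow> sqop T \<in> M"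
  using bicom_in sqop(3) by blast

lemma sres_in: "radj T = T \<Longrightarrow> T \<in> M \<Longrightarrow> sres T t \<in> M"
  using bicom_in sres(2) by blast

lemma kerp_in: "radj T = T \<Longrightarrow> T \<in> M \<Longrightarrow> kerp T \<in> M"
  using bicom_in bicom_kerp by blast

lemmas in_M = add_in scaleR_in diff_in zero_in id_in compose_in radj_in sum_in

definition prj :: "('a \<Rightarrow>\<^sub>L 'a) \<Rightarrow> bool" where
  "prj P \<longleftrightarrow> P \<in> M \<and> proj P"

lemma prj_iff: "P \<in> M \<Longrightarrow> projection P \<longleftrightarrow> proj P"
  by (simp add: projection_iff cl)

lemma prj_ssum: "orth p \<Longrightarrow> (\<And>i. p i \<in> M) \<Longrightarrow> prj (ssum p)"
  unfolding prj_def using orth_ssum sot_sums_in by blast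

definition peq :: "('a \<Rightarrow>\<^sub>L 'a) \<Rightarrow> ('a \<Rightarrow>\<^sub>L 'a) \<Rightarrow> bool" where
  "peq p q \<longleftrightarrow> (\<exists>V\<in>M. pis V p q)"

definition psub :: "('a \<Rightarrow>\<^sub>L 'a) \<Rightarrow> ('a \<Rightarrow>\<^sub>L 'a) \<Rightarrow> bool" where
  "psub p q \<longleftrightarrow> (\<exists>V\<in>M. \<exists>r. pis V p r \<and> q o\<^sub>L r = r)"

lemma mvn_equivalent_peq: "proj P \<Longrightarrow> mvn_equivalent M P Q \<longleftrightarrow> peq P Q"
  unfolding mvn_equivalent_def peq_def
  by (rule bex_cong[OF refl]) (auto simp: adj_eq_radj[OF cl] pis_def dest: pisI[unfolded pis_def])

lemma pis_in: "pis V p q \<Longrightarrow> V \<in> M \<Longrightarrow> p \<in> M" "pis V p q \<Longrightarrow> V \<in> M \<Longrightarrow> q \<in> M"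
  unfolding pis_def using compose_in radj_in by blast+

lemma peq_prj: "peq p q \<Longrightarrow> prj p" "peq p q \<Longrightarrow> prj q"
  unfolding peq_def prj_def using pis_in pis_proj by blast+

lemma psub_prj: "psub p q \<Longrightarrow> prj p"
  unfolding psub_def prj_def using pis_in pis_proj by blast

lemma mvn_subequivalent_psub:
  assumes "proj P" "prj Q" shows "mvn_subequivalent M P Q \<longleftrightarrow> psub P Q"
proof
  assume "mvn_subequivalent M P Q"
  then obtain R where "R \<in> M" "subprojection R Q" "mvn_equivalent M P R"
    unfolding mvn_subequivalent_def by blast
  then show "psub P Q" using mvn_equivalent_peq[OF assms(1)]
    unfolding psub_def peq_def subprojection_def by blast
next
  assume "psub P Q"
  then obtain V r where V: "V \<in> M" "pis V P r" "Q o\<^sub>L r = r" unfolding psub_def by blast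
  then have "r \<in> M" "proj r" using pis_in pis_proj by blast+
  moreover have "subprojection r Q"
    unfolding subprojection_def using V assms calculation prj_iff by (auto simp: prj_def)
  moreover have "mvn_equivalent M P r"
    using V mvn_equivalent_peq[OF assms(1)] by (auto simp: peq_def)
  ultimately show "mvn_subequivalent M P Q" unfolding mvn_subequivalent_def by blast
qed

lemma peq_sym: "peq p q \<Longrightarrow> peq q p"
  unfolding peq_def using pis_radj radj_in by blast

lemma peq_trans: "peq p q \<Longrightarrow> peq q r \<Longrightarrow> peq p r"
  unfolding peq_def using pis_compose compose_in by blast

lemma peq_refl: "prj p \<Longrightarrow> peq p p"
  unfolding peq_def prj_def using pis_refl by blast

lemma psubE:
  assumes "psub p q" obtains V r where "V \<in> M" "pis V p r" "q o\<^sub>L r = r" "peq p r" "prj r"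
  using assms unfolding psub_def peq_def prj_def using pis_in pis_proj by blast

lemma psub_le: "prj p \<Longrightarrow> q o\<^sub>L p = p \<Longrightarrow> psub p q"
  unfolding psub_def prj_def using pis_refl by blast

lemma peq_psub: "peq p q \<Longrightarrow> psub p q"
  unfolding peq_def psub_def using proj_idem pis_proj by blast

lemma psub_trans:
  assumes "psub p q" "psub q r" shows "psub p r"
proof -
  obtain V s where V: "V \<in> M" "pis V p s" "q o\<^sub>L s = s" using assms(1) unfolding psub_def by blast
  obtain W t where W: "W \<in> M" "pis W q t" "r o\<^sub>L t = t" using assms(2) unfolding psub_def by blast
  define u where "u = W o\<^sub>L (s o\<^sub>L radj W)"
  have "pis (W o\<^sub>L s) s u" unfolding u_def by (rule pis_restrict[OF W(2) pis_proj(2)[OF V(2)] V(3)])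
  then have "pis ((W o\<^sub>L s) o\<^sub>L V) p u" by (rule pis_compose[OF V(2)])
  moreover have "(W o\<^sub>L s) o\<^sub>L V \<in> M" using V W pis_in by (intro compose_in) blast+
  moreover have "r o\<^sub>L u = u"
  proof -
    have "r o\<^sub>L W = r o\<^sub>L (t o\<^sub>L W)" by (simp add: pis_left[OF W(2)])
    also have "\<dots> = W" by (metis W(3) pis_left[OF W(2)] compose_simps(1))
    finally show ?thesis unfolding u_def by (simp flip: compose_simps(1))
  qed
  ultimately show ?thesis unfolding psub_def by blast
qed

lemma psub_0: "psub 0 q"
  unfolding psub_def by (rule bexI[of _ 0]) (auto intro!: exI[of _ 0] zero_in simp: pis_def)

text \<open>The translates V^n D V*^n of a wandering projection D of the isometry V, as in the Wold
  decomposition.\<close>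

primrec wander :: "('a \<Rightarrow>\<^sub>L 'a) \<Rightarrow> ('a \<Rightarrow>\<^sub>L 'a) \<Rightarrow> nat \<Rightarrow> 'a \<Rightarrow>\<^sub>L 'a" where
  "wander V D 0 = D"
| "wander V D (Suc n) = V o\<^sub>L (wander V D n o\<^sub>L radj V)"

text \<open>V maps q isometrically below p \<le> q. The difference q - p is orthogonal to everything
  below p, where all later translates lie; conjugating by V carries this orthogonality to any two
  translates.\<close>

lemma wander:
  assumes q: "prj q" and p: "prj p" and qp: "q o\<^sub>L p = p"
    and V: "V \<in> M" "radj V o\<^sub>L V = q" "p o\<^sub>L V = V"
  shows "orth (wander V (q - p))" "wander V (q - p) n \<in> M" "q o\<^sub>L wander V (q - p) n = wander V (q - p) n"
    "p o\<^sub>L wander V (q - p) (Suc n) = wander V (q - p) (Suc n)" "peq (q - p) (wander V (q - p) n)"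
proof -
  define D where "D = q - p"
  define d where "d = wander V D"
  have D: "proj D" unfolding D_def using q p qp by (intro proj_diff) (auto simp: prj_def)
  have qD: "q o\<^sub>L D = D" using q by (simp add: D_def compose_simps qp proj_idem prj_def)
  have Dp: "D o\<^sub>L p = 0" using p by (simp add: D_def compose_simps qp proj_idem prj_def)
  have pV: "pis V q (V o\<^sub>L radj V)" using pisI[of V] V q by (simp add: prj_def)
  have pd: "p o\<^sub>L d (Suc n) = d (Suc n)" for n
    by (simp add: d_def V(3) flip: compose_simps(1))
  have qd: "q o\<^sub>L d n = d n" for n
  proof (cases n)
    case (Suc m)
    then show ?thesis using pd[of m] by (metis qp compose_simps(1))
  qed (simp add: d_def qD)
  have ind: "proj (d n) \<and> peq D (d n)" for n
  proof (induction n)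
    case 0
    have "D \<in> M" using q p by (auto simp: D_def prj_def intro: diff_in)
    then show ?case using D peq_refl[of D] by (simp add: d_def prj_def)
  next
    case (Suc n)
    have r: "pis (V o\<^sub>L d n) (d n) (d (Suc n))"
      using pis_restrict[OF pV _ qd[of n]] Suc by (simp add: d_def)
    have "d n \<in> M" using peq_prj(2)[OF conjunct2[OF Suc]] by (simp add: prj_def)
    then have "V o\<^sub>L d n \<in> M" by (rule compose_in[OF V(1)])
    then have e: "peq (d n) (d (Suc n))" unfolding peq_def using r by (rule bexI[rotated])
    then show ?case using peq_trans[OF conjunct2[OF Suc] e] peq_prj(2)[OF e] by (simp add: prj_def)
  qed
  have disj: "d i o\<^sub>L d (i + Suc k) = 0" for i k
  proof (induction i)
    case 0
    have "D o\<^sub>L d (Suc k) = D o\<^sub>L (p o\<^sub>L d (Suc k))" by (simp only: pd)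
    also have "\<dots> = 0" by (simp add: Dp flip: compose_simps(1))
    finally show ?case by (simp add: d_def)
  next
    case (Suc i)
    have "d (Suc i) o\<^sub>L d (Suc i + Suc k) = V o\<^sub>L ((d i o\<^sub>L ((radj V o\<^sub>L V) o\<^sub>L d (i + Suc k))) o\<^sub>L radj V)"
      by (simp add: d_def compose_simps)
    also have "\<dots> = V o\<^sub>L ((d i o\<^sub>L d (i + Suc k)) o\<^sub>L radj V)" by (simp only: V(2) qd)
    also have "\<dots> = 0" by (simp only: Suc compose_simps(12,13))
    finally show ?case .
  qed
  have dd: "d i o\<^sub>L d j = 0" if "i \<noteq> j" for i j
  proof (cases "i < j")
    case True
    then show ?thesis using disj[of i "j - i - 1"] by simp
  next
    case False
    then have "d j o\<^sub>L d i = 0" using disj[of j "i - j - 1"] that by simp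
    then show ?thesis using ind proj_orth_commute by blast
  qed
  show "orth (wander V (q - p))" unfolding orth_def using ind dd by (simp add: d_def D_def)
  show "peq (q - p) (wander V (q - p) n)" using ind by (simp add: d_def D_def)
  then show "wander V (q - p) n \<in> M" using peq_prj by (auto simp: prj_def)
  show "q o\<^sub>L wander V (q - p) n = wander V (q - p) n" using qd by (simp add: d_def D_def)
  show "p o\<^sub>L wander V (q - p) (Suc n) = wander V (q - p) (Suc n)"
    using pd by (simp only: d_def D_def)
qed

text \<open>With s the sum of the translates of q - p, the operator that acts as V on s and as the
  identity on q - s removes exactly the first translate, hence maps q onto p.\<close>

lemma schroeder_bernstein_le:
  assumes q: "prj q" and p: "prj p" and qp: "q o\<^sub>L p = p"
    and V: "V \<in> M" "radj V o\<^sub>L V = q" "p o\<^sub>L V = V"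
  shows "peq q p"
proof -
  define d where "d = wander V (q - p)"
  note w = wander[OF assms, folded d_def]
  define s where "s = ssum d"
  have s: "proj s" "s \<in> M" using prj_ssum[OF w(1,2)] by (auto simp: s_def prj_def)
  have ps: "proj q" "proj p" "q \<in> M" "p \<in> M" using q p by (auto simp: prj_def)
  have qs: "q o\<^sub>L s = s" unfolding s_def by (rule ssum_least[OF w(1,3)])
  have sq: "s o\<^sub>L q = s" by (rule proj_le_commute[OF s(1) ps(1) qs])
  have sd: "s o\<^sub>L d 0 = d 0" "d 0 o\<^sub>L s = d 0" using orth_ssum[OF w(1)] by (auto simp: s_def)
  have d0: "d 0 = q - p" by (simp add: d_def)
  have Vq: "V o\<^sub>L q = V" using gram_proj_right[of V] V(2) ps(1) by simp
  \<comment> \<open>V shifts the sequence of translates by one, so it maps s onto s without the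
    initial term.\<close>
  have VsV: "V o\<^sub>L (s o\<^sub>L radj V) = s - d 0"
  proof -
    have "sot_sums (\<lambda>n. d (Suc n)) (V o\<^sub>L (s o\<^sub>L radj V))"
      using sot_sums_compose_left[OF sot_sums_compose_right[OF orth_ssum(2)[OF w(1)], of "radj V"], of V]
      by (simp add: d_def s_def)
    moreover have "sot_sums (\<lambda>n. d (Suc n)) (s - d 0)"
      unfolding sot_sums_def
    proof
      show "(\<lambda>n. d (Suc n) x) sums (s - d 0) x" for x
        using sums_split_initial_segment[OF sot_sumsD[OF orth_ssum(2)[OF w(1)], of x], of 1]
        by (simp add: s_def blinfun.bilinear_simps)
    qed
    ultimately show ?thesis by (rule sot_sums_unique)
  qed
  have Vs: "V o\<^sub>L s = (s - d 0) o\<^sub>L V"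
  proof -
    have "(V o\<^sub>L (s o\<^sub>L radj V)) o\<^sub>L V = V o\<^sub>L (s o\<^sub>L q)" by (simp add: compose_simps V(2))
    then show ?thesis using VsV sq by simp
  qed
  have cross: "(q - s) o\<^sub>L (V o\<^sub>L s) = 0"
  proof -
    have "(q - s) o\<^sub>L (s - d 0) = 0"
      using w(3)[of 0] by (simp add: compose_simps qs sd proj_idem[OF s(1)])
    then show ?thesis by (simp add: Vs flip: compose_simps(1))
  qed
  have cross': "(s o\<^sub>L radj V) o\<^sub>L (q - s) = 0"
    using arg_cong[OF cross, of radj] by (simp add: proj_radj s ps)
  define U where "U = (V o\<^sub>L s) + (q - s)"
  have rU: "radj U = (s o\<^sub>L radj V) + (q - s)" by (simp add: U_def proj_radj s ps)
  have ss: "s o\<^sub>L (V o\<^sub>L s) = s o\<^sub>L (V o\<^sub>L s)" ..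
  have g: "(s o\<^sub>L radj V) o\<^sub>L (V o\<^sub>L s) = s"
  proof -
    have "(s o\<^sub>L radj V) o\<^sub>L (V o\<^sub>L s) = s o\<^sub>L ((radj V o\<^sub>L V) o\<^sub>L s)" by (simp add: compose_simps)
    then show ?thesis by (simp add: V(2) qs proj_idem s)
  qed
  have h: "(V o\<^sub>L s) o\<^sub>L (s o\<^sub>L radj V) = s - d 0"
  proof -
    have "(V o\<^sub>L s) o\<^sub>L (s o\<^sub>L radj V) = V o\<^sub>L ((s o\<^sub>L s) o\<^sub>L radj V)" by (simp add: compose_simps)
    then show ?thesis by (simp add: VsV proj_idem s)
  qed
  have sqs: "s o\<^sub>L (q - s) = 0" "(q - s) o\<^sub>L s = 0" "(q - s) o\<^sub>L (q - s) = q - s"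
    by (simp_all add: compose_simps sq qs proj_idem s ps)
  have 1: "radj U o\<^sub>L U = q"
    unfolding rU unfolding U_def
    by (simp only: compose_simps(2,3) g cross cross' sqs(3)) simp
  have "(V o\<^sub>L s) o\<^sub>L (q - s) = 0" "(q - s) o\<^sub>L (s o\<^sub>L radj V) = 0"
    by (simp_all add: compose_simps(1) sqs, simp add: sqs flip: compose_simps(1))
  then have 2: "U o\<^sub>L radj U = p"
    unfolding rU unfolding U_def
    by (simp only: compose_simps(2,3) h sqs(3)) (simp add: d0)
  have "U \<in> M" unfolding U_def using V s ps by (intro in_M)
  then show ?thesis unfolding peq_def using 1 2 ps by (auto simp: pis_def)
qed

text \<open>A copy t of q sits below p, and p is subequivalent to t; this is the case of a
  subprojection.\<close>

lemma schroeder_bernstein: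
  assumes "psub p q" "psub q p" shows "peq p q"
proof -
  obtain V r where V: "V \<in> M" "pis V p r" "q o\<^sub>L r = r" "peq p r" "prj r" using assms(1) by (rule psubE)
  obtain W t where W: "W \<in> M" "pis W q t" "p o\<^sub>L t = t" "peq q t" "prj t" using assms(2) by (rule psubE)
  have "psub p t"
    using psub_trans[OF assms(1) peq_psub[OF W(4)]] .
  then obtain X u where X: "X \<in> M" "pis X p u" "t o\<^sub>L u = u" unfolding psub_def by blast
  have "peq p t"
  proof (rule schroeder_bernstein_le[OF psub_prj[OF assms(1)] W(5,3) X(1) pis_eq(1)[OF X(2)]])
    show "t o\<^sub>L X = X" using X pis_left[OF X(2)] by (metis compose_simps(1))
  qed
  then show ?thesis using peq_trans peq_sym W(4) by blast
qed

end

section \<open>Comparison of projections in a sigma-finite factor\<close>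

context vN begin

text \<open>A spectral piece of the polar decomposition: V is R (R*R)^(-1/2) cut down to a spectral
  projection p on which R*R \<ge> t > 0. The cut-off keeps the inverse square root bounded, and some
  such p is nonzero because R is.\<close>

lemma partial_isometry_part:
  assumes R: "R \<in> M" "R \<noteq> 0"
  shows "\<exists>V\<in>M. V \<noteq> 0 \<and> proj (radj V o\<^sub>L V) \<and> (\<forall>X. X o\<^sub>L R = R \<longrightarrow> X o\<^sub>L V = V) \<and>
    (\<forall>P. proj P \<longrightarrow> R o\<^sub>L P = R \<longrightarrow> V o\<^sub>L P = V)"
proof -
  define S where "S = radj R o\<^sub>L R"
  have S: "psd S" "S \<in> M" unfolding S_def using R by (auto intro: psd_gram in_M)
  have rS: "radj S = S" by (rule psd_radj[OF S(1)])
  have "\<exists>n::nat. sres S (1 / (real n + 1)) \<noteq> id_blinfun"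
  proof (rule ccontr)
    assume "\<not> ?thesis"
    then have n: "sres S (1 / (real n + 1)) = id_blinfun" for n by blast
    have "S x = 0" for x
    proof (rule psd_kernel[OF S(1)])
      have le: "ip (S x) x \<le> (1 / (real n + 1)) * (norm x)\<^sup>2" for n
        using sres(3)[OF rS, of "1 / (real n + 1)" x] n by simp
      have "(\<lambda>n. (1 / (real n + 1)) * (norm x)\<^sup>2) \<longlonglongrightarrow> 0 * (norm x)\<^sup>2"
        by (intro tendsto_intros) (use LIMSEQ_inverse_real_of_nat in \<open>simp add: inverse_eq_divide add.commute\<close>)
      then have "ip (S x) x \<le> 0 * (norm x)\<^sup>2"
        by (rule LIMSEQ_le_const) (use le in blast)
      then show "ip (S x) x = 0" using psd_ge0[OF S(1), of x] by simp
    qed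
    then have "S = 0" by (intro blinfun_eqI) simp
    then show False using gram_eq_0[of R] R(2) by (simp add: S_def)
  qed
  then obtain n :: nat where n: "sres S (1 / (real n + 1)) \<noteq> id_blinfun" by blast
  define t where "t = 1 / (real n + 1)"
  have t: "0 < t" by (simp add: t_def)
  define p where "p = id_blinfun - sres S t"
  have p: "proj p" "p \<noteq> 0" "p \<in> M" "bicom S p"
    using n diff_in[OF id_in sres_in[OF rS S(2), of t]] proj_compl[OF sres(1)[OF rS, of t]]
      bicom_diff[OF bicom_id sres(2)[OF rS, of t]]
    by (auto simp: t_def p_def)
  have ge: "t * (norm x)\<^sup>2 \<le> ip (S x) x" if "p x = x" for x
    using sres_ge[OF rS, of t x] that by (simp add: p_def blinfun.bilinear_simps)
  \<comment> \<open>Filling in t off p makes the operator bounded below everywhere, so that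
    \<open>invop\<close> applies; on p it agrees with S.\<close>
  define Q where "Q = (S o\<^sub>L p) + t *\<^sub>R (id_blinfun - p)"
  have bQ: "bicom S Q" unfolding Q_def
    by (intro bicom_add bicom_compose bicom_scaleR bicom_diff bicom_refl bicom_id p)
  have Sp: "S o\<^sub>L p = p o\<^sub>L S" by (rule bicom_commute[OF p(4)])
  have Spx: "S (p x) = p (S x)" for x using Sp by (metis blinfun_apply_blinfun_compose)
  have qQ: "t * (norm x)\<^sup>2 \<le> ip (Q x) x" for x
  proof -
    have "ip (S (p x)) x = ip (S (p x)) (p x)"
      using proj_ip[OF p(1), of "S x" x] proj_ip[OF p(1), of "S x" "p x"] by (simp add: Spx proj_apply[OF p(1)])
    moreover have "t * (norm (p x))\<^sup>2 \<le> ip (S (p x)) (p x)" by (rule ge[OF proj_apply[OF p(1)]])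
    moreover have "ip (x - p x) x = (norm (x - p x))\<^sup>2"
      using proj_ip_self[OF proj_compl[OF p(1)], of x] by (simp add: blinfun.bilinear_simps)
    ultimately have "t * (norm (p x))\<^sup>2 + t * (norm (x - p x))\<^sup>2 \<le> ip (Q x) x"
      by (simp add: Q_def blinfun.bilinear_simps ip_simps)
    then show ?thesis by (simp add: proj_norm_sq[OF p(1), of x] algebra_simps)
  qed
  have "radj Q = Q"
    by (simp add: Q_def proj_radj p psd_radj[OF S(1)] Sp)
  moreover have "0 \<le> ip (Q x) x" for x using qQ[of x] t
    by (meson less_imp_le mult_nonneg_nonneg order_trans zero_le_power2)
  ultimately have Q: "psd Q" by (simp add: psd_def)
  note I = invop[OF Q t qQ]
  define D where "D = sqop (invop Q)"
  have bI: "bicom S (invop Q)" by (rule bicom_trans[OF bQ I(4)])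
  have bD: "bicom S D" unfolding D_def by (rule bicom_trans[OF bI sqop(3)[OF I(3)]])
  have DD: "D o\<^sub>L D = invop Q" and rD: "radj D = D"
    unfolding D_def by (rule sqop(2)[OF I(3)], rule psd_radj[OF sqop(1)[OF I(3)]])
  have pD: "p o\<^sub>L D = D o\<^sub>L p" and SD: "S o\<^sub>L D = D o\<^sub>L S"
    using bicom_commute2[OF p(4) bD] bicom_commute[OF bD] by auto
  define V where "V = R o\<^sub>L (D o\<^sub>L p)"
  have "radj V o\<^sub>L V = p o\<^sub>L (D o\<^sub>L (S o\<^sub>L (D o\<^sub>L p)))"
    by (simp add: V_def S_def compose_simps proj_radj[OF p(1)] rD)
  also have "S o\<^sub>L (D o\<^sub>L p) = D o\<^sub>L (S o\<^sub>L p)"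
    by (simp add: SD flip: compose_simps(1))
  also have "S o\<^sub>L p = Q o\<^sub>L p" by (simp add: Q_def compose_simps proj_idem p)
  also have "D o\<^sub>L (D o\<^sub>L (Q o\<^sub>L p)) = p"
    by (simp add: DD I(2) compose_simps flip: compose_simps(1))
  finally have VV: "radj V o\<^sub>L V = p" by (simp add: proj_idem p)
  have "V \<in> M" unfolding V_def using R S p bD bicom_in[OF S(2)] by (intro compose_in) auto
  moreover have "V \<noteq> 0" using VV p(2) by auto
  moreover have "X o\<^sub>L V = V" if "X o\<^sub>L R = R" for X
    using that by (simp add: V_def flip: compose_simps(1))
  moreover have "V o\<^sub>L P = V" if P: "proj P" "R o\<^sub>L P = R" for P
  proof -
    have SP: "S o\<^sub>L P = S" by (simp add: S_def compose_simps P)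
    have PS: "P o\<^sub>L S = S" using arg_cong[OF SP, of radj] by (simp add: rS proj_radj P)
    have Pp: "P o\<^sub>L p = p o\<^sub>L P" by (rule bicomD[OF p(4)]) (simp add: SP PS)
    have "p o\<^sub>L (id_blinfun - P) = 0"
    proof (rule blinfun_eqI)
      fix x
      define y where "y = p (x - P x)"
      have "P y = 0" using Pp by (simp add: y_def blinfun.bilinear_simps proj_apply[OF P(1)])
          (metis blinfun_apply_blinfun_compose proj_apply[OF P(1)])
      then have "S y = 0" using SP by (metis blinfun_apply_blinfun_compose blinfun.zero_right)
      then have "t * (norm y)\<^sup>2 \<le> 0" using ge[of y] by (simp add: y_def proj_apply[OF p(1)] ip_simps)
      then have "y = 0" using t by (simp add: mult_le_0_iff)
      then show "(p o\<^sub>L (id_blinfun - P)) x = blinfun_apply 0 x" by (simp add: y_def blinfun.bilinear_simps)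
    qed
    then have "p o\<^sub>L P = p" by (simp add: compose_simps)
    then show ?thesis by (simp add: V_def compose_simps)
  qed
  ultimately show ?thesis using VV p(1) by blast
qed

end

locale sfactor =
  fixes M :: "('a::complex_hilbert_space \<Rightarrow>\<^sub>L 'a) set"
  assumes fac: "factor M" and sigma_finite: "sigma_finite_algebra M" and infinite_alg: "infinite_algebra M"
begin

sublocale vN M
  using fac by unfold_locales (simp add: factor_def)

text \<open>Otherwise the vectors y with Q T y = 0 for all T in M form a closed subspace, invariant
  under M and under its commutant. Its projection is central, hence a scalar, and it fixes the range
  of P \<noteq> 0, so it is the identity. Then T = 1 gives Q = 0.\<close>

lemma factor_link:
  assumes P: "prj P" "P \<noteq> 0" and Q: "prj Q" "Q \<noteq> 0"
  shows "\<exists>T\<in>M. Q o\<^sub>L (T o\<^sub>L P) \<noteq> 0"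
proof (rule ccontr)
  assume "\<not> ?thesis"
  then have z: "Q o\<^sub>L (T o\<^sub>L P) = 0" if "T \<in> M" for T using that by blast
  define N where "N = {y. \<forall>T\<in>M. Q (T y) = 0}"
  have "subspace N" by (auto simp: N_def subspace_def blinfun.bilinear_simps)
  moreover have "closed N"
  proof -
    have "N = (\<Inter>T\<in>M. {y. (Q o\<^sub>L T) y = 0})" by (auto simp: N_def)
    moreover have "closed (\<Inter>T\<in>M. {y. (Q o\<^sub>L T) y = 0})" by (intro closed_INT ballI closed_kernel)
    ultimately show ?thesis by simp
  qed
  ultimately obtain Z where Z: "proj Z" "range (blinfun_apply Z) = N"
    using proj_onto_closed_subspace by blast
  have ZN: "Z x \<in> N" for x using Z(2) by blast
  have NZ: "Z x = x" if "x \<in> N" for x using that Z by (metis proj_apply rangeE)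
  have comm: "X o\<^sub>L Z = Z o\<^sub>L X" if "\<And>y. y \<in> N \<Longrightarrow> X y \<in> N" "\<And>y. y \<in> N \<Longrightarrow> radj X y \<in> N" for X :: "'a \<Rightarrow>\<^sub>L 'a"
    by (rule proj_invariant_commute[OF Z(1)]; rule blinfun_eqI) (use that ZN NZ in auto)
  have NM: "X y \<in> N" if "X \<in> M" "y \<in> N" for X :: "'a \<Rightarrow>\<^sub>L 'a" and y
    unfolding N_def
  proof (safe)
    fix T assume "T \<in> M"
    then have "T o\<^sub>L X \<in> M" using that compose_in by blast
    then show "Q (T (X y)) = 0" using that(2) unfolding N_def by fastforce
  qed
  have NM': "X y \<in> N" if X: "X \<in> commutant M" and y: "y \<in> N" for X :: "'a \<Rightarrow>\<^sub>L 'a" and y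
    unfolding N_def
  proof (safe)
    fix T assume T: "T \<in> M"
    have "Q o\<^sub>L T \<in> M" using Q T compose_in by (auto simp: prj_def)
    then have "(Q o\<^sub>L T) (X y) = X ((Q o\<^sub>L T) y)" using commutantD[OF X] by (metis blinfun_apply_blinfun_compose)
    then show "Q (T (X y)) = 0" using y T by (simp add: N_def blinfun.bilinear_simps)
  qed
  have ZM: "X o\<^sub>L Z = Z o\<^sub>L X" if "X \<in> M" for X
    by (rule comm) (use that radj_in NM in blast)+
  have Zcl: "complex_linear Z" unfolding complex_linear_scalar_op using ZM scalar_op_in by blast
  have "Z \<in> M"
    unfolding mem_iff using Zcl
  proof (intro conjI ballI)
    fix X assume X: "X \<in> commutant M"
    have "X o\<^sub>L Z = Z o\<^sub>L X" by (rule comm) (use X commutant_radj NM' in blast)+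
    then show "Z o\<^sub>L X = X o\<^sub>L Z" by simp
  qed
  moreover have "Z \<in> commutant M" unfolding commutant_def using Zcl ZM by auto
  ultimately obtain c where c: "Z = scalar_op c" using fac by (auto simp: factor_def)
  have "P x \<in> N" for x
    unfolding N_def
  proof (safe)
    fix T assume "T \<in> M"
    then have "(Q o\<^sub>L (T o\<^sub>L P)) x = 0" by (simp only: z zero_blinfun.rep_eq)
    then show "Q (T (P x)) = 0" by simp
  qed
  then have ZP: "Z (P x) = P x" for x by (rule NZ)
  obtain x where x: "P x \<noteq> 0" using P(2) by (metis blinfun_eqI zero_blinfun.rep_eq)
  have "(c - 1) *\<^sub>C P x + P x = P x"
    using ZP[of x] scaleC_add_left[of "c - 1" 1 "P x"] scaleC_of_real[of 1 "P x"]
    by (simp add: c scalar_op.rep_eq)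
  then have "norm ((c - 1) *\<^sub>C P x) = 0" by simp
  then have "c = 1" using x by (simp add: norm_scaleC)
  then have "Z y = y" for y using scaleC_of_real[of 1 y] by (simp add: c scalar_op.rep_eq)
  then have "y \<in> N" for y using ZN by metis
  then have "Q y = 0" for y using id_in unfolding N_def by fastforce
  then show False using Q(2) by (metis blinfun_eqI zero_blinfun.rep_eq)
qed

lemma nonzero_partial_isometry:
  assumes P: "prj P" "P \<noteq> 0" and Q: "prj Q" "Q \<noteq> 0"
  shows "\<exists>V\<in>M. V \<noteq> 0 \<and> proj (radj V o\<^sub>L V) \<and> V o\<^sub>L P = V \<and> Q o\<^sub>L V = V"
proof -
  obtain T where T: "T \<in> M" "Q o\<^sub>L (T o\<^sub>L P) \<noteq> 0" using factor_link[OF assms] by blast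
  have QQ: "Q o\<^sub>L Q = Q" and PP: "P o\<^sub>L P = P" "proj P" using P Q by (auto simp: prj_def proj_idem)
  have "Q o\<^sub>L (T o\<^sub>L P) \<in> M" using P Q T by (auto simp: prj_def intro: in_M)
  from partial_isometry_part[OF this T(2)] obtain V where V: "V \<in> M" "V \<noteq> 0" "proj (radj V o\<^sub>L V)"
    "\<forall>X. X o\<^sub>L (Q o\<^sub>L (T o\<^sub>L P)) = Q o\<^sub>L (T o\<^sub>L P) \<longrightarrow> X o\<^sub>L V = V"
    "\<forall>X. proj X \<longrightarrow> (Q o\<^sub>L (T o\<^sub>L P)) o\<^sub>L X = Q o\<^sub>L (T o\<^sub>L P) \<longrightarrow> V o\<^sub>L X = V" by blast
  have "Q o\<^sub>L V = V" by (rule V(4)[rule_format]) (metis QQ compose_simps(1))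
  moreover have "V o\<^sub>L P = V" by (rule V(5)[rule_format, OF PP(2)]) (simp add: compose_simps PP)
  ultimately show ?thesis using V by blast
qed

text \<open>Zorn's lemma yields a maximal family with orthogonal initial and orthogonal final
  projections. Its initial projections are nonzero and pairwise orthogonal, so sigma-finiteness
  makes the family countable.\<close>

lemma maximal_orthogonal_sequence:
  assumes \<Phi>: "\<And>V. \<Phi> V \<Longrightarrow> V \<in> M \<and> V \<noteq> 0 \<and> proj (radj V o\<^sub>L V)"
  shows "\<exists>f::nat \<Rightarrow> _. (\<forall>i. f i = 0 \<or> \<Phi> (f i)) \<and>
    (\<forall>i j. i \<noteq> j \<longrightarrow> f i o\<^sub>L radj (f j) = 0 \<and> radj (f i) o\<^sub>L f j = 0) \<and>
    (\<forall>V. \<Phi> V \<longrightarrow> (\<exists>i. \<not> (V o\<^sub>L radj (f i) = 0 \<and> radj V o\<^sub>L f i = 0)))"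
proof -
  define R where "R V W \<longleftrightarrow> V o\<^sub>L radj W = 0 \<and> radj V o\<^sub>L W = 0" for V W :: "'a \<Rightarrow>\<^sub>L 'a"
  have Rsym: "R W V" if "R V W" for V W
  proof -
    have "radj (V o\<^sub>L radj W) = 0" "radj (radj V o\<^sub>L W) = 0" using that unfolding R_def by simp_all
    then show ?thesis by (simp add: R_def)
  qed
  define \<A> where "\<A> = {F. (\<forall>V\<in>F. \<Phi> V) \<and> pairwise R F}"
  have "\<exists>F\<in>\<A>. \<forall>X\<in>\<A>. F \<subseteq> X \<longrightarrow> X = F"
  proof (rule subset_Zorn')
    fix C assume C: "subset.chain \<A> C"
    have "R V W" if "V \<in> \<Union>C" "W \<in> \<Union>C" "V \<noteq> W" for V W
    proof -
      from that(1,2) obtain X Y where XY: "X \<in> C" "V \<in> X" "Y \<in> C" "W \<in> Y" by blast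
      have "X \<subseteq> Y \<or> Y \<subseteq> X" using C XY by (auto simp: subset_chain_def)
      then obtain U where U: "U \<in> C" "V \<in> U" "W \<in> U" using XY by blast
      then have "pairwise R U" using C by (auto simp: subset_chain_def \<A>_def)
      then show ?thesis using U that(3) by (auto simp: pairwise_def)
    qed
    moreover have "\<forall>V\<in>\<Union>C. \<Phi> V" using C by (auto simp: subset_chain_def \<A>_def)
    ultimately show "\<Union>C \<in> \<A>" by (auto simp: \<A>_def pairwise_def)
  qed
  then obtain F where F: "F \<in> \<A>" "\<And>X. X \<in> \<A> \<Longrightarrow> F \<subseteq> X \<Longrightarrow> X = F" by blast
  have \<Phi>F: "\<Phi> V" if "V \<in> F" for V using F(1) that by (auto simp: \<A>_def)
  have RF: "R V W" if "V \<in> F" "W \<in> F" "V \<noteq> W" for V W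
    using F(1) that by (auto simp: \<A>_def pairwise_def)
  define g where "g V = radj V o\<^sub>L V" for V :: "'a \<Rightarrow>\<^sub>L 'a"
  have g0: "g V \<noteq> 0" if "V \<in> F" for V using \<Phi>[OF \<Phi>F[OF that]] gram_eq_0 by (auto simp: g_def)
  have gg: "g V o\<^sub>L g W = 0" if "V \<in> F" "W \<in> F" "V \<noteq> W" for V W
  proof -
    have "g V o\<^sub>L g W = radj V o\<^sub>L ((V o\<^sub>L radj W) o\<^sub>L W)" by (simp add: g_def compose_simps)
    also have "V o\<^sub>L radj W = 0" using RF[OF that] by (simp add: R_def)
    finally show ?thesis by simp
  qed
  have gp: "g V \<in> M \<and> projection (g V)" if "V \<in> F" for V
  proof -
    have "g V \<in> M" using \<Phi>[OF \<Phi>F[OF that]] by (auto simp: g_def intro: in_M)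
    then show ?thesis using \<Phi>[OF \<Phi>F[OF that]] prj_iff by (auto simp: g_def)
  qed
  have "inj_on g F"
  proof (rule inj_onI, rule ccontr)
    fix V W assume V: "V \<in> F" "W \<in> F" "g V = g W" "V \<noteq> W"
    have "g V o\<^sub>L g V = g V" using gp[OF V(1)] by (simp add: projection_def)
    then show False using gg[OF V(1,2,4)] g0[OF V(1)] V(3) by simp
  qed
  moreover have "countable (g ` F)"
    using sigma_finite[unfolded sigma_finite_algebra_def, rule_format, of "g ` F"] gp g0 gg
    by (fastforce simp: pairwise_def)
  ultimately have cF: "countable F" using countable_image_inj_on by blast
  define f where "f n = (if n \<in> to_nat_on F ` F then from_nat_into F n else 0)" for n
  have fF: "f n = 0 \<or> (f n \<in> F \<and> n = to_nat_on F (f n))" for n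
    using from_nat_into_to_nat_on[OF cF] by (auto simp: f_def)
  have Ff: "f (to_nat_on F V) = V" if "V \<in> F" for V
    using from_nat_into_to_nat_on[OF cF that] that by (auto simp: f_def)
  have "R (f i) (f j)" if "i \<noteq> j" for i j
  proof (cases "f i = 0 \<or> f j = 0")
    case False
    then have "f i \<in> F" "f j \<in> F" "f i \<noteq> f j" using fF[of i] fF[of j] that by auto
    then show ?thesis by (rule RF)
  qed (auto simp: R_def compose_simps)
  moreover have "\<exists>i. \<not> R V (f i)" if "\<Phi> V" for V
  proof (rule ccontr)
    assume "\<nexists>i. \<not> R V (f i)"
    then have RV: "R V (f i)" for i by blast
    have "insert V F \<in> \<A>"
      using F(1) that RV Ff Rsym by (auto simp: \<A>_def pairwise_insert) metis+
    then have "V \<in> F" using F(2) by blast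
    then have "R V V" using RV Ff by metis
    then have "V = 0" using gram_eq_0 by (auto simp: R_def)
    then show False using \<Phi>[OF that] by blast
  qed
  ultimately show ?thesis using fF \<Phi>F unfolding R_def by metis
qed

text \<open>The partial isometries of a maximal orthogonal family from P into Q are added up. If
  both P and Q had a remainder, \<open>nonzero_partial_isometry\<close> would link the remainders
  and enlarge the family; so one of the two is used up.\<close>

lemma comparison:
  assumes P: "prj P" and Q: "prj Q"
  shows "psub P Q \<or> psub Q P"
proof -
  define \<Phi> where "\<Phi> V \<longleftrightarrow> V \<in> M \<and> V \<noteq> 0 \<and> proj (radj V o\<^sub>L V) \<and> V o\<^sub>L P = V \<and> Q o\<^sub>L V = V" for V
  obtain f :: "nat \<Rightarrow> _" where f: "\<And>i. f i = 0 \<or> \<Phi> (f i)"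
    "\<And>i j. i \<noteq> j \<Longrightarrow> f i o\<^sub>L radj (f j) = 0 \<and> radj (f i) o\<^sub>L f j = 0"
    "\<And>V. \<Phi> V \<Longrightarrow> (\<exists>i. \<not> (V o\<^sub>L radj (f i) = 0 \<and> radj V o\<^sub>L f i = 0))"
    using maximal_orthogonal_sequence[of \<Phi>] unfolding \<Phi>_def by blast
  have fM: "f i \<in> M" "f i o\<^sub>L P = f i" "Q o\<^sub>L f i = f i" for i
    using f(1)[of i] zero_in by (auto simp: \<Phi>_def compose_simps)
  define p where "p i = radj (f i) o\<^sub>L f i" for i
  define q where "q i = f i o\<^sub>L radj (f i)" for i
  have pis: "pis (f i) (p i) (q i)" for i
    unfolding p_def q_def using f(1)[of i] by (intro pisI) (auto simp: \<Phi>_def)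
  have op: "orth p" unfolding orth_def
  proof (intro conjI allI impI)
    show "p i o\<^sub>L p j = 0" if "i \<noteq> j" for i j
    proof -
      have "p i o\<^sub>L p j = radj (f i) o\<^sub>L ((f i o\<^sub>L radj (f j)) o\<^sub>L f j)" by (simp add: p_def compose_simps)
      then show ?thesis using f(2)[OF that] by (simp add: compose_simps)
    qed
  qed (use pis pis_proj in blast)
  have oq: "orth q" unfolding orth_def
  proof (intro conjI allI impI)
    show "q i o\<^sub>L q j = 0" if "i \<noteq> j" for i j
    proof -
      have "q i o\<^sub>L q j = f i o\<^sub>L ((radj (f i) o\<^sub>L f j) o\<^sub>L radj (f j))" by (simp add: q_def compose_simps)
      then show ?thesis using f(2)[OF that] by (simp add: compose_simps)
    qed
  qed (use pis pis_proj in blast)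
  have PQ: "proj P" "proj Q" "P \<in> M" "Q \<in> M" using P Q by (auto simp: prj_def)
  have Pf: "P o\<^sub>L radj (f i) = radj (f i)" for i
    using arg_cong[OF fM(2)[of i], of radj] by (simp add: proj_radj PQ)
  have "P o\<^sub>L p i = p i" for i unfolding p_def using Pf by (simp flip: compose_simps(1))
  then have Pp: "P o\<^sub>L ssum p = ssum p" by (rule ssum_least[OF op])
  have "Q o\<^sub>L q i = q i" for i unfolding q_def using fM(3) by (simp flip: compose_simps(1))
  then have Qq: "Q o\<^sub>L ssum q = ssum q" by (rule ssum_least[OF oq])
  have pM: "p i \<in> M" "q i \<in> M" for i unfolding p_def q_def using fM by (auto intro: in_M)
  note W = pis_sums[OF pis op oq]
  have WM: "ssum f \<in> M" by (rule sot_sums_in[OF W(1) fM(1)])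
  have sM: "prj (ssum p)" "prj (ssum q)" using prj_ssum op oq pM by blast+
  have "P = ssum p \<or> Q = ssum q"
  proof (rule ccontr)
    assume n: "\<not> ?thesis"
    have "prj (P - ssum p)" "prj (Q - ssum q)"
      using sM PQ Pp Qq proj_diff in_M by (auto simp: prj_def)
    from nonzero_partial_isometry[OF this(1) _ this(2)] n
    obtain V where V: "V \<in> M" "V \<noteq> 0" "proj (radj V o\<^sub>L V)" "V o\<^sub>L (P - ssum p) = V" "(Q - ssum q) o\<^sub>L V = V"
      by auto
    have 1: "(P - ssum p) o\<^sub>L P = P - ssum p" "Q o\<^sub>L (Q - ssum q) = Q - ssum q"
      using proj_le_commute[OF _ PQ(1) Pp] sM by (auto simp: compose_simps Qq proj_idem PQ prj_def)
    have "\<Phi> V" unfolding \<Phi>_def using V 1 by (metis compose_simps(1))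
    then obtain i where i: "\<not> (V o\<^sub>L radj (f i) = 0 \<and> radj V o\<^sub>L f i = 0)" using f(3) by blast
    have "(P - ssum p) o\<^sub>L radj (f i) = 0"
    proof -
      have "ssum p o\<^sub>L radj (f i) = radj (f i)"
        using orth_ssum(3)[OF op, of i] pis_left[OF pis_radj[OF pis], of i] by (metis compose_simps(1))
      then show ?thesis by (simp add: compose_simps Pf)
    qed
    then have a: "V o\<^sub>L radj (f i) = 0" using V(4) by (metis compose_simps(1,13))
    have "(Q - ssum q) o\<^sub>L f i = 0"
    proof -
      have "ssum q o\<^sub>L f i = f i"
        using orth_ssum(3)[OF oq, of i] pis_left[OF pis, of i] by (metis compose_simps(1))
      then show ?thesis by (simp add: compose_simps fM)
    qed
    moreover have "radj V o\<^sub>L (Q - ssum q) = radj V"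
      using arg_cong[OF V(5), of radj] sM by (simp add: proj_radj PQ prj_def)
    ultimately have "radj V o\<^sub>L f i = 0" by (metis compose_simps(1,13))
    then show False using a i by blast
  qed
  then show ?thesis
  proof
    assume "P = ssum p"
    then show ?thesis using W(2) WM Qq unfolding psub_def by blast
  next
    assume "Q = ssum q"
    then show ?thesis using pis_radj[OF W(2)] radj_in[OF WM] Pp unfolding psub_def by blast
  qed
qed

text \<open>A maximal orthogonal family of projections subequivalent to D sums to the identity: a
  nonzero remainder is linked to D by a partial isometry, whose initial projection could be
  added.\<close>

lemma exhaustion_by_small:
  assumes D: "prj D" "D \<noteq> 0"
  shows "\<exists>g. orth g \<and> (\<forall>i. psub (g i) D) \<and> ssum g = id_blinfun"
proof -
  define \<Phi> where "\<Phi> p \<longleftrightarrow> prj p \<and> p \<noteq> 0 \<and> psub p D" for p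
  have \<Phi>: "p \<in> M \<and> p \<noteq> 0 \<and> proj (radj p o\<^sub>L p)" if "\<Phi> p" for p
    using that by (auto simp: \<Phi>_def prj_def proj_radj proj_idem)
  obtain g :: "nat \<Rightarrow> _" where g: "\<And>i. g i = 0 \<or> \<Phi> (g i)"
    "\<And>i j. i \<noteq> j \<Longrightarrow> g i o\<^sub>L radj (g j) = 0 \<and> radj (g i) o\<^sub>L g j = 0"
    "\<And>V. \<Phi> V \<Longrightarrow> (\<exists>i. \<not> (V o\<^sub>L radj (g i) = 0 \<and> radj V o\<^sub>L g i = 0))"
    using maximal_orthogonal_sequence[of \<Phi>, OF \<Phi>] by blast
  have gp: "proj (g i)" "g i \<in> M" "psub (g i) D" for i
    using g(1)[of i] zero_in psub_0 by (auto simp: \<Phi>_def prj_def)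
  have o: "orth g" unfolding orth_def using g(2) gp proj_radj by metis
  have s: "prj (ssum g)" by (rule prj_ssum[OF o gp(2)])
  have "ssum g = id_blinfun"
  proof (rule ccontr)
    assume n: "ssum g \<noteq> id_blinfun"
    define r where "r = id_blinfun - ssum g"
    have r: "prj r" "r \<noteq> 0" using s n in_M proj_compl by (auto simp: r_def prj_def)
    obtain V where V: "V \<in> M" "V \<noteq> 0" "proj (radj V o\<^sub>L V)" "V o\<^sub>L r = V" "D o\<^sub>L V = V"
      using nonzero_partial_isometry[OF r D] by blast
    define p where "p = radj V o\<^sub>L V"
    have pV: "pis V p (V o\<^sub>L radj V)" unfolding p_def by (rule pisI[OF V(3)])
    have "D o\<^sub>L (V o\<^sub>L radj V) = V o\<^sub>L radj V" using V(5) by (simp flip: compose_simps(1))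
    then have "psub p D" unfolding psub_def using V(1) pV by blast
    moreover have "p \<noteq> 0" using V(2) gram_eq_0[of V] by (auto simp: p_def)
    ultimately have "\<Phi> p" using psub_prj by (auto simp: \<Phi>_def)
    then obtain i where i: "\<not> (p o\<^sub>L radj (g i) = 0 \<and> radj p o\<^sub>L g i = 0)" using g(3) by blast
    have "p o\<^sub>L r = p" by (simp add: p_def compose_simps V)
    moreover have "r o\<^sub>L g i = 0" using orth_ssum(3)[OF o] by (simp add: r_def compose_simps)
    ultimately have "p o\<^sub>L g i = 0" by (metis compose_simps(1,13))
    then show False using i by (simp add: proj_radj gp pis_proj[OF pV])
  qed
  then show ?thesis using o gp by blast
qed

definition large :: "('a \<Rightarrow>\<^sub>L 'a) \<Rightarrow> bool" where
  "large P \<longleftrightarrow> prj P \<and> psub id_blinfun P"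

lemma large_prj: "large P \<Longrightarrow> prj P"
  by (simp add: large_def)

lemma prj_id: "prj id_blinfun"
  by (simp add: prj_def id_in)

lemma large_psub: "large P \<Longrightarrow> psub P Q \<Longrightarrow> prj Q \<Longrightarrow> large Q"
  unfolding large_def using psub_trans by blast

lemma large_mono: "large P \<Longrightarrow> Q o\<^sub>L P = P \<Longrightarrow> prj Q \<Longrightarrow> large Q"
  using large_psub psub_le large_prj by blast

lemma psub_large: "prj P \<Longrightarrow> large Q \<Longrightarrow> psub P Q"
  unfolding large_def using psub_trans[of P id_blinfun Q] psub_le[of P id_blinfun]
  by (simp add: compose_simps)

lemma large_peq: "large P \<Longrightarrow> large Q \<Longrightarrow> peq P Q"
  by (intro schroeder_bernstein psub_large large_prj)

text \<open>The identity is an orthogonal sum of pieces subequivalent to D. The i-th piece embeds in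
  \<open>d i\<close>, and the orthogonal sum of the embeddings maps the identity below P. This is
  the test for largeness used throughout.\<close>

lemma orthogonal_copies_large:
  assumes D: "D \<noteq> 0" and d: "orth d" "\<And>n. d n \<in> M" "\<And>n. psub D (d n)"
    and P: "prj P" "\<And>n. P o\<^sub>L d n = d n"
  shows "large P"
proof -
  obtain g where g: "orth g" "\<And>i. psub (g i) D" "ssum g = id_blinfun"
    using exhaustion_by_small[OF psub_prj[OF d(3)] D] by blast
  have "\<exists>V q. V \<in> M \<and> pis V (g i) q \<and> d i o\<^sub>L q = q" for i
    using psub_trans[OF g(2) d(3), of i i] unfolding psub_def by blast
  then obtain V q where V: "\<And>i. V i \<in> M" "\<And>i. pis (V i) (g i) (q i)" "\<And>i. d i o\<^sub>L q i = q i"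
    by metis
  have qd: "q i o\<^sub>L d i = q i" for i
    by (rule proj_le_commute[OF pis_proj(2)[OF V(2)] orth_proj[OF d(1)] V(3)])
  have oq: "orth q" unfolding orth_def
  proof (intro conjI allI impI)
    show "q i o\<^sub>L q j = 0" if "i \<noteq> j" for i j
    proof -
      have "q i o\<^sub>L q j = q i o\<^sub>L ((d i o\<^sub>L d j) o\<^sub>L q j)"
        by (simp add: compose_simps V(3)) (simp add: qd flip: compose_simps(1))
      then show ?thesis using orth_zero[OF d(1) that] by (simp add: compose_simps)
    qed
  qed (use V pis_proj in blast)
  note W = pis_sums[OF V(2) g(1) oq]
  have "P o\<^sub>L q i = q i" for i using P(2) V(3) by (metis compose_simps(1))
  then have "P o\<^sub>L ssum q = ssum q" by (rule ssum_least[OF oq])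
  then have "psub id_blinfun P"
    using W(2) sot_sums_in[OF W(1) V(1)] g(3) unfolding psub_def by auto
  then show ?thesis using P(1) by (simp add: large_def)
qed

text \<open>An equivalence of P with a proper subprojection Q has infinitely many orthogonal
  translates of P - Q below P.\<close>

lemma not_finite_large:
  assumes P: "prj P" and nf: "\<not> finite_projection M P"
  shows "large P"
proof -
  obtain Q where Q: "Q \<in> M" "subprojection Q P" "mvn_equivalent M Q P" "Q \<noteq> P"
    using nf P prj_iff unfolding finite_projection_def prj_def by blast
  have q: "prj Q" "P o\<^sub>L Q = Q" using Q prj_iff by (auto simp: subprojection_def prj_def)
  have "peq P Q" using Q(3) mvn_equivalent_peq q(1) peq_sym by (auto simp: prj_def)
  then obtain V where V: "V \<in> M" "pis V P Q" by (auto simp: peq_def)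
  note w = wander[OF P q V(1) pis_eq(1)[OF V(2)] pis_left[OF V(2)]]
  show ?thesis
    by (rule orthogonal_copies_large[OF _ w(1,2) peq_psub[OF w(5)] P w(3)]) (use Q(4) in auto)
qed

text \<open>The translates of a wandering projection are indexed by pairs; each row of the pairing
  is an infinite family of equivalent projections and therefore has a large sum.\<close>

lemma large_split:
  shows "\<exists>H. orth H \<and> (\<forall>n. large (H n))"
proof -
  have "\<exists>Q\<in>M. subprojection Q id_blinfun \<and> mvn_equivalent M Q id_blinfun \<and> Q \<noteq> id_blinfun"
    using infinite_alg prj_id prj_iff unfolding infinite_algebra_def finite_projection_def prj_def by blast
  then obtain Q where Q: "Q \<in> M" "subprojection Q id_blinfun" "mvn_equivalent M Q id_blinfun" "Q \<noteq> id_blinfun"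
    by blast
  have q: "prj Q" "id_blinfun o\<^sub>L Q = Q" using Q prj_iff by (auto simp: subprojection_def prj_def)
  have "peq id_blinfun Q" using Q(3) mvn_equivalent_peq q(1) peq_sym by (auto simp: prj_def)
  then obtain V where V: "V \<in> M" "pis V id_blinfun Q" by (auto simp: peq_def)
  define d where "d = wander V (id_blinfun - Q)"
  note w = wander[OF prj_id q V(1) pis_eq(1)[OF V(2)] pis_left[OF V(2)], folded d_def]
  define H where "H n = ssum (\<lambda>i. d (prod_encode (n, i)))" for n
  have inj: "inj (\<lambda>i. prod_encode (n, i))" for n by (auto simp: inj_on_def)
  have o: "orth (\<lambda>i. d (prod_encode (n, i)))" for n by (rule orth_reindex[OF w(1) inj])
  have pH: "prj (H n)" for n unfolding H_def by (rule prj_ssum[OF o w(2)])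
  have "large (H n)" for n
    by (rule orthogonal_copies_large[OF _ o w(2) peq_psub[OF w(5)] pH])
      (use Q(4) orth_ssum(3)[OF o] in \<open>auto simp: H_def\<close>)
  moreover have "orth H" unfolding orth_def
  proof (intro conjI allI impI)
    show "proj (H n)" for n using pH by (simp add: prj_def)
    show "H m o\<^sub>L H n = 0" if "m \<noteq> n" for m n
      unfolding H_def by (rule orth_ssum_disjoint[OF w(1) inj inj]) (use that in auto)
  qed
  ultimately show ?thesis by blast
qed

lemma large_split_below:
  assumes P: "large P"
  shows "\<exists>H. orth H \<and> (\<forall>n. large (H n)) \<and> (\<forall>n. P o\<^sub>L H n = H n)"
proof -
  obtain K where K: "orth K" "\<And>n. large (K n)" using large_split by blast
  obtain V where V: "V \<in> M" "pis V id_blinfun P"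
    using large_peq[of id_blinfun P] P peq_refl[OF prj_id] peq_psub prj_id by (auto simp: large_def peq_def)
  define H where "H n = V o\<^sub>L (K n o\<^sub>L radj V)" for n
  have pK: "prj (K n)" for n using K large_prj by blast
  have r: "pis (V o\<^sub>L K n) (K n) (H n)" for n
    unfolding H_def using pis_restrict[OF V(2)] pK by (simp add: prj_def compose_simps)
  have "V o\<^sub>L K n \<in> M" for n using V(1) pK[of n] compose_in[of V "K n"] by (simp add: prj_def)
  then have "peq (K n) (H n)" for n unfolding peq_def using r[of n] by (intro bexI)
  then have "large (H n)" for n using large_psub[OF K(2) peq_psub peq_prj(2)] by blast
  moreover have "P o\<^sub>L H n = H n" for n
    unfolding H_def using pis_left[OF V(2)] by (simp flip: compose_simps(1))
  moreover have "orth H" unfolding orth_def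
  proof (intro conjI allI impI)
    show "proj (H n)" for n using pis_proj(2)[OF r] .
    show "H m o\<^sub>L H n = 0" if "m \<noteq> n" for m n
    proof -
      have "H m o\<^sub>L H n = V o\<^sub>L ((K m o\<^sub>L ((radj V o\<^sub>L V) o\<^sub>L K n)) o\<^sub>L radj V)" by (simp add: H_def compose_simps)
      also have "\<dots> = 0" using orth_zero[OF K(1) that] by (simp add: pis_eq(1)[OF V(2)] compose_simps)
      finally show ?thesis .
    qed
  qed
  ultimately show ?thesis by blast
qed

end

section \<open>Splitting large spectral projections\<close>

text \<open>Omitted indices contribute 0, so that subfamilies remain sequences over all natural
  numbers.\<close>

definition psum :: "(nat \<Rightarrow> ('a::complex_hilbert_space \<Rightarrow>\<^sub>L 'a)) \<Rightarrow> nat set \<Rightarrow> ('a \<Rightarrow>\<^sub>L 'a)" where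
  "psum F S = ssum (\<lambda>k. if k \<in> S then F k else 0)"

lemma orth_restrict: "orth F \<Longrightarrow> orth (\<lambda>k. if k \<in> S then F k else 0)"
  by (auto simp: orth_def compose_simps)

lemma psum_absorb: "orth F \<Longrightarrow> k \<in> S \<Longrightarrow> psum F S o\<^sub>L F k = F k"
  using orth_ssum(3)[OF orth_restrict, of F S k] by (simp add: psum_def)

lemma psum_disjoint:
  assumes F: "orth F" and ST: "S \<inter> T = {}" shows "psum F S o\<^sub>L psum F T = 0"
proof -
  note o = orth_restrict[OF F]
  have z: "F k o\<^sub>L psum F S = 0" if "k \<notin> S" for k
    unfolding psum_def by (rule ssum_zero[OF o]) (use that in \<open>auto intro: orth_zero[OF F]\<close>)
  show ?thesis
    unfolding psum_def[of F T]
  proof (rule ssum_zero[OF o])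
    fix k
    show "psum F S o\<^sub>L (if k \<in> T then F k else 0) = 0"
    proof (cases "k \<in> T")
      case True
      then have "F k o\<^sub>L psum F S = 0" using ST by (intro z) auto
      then show ?thesis
        using proj_orth_commute[OF orth_proj[OF F] orth_ssum(1)[OF o]] True by (simp add: psum_def)
    qed simp
  qed
qed

context sfactor begin

lemma id_ne_0: "id_blinfun \<noteq> (0 :: 'a \<Rightarrow>\<^sub>L 'a)"
proof
  assume "id_blinfun = (0 :: 'a \<Rightarrow>\<^sub>L 'a)"
  then have "Q = 0" for Q :: "'a \<Rightarrow>\<^sub>L 'a" using compose_simps(10,12) by metis
  then have "finite_projection M id_blinfun"
    unfolding finite_projection_def using prj_id prj_iff by (metis prj_def)
  then show False using infinite_alg by (simp add: infinite_algebra_def)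
qed

lemma large_ne_0: "large P \<Longrightarrow> P \<noteq> 0"
proof
  assume "large P" "P = 0"
  then have "psub id_blinfun 0" by (simp add: large_def)
  then obtain V r :: "'a \<Rightarrow>\<^sub>L 'a" where V: "pis V id_blinfun r" "0 o\<^sub>L r = r" unfolding psub_def by blast
  then have "V = 0" using pis_left[OF V(1)] by (metis compose_simps(12))
  then show False using pis_eq(1)[OF V(1)] id_ne_0 by simp
qed

lemma psub_add:
  assumes "psub a b" "psub a' b'" and o: "a o\<^sub>L a' = 0" "b o\<^sub>L b' = 0" and b: "prj b" "prj b'"
  shows "psub (a + a') (b + b')"
proof -
  obtain V r where V: "V \<in> M" "pis V a r" "b o\<^sub>L r = r" using assms(1) unfolding psub_def by blast
  obtain W t where W: "W \<in> M" "pis W a' t" "b' o\<^sub>L t = t" using assms(2) unfolding psub_def by blast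
  have pb: "proj b" "proj b'" using b by (auto simp: prj_def)
  have rb: "r o\<^sub>L b = r" by (rule proj_le_commute[OF pis_proj(2)[OF V(2)] pb(1) V(3)])
  have b'b: "b' o\<^sub>L b = 0" by (rule proj_orth_commute[OF pb o(2)])
  have "r o\<^sub>L t = r o\<^sub>L ((b o\<^sub>L b') o\<^sub>L t)" by (simp add: compose_simps W(3) rb flip: compose_simps(1))
     (simp add: compose_simps W(3))
  then have rt: "r o\<^sub>L t = 0" by (simp add: o)
  have "b o\<^sub>L t = 0" by (metis W(3) o(2) compose_simps(1,12))
  moreover have "b' o\<^sub>L r = 0" by (metis V(3) b'b compose_simps(1,12))
  ultimately have "(b + b') o\<^sub>L (r + t) = r + t" by (simp add: compose_simps V(3) W(3))
  then show ?thesis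
    unfolding psub_def using pis_add[OF V(2) W(2) o(1) rt] add_in[OF V(1) W(1)] by blast
qed

lemma prj_sum: "orth F \<Longrightarrow> (\<And>k. F k \<in> M) \<Longrightarrow> prj (\<Sum>k\<in>{n..<m}. F k)"
proof (induction m)
  case (Suc m)
  show ?case
  proof (cases "n \<le> m")
    case True
    have "(\<Sum>k\<in>{n..<m}. F k) o\<^sub>L F m = 0"
      unfolding sum_compose by (rule sum.neutral) (auto intro!: orth_zero[OF Suc.prems(1)])
    then show ?thesis using True Suc by (auto simp: prj_def intro: proj_add orth_proj add_in)
  qed (simp add: prj_def zero_in)
qed (simp add: prj_def zero_in)

lemma embed_tail:
  assumes F: "orth F" "\<And>k. F k \<in> M" and P: "prj P" and n: "\<And>m. m > n \<Longrightarrow> \<not> psub P (\<Sum>k\<in>{n..<m}. F k)"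
  shows "psub (ssum (\<lambda>k. F (k + n))) P"
proof -
  \<comment> \<open>The first component is the part of P already occupied; the second is the partial
    isometry that carried the most recent piece there.\<close>
  define \<Phi> where "\<Phi> j TV \<longleftrightarrow> prj (fst TV) \<and> P o\<^sub>L fst TV = fst TV \<and> peq (\<Sum>k\<in>{n..<n+j}. F k) (fst TV)"
    for j :: nat and TV :: "('a \<Rightarrow>\<^sub>L 'a) \<times> ('a \<Rightarrow>\<^sub>L 'a)"
  define \<Psi> where "\<Psi> j TV TV' \<longleftrightarrow> snd TV' \<in> M \<and> (\<exists>g. pis (snd TV') (F (j + n)) g \<and> P o\<^sub>L g = g \<and>
      fst TV' = fst TV + g \<and> fst TV o\<^sub>L g = 0)"
    for j :: nat and TV TV' :: "('a \<Rightarrow>\<^sub>L 'a) \<times> ('a \<Rightarrow>\<^sub>L 'a)"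
  have pP: "proj P" "P \<in> M" using P by (auto simp: prj_def)
  have "\<exists>f. \<forall>j. \<Phi> j (f j) \<and> \<Psi> j (f j) (f (Suc j))"
  proof (rule dependent_nat_choice)
    show "\<exists>x. \<Phi> 0 x"
      using peq_refl[of 0] by (intro exI[of _ "(0, 0)"]) (simp add: \<Phi>_def prj_def zero_in)
  next
    fix TV j assume \<Phi>: "\<Phi> j TV"
    define T where "T = fst TV"
    have T: "prj T" "P o\<^sub>L T = T" "peq (\<Sum>k\<in>{n..<n+j}. F k) T" using \<Phi> by (auto simp: \<Phi>_def T_def)
    have pT: "proj T" "T \<in> M" using T by (auto simp: prj_def)
    have PT: "prj (P - T)" using pT pP T by (auto simp: prj_def intro: proj_diff diff_in)
    have TP: "T o\<^sub>L P = T" by (rule proj_le_commute[OF pT(1) pP(1) T(2)])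
    have Fj: "prj (F (j + n))" using F by (auto simp: prj_def orth_proj)
    have "\<not> psub (P - T) (F (j + n))"
    proof
      assume a: "psub (P - T) (F (j + n))"
      have o: "(\<Sum>k\<in>{n..<n+j}. F k) o\<^sub>L F (j + n) = 0"
        unfolding sum_compose by (rule sum.neutral) (auto intro!: orth_zero[OF F(1)])
      have "psub (T + (P - T)) ((\<Sum>k\<in>{n..<n+j}. F k) + F (j + n))"
        by (rule psub_add[OF peq_psub[OF peq_sym[OF T(3)]] a _ o prj_sum[OF F] Fj])
          (simp add: compose_simps TP proj_idem pT)
      then have "psub P (\<Sum>k\<in>{n..<Suc (n+j)}. F k)" by (simp add: add.commute)
      then show False using n[of "Suc (n + j)"] by simp
    qed
    then have "psub (F (j + n)) (P - T)" using comparison[OF PT Fj] by blast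
    then obtain V g where V: "V \<in> M" "pis V (F (j + n)) g" "(P - T) o\<^sub>L g = g" unfolding psub_def by blast
    have "T o\<^sub>L g = T o\<^sub>L ((P - T) o\<^sub>L g)" by (simp add: V)
    also have "\<dots> = (T o\<^sub>L (P - T)) o\<^sub>L g" by (simp only: compose_simps(1))
    also have "\<dots> = 0" by (simp add: compose_simps TP proj_idem pT)
    finally have Tg: "T o\<^sub>L g = 0" .
    have "P o\<^sub>L (P - T) = P - T" by (simp add: compose_simps T proj_idem pP)
    then have Pg: "P o\<^sub>L g = g" using V(3) by (metis compose_simps(1))
    have o: "(\<Sum>k\<in>{n..<n+j}. F k) o\<^sub>L F (j + n) = 0"
      unfolding sum_compose by (rule sum.neutral) (auto intro!: orth_zero[OF F(1)])
    obtain W where W: "W \<in> M" "pis W (\<Sum>k\<in>{n..<n+j}. F k) T" using T(3) by (auto simp: peq_def)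
    have "peq ((\<Sum>k\<in>{n..<n+j}. F k) + F (j + n)) (T + g)"
      unfolding peq_def using pis_add[OF W(2) V(2) o Tg] add_in[OF W(1) V(1)] by blast
    then have "peq (\<Sum>k\<in>{n..<n + Suc j}. F k) (T + g)" by (simp add: add.commute)
    then have "\<Phi> (Suc j) (T + g, V)" using peq_prj(2) by (auto simp: \<Phi>_def compose_simps Pg T)
    moreover have "\<Psi> j TV (T + g, V)" using V Tg Pg by (auto simp: \<Psi>_def T_def)
    ultimately show "\<exists>y. \<Phi> (Suc j) y \<and> \<Psi> j TV y" by blast
  qed
  then obtain f where f: "\<And>j. \<Phi> j (f j)" "\<And>j. \<Psi> j (f j) (f (Suc j))" by blast
  define T where "T j = fst (f j)" for j
  define V where "V j = snd (f (Suc j))" for j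
  obtain g where g: "\<And>j. pis (V j) (F (j + n)) (g j)" "\<And>j. P o\<^sub>L g j = g j" "\<And>j. T (Suc j) = T j + g j"
      "\<And>j. T j o\<^sub>L g j = 0"
    using f(2) unfolding \<Psi>_def T_def V_def by metis
  have VM: "V j \<in> M" for j using f(2)[of j] by (simp add: \<Psi>_def V_def)
  have gp: "proj (g j)" for j using g(1) pis_proj by blast
  have pT: "proj (T j)" for j using f(1)[of j] by (simp add: \<Phi>_def T_def prj_def)
  have "g i o\<^sub>L T (i + Suc k) = g i" for i k
  proof (induction k)
    case 0
    have "g i o\<^sub>L T i = 0" by (rule proj_orth_commute[OF pT gp g(4)])
    then show ?case by (simp add: g(3) compose_simps proj_idem gp)
  next
    case (Suc k)
    have "g i o\<^sub>L g (i + Suc k) = (g i o\<^sub>L T (i + Suc k)) o\<^sub>L g (i + Suc k)" by (simp only: Suc)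
    also have "\<dots> = 0" unfolding compose_simps(1) g(4) by simp
    finally show ?case using Suc by (simp add: g(3) compose_simps)
  qed
  then have gT: "g i o\<^sub>L T j = g i" if "i < j" for i j using that by (metis less_iff_Suc_add add_Suc_right)
  have gg: "g i o\<^sub>L g j = 0" if "i < j" for i j
  proof -
    have "g i o\<^sub>L g j = (g i o\<^sub>L T j) o\<^sub>L g j" by (simp add: gT that)
    then show ?thesis by (simp add: compose_simps g(4))
  qed
  have og: "orth g" unfolding orth_def
    using gp gg proj_orth_commute by (metis linorder_neqE_nat)
  have oF: "orth (\<lambda>k. F (k + n))" by (rule orth_reindex[OF F(1)]) (simp add: inj_def)
  note W = pis_sums[OF g(1) oF og]
  show ?thesis
    unfolding psub_def using W(2) sot_sums_in[OF W(1) VM] ssum_least[OF og g(2)] by blast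
qed

text \<open>Some fixed nonzero P embeds in a finite block beginning at any index. Consecutive blocks
  then hold orthogonal copies of P, and distributing them over the rows of a pairing gives
  infinitely many disjoint large sums.\<close>

lemma tail_splitting:
  assumes F: "orth F" "\<And>k. F k \<in> M" and tails: "\<And>m. large (ssum (\<lambda>k. F (k + m)))"
  shows "\<exists>S. (\<forall>n. large (psum F (S n)) \<and> S n \<subseteq> {n..}) \<and> (\<forall>m n. m \<noteq> n \<longrightarrow> S m \<inter> S n = {})"
proof -
  \<comment> \<open>A nonzero projection that is not large works, for otherwise
    \<open>embed_tail\<close> would place a large tail below it. If every nonzero projection is
    large, a block with one nonzero member already contains a copy of the identity.\<close>
  have "\<exists>P. prj P \<and> P \<noteq> 0 \<and> (\<forall>n. \<exists>m>n. psub P (\<Sum>k\<in>{n..<m}. F k))"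
  proof (cases "\<exists>P. prj P \<and> P \<noteq> 0 \<and> \<not> large P")
    case True
    then obtain P where P: "prj P" "P \<noteq> 0" "\<not> large P" by blast
    have "\<exists>m>n. psub P (\<Sum>k\<in>{n..<m}. F k)" for n
      using embed_tail[OF F P(1), of n] large_psub[OF tails _ P(1), of n] P(3) by blast
    then show ?thesis using P by blast
  next
    case False
    have "\<exists>m>n. psub id_blinfun (\<Sum>k\<in>{n..<m}. F k)" for n
    proof -
      have "\<exists>k. F (k + n) \<noteq> 0"
      proof (rule ccontr)
        assume "\<not> ?thesis"
        then have "ssum (\<lambda>k. F (k + n)) = 0" using ssum_eqI[OF sot_sums_0] by simp
        then show False using large_ne_0[OF tails[of n]] by simp
      qed
      then obtain k where k: "F (k + n) \<noteq> 0" by blast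
      then have "large (F (k + n))" using False F orth_proj by (auto simp: prj_def)
      moreover have "(\<Sum>j\<in>{n..<Suc (k + n)}. F j) o\<^sub>L F (k + n) = F (k + n)"
      proof -
        have "(\<Sum>j\<in>{n..<Suc (k + n)}. F j) o\<^sub>L F (k + n) = (\<Sum>j\<in>{n..<Suc (k + n)}. if j = k + n then F (k + n) else 0)"
          unfolding sum_compose by (rule sum.cong[OF refl]) (use orth_zero[OF F(1)] proj_idem[OF orth_proj[OF F(1)]] in auto)
        then show ?thesis by simp
      qed
      ultimately have "large (\<Sum>j\<in>{n..<Suc (k + n)}. F j)" using large_mono prj_sum[OF F] by blast
      then show ?thesis unfolding large_def by (intro exI[of _ "Suc (k + n)"]) simp
    qed
    then show ?thesis using prj_id id_ne_0 by blast
  qed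
  then obtain P where P: "prj P" "P \<noteq> 0" "\<And>n. \<exists>m>n. psub P (\<Sum>k\<in>{n..<m}. F k)" by blast
  then obtain nx where nx: "\<And>n. nx n > n" "\<And>n. psub P (\<Sum>k\<in>{n..<nx n}. F k)" by metis
  define b where "b = rec_nat 0 (\<lambda>_. nx)"
  have b: "b (Suc i) = nx (b i)" for i by (simp add: b_def)
  have sb: "strict_mono b" by (simp add: strict_mono_Suc_iff b nx)
  define H where "H i = (\<Sum>k\<in>{b i..<b (Suc i)}. F k)" for i
  define S where "S n = (\<Union>i. {b (prod_encode (n, i))..<b (Suc (prod_encode (n, i)))})" for n
  have block: "i = j" if "k \<in> {b i..<b (Suc i)}" "k \<in> {b j..<b (Suc j)}" for i j k
  proof (rule ccontr)
    assume "i \<noteq> j"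
    then consider "Suc i \<le> j" | "Suc j \<le> i" by linarith
    then show False
      using strict_mono_leD[OF sb, of "Suc i" j] strict_mono_leD[OF sb, of "Suc j" i] that by cases auto
  qed
  have disj: "S m \<inter> S n = {}" if "m \<noteq> n" for m n
    using block that unfolding S_def by (auto, metis prod_encode_eq Pair_inject atLeastLessThan_iff)
  have Sn: "S n \<subseteq> {n..}" for n
  proof -
    \<comment> \<open>The pairing dominates its first argument and the block boundaries are strictly
      increasing; hence the n-th set starts no earlier than n.\<close>
    have "n \<le> b (prod_encode (n, i))" for i
      using le_prod_encode_1[of n i] strict_mono_imp_increasing[OF sb, of "prod_encode (n, i)"] by linarith
    then show ?thesis unfolding S_def by (fastforce intro: order_trans)
  qed
  have HH: "H i o\<^sub>L H j = 0" if "i \<noteq> j" for i j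
    unfolding H_def sum_compose
    using block that by (intro sum.neutral ballI orth_zero[OF F(1)]) blast
  have pH: "prj (H i)" for i unfolding H_def by (rule prj_sum[OF F])
  have o: "orth (\<lambda>i. H (prod_encode (n, i)))" for n
    unfolding orth_def using HH pH by (auto simp: prj_def)
  have "large (psum F (S n))" for n
  proof (rule orthogonal_copies_large[OF P(2) o])
    show "H (prod_encode (n, i)) \<in> M" for i using pH by (simp add: prj_def)
    show "psub P (H (prod_encode (n, i)))" for i unfolding H_def b using nx by blast
    show "prj (psum F (S n))"
      unfolding psum_def by (rule prj_ssum[OF orth_restrict[OF F(1)]]) (simp add: F zero_in)
    show "psum F (S n) o\<^sub>L H (prod_encode (n, i)) = H (prod_encode (n, i))" for i
      unfolding H_def sum_compose
      by (rule sum.cong[OF refl], rule psum_absorb[OF F(1)]) (auto simp: S_def)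
  qed
  then show ?thesis using disj Sn by blast
qed

text \<open>The differences of consecutive \<open>E n\<close> have large tails, so
  \<open>tail_splitting\<close> applies. The n-th set uses only differences from index n on, which
  makes \<open>Q n\<close> orthogonal to \<open>E n\<close>; being sums of the differences, the
  \<open>Q n\<close> inherit commutation with X.\<close>

lemma split_increasing_limit:
  assumes E: "\<And>n. prj (E n)" "\<And>n. E (Suc n) o\<^sub>L E n = E n" "E 0 = 0"
    and L: "\<And>x. (\<lambda>n. E n x) \<longlonglongrightarrow> blinfun_apply L x" and large: "\<And>m. large (L - E m)"
    and comm: "\<And>n. X o\<^sub>L E n = E n o\<^sub>L X"
  shows "\<exists>Q. orth Q \<and> (\<forall>n. large (Q n) \<and> L o\<^sub>L Q n = Q n \<and> E n o\<^sub>L Q n = 0 \<and> X o\<^sub>L Q n = Q n o\<^sub>L X)"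
proof -
  have pE: "proj (E n)" "E n \<in> M" for n using E by (auto simp: prj_def)
  have mm: "E n o\<^sub>L E k = E k" if "k \<le> n" for k n
    using that
  proof (induction rule: dec_induct)
    case (step n)
    then show ?case by (metis E(2) compose_simps(1))
  qed (simp add: proj_idem pE)
  have mm': "E k o\<^sub>L E n = E k" if "k \<le> n" for k n by (rule proj_le_commute[OF pE(1) pE(1) mm[OF that]])
  have pL: "proj L"
  proof -
    have "large (L - E 0)" by (rule large)
    then show ?thesis using large_prj E(3) by (auto simp: prj_def)
  qed
  have LE: "L o\<^sub>L E k = E k" for k
  proof (rule blinfun_eqI)
    fix x
    have "(\<lambda>n. E n (E k x)) \<longlonglongrightarrow> E k x"
      by (rule tendsto_eventually, rule eventually_sequentiallyI[of k])
        (metis mm blinfun_apply_blinfun_compose)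
    then show "(L o\<^sub>L E k) x = E k x" using L LIMSEQ_unique by auto
  qed
  define F where "F k = E (Suc k) - E k" for k
  have EF: "E n o\<^sub>L F k = 0" if "n \<le> k" for n k
    using that by (simp add: F_def compose_simps mm')
  have pF: "proj (F k)" for k unfolding F_def by (rule proj_diff[OF pE(1) pE(1) E(2)])
  have FF: "F i o\<^sub>L F k = 0" if "i < k" for i k
    using that EF[of "Suc i" k] EF[of i k] by (subst F_def) (simp add: compose_simps)
  have oF: "orth F" unfolding orth_def using pF FF proj_orth_commute by (metis linorder_neqE_nat)
  have FM: "F k \<in> M" for k unfolding F_def by (intro in_M pE)
  have "sot_sums (\<lambda>k. F (k + m)) (L - E m)" for m
    unfolding sot_sums_def sums_def
  proof
    fix x
    have "(\<lambda>n. E (n + m) x - E m x) \<longlonglongrightarrow> L x - E m x"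
      by (intro tendsto_intros LIMSEQ_ignore_initial_segment[OF L])
    moreover have "(\<Sum>k<n. F (k + m) x) = E (n + m) x - E m x" for n
      by (induction n) (auto simp: F_def blinfun.bilinear_simps)
    ultimately show "(\<lambda>n. \<Sum>k<n. F (k + m) x) \<longlonglongrightarrow> (L - E m) x" by (simp add: blinfun.bilinear_simps)
  qed
  then have "large (ssum (\<lambda>k. F (k + m)))" for m using ssum_eqI large by metis
  from tail_splitting[OF oF FM this] obtain S where
    S: "\<And>n. large (psum F (S n))" "\<And>n. S n \<subseteq> {n..}" "\<And>m n. m \<noteq> n \<Longrightarrow> S m \<inter> S n = {}" by blast
  have "orth (\<lambda>n. psum F (S n))"
    unfolding orth_def using S large_prj psum_disjoint[OF oF] by (auto simp: prj_def)
  moreover have "L o\<^sub>L psum F (S n) = psum F (S n)" for n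
    unfolding psum_def
    by (rule ssum_least[OF orth_restrict[OF oF]]) (auto simp: F_def compose_simps LE)
  moreover have "E n o\<^sub>L psum F (S n) = 0" for n
    unfolding psum_def
    by (rule ssum_zero[OF orth_restrict[OF oF]]) (use S(2)[of n] EF in auto)
  moreover have "X o\<^sub>L psum F (S n) = psum F (S n) o\<^sub>L X" for n
    unfolding psum_def
    by (rule ssum_commute[OF orth_restrict[OF oF]]) (auto simp: F_def compose_simps comm)
  ultimately show ?thesis using S by blast
qed

end

text \<open>\<open>large_add\<close> says that the sum of two finite projections is finite.\<close>

locale lfactor = sfactor M for M :: "('a::complex_hilbert_space \<Rightarrow>\<^sub>L 'a) set" +
  assumes large_add: "prj p \<Longrightarrow> prj q \<Longrightarrow> p o\<^sub>L q = 0 \<Longrightarrow> large (p + q) \<Longrightarrow> large p \<or> large q"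
begin

lemma large_diff:
  assumes "large q" "prj p" "q o\<^sub>L p = p" "\<not> large p" shows "large (q - p)"
proof -
  have pq: "proj p" "proj q" "p \<in> M" "q \<in> M" using assms large_prj by (auto simp: prj_def)
  have "p o\<^sub>L (q - p) = 0"
    using proj_le_commute[OF pq(1,2) assms(3)] by (simp add: compose_simps proj_idem pq)
  moreover have "prj (q - p)" using pq assms proj_diff diff_in by (auto simp: prj_def)
  ultimately show ?thesis using large_add[OF assms(2), of "q - p"] assms by auto
qed

text \<open>Let t0 be the last level up to which T has a large spectral part below p. Such a part
  accumulates at t0 from above, sits in the eigenspace of t0, or accumulates from below; each case
  can be split into infinitely many large projections commuting with T.\<close>

lemma large_spectral_sequence:
  assumes T: "T \<in> M" "radj T = T" and p: "prj p" "p o\<^sub>L T = T o\<^sub>L p"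
    and big: "\<And>c. c < \<gamma> \<Longrightarrow> large (p o\<^sub>L (id_blinfun - sres T c))" and c: "\<And>n::nat. c n < \<gamma>"
  shows "\<exists>Q. orth Q \<and> (\<forall>n. large (Q n) \<and> p o\<^sub>L Q n = Q n \<and> T o\<^sub>L Q n = Q n o\<^sub>L T \<and>
    (\<forall>x. Q n x = x \<longrightarrow> c n * (norm x)\<^sup>2 \<le> ip (T x) x))"
proof -
  define e where "e t = sres T t" for t
  define L where "L t = p o\<^sub>L (id_blinfun - e t)" for t
  have pp: "proj p" "p \<in> M" using p by (auto simp: prj_def)
  have e: "proj (e t)" "e t \<in> M" "bicom T (e t)" for t
    using sres[OF T(2)] sres_in[OF T(2,1)] by (auto simp: e_def)
  have pe: "p o\<^sub>L e t = e t o\<^sub>L p" for t by (rule bicomD[OF e(3) p(2)])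
  have Te: "T o\<^sub>L e t = e t o\<^sub>L T" for t by (rule bicom_commute[OF e(3)])
  have est: "e t o\<^sub>L e s = e s" "e s o\<^sub>L e t = e s" if "s \<le> t" for s t
    using sres_mono[OF T(2) that] sres_mono'[OF T(2) that] by (auto simp: e_def)
  have prjp: "prj (p o\<^sub>L q)" if "proj q" "q \<in> M" "p o\<^sub>L q = q o\<^sub>L p" for q
    unfolding prj_def using that pp proj_compose[OF pp(1) that(1,3)] compose_in by blast
  have pL: "prj (L t)" for t
    unfolding L_def using e pe by (intro prjp proj_compl in_M) (auto simp: compose_simps)
  have pcomp: "(p o\<^sub>L a) o\<^sub>L (p o\<^sub>L b) = p o\<^sub>L (a o\<^sub>L b)" if "p o\<^sub>L a = a o\<^sub>L p" for a b :: "'a \<Rightarrow>\<^sub>L 'a"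
  proof -
    have "(p o\<^sub>L a) o\<^sub>L (p o\<^sub>L b) = p o\<^sub>L ((a o\<^sub>L p) o\<^sub>L b)" by (simp only: compose_simps(1))
    also have "\<dots> = p o\<^sub>L ((p o\<^sub>L a) o\<^sub>L b)" by (simp only: that)
    finally have "(p o\<^sub>L a) o\<^sub>L (p o\<^sub>L b) = p o\<^sub>L ((p o\<^sub>L a) o\<^sub>L b)" .
    then show ?thesis by (simp add: proj_idem pp flip: compose_simps(1))
  qed
  have pe1: "p o\<^sub>L (id_blinfun - e t) = (id_blinfun - e t) o\<^sub>L p" for t by (simp add: compose_simps pe)
  have Lst: "L s o\<^sub>L L t = L t" if "s \<le> t" for s t
    unfolding L_def pcomp[OF pe1] using that by (simp add: compose_simps est)
  have Xe: "T o\<^sub>L (p o\<^sub>L q) = (p o\<^sub>L q) o\<^sub>L T" if "T o\<^sub>L q = q o\<^sub>L T" for q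
    by (rule commute_compose) (use that p in auto)
  have TL: "T o\<^sub>L L t = L t o\<^sub>L T" for t
    unfolding L_def by (rule Xe) (simp add: compose_simps Te)
  have bound: "s * (norm x)\<^sup>2 \<le> ip (T x) x" if "e s o\<^sub>L Q = 0" "Q x = x" for s x Q
  proof -
    have "e s x = 0" using that by (metis blinfun_apply_blinfun_compose zero_blinfun.rep_eq)
    then show ?thesis using sres_ge[OF T(2)] by (simp add: e_def)
  qed
  define X where "X = {t. large (L t)}"
  have "t \<le> norm T" if "t \<in> X" for t
  proof (rule ccontr)
    assume n: "\<not> ?thesis"
    have "e t = id_blinfun" unfolding e_def
    proof (rule sres_eq_id[OF T(2)])
      fix x
      have "ip (T x) x \<le> norm T * (norm x)\<^sup>2" using ip_apply_le[of T x] by linarith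
      also have "\<dots> \<le> t * (norm x)\<^sup>2" using n by (intro mult_right_mono) auto
      finally show "ip (T x) x \<le> t * (norm x)\<^sup>2" .
    qed
    then have "L t = 0" by (simp add: L_def compose_simps)
    then show False using that large_ne_0 by (auto simp: X_def)
  qed
  then have bdd: "bdd_above X" by (rule bdd_aboveI)
  have cX: "c \<in> X" if "c < \<gamma>" for c using big[OF that] by (simp add: X_def L_def e_def)
  then have ne: "X \<noteq> {}" using lt_ex by blast
  \<comment> \<open>The essential maximum of T on p; it is at least \<gamma>, because all levels
    below \<gamma> belong to X.\<close>
  define t0 where "t0 = Sup X"
  have \<gamma>: "\<gamma> \<le> t0"
    by (rule dense_le) (auto simp: t0_def intro: cSup_upper[OF cX bdd])
  have below: "large (L t)" if "t < t0" for t
  proof -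
    from that obtain s where s: "s \<in> X" "t < s" unfolding t0_def less_cSup_iff[OF ne bdd] by blast
    then show ?thesis using large_mono[OF _ Lst pL, of s t] by (auto simp: X_def)
  qed
  have above: "\<not> large (L t)" if "t > t0" for t
    using cSup_upper[OF _ bdd, of t] that by (auto simp: X_def t0_def)
  have c0: "c n \<le> t0" for n using c[of n] \<gamma> by linarith
  show ?thesis
  proof (cases "large (L t0)")
    case True
    \<comment> \<open>Spectral projections above t0 + 1/k are not large but increase to the large
      one above t0, so every remainder is large by \<open>large_diff\<close>. The value 0 at k = 0
      makes the sequence start as required.\<close>
    define E where "E k = (if k = 0 then 0 else L (t0 + 1 / real k))" for k :: nat
    have EL: "L t0 o\<^sub>L E k = E k" for k by (simp add: E_def Lst)
    have "\<exists>Q. orth Q \<and> (\<forall>n. large (Q n) \<and> L t0 o\<^sub>L Q n = Q n \<and> E n o\<^sub>L Q n = 0 \<and> T o\<^sub>L Q n = Q n o\<^sub>L T)"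
    proof (rule split_increasing_limit)
      show "prj (E n)" for n by (simp add: E_def pL, simp add: prj_def zero_in)
      show "E (Suc n) o\<^sub>L E n = E n" for n by (simp add: E_def Lst frac_le)
      show "E 0 = 0" by (simp add: E_def)
      show "(\<lambda>n. E n x) \<longlonglongrightarrow> L t0 x" for x
      proof -
        have "(\<lambda>n. sres T (t0 + 1 / real (Suc n)) x) \<longlonglongrightarrow> sres T t0 x"
        proof (rule sres_right_continuous[OF T(2)])
          show "decseq (\<lambda>n. t0 + 1 / real (Suc n))" by (intro decseq_SucI) (simp add: frac_le)
          show "(\<lambda>n. t0 + 1 / real (Suc n)) \<longlonglongrightarrow> t0"
            using tendsto_add[OF tendsto_const LIMSEQ_inverse_real_of_nat, of t0]
            by (simp add: inverse_eq_divide)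
        qed simp
        then have "(\<lambda>n. p (x - sres T (t0 + 1 / real (Suc n)) x)) \<longlonglongrightarrow> p (x - sres T t0 x)"
          by (intro tendsto_apply tendsto_diff tendsto_const)
        then have "(\<lambda>n. E (Suc n) x) \<longlonglongrightarrow> L t0 x"
          by (simp add: E_def L_def e_def blinfun.bilinear_simps)
        then show ?thesis by (rule LIMSEQ_imp_Suc)
      qed
      show "large (L t0 - E m)" for m
      proof (cases m)
        case 0 then show ?thesis using True by (simp add: E_def)
      next
        case (Suc j)
        have "E m = L (t0 + 1 / real (Suc j))" by (simp add: E_def Suc)
        then show ?thesis using large_diff[OF True pL Lst above, of "t0 + 1 / real (Suc j)"] by simp
      qed
      show "T o\<^sub>L E n = E n o\<^sub>L T" for n
        by (simp add: E_def TL)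
    qed
    then obtain Q where Q: "orth Q" "\<And>n. large (Q n)" "\<And>n. L t0 o\<^sub>L Q n = Q n" "\<And>n. T o\<^sub>L Q n = Q n o\<^sub>L T" by blast
    have "p o\<^sub>L L t0 = L t0" by (simp add: L_def proj_idem pp flip: compose_simps(1))
    then have 1: "p o\<^sub>L Q n = Q n" for n using Q(3) by (metis compose_simps(1))
    have "e t0 o\<^sub>L L t0 = 0"
      by (simp add: L_def pe1) (simp add: compose_simps proj_idem e flip: compose_simps(1))
    then have "e t0 o\<^sub>L Q n = 0" for n using Q(3) by (metis compose_simps(1,12))
    then have "t0 * (norm x)\<^sup>2 \<le> ip (T x) x" if "Q n x = x" for n x using bound that by blast
    then have "c n * (norm x)\<^sup>2 \<le> ip (T x) x" if "Q n x = x" for n x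
      using that c0[of n] by (meson mult_right_mono order_trans zero_le_power2)
    then show ?thesis using Q 1 by blast
  next
    case False
    define s where "s k = t0 - 1 / (real k + 1)" for k :: nat
    have s0: "s k < t0" for k by (simp add: s_def)
    have sm: "s j \<le> s k" if "j \<le> k" for j k using that by (simp add: s_def frac_le)
    have slim: "s \<longlonglongrightarrow> t0"
      using tendsto_diff[OF tendsto_const LIMSEQ_inverse_real_of_nat, of t0]
      by (simp add: s_def[abs_def] inverse_eq_divide add.commute)
    obtain e1 where e1: "proj e1" "\<And>x. (\<lambda>n. e (s n) x) \<longlonglongrightarrow> e1 x" "\<And>n. e1 o\<^sub>L e (s n) = e (s n)"
      using incseq_proj_limit[of "\<lambda>n. e (s n)", OF e(1) est(1)[OF sm]] by auto
    have e1M: "e1 \<in> M" by (rule strong_limit_in[OF e(2) e1(2)])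
    have be1: "bicom T e1" by (rule bicom_strong_limit[OF e(3) e1(2)])
    have pe1': "p o\<^sub>L e1 = e1 o\<^sub>L p" by (rule bicomD[OF be1 p(2)])
    have e10: "e t0 o\<^sub>L e1 = e1"
    proof (rule strong_limit_unique[OF _ e1(2)])
      fix x
      have "(\<lambda>n. e t0 (e (s n) x)) \<longlonglongrightarrow> e t0 (e1 x)" by (intro tendsto_apply e1)
      then show "(\<lambda>n. e (s n) x) \<longlonglongrightarrow> (e t0 o\<^sub>L e1) x"
        using est(1)[of "s _" t0] s0 by (simp add: less_imp_le flip: blinfun_apply_blinfun_compose)
    qed
    have e10': "e1 o\<^sub>L e t0 = e1" by (rule proj_le_commute[OF e1(1) e(1) e10])
    have ese1: "e (s n) o\<^sub>L e1 = e (s n)" for n by (rule proj_le_commute[OF e(1) e1(1) e1(3)])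
    \<comment> \<open>\<open>e1\<close> is the left limit of the resolution at t0, so V is the part
      of p in the eigenspace of T for t0.\<close>
    define V where "V = p o\<^sub>L (e t0 - e1)"
    have pcV: "p o\<^sub>L (e t0 - e1) = (e t0 - e1) o\<^sub>L p" by (simp add: compose_simps pe pe1')
    have pV: "prj V" unfolding V_def
      using e e1 e1M pcV by (intro prjp in_M proj_diff e10) auto
    have pW: "prj (p o\<^sub>L (e1 - e (s m)))" for m
      using e e1 e1M pe pe1' by (intro prjp in_M proj_diff) (auto simp: compose_simps)
    show ?thesis
    proof (cases "large V")
      case True
      obtain Q where Q: "orth Q" "\<And>n. large (Q n)" "\<And>n. V o\<^sub>L Q n = Q n"
        using large_split_below[OF True] by blast
      have "p o\<^sub>L V = V" by (simp add: V_def proj_idem pp flip: compose_simps(1))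
      then have 1: "p o\<^sub>L Q n = Q n" for n using Q(3) by (metis compose_simps(1))
      have TV: "T o\<^sub>L V = V o\<^sub>L T"
        unfolding V_def by (rule Xe) (simp add: compose_simps Te bicom_commute[OF be1])
      have eV: "e t0 o\<^sub>L V = V"
        unfolding V_def pcV by (simp add: compose_simps e10 proj_idem e flip: compose_simps(1))
      have esV: "e (s n) o\<^sub>L V = 0" for n
        unfolding V_def pcV using est(2)[of "s n" t0] s0[of n]
        by (simp add: compose_simps ese1 flip: compose_simps(1))
      have up: "ip (T x) x \<le> t0 * (norm x)\<^sup>2" if "V x = x" for x
        using sres(3)[OF T(2), of t0 x] eV that unfolding e_def by (metis blinfun_apply_blinfun_compose)
      have lo: "t0 * (norm x)\<^sup>2 \<le> ip (T x) x" if "V x = x" for x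
        by (rule LIMSEQ_le_const2[OF tendsto_mult_right[OF slim]]) (use bound[OF esV that] in blast)
      \<comment> \<open>On V the form of T is squeezed to t0, so D vanishes and T is scalar there.
        Any splitting of V therefore commutes with T.\<close>
      define D where "D = (t0 *\<^sub>R id_blinfun - T) o\<^sub>L V"
      have pV': "proj V" using pV by (simp add: prj_def)
      have Dq: "ip (D x) x = 0" for x
      proof -
        have D': "D = V o\<^sub>L D"
          unfolding D_def by (simp add: compose_simps TV) (simp add: proj_idem pV' flip: compose_simps(1))
        have "ip (D x) x = ip (V (D x)) x" using D' by (metis blinfun_apply_blinfun_compose)
        also have "\<dots> = ip (D x) (V x)" by (rule proj_ip[OF pV'])
        also have "\<dots> = t0 * (norm (V x))\<^sup>2 - ip (T (V x)) (V x)"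
          by (simp add: D_def blinfun.bilinear_simps ip_simps ip_self)
        also have "\<dots> = 0" using up[of "V x"] lo[of "V x"] proj_apply[OF pV'] by fastforce
        finally show ?thesis .
      qed
      have "radj D = D" by (simp add: D_def compose_simps T proj_radj pV' TV)
      then have "psd D" using Dq by (simp add: psd_def)
      then have "D x = 0" for x using psd_kernel Dq by blast
      then have "D = 0" by (intro blinfun_eqI) simp
      then have TV0: "T o\<^sub>L V = t0 *\<^sub>R V" by (simp add: D_def compose_simps)
      have TQ: "T o\<^sub>L Q n = t0 *\<^sub>R Q n" for n
        by (metis Q(3) TV0 compose_simps(1,9))
      have QT: "Q n o\<^sub>L T = t0 *\<^sub>R Q n" for n
        using arg_cong[OF TQ, of radj n] by (simp add: T proj_radj orth_proj[OF Q(1)])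
      have "c n * (norm x)\<^sup>2 \<le> ip (T x) x" if "Q n x = x" for n x
      proof -
        have "V x = x" using Q(3)[of n] that by (metis blinfun_apply_blinfun_compose)
        then show ?thesis using lo[of x] c0[of n] by (meson mult_right_mono order_trans zero_le_power2)
      qed
      then show ?thesis using Q 1 TQ QT by metis
    next
      case nV: False
      \<comment> \<open>The spectral part above \<open>s m\<close> is large and consists of the part
        above t0, the eigenspace of t0 and this strip; the other two are not large.\<close>
      have lW: "large (p o\<^sub>L (e1 - e (s m)))" for m
      proof (rule ccontr)
        assume n: "\<not> ?thesis"
        have "large (L (s m))" by (rule below[OF s0])
        moreover have "L (s m) = L t0 + (V + (p o\<^sub>L (e1 - e (s m))))"
          by (simp add: L_def V_def compose_simps)
        moreover have o1: "V o\<^sub>L (p o\<^sub>L (e1 - e (s m))) = 0"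
          unfolding V_def pcomp[OF pcV] using est(1)[of "s m" t0] s0[of m]
          by (simp add: compose_simps e10 e1 proj_idem)
        have o2: "L t0 o\<^sub>L (V + (p o\<^sub>L (e1 - e (s m)))) = 0"
          unfolding V_def compose_simps(2)[symmetric] L_def pcomp[OF pe1] using est(1)[of "s m" t0] s0[of m]
          by (simp add: compose_simps e10 e1 proj_idem e)
        moreover have "prj (V + (p o\<^sub>L (e1 - e (s m))))"
          using o1 pV pW by (auto simp: prj_def intro: proj_add add_in)
        ultimately have "large (L t0) \<or> large (V + (p o\<^sub>L (e1 - e (s m))))"
          using large_add[OF pL] by metis
        then show False using False nV n large_add[OF pV pW o1] by blast
      qed
      define E where "E k = p o\<^sub>L (e (s k) - e (s 0))" for k
      have "\<exists>Q. orth Q \<and> (\<forall>n. large (Q n) \<and> (p o\<^sub>L (e1 - e (s 0))) o\<^sub>L Q n = Q n \<and>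
          E n o\<^sub>L Q n = 0 \<and> T o\<^sub>L Q n = Q n o\<^sub>L T)"
      proof (rule split_increasing_limit)
        show "prj (E n)" for n unfolding E_def
          using e pe by (intro prjp in_M proj_diff est sm) (auto simp: compose_simps)
        have pes: "p o\<^sub>L (e (s k) - e (s 0)) = (e (s k) - e (s 0)) o\<^sub>L p" for k by (simp add: compose_simps pe)
        show "E (Suc n) o\<^sub>L E n = E n" for n
          unfolding E_def pcomp[OF pes] by (simp add: compose_simps est sm proj_idem e)
        show "E 0 = 0" by (simp add: E_def compose_simps)
        show "(\<lambda>n. E n x) \<longlonglongrightarrow> (p o\<^sub>L (e1 - e (s 0))) x" for x
          by (simp add: E_def blinfun.bilinear_simps) (intro tendsto_apply tendsto_diff tendsto_const e1)
        show "large ((p o\<^sub>L (e1 - e (s 0))) - E m)" for m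
          using lW[of m] by (simp add: E_def compose_simps)
        show "T o\<^sub>L E n = E n o\<^sub>L T" for n
          unfolding E_def by (rule Xe) (simp add: compose_simps Te)
      qed
      then obtain Q where Q: "orth Q" "\<And>n. large (Q n)" "\<And>n. (p o\<^sub>L (e1 - e (s 0))) o\<^sub>L Q n = Q n"
        "\<And>n. E n o\<^sub>L Q n = 0" "\<And>n. T o\<^sub>L Q n = Q n o\<^sub>L T" by blast
      have pQ: "p o\<^sub>L Q n = Q n" for n
      proof -
        have "p o\<^sub>L (p o\<^sub>L (e1 - e (s 0))) = p o\<^sub>L (e1 - e (s 0))" by (simp add: proj_idem pp flip: compose_simps(1))
        then show ?thesis using Q(3)[of n] by (metis compose_simps(1))
      qed
      have eQ: "e (s n) o\<^sub>L Q n = 0" for n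
      proof -
        have "e (s 0) o\<^sub>L (p o\<^sub>L (e1 - e (s 0))) = p o\<^sub>L (e (s 0) o\<^sub>L (e1 - e (s 0)))"
          by (simp add: pe flip: compose_simps(1))
        also have "\<dots> = 0" by (simp add: compose_simps ese1 proj_idem e)
        finally have "e (s 0) o\<^sub>L Q n = 0" using Q(3)[of n] by (metis compose_simps(1,12))
        moreover have "E n o\<^sub>L Q n = (e (s n) o\<^sub>L (p o\<^sub>L Q n)) - (e (s 0) o\<^sub>L (p o\<^sub>L Q n))"
          unfolding E_def by (simp add: compose_simps pe flip: compose_simps(1))
        ultimately show ?thesis using Q(4)[of n] by (simp add: pQ)
      qed
      have "\<exists>N. c n \<le> s N" for n
      proof -
        have "eventually (\<lambda>k. c n < s k) sequentially"
          by (rule order_tendstoD(1)[OF slim]) (use c[of n] \<gamma> in linarith)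
        then show ?thesis by (auto simp: eventually_sequentially intro: less_imp_le)
      qed
      then obtain N where N: "\<And>n. c n \<le> s (N n)" by metis
      \<comment> \<open>A strictly increasing choice above all \<open>N n\<close>, so that the
        levels reach \<open>c n\<close> while the selected projections stay distinct.\<close>
      define g where "g n = n + (\<Sum>i\<le>n. N i)" for n
      have gN: "N n \<le> g n" for n by (simp add: g_def member_le_sum trans_le_add2)
      have "strict_mono g" by (simp add: strict_mono_Suc_iff g_def)
      then have ig: "inj g" by (rule strict_mono_imp_inj_on)
      have "c n * (norm x)\<^sup>2 \<le> ip (T x) x" if "Q (g n) x = x" for n x
      proof -
        have "c n \<le> s (g n)" using N[of n] sm[OF gN[of n]] by linarith
        then show ?thesis using bound[OF eQ that] by (meson mult_right_mono order_trans zero_le_power2)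
      qed
      then show ?thesis using orth_reindex[OF Q(1) ig] Q pQ by (intro exI[of _ "\<lambda>n. Q (g n)"]) auto
    qed
  qed
qed

end

section \<open>Covering an operator by a unitary copy\<close>

lemma quadratic_sums:
  fixes B :: "'a::complex_hilbert_space \<Rightarrow>\<^sub>L 'a"
  assumes K: "orth K" "\<And>k. B o\<^sub>L K k = K k o\<^sub>L B"
  shows "(\<lambda>k. ip (B (K k y)) (K k y)) sums ip (B (ssum K y)) (ssum K y)"
proof -
  have "(\<lambda>k. ip (B (K k y)) (ssum K y)) sums ip (B (ssum K y)) (ssum K y)"
    by (intro bounded_linear.sums[OF ip.bounded_linear_left] bounded_linear.sums[OF blinfun.bounded_linear_right]
        sot_sumsD orth_ssum K)
  moreover have "ip (B (K k y)) (ssum K y) = ip (B (K k y)) (K k y)" for k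
  proof -
    have "B (K k y) = K k (B (K k y))"
      using K(2)[of k] orth_proj[OF K(1), of k] by (metis blinfun_apply_blinfun_compose proj_apply)
    then have "ip (B (K k y)) (ssum K y) = ip (B (K k y)) (K k (ssum K y))"
      by (metis proj_ip[OF orth_proj[OF K(1)]])
    then show ?thesis using orth_ssum(4)[OF K(1)] by (metis blinfun_apply_blinfun_compose)
  qed
  ultimately show ?thesis by simp
qed

lemma quadratic_split:
  fixes B :: "'a::complex_hilbert_space \<Rightarrow>\<^sub>L 'a"
  assumes p: "proj p" "B o\<^sub>L p = p o\<^sub>L B"
  shows "ip (B x) x = ip (B (p x)) (p x) + ip (B (x - p x)) (x - p x)"
proof -
  have c: "B (p y) = p (B y)" for y using p(2) by (metis blinfun_apply_blinfun_compose)
  have "ip (B (p x)) (x - p x) = 0" "ip (B (x - p x)) (p x) = 0"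
    using proj_ip[OF p(1), of "B x" x] proj_ip[OF p(1), of "B x" "p x"]
    by (simp_all add: c ip_simps blinfun.bilinear_simps proj_apply[OF p(1)] ip_commute)
  then show ?thesis
    by (simp add: ip_simps blinfun.bilinear_simps)
qed

lemma telescoping_projections:
  fixes E :: "nat \<Rightarrow> 'a::complex_hilbert_space \<Rightarrow>\<^sub>L 'a"
  assumes E: "\<And>n. proj (E n)" "\<And>n. E (Suc n) o\<^sub>L E n = E n" "E 0 = 0"
    and L: "\<And>x. (\<lambda>n. E n x) \<longlonglongrightarrow> blinfun_apply L x"
  shows "orth (\<lambda>k. E (Suc k) - E k)" "ssum (\<lambda>k. E (Suc k) - E k) = L"
proof -
  have mm: "E n o\<^sub>L E k = E k" if "k \<le> n" for k n
    using that
  proof (induction rule: dec_induct)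
    case (step n)
    then show ?case by (metis E(2) compose_simps(1))
  qed (simp add: proj_idem E)
  have mm': "E k o\<^sub>L E n = E k" if "k \<le> n" for k n by (rule proj_le_commute[OF E(1) E(1) mm[OF that]])
  have pF: "proj (E (Suc k) - E k)" for k by (rule proj_diff[OF E(1) E(1) E(2)])
  have FF: "(E (Suc i) - E i) o\<^sub>L (E (Suc k) - E k) = 0" if "i < k" for i k
    using that by (simp add: compose_simps mm')
  show "orth (\<lambda>k. E (Suc k) - E k)"
    unfolding orth_def using pF FF proj_orth_commute by (metis linorder_neqE_nat)
  show "ssum (\<lambda>k. E (Suc k) - E k) = L"
  proof (rule ssum_eqI, unfold sot_sums_def sums_def, rule allI)
    fix x
    have "(\<Sum>k<n. (E (Suc k) - E k) x) = E n x" for n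
      by (induction n) (auto simp: E(3) blinfun.bilinear_simps)
    then show "(\<lambda>n. \<Sum>k<n. (E (Suc k) - E k) x) \<longlonglongrightarrow> L x" using L by simp
  qed
qed

text \<open>The cross terms contain p p', because B can be moved past p.\<close>

lemma compose_sandwich_add:
  assumes u: "pis u p q" "pis v p' q'" and B: "B o\<^sub>L p = p o\<^sub>L B" and pp: "p o\<^sub>L p' = 0"
  shows "(u + v) o\<^sub>L (B o\<^sub>L radj (u + v)) = (u o\<^sub>L (B o\<^sub>L radj u)) + (v o\<^sub>L (B o\<^sub>L radj v))"
proof -
  have z: "u o\<^sub>L (B o\<^sub>L radj v) = 0" if u: "pis u p q" and v: "pis v p' q'" and B: "B o\<^sub>L p = p o\<^sub>L B" and pp: "p o\<^sub>L p' = 0"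
    for u v p p' q q' B :: "'a \<Rightarrow>\<^sub>L 'a"
  proof -
    have "u o\<^sub>L (B o\<^sub>L radj v) = (u o\<^sub>L p) o\<^sub>L (B o\<^sub>L (p' o\<^sub>L radj v))"
      by (simp only: pis_right[OF u] pis_left[OF pis_radj[OF v]])
    also have "\<dots> = u o\<^sub>L ((p o\<^sub>L B) o\<^sub>L (p' o\<^sub>L radj v))" by (simp only: compose_simps(1))
    also have "\<dots> = u o\<^sub>L (B o\<^sub>L ((p o\<^sub>L p') o\<^sub>L radj v))" by (simp only: B[symmetric] compose_simps(1))
    finally show ?thesis by (simp add: pp)
  qed
  have 1: "u o\<^sub>L (B o\<^sub>L radj v) = 0" by (rule z[OF u B pp])
  have pj: "proj p" "proj p'" using u pis_proj by blast+
  have "radj B o\<^sub>L p = p o\<^sub>L radj B" using arg_cong[OF B, of radj] by (simp add: proj_radj pj)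
  from z[OF u this pp] have "radj (u o\<^sub>L (radj B o\<^sub>L radj v)) = 0" by simp
  then have 2: "v o\<^sub>L (B o\<^sub>L radj u) = 0" by (simp add: compose_simps)
  show ?thesis by (simp add: compose_simps 1 2)
qed

context vN begin

text \<open>The spectral projections of S for (1,\<infinity>) and for the intervals (1/(k+1), 1/k]
  exhaust the complement of its kernel, and S \<ge> 1/(k+1) on the k-th. So S dominates a diagonal
  operator with positive weights, below which small pieces of another operator can be
  placed.\<close>

lemma positive_chunks:
  assumes S: "psd S" "S \<in> M"
  shows "\<exists>L \<epsilon>. orth L \<and> (\<forall>k. L k \<in> M) \<and> ssum L = id_blinfun - kerp S \<and> (\<forall>k. 0 < \<epsilon> k \<and> \<epsilon> k \<le> (1::real)) \<and>
    (\<forall>x. (\<Sum>k. \<epsilon> k * (norm (L k x))\<^sup>2) \<le> ip (S x) x)"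
proof -
  have r: "radj S = S" by (rule psd_radj[OF S(1)])
  define e where "e t = sres S t" for t
  define E where "E n = (if n = 0 then 0 else id_blinfun - e (1 / real n))" for n :: nat
  have est: "e t o\<^sub>L e s = e s" "e s o\<^sub>L e t = e s" if "s \<le> t" for s t
    using sres_mono[OF r that] sres_mono'[OF r that] by (auto simp: e_def)
  have pE: "proj (E n)" for n using proj_compl sres(1)[OF r] by (auto simp: E_def e_def)
  have EE: "E (Suc n) o\<^sub>L E n = E n" for n
    by (simp add: E_def compose_simps est frac_le)
  have lim: "(\<lambda>n. E n x) \<longlonglongrightarrow> (id_blinfun - kerp S) x" for x
  proof -
    have "(\<lambda>n. sres S (1 / real (Suc n)) x) \<longlonglongrightarrow> sres S 0 x"
    proof (rule sres_right_continuous[OF r])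
      show "decseq (\<lambda>n. 1 / real (Suc n))" by (intro decseq_SucI) (simp add: frac_le)
      show "(\<lambda>n. 1 / real (Suc n)) \<longlonglongrightarrow> 0" using LIMSEQ_inverse_real_of_nat by (simp add: inverse_eq_divide)
    qed simp
    then have "(\<lambda>n. x - sres S (1 / real (Suc n)) x) \<longlonglongrightarrow> x - sres S 0 x"
      by (intro tendsto_diff tendsto_const)
    then have "(\<lambda>n. E (Suc n) x) \<longlonglongrightarrow> (id_blinfun - kerp S) x"
      by (simp add: E_def e_def blinfun.bilinear_simps sres_0_psd[OF S(1)])
    then show ?thesis by (rule LIMSEQ_imp_Suc)
  qed
  define L where "L k = E (Suc k) - E k" for k
  define \<epsilon> where "\<epsilon> k = 1 / (real k + 1)" for k :: nat
  have oL: "orth L" and sL: "ssum L = id_blinfun - kerp S"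
    using telescoping_projections[OF pE EE _ lim] by (auto simp: L_def[abs_def] E_def)
  have eM: "e t \<in> M" for t unfolding e_def by (rule sres_in[OF r S(2)])
  have LM: "L k \<in> M" for k by (auto simp: L_def E_def intro!: in_M eM)
  have Se: "S o\<^sub>L e t = e t o\<^sub>L S" for t unfolding e_def by (rule bicom_commute[OF sres(2)[OF r]])
  have SL: "S o\<^sub>L L k = L k o\<^sub>L S" for k by (auto simp: L_def E_def compose_simps Se)
  have low: "\<epsilon> k * (norm (L k x))\<^sup>2 \<le> ip (S (L k x)) (L k x)" for k x
  proof (cases "L k x = 0")
    case False
    have "e (1 / real (Suc k)) o\<^sub>L L k = 0"
      by (auto simp: L_def E_def compose_simps est frac_le proj_idem sres(1)[OF r] e_def[of "1 / real (Suc k)"])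
        (simp add: e_def sres_mono[OF r] sres_mono'[OF r] frac_le)?
    then have "sres S (1 / real (Suc k)) (L k x) = 0"
      by (metis e_def blinfun_apply_blinfun_compose zero_blinfun.rep_eq)
    then show ?thesis using sres_ge[OF r, of "1 / real (Suc k)" "L k x"] by (simp add: \<epsilon>_def add.commute)
  qed (simp add: ip_simps)
  have "(\<Sum>k. \<epsilon> k * (norm (L k x))\<^sup>2) \<le> ip (S x) x" for x
  proof -
    have q: "(\<lambda>k. ip (S (L k x)) (L k x)) sums ip (S (ssum L x)) (ssum L x)"
      by (rule quadratic_sums[OF oL SL])
    have "kerp S o\<^sub>L S = S o\<^sub>L kerp S" using bicom_commute[OF bicom_kerp[OF r]] by simp
    then have "ip (S x) x = ip (S (ssum L x)) (ssum L x)"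
      using quadratic_split[OF kerp(1)[of S], of S x] by (simp add: sL apply_kerp ip_simps blinfun.bilinear_simps)
    moreover have "summable (\<lambda>k. \<epsilon> k * (norm (L k x))\<^sup>2)"
      by (rule summable_comparison_test'[OF sums_summable[OF q], of 0]) (use low in \<open>simp add: \<epsilon>_def\<close>)
    ultimately show ?thesis using suminf_le[OF low _ sums_summable[OF q]] sums_unique[OF q] by simp
  qed
  moreover have "0 < \<epsilon> k \<and> \<epsilon> k \<le> 1" for k by (simp add: \<epsilon>_def)
  ultimately show ?thesis using oL LM sL by blast
qed

end

context lfactor begin

text \<open>A copy of N has to be taken out of the kernel of B without destroying the largeness of
  the spectral parts near 0, which later supply the small pieces.\<close>

lemma source_projection:
  assumes B: "B \<in> M" "psd B" and small: "\<And>\<delta>. 0 < \<delta> \<Longrightarrow> large (sres B \<delta>)"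
    and \<beta>: "0 < \<beta>" and G: "prj G" "G o\<^sub>L B = B o\<^sub>L G" "\<And>x. G x = x \<Longrightarrow> \<beta> * (norm x)\<^sup>2 \<le> ip (B x) x"
    and N: "psub N (kerp B)"
  shows "\<exists>N'. peq N N' \<and> B o\<^sub>L N' = 0 \<and> N' o\<^sub>L B = 0 \<and> G o\<^sub>L N' = 0 \<and>
    (\<forall>\<delta>. 0 < \<delta> \<longrightarrow> \<delta> < \<beta> \<longrightarrow> large ((id_blinfun - G - N') o\<^sub>L sres B \<delta>))"
proof -
  define k where "k = kerp B"
  have r: "radj B = B" by (rule psd_radj[OF B(2)])
  have k: "prj k" unfolding k_def prj_def using kerp kerp_in[OF r B(1)] by blast
  have Bk: "B o\<^sub>L k = 0" by (rule blinfun_eqI) (simp add: k_def apply_kerp)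
  have pG: "proj G" "G \<in> M" using G by (auto simp: prj_def)
  have e: "proj (sres B \<delta>)" "sres B \<delta> \<in> M" for \<delta> using sres[OF r] sres_in[OF r B(1)] by auto
  have ek: "sres B \<delta> o\<^sub>L k = k" if "0 < \<delta>" for \<delta>
    unfolding k_def using sres_mono[OF r, of 0 \<delta>] that sres_0_psd[OF B(2)] by simp
  have eG: "sres B \<delta> o\<^sub>L G = 0" if "\<delta> < \<beta>" for \<delta>
  proof (rule sres_disjoint[OF r pG(1) G(2)])
    show "\<delta> * (norm x)\<^sup>2 < ip (B x) x" if "G x = x" "x \<noteq> 0" for x
    proof -
      have "\<delta> * (norm x)\<^sup>2 < \<beta> * (norm x)\<^sup>2" using \<open>\<delta> < \<beta>\<close> that(2) by (intro mult_strict_right_mono) auto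
      then show ?thesis using G(3)[OF that(1)] by linarith
    qed
  qed
  have Ge: "G o\<^sub>L sres B \<delta> = 0" if "\<delta> < \<beta>" for \<delta> by (rule proj_orth_commute[OF e(1) pG(1) eG[OF that]])
  \<comment> \<open>A large kernel has two orthogonal large parts, one to hold the copy and one to
    stay behind. If the kernel is not large, neither is the copy, and removing it from a large
    projection leaves a large one.\<close>
  have "\<exists>N'. peq N N' \<and> k o\<^sub>L N' = N' \<and> (\<forall>\<delta>>0. large (sres B \<delta> - N'))"
  proof (cases "large k")
    case True
    obtain H where H: "orth H" "\<And>n. large (H n)" "\<And>n. k o\<^sub>L H n = H n" using large_split_below[OF True] by blast
    have "psub N (H 0)" by (rule psub_large[OF psub_prj[OF N] H(2)])
    then obtain V N' where V: "H 0 o\<^sub>L N' = N'" "peq N N'" "prj N'" by (rule psubE)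
    have kN: "k o\<^sub>L N' = N'" using V(1) H(3) by (metis compose_simps(1))
    have pN: "proj N'" "N' \<in> M" using V by (auto simp: prj_def)
    have "large (sres B \<delta> - N')" if "0 < \<delta>" for \<delta>
    proof (rule large_mono[OF H(2)[of 1]])
      have eN: "sres B \<delta> o\<^sub>L N' = N'" using ek[OF that] kN by (metis compose_simps(1))
      show "prj (sres B \<delta> - N')" unfolding prj_def using proj_diff[OF pN(1) e(1) eN] diff_in e pN by blast
      have "N' o\<^sub>L H 0 = N'" by (rule proj_le_commute[OF pN(1) orth_proj[OF H(1)] V(1)])
      then have "N' o\<^sub>L H 1 = N' o\<^sub>L (H 0 o\<^sub>L H 1)" by (metis compose_simps(1))
      then have "N' o\<^sub>L H 1 = 0" using orth_zero[OF H(1), of 0 1] by simp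
      moreover have "sres B \<delta> o\<^sub>L H 1 = H 1" using ek[OF that] H(3)[of 1] by (metis compose_simps(1))
      ultimately show "(sres B \<delta> - N') o\<^sub>L H 1 = H 1" by (simp add: compose_simps)
    qed
    then show ?thesis using V kN by blast
  next
    case False
    from N obtain V N' where V: "k o\<^sub>L N' = N'" "peq N N'" "prj N'" unfolding k_def by (rule psubE)
    have "\<not> large N'" using False large_mono V(1) k by blast
    moreover have "sres B \<delta> o\<^sub>L N' = N'" if "0 < \<delta>" for \<delta> using ek[OF that] V(1) by (metis compose_simps(1))
    ultimately have "large (sres B \<delta> - N')" if "0 < \<delta>" for \<delta> using large_diff[OF small[OF that] V(3)] that by blast
    then show ?thesis using V by blast
  qed
  then obtain N' where N': "peq N N'" "k o\<^sub>L N' = N'" "\<And>\<delta>. 0 < \<delta> \<Longrightarrow> large (sres B \<delta> - N')" by blast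
  have pN: "proj N'" using peq_prj(2)[OF N'(1)] by (simp add: prj_def)
  have BN: "B o\<^sub>L N' = 0" by (metis Bk N'(2) compose_simps(1,12))
  have NB: "N' o\<^sub>L B = 0" using arg_cong[OF BN, of radj] by (simp add: r proj_radj pN)
  have eN: "sres B \<delta> o\<^sub>L N' = N'" if "0 < \<delta>" for \<delta> using ek[OF that] N'(2) by (metis compose_simps(1))
  have GN: "G o\<^sub>L N' = 0"
  proof -
    have "G o\<^sub>L N' = (G o\<^sub>L sres B (\<beta>/2)) o\<^sub>L N'" using eN[of "\<beta>/2"] \<beta> by (simp add: compose_simps)
    then show ?thesis using Ge[of "\<beta>/2"] \<beta> by simp
  qed
  have "(id_blinfun - G - N') o\<^sub>L sres B \<delta> = sres B \<delta> - N'" if "0 < \<delta>" "\<delta> < \<beta>" for \<delta>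
    using proj_le_commute[OF pN e(1) eN[OF that(1)]] by (simp add: compose_simps Ge[OF that(2)])
  then show ?thesis using N' BN NB GN by metis
qed

text \<open>Applied to -B at the level 0, \<open>large_spectral_sequence\<close> gives large pieces
  on which B is as small as prescribed. Half of them meet the bounds \<open>\<omega>\<close>; the
  other half make the pieces with bounds \<open>o'\<close> large, to which the whole rest of p is
  then added.\<close>

lemma source_decomposition:
  assumes B: "B \<in> M" "psd B" and p: "prj p" "p o\<^sub>L B = B o\<^sub>L p"
    and \<beta>: "0 < \<beta>" and big: "\<And>\<delta>. 0 < \<delta> \<Longrightarrow> \<delta> < \<beta> \<Longrightarrow> large (p o\<^sub>L sres B \<delta>)"
    and \<omega>: "\<And>n::nat. 0 < \<omega> n" and o': "\<And>n. 0 < o' n" "incseq o'" "\<And>x. (\<lambda>n. sres B (o' n) x) \<longlonglongrightarrow> x"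
  shows "\<exists>K H. orth K \<and> orth H \<and> (\<forall>n. large (K n) \<and> large (H n) \<and> B o\<^sub>L K n = K n o\<^sub>L B \<and> B o\<^sub>L H n = H n o\<^sub>L B) \<and>
    ssum K o\<^sub>L ssum H = 0 \<and> ssum K + ssum H = p \<and>
    (\<forall>n x. K n x = x \<longrightarrow> ip (B x) x \<le> \<omega> n * (norm x)\<^sup>2) \<and>
    (\<forall>n x. H n x = x \<longrightarrow> ip (B x) x \<le> o' n * (norm x)\<^sup>2)"
proof -
  have r: "radj B = B" by (rule psd_radj[OF B(2)])
  have pp: "proj p" "p \<in> M" using p by (auto simp: prj_def)
  have e: "proj (sres B t)" "sres B t \<in> M" "bicom B (sres B t)" for t
    using sres[OF r] sres_in[OF r B(1)] by auto
  define T where "T = - B"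
  have T: "T \<in> M" "radj T = T" unfolding T_def using scaleR_in[OF B(1), of "-1"] by (auto simp: r)
  have pT: "p o\<^sub>L T = T o\<^sub>L p" by (simp add: T_def compose_simps p)
  have "large (p o\<^sub>L (id_blinfun - sres T c))" if c: "c < 0" for c
  proof -
    \<comment> \<open>On \<open>p o\<^sub>L sres B \<delta>\<close> one has -B \<ge> -\<delta> > c,
      and \<delta> < \<beta> keeps this projection among those known to be large.\<close>
    define \<delta> where "\<delta> = min (- c / 2) (\<beta> / 2)"
    have \<delta>: "0 < \<delta>" "\<delta> < \<beta>" "c < - \<delta>" using c \<beta> by (auto simp: \<delta>_def min_def)
    define q where "q = p o\<^sub>L sres B \<delta>"
    have pe: "p o\<^sub>L sres B \<delta> = sres B \<delta> o\<^sub>L p" by (rule bicomD[OF e(3) p(2)])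
    have q: "proj q" unfolding q_def by (rule proj_compose[OF pp(1) e(1) pe])
    have qT: "q o\<^sub>L T = T o\<^sub>L q"
      unfolding q_def T_def using commute_compose[of B p "sres B \<delta>"] p(2) bicom_commute[OF e(3)]
      by (simp add: compose_simps(6,7))
    have eq: "sres B \<delta> o\<^sub>L q = q" by (simp add: q_def pe proj_idem e flip: compose_simps(1))
    have "sres T c o\<^sub>L q = 0"
    proof (rule sres_disjoint[OF T(2) q qT])
      show "c * (norm x)\<^sup>2 < ip (T x) x" if "q x = x" "x \<noteq> 0" for x
      proof -
        have "sres B \<delta> x = x" using eq that(1) by (metis blinfun_apply_blinfun_compose)
        then have "- \<delta> * (norm x)\<^sup>2 \<le> ip (T x) x" using sres(3)[OF r] by (simp add: T_def blinfun.bilinear_simps ip_simps)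
        moreover have "c * (norm x)\<^sup>2 < - \<delta> * (norm x)\<^sup>2" using \<delta> that(2) by (intro mult_strict_right_mono) auto
        ultimately show ?thesis by linarith
      qed
    qed
    moreover have "p o\<^sub>L q = q" by (simp add: q_def proj_idem pp flip: compose_simps(1))
    ultimately have "(p o\<^sub>L (id_blinfun - sres T c)) o\<^sub>L q = q" by (simp add: compose_simps)
    moreover have "large q" unfolding q_def by (rule big[OF \<delta>(1,2)])
    moreover have "prj (p o\<^sub>L (id_blinfun - sres T c))"
    proof -
      have "p o\<^sub>L sres T c = sres T c o\<^sub>L p" by (rule sres_commute[OF T(2) pT])
      then have c: "p o\<^sub>L (id_blinfun - sres T c) = (id_blinfun - sres T c) o\<^sub>L p" by (simp add: compose_simps)
      show ?thesis unfolding prj_def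
        by (intro conjI proj_compose[OF pp(1) proj_compl[OF sres(1)[OF T(2)]] c] compose_in pp(2) diff_in id_in
            sres_in[OF T(2,1)])
    qed
    ultimately show ?thesis using large_mono by blast
  qed
  moreover define c where "c n = (if even n then - \<omega> (n div 2) else - o' (n div 2))" for n :: nat
  moreover have "c n < 0" for n using \<omega> o'(1) by (simp add: c_def)
  ultimately obtain Q where Q: "orth Q" "\<And>n. large (Q n)" "\<And>n. p o\<^sub>L Q n = Q n" "\<And>n. T o\<^sub>L Q n = Q n o\<^sub>L T"
      "\<And>n x. Q n x = x \<Longrightarrow> c n * (norm x)\<^sup>2 \<le> ip (T x) x"
    using large_spectral_sequence[OF T p(1) pT, of 0 c] by blast
  have BQ: "B o\<^sub>L Q n = Q n o\<^sub>L B" for n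
  proof -
    have "- (B o\<^sub>L Q n) = - (Q n o\<^sub>L B)" using Q(4)[of n] by (simp add: T_def compose_simps(6,7))
    then show ?thesis by simp
  qed
  have QM: "Q n \<in> M" for n using Q(2) large_prj by (auto simp: prj_def)
  have i2: "inj (\<lambda>n::nat. 2 * n)" "inj (\<lambda>n::nat. 2 * n + 1)" by (auto simp: inj_def)
  define K where "K n = Q (2 * n)" for n
  define K2 where "K2 n = Q (2 * n + 1)" for n
  have oK: "orth K" "orth K2" unfolding K_def K2_def using orth_reindex[OF Q(1)] i2 by auto
  define s1 s2 where "s1 = ssum K" and "s2 = ssum K2"
  have s12: "s1 o\<^sub>L s2 = 0" unfolding s1_def s2_def K_def K2_def
    by (rule orth_ssum_disjoint[OF Q(1) i2]) (auto, presburger)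
  have prs: "prj s1" "prj s2" unfolding s1_def s2_def using oK QM by (auto intro!: prj_ssum simp: K_def K2_def)
  then have ps: "proj s1" "proj s2" "s1 \<in> M" "s2 \<in> M" by (auto simp: prj_def)
  have pss: "p o\<^sub>L s1 = s1" "p o\<^sub>L s2 = s2"
    unfolding s1_def s2_def using Q(3) by (auto intro!: ssum_least oK simp: K_def K2_def)
  have Bs: "B o\<^sub>L s1 = s1 o\<^sub>L B" "B o\<^sub>L s2 = s2 o\<^sub>L B"
    unfolding s1_def s2_def using BQ by (auto intro!: ssum_commute oK simp: K_def K2_def)
  define p' where "p' = p - (s1 + s2)"
  have s: "proj (s1 + s2)" "p o\<^sub>L (s1 + s2) = s1 + s2"
    by (rule proj_add[OF ps(1,2) s12]) (simp add: compose_simps pss)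
  have p': "proj p'" "p' \<in> M" unfolding p'_def using proj_diff[OF s(1) pp(1) s(2)] pp ps by (auto intro: in_M)
  have Bp': "B o\<^sub>L p' = p' o\<^sub>L B" by (simp add: p'_def compose_simps p(2) Bs)
  have s21: "s2 o\<^sub>L s1 = 0" by (rule proj_orth_commute[OF ps(1,2) s12])
  have p's: "p' o\<^sub>L s1 = 0" "p' o\<^sub>L s2 = 0"
    by (simp_all add: p'_def compose_simps pss s12 s21 proj_idem ps)
  \<comment> \<open>The shift by one makes the n-th difference of E lie below
    \<open>sres B (o' n)\<close>, so that B \<le> \<open>o' n\<close> there.\<close>
  define E where "E n = (if n = 0 then 0 else sres B (o' (n - 1)) o\<^sub>L p')" for n :: nat
  have ep': "sres B t o\<^sub>L p' = p' o\<^sub>L sres B t" for t using bicomD[OF e(3) Bp'[symmetric]] by simp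
  have pE: "proj (E n)" for n using proj_compose[OF e(1) p'(1) ep'] by (simp add: E_def)
  have eep: "(sres B t o\<^sub>L p') o\<^sub>L (sres B t' o\<^sub>L p') = sres B t' o\<^sub>L p'" if "t' \<le> t" for t t'
  proof -
    have "(sres B t o\<^sub>L p') o\<^sub>L (sres B t' o\<^sub>L p') = sres B t o\<^sub>L ((p' o\<^sub>L sres B t') o\<^sub>L p')" by (simp only: compose_simps(1))
    also have "\<dots> = (sres B t o\<^sub>L sres B t') o\<^sub>L (p' o\<^sub>L p')" by (simp only: ep'[symmetric] compose_simps(1))
    finally show ?thesis using sres_mono[OF r that] by (simp add: proj_idem p')
  qed
  have EE: "E (Suc n) o\<^sub>L E n = E n" for n
    by (cases n) (simp_all add: E_def eep incseqD[OF o'(2)])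
  have lim: "(\<lambda>n. E n x) \<longlonglongrightarrow> p' x" for x
  proof (rule LIMSEQ_imp_Suc)
    show "(\<lambda>n. E (Suc n) x) \<longlonglongrightarrow> p' x" using o'(3)[of "p' x"] by (simp add: E_def)
  qed
  define O' where "O' k = E (Suc k) - E k" for k
  have oO: "orth O'" and sO: "ssum O' = p'"
    using telescoping_projections[OF pE EE _ lim] by (auto simp: O'_def[abs_def] E_def)
  have EM: "E k \<in> M" for k by (auto simp: E_def intro!: in_M e p')
  have OM: "O' k \<in> M" for k unfolding O'_def by (intro in_M EM)
  have BE: "B o\<^sub>L E k = E k o\<^sub>L B" for k
    using commute_compose[OF bicom_commute[OF e(3)] Bp'] by (simp add: E_def)
  have BO: "B o\<^sub>L O' k = O' k o\<^sub>L B" for k by (simp add: O'_def compose_simps BE)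
  have p'O: "p' o\<^sub>L O' k = O' k" for k using orth_ssum(3)[OF oO] sO by simp
  have s2K: "s2 o\<^sub>L K2 k = K2 k" for k unfolding s2_def using orth_ssum(3)[OF oK(2)] .
  have s2p': "s2 o\<^sub>L p' = 0" by (rule proj_orth_commute[OF p'(1) ps(2) p's(2)])
  have K2O: "K2 i o\<^sub>L O' j = 0" for i j
  proof -
    have "K2 i o\<^sub>L s2 = K2 i" unfolding s2_def by (rule orth_ssum(4)[OF oK(2)])
    then have "K2 i o\<^sub>L O' j = K2 i o\<^sub>L ((s2 o\<^sub>L p') o\<^sub>L O' j)" using p'O by (metis compose_simps(1))
    then show ?thesis by (simp add: s2p')
  qed
  have OK2: "O' i o\<^sub>L K2 j = 0" for i j by (rule proj_orth_commute[OF orth_proj[OF oK(2)] orth_proj[OF oO] K2O])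
  \<comment> \<open>Nothing is known about the size of \<open>O' k\<close>; \<open>K2 k\<close>
    makes the sum large.\<close>
  define H where "H k = K2 k + O' k" for k
  have pH: "proj (H k)" for k unfolding H_def by (rule proj_add[OF orth_proj[OF oK(2)] orth_proj[OF oO] K2O])
  have oH: "orth H" unfolding orth_def
  proof (intro conjI allI impI pH)
    show "H i o\<^sub>L H j = 0" if "i \<noteq> j" for i j
      by (simp add: H_def compose_simps K2O OK2 orth_zero[OF oK(2) that] orth_zero[OF oO that])
  qed
  have sH: "ssum H = s2 + p'"
    unfolding H_def s2_def sO[symmetric] by (intro ssum_eqI sot_sums_add orth_ssum oK oO)
  have lH: "large (H k)" for k
  proof (rule large_mono)
    show "large (K2 k)" unfolding K2_def by (rule Q(2))
    show "prj (H k)" using pH QM OM by (auto simp: prj_def H_def K2_def intro: add_in)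
    show "H k o\<^sub>L K2 k = K2 k" by (simp add: H_def compose_simps OK2 proj_idem orth_proj[OF oK(2)])
  qed
  have BK2: "B o\<^sub>L K2 k = K2 k o\<^sub>L B" for k unfolding K2_def by (rule BQ)
  have BH: "B o\<^sub>L H k = H k o\<^sub>L B" for k by (simp add: H_def compose_simps BK2 BO)
  have Kb: "ip (B x) x \<le> \<omega> n * (norm x)\<^sup>2" if "K n x = x" for n x
    using Q(5)[of "2 * n" x] that by (simp add: K_def c_def T_def blinfun.bilinear_simps ip_simps)
  have K2b: "ip (B x) x \<le> o' n * (norm x)\<^sup>2" if "K2 n x = x" for n x
    using Q(5)[of "2 * n + 1" x] that by (simp add: K2_def c_def T_def blinfun.bilinear_simps ip_simps)
  have Ob: "ip (B x) x \<le> o' n * (norm x)\<^sup>2" if "O' n x = x" for n x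
  proof -
    have "sres B (o' n) o\<^sub>L E (Suc n) = E (Suc n)"
      by (simp add: E_def proj_idem e flip: compose_simps(1))
    moreover have "E (Suc n) o\<^sub>L O' n = O' n" by (simp add: O'_def compose_simps EE proj_idem pE)
    ultimately have "sres B (o' n) o\<^sub>L O' n = O' n" by (metis compose_simps(1))
    then have "sres B (o' n) x = x" using that by (metis blinfun_apply_blinfun_compose)
    then show ?thesis by (rule sres(3)[OF r])
  qed
  have Hb: "ip (B x) x \<le> o' n * (norm x)\<^sup>2" if x: "H n x = x" for n x
  proof -
    have xy: "x - K2 n x = O' n x" using x by (simp add: H_def blinfun.bilinear_simps algebra_simps)
    have "ip (B x) x = ip (B (K2 n x)) (K2 n x) + ip (B (O' n x)) (O' n x)"
      using quadratic_split[OF orth_proj[OF oK(2)] BK2, of x n] by (simp add: xy)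
    also have "\<dots> \<le> o' n * (norm (K2 n x))\<^sup>2 + o' n * (norm (O' n x))\<^sup>2"
      by (intro add_mono K2b Ob proj_apply orth_proj oK oO)
    also have "\<dots> = o' n * (norm x)\<^sup>2"
      using proj_norm_sq[OF orth_proj[OF oK(2)], of x n] by (simp add: xy distrib_left)
    finally show ?thesis .
  qed
  have KH: "ssum K o\<^sub>L ssum H = 0"
    using proj_orth_commute[OF p'(1) ps(1) p's(1)] by (simp add: sH compose_simps s12 flip: s1_def)
  have KH': "ssum K + ssum H = p" by (simp add: sH p'_def flip: s1_def)
  have lK: "large (K n)" "B o\<^sub>L K n = K n o\<^sub>L B" for n using Q(2) BQ by (auto simp: K_def)
  show ?thesis
    by (rule exI[of _ K], rule exI[of _ H], intro conjI allI impI)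
      (rule oK(1) oH lK lH BH KH KH' | erule Kb Hb)+
qed

text \<open>The unitary is assembled from w, a partial isometry from a copy of N in the kernel of B
  onto N, and equivalences between large pieces of source and target. The copy of B is then the
  prescribed block plus an operator bounded by the weights of the target pieces.\<close>

lemma unitary_cover:
  assumes B: "B \<in> M" "psd B" and small: "\<And>\<delta>. 0 < \<delta> \<Longrightarrow> large (sres B \<delta>)"
    and \<beta>: "0 < \<beta>" and G: "prj G" "G o\<^sub>L B = B o\<^sub>L G" "\<And>x. G x = x \<Longrightarrow> \<beta> * (norm x)\<^sup>2 \<le> ip (B x) x"
    and N: "psub N (kerp B)" and w: "w \<in> M" "pis w G Z" and NZ: "N o\<^sub>L Z = 0"
    and W: "orth W" "\<And>n::nat. large (W n)" "\<And>n. 0 < \<omega> n" "\<And>n. \<omega> n \<le> k"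
    and W': "orth W'" "\<And>n. large (W' n)" "\<And>n. 0 < o' n" "\<And>n. o' n \<le> k" "incseq o'"
      "\<And>x. (\<lambda>n. sres B (o' n) x) \<longlonglongrightarrow> x"
    and WW: "ssum W o\<^sub>L ssum W' = 0" "ssum W + ssum W' = id_blinfun - (N + Z)"
  shows "\<exists>C Cr. unitarily_equivalent M C B \<and> C = (w o\<^sub>L (B o\<^sub>L radj w)) + Cr \<and> Cr \<in> M \<and> psd Cr \<and>
    (\<forall>n. Cr o\<^sub>L W n = W n o\<^sub>L Cr) \<and>
    (\<forall>x. ip (Cr x) x \<le> (\<Sum>n. \<omega> n * (norm (W n x))\<^sup>2) + (\<Sum>n. o' n * (norm (W' n x))\<^sup>2))"
proof -
  obtain N' where N': "peq N N'" "B o\<^sub>L N' = 0" "N' o\<^sub>L B = 0" "G o\<^sub>L N' = 0"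
      "\<And>\<delta>. 0 < \<delta> \<Longrightarrow> \<delta> < \<beta> \<Longrightarrow> large ((id_blinfun - G - N') o\<^sub>L sres B \<delta>)"
    using source_projection[OF B small \<beta> G N] by blast
  define p where "p = id_blinfun - (G + N')"
  have pG: "proj G" "G \<in> M" using G by (auto simp: prj_def)
  have pN': "proj N'" "N' \<in> M" using peq_prj(2)[OF N'(1)] by (auto simp: prj_def)
  have GN: "proj (G + N')" by (rule proj_add[OF pG(1) pN'(1) N'(4)])
  have p: "prj p" unfolding p_def prj_def using proj_compl[OF GN] pG pN' by (auto intro: in_M)
  have pB: "p o\<^sub>L B = B o\<^sub>L p" by (simp add: p_def compose_simps G(2) N')
  have "large (p o\<^sub>L sres B \<delta>)" if "0 < \<delta>" "\<delta> < \<beta>" for \<delta>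
    using N'(5)[OF that] by (simp add: p_def diff_diff_eq)
  from source_decomposition[where \<omega> = \<omega> and o' = o', OF B p pB \<beta> this W(3) W'(3,5,6)]
  obtain K H where KH: "orth K" "orth H" "\<And>n. large (K n)" "\<And>n. large (H n)" "\<And>n. B o\<^sub>L K n = K n o\<^sub>L B"
      "\<And>n. B o\<^sub>L H n = H n o\<^sub>L B" "ssum K o\<^sub>L ssum H = 0" "ssum K + ssum H = p"
      "\<And>n x. K n x = x \<Longrightarrow> ip (B x) x \<le> \<omega> n * (norm x)\<^sup>2"
      "\<And>n x. H n x = x \<Longrightarrow> ip (B x) x \<le> o' n * (norm x)\<^sup>2" by blast
  have "\<exists>V. V \<in> M \<and> pis V (K n) (W n)" "\<exists>V. V \<in> M \<and> pis V (H n) (W' n)" for n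
    using large_peq[OF KH(3) W(2), unfolded peq_def] large_peq[OF KH(4) W'(2), unfolded peq_def] by blast+
  then obtain V V' where V: "\<And>n. V n \<in> M" "\<And>n. pis (V n) (K n) (W n)"
      and V': "\<And>n. V' n \<in> M" "\<And>n. pis (V' n) (H n) (W' n)" by metis
  note S = pis_sums[OF V(2) KH(1) W(1)] and S' = pis_sums[OF V'(2) KH(2) W'(1)]
  have SM: "ssum V \<in> M" "ssum V' \<in> M" using sot_sums_in[OF S(1) V(1)] sot_sums_in[OF S'(1) V'(1)] by auto
  obtain n where n: "n \<in> M" "pis n N' N" using peq_sym[OF N'(1)] by (auto simp: peq_def)
  define Y where "Y = ssum V + ssum V'"
  have Y: "pis Y p (id_blinfun - (N + Z))"
    unfolding Y_def KH(8)[symmetric] WW(2)[symmetric] by (rule pis_add[OF S(2) S'(2) KH(7) WW(1)])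
  have YM: "Y \<in> M" unfolding Y_def by (intro add_in SM)
  have ZN: "Z o\<^sub>L N = 0" by (rule proj_orth_commute[OF pis_proj(2)[OF n(2)] pis_proj(2)[OF w(2)] NZ])
  have wn: "pis (w + n) (G + N') (Z + N)" by (rule pis_add[OF w(2) n(2) N'(4) ZN])
  have U: "pis ((w + n) + Y) id_blinfun id_blinfun"
  proof -
    have "(G + N') o\<^sub>L p = 0" "(Z + N) o\<^sub>L (id_blinfun - (N + Z)) = 0"
      using proj_idem[OF GN] proj_idem[OF pis_proj(2)[OF wn]] by (simp_all add: p_def compose_simps(4,11) add.commute)
    from pis_add[OF wn Y this] show ?thesis by (simp add: p_def add.commute)
  qed
  define C where "C = ((w + n) + Y) o\<^sub>L (B o\<^sub>L radj ((w + n) + Y))"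
  have UM: "(w + n) + Y \<in> M" by (intro add_in w n YM)
  have eqv: "unitarily_equivalent M C B"
    unfolding unitarily_equivalent_def unitary_in_def
    by (rule exI[of _ "(w + n) + Y"])
      (use UM U in \<open>simp add: adj_eq_radj[OF cl[OF UM]] pis_eq[OF U] C_def compose_simps(1) del: radj_add\<close>)
  have BGN: "B o\<^sub>L (G + N') = (G + N') o\<^sub>L B" by (simp add: compose_simps G(2) N')
  define Cr where "Cr = Y o\<^sub>L (B o\<^sub>L radj Y)"
  have "C = ((w + n) o\<^sub>L (B o\<^sub>L radj (w + n))) + Cr"
    unfolding C_def Cr_def
    by (rule compose_sandwich_add[OF wn Y BGN]) (simp add: p_def compose_simps(4,11) proj_idem GN)
  moreover have "(w + n) o\<^sub>L (B o\<^sub>L radj (w + n)) = (w o\<^sub>L (B o\<^sub>L radj w)) + (n o\<^sub>L (B o\<^sub>L radj n))"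
    by (rule compose_sandwich_add[OF w(2) n(2) G(2)[symmetric] N'(4)])
  \<comment> \<open>The part carried onto N comes from the kernel of B and contributes
    nothing.\<close>
  moreover have "n o\<^sub>L (B o\<^sub>L radj n) = 0"
  proof -
    have "n o\<^sub>L (B o\<^sub>L radj n) = n o\<^sub>L ((N' o\<^sub>L B) o\<^sub>L radj n)"
      using pis_right[OF n(2)] by (metis compose_simps(1))
    then show ?thesis by (simp add: N')
  qed
  ultimately have C: "C = (w o\<^sub>L (B o\<^sub>L radj w)) + Cr" by simp
  have CrM: "Cr \<in> M" unfolding Cr_def by (intro compose_in radj_in YM B)
  have Crp: "psd Cr" unfolding Cr_def by (rule psd_conj'[OF B(2)])
  have WY: "W m o\<^sub>L Y = V m" and YK: "Y o\<^sub>L K m = V m" for m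
  proof -
    have "W m o\<^sub>L ssum V' = (W m o\<^sub>L ssum W) o\<^sub>L (ssum W' o\<^sub>L ssum V')"
      by (simp only: orth_ssum(4)[OF W(1)] pis_left[OF S'(2)])
    also have "\<dots> = W m o\<^sub>L ((ssum W o\<^sub>L ssum W') o\<^sub>L ssum V')" by (simp only: compose_simps(1))
    finally show "W m o\<^sub>L Y = V m" by (simp add: Y_def compose_simps S(4) WW(1))
    have HK: "ssum H o\<^sub>L ssum K = 0"
      by (rule proj_orth_commute[OF orth_ssum(1)[OF KH(1)] orth_ssum(1)[OF KH(2)] KH(7)])
    have "ssum V' o\<^sub>L K m = (ssum V' o\<^sub>L ssum H) o\<^sub>L (ssum K o\<^sub>L K m)"
      by (simp only: orth_ssum(3)[OF KH(1)] pis_right[OF S'(2)])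
    also have "\<dots> = ssum V' o\<^sub>L ((ssum H o\<^sub>L ssum K) o\<^sub>L K m)" by (simp only: compose_simps(1))
    finally show "Y o\<^sub>L K m = V m" by (simp add: Y_def compose_simps S(3) HK)
  qed
  have YH: "Y o\<^sub>L H m = V' m" for m
  proof -
    have "ssum V o\<^sub>L H m = (ssum V o\<^sub>L ssum K) o\<^sub>L (ssum H o\<^sub>L H m)"
      by (simp only: orth_ssum(3)[OF KH(2)] pis_right[OF S(2)])
    also have "\<dots> = ssum V o\<^sub>L ((ssum K o\<^sub>L ssum H) o\<^sub>L H m)" by (simp only: compose_simps(1))
    finally show ?thesis by (simp add: Y_def compose_simps S'(3) KH(7))
  qed
  have rYW: "radj Y o\<^sub>L W m = radj (V m)" and KrY: "K m o\<^sub>L radj Y = radj (V m)" and HrY: "H m o\<^sub>L radj Y = radj (V' m)" for m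
    using arg_cong[OF WY[of m], of radj] arg_cong[OF YK[of m], of radj] arg_cong[OF YH[of m], of radj]
    by (simp_all add: proj_radj orth_proj[OF W(1)] orth_proj[OF KH(1)] orth_proj[OF KH(2)])
  \<comment> \<open>Y intertwines \<open>K m\<close> with \<open>W m\<close>, and B commutes with
    \<open>K m\<close>. This is what later lets the new reserve commute with the remainder.\<close>
  have CW: "Cr o\<^sub>L W m = W m o\<^sub>L Cr" for m
  proof -
    have "W m o\<^sub>L Cr = (Y o\<^sub>L K m) o\<^sub>L (B o\<^sub>L radj Y)" by (simp add: Cr_def WY YK flip: compose_simps(1))
    also have "\<dots> = Y o\<^sub>L ((K m o\<^sub>L B) o\<^sub>L radj Y)" by (simp only: compose_simps(1))
    also have "\<dots> = Y o\<^sub>L (B o\<^sub>L (K m o\<^sub>L radj Y))" by (simp only: KH(5)[symmetric] compose_simps(1))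
    finally show ?thesis by (simp add: Cr_def compose_simps(1) KrY rYW)
  qed
  have est: "ip (Cr x) x \<le> (\<Sum>n. \<omega> n * (norm (W n x))\<^sup>2) + (\<Sum>n. o' n * (norm (W' n x))\<^sup>2)" for x
  proof -
    \<comment> \<open>The form of the copy at x is the form of B at y, and the components of y in
      the source pieces have the norms of the components of x in the target pieces.\<close>
    define y where "y = radj Y x"
    have Cy: "ip (Cr x) x = ip (B y) y" by (simp add: Cr_def y_def radj_ip)
    have yp: "ssum K y + ssum H y = y"
    proof -
      have "p y = y" unfolding y_def using pis_left[OF pis_radj[OF Y]] by (metis blinfun_apply_blinfun_compose)
      then show ?thesis by (simp add: KH(8)[symmetric] blinfun.bilinear_simps)
    qed
    then have yH: "y - ssum K y = ssum H y" by (metis add_diff_cancel_left')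
    have Ky: "norm (K m y) = norm (W m x)" and Hy: "norm (H m y) = norm (W' m x)" for m
      unfolding y_def using KrY HrY pis_norm[OF pis_radj[OF V(2)]] pis_norm[OF pis_radj[OF V'(2)]]
      by (metis blinfun_apply_blinfun_compose)+
    have BsK: "B o\<^sub>L ssum K = ssum K o\<^sub>L B" by (rule ssum_commute[OF KH(1,5)])
    have q: "ip (B y) y = ip (B (ssum K y)) (ssum K y) + ip (B (ssum H y)) (ssum H y)"
      using quadratic_split[OF orth_ssum(1)[OF KH(1)] BsK, of y] by (simp add: yH)
    have part: "ip (B (ssum K y)) (ssum K y) \<le> (\<Sum>n. \<omega> n * (norm (W n x))\<^sup>2)"
      if oK: "orth K" and oW: "orth W" and BK: "\<And>n. B o\<^sub>L K n = K n o\<^sub>L B" and Ky: "\<And>n. norm (K n y) = norm (W n x)"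
        and b: "\<And>n x. K n x = x \<Longrightarrow> ip (B x) x \<le> \<omega> n * (norm x)\<^sup>2" and \<omega>: "\<And>n. 0 < \<omega> n" "\<And>n. \<omega> n \<le> k"
      for K W :: "nat \<Rightarrow> 'a \<Rightarrow>\<^sub>L 'a" and \<omega> :: "nat \<Rightarrow> real"
    proof -
      have s: "(\<lambda>n. ip (B (K n y)) (K n y)) sums ip (B (ssum K y)) (ssum K y)" by (rule quadratic_sums[OF oK BK])
      have le: "ip (B (K n y)) (K n y) \<le> \<omega> n * (norm (W n x))\<^sup>2" for n
        using b[OF proj_apply[OF orth_proj[OF oK]], of n y] Ky by simp
      have "summable (\<lambda>n. k * (norm (W n x))\<^sup>2)"
        by (intro summable_mult sums_summable[OF ssum_norm_sums[OF oW]])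
      then have "summable (\<lambda>n. \<omega> n * (norm (W n x))\<^sup>2)"
        by (rule summable_comparison_test'[of _ 0]) (use \<omega> in \<open>simp add: mult_right_mono less_imp_le\<close>)
      then show ?thesis using suminf_le[OF le sums_summable[OF s]] sums_unique[OF s] by simp
    qed
    have "ip (B (ssum K y)) (ssum K y) \<le> (\<Sum>n. \<omega> n * (norm (W n x))\<^sup>2)"
      by (rule part[OF KH(1) W(1) KH(5) Ky KH(9) W(3,4)])
    moreover have "ip (B (ssum H y)) (ssum H y) \<le> (\<Sum>n. o' n * (norm (W' n x))\<^sup>2)"
      by (rule part[OF KH(2) W'(1) KH(6) Hy KH(10) W'(3,4)])
    ultimately show ?thesis by (simp add: Cy q)
  qed
  show ?thesis using eqv C CrM Crp CW est by blast
qed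

end

context vN begin

text \<open>The column \<open>(u, v)\<close> with \<open>u = (c - a)\<^sup>-\<^sup>1\<^sup>/\<^sup>2 (c - B)\<^sup>1\<^sup>/\<^sup>2\<close> and \<open>v = (1 - u\<^sup>*u)\<^sup>1\<^sup>/\<^sup>2\<close> is isometric and
  satisfies \<open>u\<^sup>*au + c v\<^sup>*v = B\<close> for \<open>a = Y\<^sup>*Y\<close>; it rotates the row \<open>(Y, \<surd>c f)\<close> into an operator with
  Gram matrix \<open>B\<close>.\<close>

lemma rotation:
  assumes c: "0 < \<beta>" "\<beta> \<le> \<gamma>" "\<gamma> < c"
    and B: "B \<in> M" "psd B" and G: "prj G" "G o\<^sub>L B = B o\<^sub>L G"
      "\<And>x. G x = x \<Longrightarrow> \<beta> * (norm x)\<^sup>2 \<le> ip (B x) x" "\<And>x. G x = x \<Longrightarrow> ip (B x) x \<le> \<gamma> * (norm x)\<^sup>2"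
    and Y: "Y \<in> M" "Y o\<^sub>L G = Y" "\<And>x. (norm (Y x))\<^sup>2 \<le> \<beta> * (norm x)\<^sup>2"
    and f: "f \<in> M" "pis f G F" and Yf: "radj Y o\<^sub>L f = 0"
  shows "\<exists>w Z. w \<in> M \<and> pis w G Z \<and> (\<forall>x. let g = ip ((w o\<^sub>L (B o\<^sub>L radj w)) x) x in
    g \<le> (norm (radj Y x))\<^sup>2 + c * (norm (F x))\<^sup>2 \<and> \<beta> * (norm (Z x))\<^sup>2 \<le> g \<and>
    (F x = 0 \<longrightarrow> (c - \<gamma>) / c * (norm (radj Y x))\<^sup>2 \<le> g))"
proof -
  have pG: "proj G" "G \<in> M" using G by (auto simp: prj_def)
  have rB: "radj B = B" by (rule psd_radj[OF B(2)])
  have GG: "G o\<^sub>L G = G" and rG: "radj G = G" using pG by (auto simp: proj_idem proj_radj)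
  define a where "a = radj Y o\<^sub>L Y"
  have a: "psd a" "a \<in> M" "a o\<^sub>L G = a" unfolding a_def
    using Y by (auto intro: psd_gram in_M simp: compose_simps)
  have Ga: "G o\<^sub>L a = a" using arg_cong[OF a(3), of radj] by (simp add: rG psd_radj[OF a(1)])
  have qa: "ip (a x) x \<le> \<beta> * (norm x)\<^sup>2" for x using Y(3)[of x] norm_gram[of Y x] by (simp add: a_def)
  \<comment> \<open>B on G, completed by \<beta> off G; it lies between \<beta> and \<gamma>
    everywhere and is therefore invertible.\<close>
  define \<Lambda> where "\<Lambda> = (B o\<^sub>L G) + \<beta> *\<^sub>R (id_blinfun - G)"
  have q\<Lambda>: "ip (\<Lambda> x) x = ip (B (G x)) (G x) + \<beta> * (norm (x - G x))\<^sup>2" for x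
  proof -
    have "ip (B (G x)) x = ip (G (B (G x))) x"
      using G(2) proj_apply[OF pG(1)] by (metis blinfun_apply_blinfun_compose)
    then have "ip (B (G x)) x = ip (B (G x)) (G x)" by (simp add: proj_ip[OF pG(1)])
    moreover have "ip (x - G x) x = (norm (x - G x))\<^sup>2"
      using proj_ip_self[OF proj_compl[OF pG(1)], of x] by (simp add: blinfun.bilinear_simps)
    ultimately show ?thesis by (simp add: \<Lambda>_def blinfun.bilinear_simps ip_simps)
  qed
  have ns: "(norm x)\<^sup>2 = (norm (G x))\<^sup>2 + (norm (x - G x))\<^sup>2" for x by (rule proj_norm_sq[OF pG(1)])
  have \<Lambda>lo: "\<beta> * (norm x)\<^sup>2 \<le> ip (\<Lambda> x) x" for x
    using G(3)[OF proj_apply[OF pG(1)], of x] by (simp add: q\<Lambda> ns[of x] distrib_left)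
  have \<Lambda>hi: "ip (\<Lambda> x) x \<le> \<gamma> * (norm x)\<^sup>2" for x
    using G(4)[OF proj_apply[OF pG(1)], of x] mult_right_mono[OF c(2), of "(norm (x - G x))\<^sup>2"]
    by (simp add: q\<Lambda> ns[of x] distrib_left)
  have r\<Lambda>: "radj \<Lambda> = \<Lambda>" by (simp add: \<Lambda>_def rB rG G(2))
  have \<Lambda>: "psd \<Lambda>" unfolding psd_def using r\<Lambda> \<Lambda>lo c(1) by (meson less_imp_le mult_nonneg_nonneg order_trans zero_le_power2)
  have \<Lambda>M: "\<Lambda> \<in> M" unfolding \<Lambda>_def by (intro in_M B pG)
  have GBG: "G o\<^sub>L (B o\<^sub>L G) = B o\<^sub>L G" by (metis G(2) GG compose_simps(1))
  have G\<Lambda>: "G o\<^sub>L \<Lambda> = \<Lambda> o\<^sub>L G" by (simp add: \<Lambda>_def compose_simps GG GBG)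
  have \<Lambda>G: "\<Lambda> o\<^sub>L G = B o\<^sub>L G" by (simp add: \<Lambda>_def compose_simps GG)
  define P1 where "P1 = c *\<^sub>R id_blinfun - a"
  define P2 where "P2 = c *\<^sub>R id_blinfun - \<Lambda>"
  have q1: "ip (P1 x) x = c * (norm x)\<^sup>2 - ip (a x) x" and q2: "ip (P2 x) x = c * (norm x)\<^sup>2 - ip (\<Lambda> x) x" for x
    by (simp_all add: P1_def P2_def blinfun.bilinear_simps ip_simps ip_self)
  have lo1: "(c - \<beta>) * (norm x)\<^sup>2 \<le> ip (P1 x) x" for x using qa[of x] by (simp add: q1 left_diff_distrib)
  have hi1: "ip (P1 x) x \<le> c * (norm x)\<^sup>2" for x using psd_ge0[OF a(1), of x] by (simp add: q1)
  have lo2: "(c - \<gamma>) * (norm x)\<^sup>2 \<le> ip (P2 x) x" for x using \<Lambda>hi[of x] by (simp add: q2 left_diff_distrib)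
  have hi2: "ip (P2 x) x \<le> (c - \<beta>) * (norm x)\<^sup>2" for x using \<Lambda>lo[of x] by (simp add: q2 left_diff_distrib)
  have cb: "0 < c - \<beta>" "0 < c - \<gamma>" "0 < c" using c by auto
  have P1: "psd P1"
    unfolding psd_def
  proof (intro conjI allI)
    show "radj P1 = P1" by (simp add: P1_def psd_radj[OF a(1)])
    show "0 \<le> ip (P1 x) x" for x
      using cb(1) by (intro order_trans[OF _ lo1[of x]] mult_nonneg_nonneg) auto
  qed
  have P2: "psd P2"
    unfolding psd_def
  proof (intro conjI allI)
    show "radj P2 = P2" by (simp add: P2_def r\<Lambda>)
    show "0 \<le> ip (P2 x) x" for x
      using cb(2) by (intro order_trans[OF _ lo2[of x]] mult_nonneg_nonneg) auto
  qed
  have PM: "P1 \<in> M" "P2 \<in> M" unfolding P1_def P2_def by (intro in_M a \<Lambda>M)+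
  note I1 = invop[OF P1 cb(1) lo1]
  define d where "d = sqop (invop P1)"
  define D where "D = sqop P2"
  have d: "psd d" "d o\<^sub>L d = invop P1" "bicom P1 d"
    unfolding d_def using sqop[OF I1(3)] bicom_trans[OF I1(4)] by auto
  have D: "psd D" "D o\<^sub>L D = P2" "bicom P2 D" unfolding D_def using sqop[OF P2] by auto
  have rd: "radj d = d" and rD: "radj D = D" using d D psd_radj by auto
  have dPd: "d o\<^sub>L (P1 o\<^sub>L d) = id_blinfun"
    using bicom_commute[OF d(3)] d(2) I1(2) I1(1) by (metis compose_simps(1))
  define u where "u = d o\<^sub>L D"
  have ru: "radj u = D o\<^sub>L d" by (simp add: u_def rd rD)
  have GP: "G o\<^sub>L P1 = P1 o\<^sub>L G" "G o\<^sub>L P2 = P2 o\<^sub>L G" by (simp_all add: P1_def P2_def compose_simps Ga a G\<Lambda>)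
  have Gd: "G o\<^sub>L d = d o\<^sub>L G" and GD: "G o\<^sub>L D = D o\<^sub>L G" using bicomD[OF d(3) GP(1)] bicomD[OF D(3) GP(2)] by auto
  have Gu: "G o\<^sub>L u = u o\<^sub>L G" unfolding u_def by (rule commute_compose[OF Gd GD])
  have Gru: "G o\<^sub>L radj u = radj u o\<^sub>L G" unfolding ru by (rule commute_compose[OF GD Gd])
  have uPu: "radj u o\<^sub>L (P1 o\<^sub>L u) = P2"
  proof -
    have "radj u o\<^sub>L (P1 o\<^sub>L u) = D o\<^sub>L ((d o\<^sub>L (P1 o\<^sub>L d)) o\<^sub>L D)" unfolding ru by (simp add: u_def compose_simps(1))
    then show ?thesis by (simp add: dPd D compose_simps)
  qed
  define e0 where "e0 = id_blinfun - (radj u o\<^sub>L u)"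
  \<comment> \<open>The numerator c - \<Lambda> is at most c - \<beta> and the denominator c - a is
    at least c - \<beta>, so u is a contraction and v is defined.\<close>
  have unorm: "(norm (u x))\<^sup>2 \<le> (norm x)\<^sup>2" for x
  proof -
    have "(norm (u x))\<^sup>2 = ip (invop P1 (D x)) (D x)" using norm_sqop[OF I1(3), of "D x"] by (simp add: u_def d_def)
    then have "(c - \<beta>) * (norm (u x))\<^sup>2 \<le> (norm (D x))\<^sup>2" using I1(5)[of "D x"] by simp
    also have "\<dots> = ip (P2 x) x" unfolding D_def by (rule norm_sqop[OF P2])
    also have "\<dots> \<le> (c - \<beta>) * (norm x)\<^sup>2" by (rule hi2)
    finally show ?thesis using cb(1) by simp
  qed
  have e0: "psd e0" unfolding psd_def
    using unorm by (auto simp: e0_def blinfun.bilinear_simps ip_simps ip_self norm_gram[symmetric] simp flip: blinfun_apply_blinfun_compose)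
      (metis norm_gram diff_ge_0_iff_ge blinfun_apply_blinfun_compose)?
  define v where "v = sqop e0"
  have v: "psd v" "v o\<^sub>L v = e0" "bicom e0 v" unfolding v_def using sqop[OF e0] by auto
  have rv: "radj v = v" by (rule psd_radj[OF v(1)])
  have Ge0: "G o\<^sub>L e0 = e0 o\<^sub>L G" using commute_compose[OF Gru Gu] by (simp add: e0_def compose_simps(4,5,10,11))
  have Gv: "G o\<^sub>L v = v o\<^sub>L G" by (rule bicomD[OF v(3) Ge0])
  have uM: "u \<in> M" unfolding u_def using bicom_in[OF PM(1) d(3)] bicom_in[OF PM(2) D(3)] by (rule compose_in)
  have vM: "v \<in> M" unfolding v_def by (rule sqop_in[OF e0]) (auto simp: e0_def intro!: in_M uM)
  have uv: "(norm (u x))\<^sup>2 + (norm (v x))\<^sup>2 = (norm x)\<^sup>2" for x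
    using norm_sqop[OF e0, of x] norm_gram[of u x] by (simp add: v_def e0_def blinfun.bilinear_simps ip_simps ip_self)
  \<comment> \<open>The second entry of the row has Gram operator c on G, and it is orthogonal to Y
    since Y*f = 0.\<close>
  define z where "z = sqrt c *\<^sub>R f"
  have zz: "radj z o\<^sub>L z = c *\<^sub>R G" using cb(3) pis_eq(1)[OF f(2)] by (simp add: z_def compose_simps)
  have Yz: "radj Y o\<^sub>L z = 0" by (simp add: z_def compose_simps Yf)
  have zY: "radj z o\<^sub>L Y = 0" using arg_cong[OF Yz, of radj] by simp
  define X where "X = ((Y o\<^sub>L u) + (z o\<^sub>L v)) o\<^sub>L G"
  have rX: "radj X = G o\<^sub>L ((radj u o\<^sub>L radj Y) + (v o\<^sub>L radj z))" by (simp add: X_def rG rv)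
  have XM: "X \<in> M" unfolding X_def z_def by (intro in_M Y uM f vM pG)
  have XX: "radj X o\<^sub>L X = \<Lambda> o\<^sub>L G"
  proof -
    have 1: "(radj u o\<^sub>L radj Y) o\<^sub>L (Y o\<^sub>L u) = radj u o\<^sub>L (a o\<^sub>L u)" by (simp add: a_def compose_simps(1))
    have "(v o\<^sub>L radj z) o\<^sub>L (z o\<^sub>L v) = v o\<^sub>L ((radj z o\<^sub>L z) o\<^sub>L v)" by (simp only: compose_simps(1))
    also have "\<dots> = c *\<^sub>R (v o\<^sub>L (G o\<^sub>L v))" by (simp add: zz compose_simps)
    also have "v o\<^sub>L (G o\<^sub>L v) = e0 o\<^sub>L G" by (simp add: Gv v(2) flip: compose_simps(1))
    finally have 2: "(v o\<^sub>L radj z) o\<^sub>L (z o\<^sub>L v) = c *\<^sub>R (e0 o\<^sub>L G)" .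
    have "(radj u o\<^sub>L radj Y) o\<^sub>L (z o\<^sub>L v) = radj u o\<^sub>L ((radj Y o\<^sub>L z) o\<^sub>L v)" by (simp only: compose_simps(1))
    then have 3: "(radj u o\<^sub>L radj Y) o\<^sub>L (z o\<^sub>L v) = 0" by (simp add: Yz)
    have "(v o\<^sub>L radj z) o\<^sub>L (Y o\<^sub>L u) = v o\<^sub>L ((radj z o\<^sub>L Y) o\<^sub>L u)" by (simp only: compose_simps(1))
    then have 4: "(v o\<^sub>L radj z) o\<^sub>L (Y o\<^sub>L u) = 0" by (simp add: zY)
    \<comment> \<open>This rearranges u*(c - a)u = c - \<Lambda>; together with c (1 - u*u) it makes
      the Gram operator equal to \<Lambda>.\<close>
    have ua: "radj u o\<^sub>L (a o\<^sub>L u) = c *\<^sub>R (radj u o\<^sub>L u) - P2"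
    proof -
      have "radj u o\<^sub>L (P1 o\<^sub>L u) = c *\<^sub>R (radj u o\<^sub>L u) - (radj u o\<^sub>L (a o\<^sub>L u))" by (simp add: P1_def compose_simps)
      then show ?thesis using uPu by (simp add: algebra_simps)
    qed
    have "radj X o\<^sub>L X = G o\<^sub>L ((((radj u o\<^sub>L radj Y) + (v o\<^sub>L radj z)) o\<^sub>L ((Y o\<^sub>L u) + (z o\<^sub>L v))) o\<^sub>L G)"
      unfolding rX by (simp only: X_def compose_simps(1))
    also have "((radj u o\<^sub>L radj Y) + (v o\<^sub>L radj z)) o\<^sub>L ((Y o\<^sub>L u) + (z o\<^sub>L v)) = (c *\<^sub>R (radj u o\<^sub>L u) - P2) + c *\<^sub>R (e0 o\<^sub>L G)"
      by (simp only: compose_simps(2,3) 1 2 3 4 ua) simp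
    also have "G o\<^sub>L (((c *\<^sub>R (radj u o\<^sub>L u) - P2) + c *\<^sub>R (e0 o\<^sub>L G)) o\<^sub>L G) = G o\<^sub>L ((c *\<^sub>R (radj u o\<^sub>L u) - P2 + c *\<^sub>R e0) o\<^sub>L G)"
      by (simp only: compose_simps GG)
    also have "c *\<^sub>R (radj u o\<^sub>L u) - P2 + c *\<^sub>R e0 = \<Lambda>"
      by (simp add: e0_def P2_def scaleR_diff_right)
    also have "G o\<^sub>L (\<Lambda> o\<^sub>L G) = \<Lambda> o\<^sub>L G" by (simp add: G\<Lambda> GG compose_simps(1) flip: compose_simps(1)) (simp add: compose_simps(1) GG)
    finally show ?thesis .
  qed
  note I2 = invop[OF \<Lambda> c(1) \<Lambda>lo]
  define e where "e = sqop (invop \<Lambda>)"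
  have e: "psd e" "e o\<^sub>L e = invop \<Lambda>" "bicom \<Lambda> e"
    unfolding e_def using sqop[OF I2(3)] bicom_trans[OF I2(4)] by auto
  have re: "radj e = e" by (rule psd_radj[OF e(1)])
  have Ge: "G o\<^sub>L e = e o\<^sub>L G" by (rule bicomD[OF e(3) G\<Lambda>])
  have e\<Lambda>e: "e o\<^sub>L (\<Lambda> o\<^sub>L e) = id_blinfun"
    using bicom_commute[OF e(3)] e(2) I2(2) I2(1) by (metis compose_simps(1))
  \<comment> \<open>The polar part of X: dividing by the square root of its Gram operator gives an
    isometry on G, and w B w* becomes X X*.\<close>
  define w where "w = X o\<^sub>L e"
  have wM: "w \<in> M" unfolding w_def by (rule compose_in[OF XM bicom_in[OF \<Lambda>M e(3)]])
  have ww: "radj w o\<^sub>L w = G"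
  proof -
    have "radj w o\<^sub>L w = e o\<^sub>L ((radj X o\<^sub>L X) o\<^sub>L e)" by (simp add: w_def re compose_simps(1))
    also have "\<dots> = e o\<^sub>L (\<Lambda> o\<^sub>L (G o\<^sub>L e))" by (simp only: XX compose_simps(1))
    also have "\<dots> = (e o\<^sub>L (\<Lambda> o\<^sub>L e)) o\<^sub>L G" by (simp only: Ge compose_simps(1))
    finally show ?thesis by (simp add: e\<Lambda>e compose_simps)
  qed
  define Z where "Z = w o\<^sub>L radj w"
  have wp: "pis w G Z" using pisI[of w] pG by (simp add: ww Z_def)
  have XG: "X o\<^sub>L G = X" by (simp add: X_def compose_simps(1) GG)
  have eXX: "w o\<^sub>L (B o\<^sub>L radj w) = X o\<^sub>L radj X"
  proof -
    have "w o\<^sub>L (B o\<^sub>L radj w) = w o\<^sub>L (B o\<^sub>L (G o\<^sub>L radj w))" by (simp only: pis_left[OF pis_radj[OF wp]])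
    also have "\<dots> = w o\<^sub>L ((\<Lambda> o\<^sub>L G) o\<^sub>L radj w)" by (simp only: \<Lambda>G compose_simps(1))
    also have "\<dots> = w o\<^sub>L (\<Lambda> o\<^sub>L radj w)" by (simp only: compose_simps(1) pis_left[OF pis_radj[OF wp]])
    also have "\<dots> = X o\<^sub>L ((e o\<^sub>L (\<Lambda> o\<^sub>L e)) o\<^sub>L radj X)" by (simp add: w_def re compose_simps(1))
    finally show ?thesis by (simp add: e\<Lambda>e compose_simps)
  qed
  have g: "ip ((w o\<^sub>L (B o\<^sub>L radj w)) x) x = (norm (radj X x))\<^sup>2" for x
    unfolding eXX using norm_gram[of "radj X" x] by simp
  have "let g = ip ((w o\<^sub>L (B o\<^sub>L radj w)) x) x in
    g \<le> (norm (radj Y x))\<^sup>2 + c * (norm (F x))\<^sup>2 \<and> \<beta> * (norm (Z x))\<^sup>2 \<le> g \<and>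
    (F x = 0 \<longrightarrow> (c - \<gamma>) / c * (norm (radj Y x))\<^sup>2 \<le> g)" for x
    unfolding Let_def g
  proof (intro conjI impI)
    define y where "y = radj Y x"
    define t where "t = radj z x"
    define h where "h = radj u y + v t"
    have Xx: "radj X x = G h" by (simp add: rX h_def y_def t_def blinfun.bilinear_simps)
    have nf: "norm (radj f x) = norm (F x)" by (rule pis_norm[OF pis_radj[OF f(2)]])
    then have nt: "(norm t)\<^sup>2 = c * (norm (F x))\<^sup>2" using cb(3) by (simp add: t_def z_def blinfun.bilinear_simps power_mult_distrib)
    have "(norm h)\<^sup>2 = ip y (u h) + ip t (v h)"
    proof -
      have "ip (radj u y) h = ip y (u h)" by (simp add: radj_ip')
      moreover have "ip (v t) h = ip t (v h)" by (rule sa_ip[OF rv])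
      ultimately show ?thesis by (simp add: h_def[symmetric] ip_simps flip: ip_self) (simp add: h_def ip_simps)
    qed
    \<comment> \<open>The column (u, v) is isometric, so its adjoint is a contraction from pairs (y,
      t).\<close>
    moreover have "2 * ip y (u h) \<le> (norm y)\<^sup>2 + (norm (u h))\<^sup>2" "2 * ip t (v h) \<le> (norm t)\<^sup>2 + (norm (v h))\<^sup>2"
      using norm_diff_sq[of y "u h"] norm_diff_sq[of t "v h"]
      by (smt (verit) zero_le_power2)+
    ultimately have hle: "(norm h)\<^sup>2 \<le> (norm y)\<^sup>2 + (norm t)\<^sup>2" using uv[of h] by linarith
    have "(norm (G h))\<^sup>2 \<le> (norm h)\<^sup>2" by (rule power_mono[OF proj_norm_le[OF pG(1)]]) simp
    then show "(norm (radj X x))\<^sup>2 \<le> (norm (radj Y x))\<^sup>2 + c * (norm (F x))\<^sup>2"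
      using hle nt unfolding Xx y_def by linarith
    have "norm (Z x) = norm (radj w x)"
      using pis_norm[OF pis_radj[OF wp], of x] by simp
    also have "radj w x = e (radj X x)" by (simp add: w_def re)
    finally have "(norm (Z x))\<^sup>2 = ip (invop \<Lambda> (radj X x)) (radj X x)" using norm_sqop[OF I2(3)] by (simp add: e_def)
    then show "\<beta> * (norm (Z x))\<^sup>2 \<le> (norm (radj X x))\<^sup>2" using I2(5) by simp
    assume "F x = 0"
    then have "t = 0" using nt by simp
    have "G y = y"
    proof -
      have "G o\<^sub>L radj Y = radj Y" using arg_cong[OF Y(2), of radj] by (simp add: rG)
      then show ?thesis unfolding y_def by (metis blinfun_apply_blinfun_compose)
    qed
    then have "G (radj u y) = radj u y" using Gru by (metis blinfun_apply_blinfun_compose)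
    then have "radj X x = D (d y)" using \<open>t = 0\<close> by (simp add: Xx h_def ru blinfun.bilinear_simps)
    then have "(norm (radj X x))\<^sup>2 = ip (P2 (d y)) (d y)" using norm_sqop[OF P2] by (simp add: D_def)
    then have 1: "(c - \<gamma>) * (norm (d y))\<^sup>2 \<le> (norm (radj X x))\<^sup>2" using lo2 by simp
    \<comment> \<open>Without the second row entry, X* x equals D d y. The square of D is at least c
      - \<gamma> and the inverse square of d at most c, which gives the factor (c - \<gamma>) /
      c.\<close>
    have "d (P1 (d y)) = y" using dPd by (metis blinfun_apply_blinfun_compose blinfun_apply_id_blinfun)
    then have "ip (P1 (d y)) (d y) = (norm y)\<^sup>2" by (metis sa_ip[OF rd] ip_self)
    then have "(norm y)\<^sup>2 \<le> c * (norm (d y))\<^sup>2" using hi1[of "d y"] by simp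
    then have "(c - \<gamma>) / c * (norm y)\<^sup>2 \<le> (c - \<gamma>) / c * (c * (norm (d y))\<^sup>2)" using cb by (intro mult_left_mono) auto
    then show "(c - \<gamma>) / c * (norm (radj Y x))\<^sup>2 \<le> (norm (radj X x))\<^sup>2" using 1 cb(3) by (simp add: y_def)
  qed
  then show ?thesis using wM wp by blast
qed

end

section \<open>One step of the exhaustion\<close>

lemma norm_sq_scaled_compose_le:
  fixes R T k :: "'a::complex_hilbert_space \<Rightarrow>\<^sub>L 'a"
  assumes "norm R \<le> a" "proj T" "norm k \<le> 1" "\<kappa>\<^sup>2 * a\<^sup>2 \<le> \<beta>"
  shows "(norm ((\<kappa> *\<^sub>R (R o\<^sub>L (T o\<^sub>L k))) x))\<^sup>2 \<le> \<beta> * (norm x)\<^sup>2"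
proof -
  have a: "0 \<le> a" using assms(1) norm_ge_zero[of R] by linarith
  have "norm (R (T (k x))) \<le> norm R * norm (T (k x))" by (rule norm_blinfun)
  also have "\<dots> \<le> a * norm (k x)" using a by (intro mult_mono assms proj_norm_le) auto
  also have "\<dots> \<le> a * norm x"
    using norm_blinfun[of k x] mult_right_mono[OF assms(3), of "norm x"] a by (intro mult_left_mono) auto
  finally have "(norm (R (T (k x))))\<^sup>2 \<le> (a * norm x)\<^sup>2" by (intro power_mono) auto
  then have "\<kappa>\<^sup>2 * (norm (R (T (k x))))\<^sup>2 \<le> \<kappa>\<^sup>2 * (a * norm x)\<^sup>2" by (intro mult_left_mono) auto
  also have "\<dots> = (\<kappa>\<^sup>2 * a\<^sup>2) * (norm x)\<^sup>2" by (simp add: power_mult_distrib mult.assoc)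
  also have "\<dots> \<le> \<beta> * (norm x)\<^sup>2" by (intro mult_right_mono assms) auto
  finally show ?thesis by (simp add: blinfun.bilinear_simps power_mult_distrib)
qed

lemma sums_group2: "f sums (s::'a::real_normed_vector) \<Longrightarrow> (\<lambda>n. f (2 * n) + f (2 * n + 1)) sums s"
  using sums_group[of f s 2] by (simp add: numeral_2_eq_2 mult.commute)

lemma sums_group3:
  "f sums (s::'a::real_normed_vector) \<Longrightarrow> (\<lambda>n. f (3 * n) + f (3 * n + 1) + f (3 * n + 2)) sums s"
  using sums_group[of f s 3] by (simp add: numeral_3_eq_3 numeral_2_eq_2 mult.commute)

context lfactor begin

text \<open>The projections \<open>Q n\<close> leave room for the parts of later operators that do not fit elsewhere:
  on \<open>Q n\<close> the operator \<open>R\<close> strictly dominates the multiple \<open>o' n\<close> of the identity.\<close>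

definition reserve :: "(nat \<Rightarrow> real) \<Rightarrow> ('a \<Rightarrow>\<^sub>L 'a) \<Rightarrow> (nat \<Rightarrow> 'a \<Rightarrow>\<^sub>L 'a) \<Rightarrow> bool" where
  "reserve o' R Q \<longleftrightarrow> psd R \<and> R \<in> M \<and> orth Q \<and> (\<forall>n. large (Q n) \<and> R o\<^sub>L Q n = Q n o\<^sub>L R \<and>
    (\<exists>\<eta>>0. \<forall>x. Q n x = x \<longrightarrow> (o' n + \<eta>) * (norm x)\<^sup>2 \<le> ip (R x) x))"

text \<open>What one step needs of a summand: large spectral parts near 0, spectral projections up
  to the bounds \<open>o'\<close> exhausting the identity, and a reducing projection G on which B
  lies between \<beta> and \<gamma>.\<close>

definition admissible :: "real \<Rightarrow> real \<Rightarrow> (nat \<Rightarrow> real) \<Rightarrow> ('a \<Rightarrow>\<^sub>L 'a) \<Rightarrow> ('a \<Rightarrow>\<^sub>L 'a) \<Rightarrow> bool" where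
  "admissible \<beta> \<gamma> o' B G \<longleftrightarrow> B \<in> M \<and> psd B \<and> (\<forall>\<delta>>0. large (sres B \<delta>)) \<and>
    (\<forall>x. (\<lambda>n. sres B (o' n) x) \<longlonglongrightarrow> x) \<and> prj G \<and> G o\<^sub>L B = B o\<^sub>L G \<and>
    (\<forall>x. G x = x \<longrightarrow> \<beta> * (norm x)\<^sup>2 \<le> ip (B x) x \<and> ip (B x) x \<le> \<gamma> * (norm x)\<^sup>2)"

text \<open>\<open>Q 0\<close> receives the excess of the rotation. The remaining
  \<open>Q (Suc m)\<close> are used in triples: one makes room for small weights, one carries the
  bounds \<open>o'\<close>, and one, \<open>Q (3 * n + 3)\<close>, is the new reserve. Small weights
  are also laid over a compression of what the rotation leaves of R off the reserve, and strict
  slack everywhere preserves the kernel.\<close>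

lemma exhaustion_step:
  assumes c: "0 < \<beta>" "\<beta> \<le> \<gamma>" "\<gamma> < c" and o': "incseq o'" "\<And>n. c \<le> o' n" "\<And>n. o' n \<le> kk"
    and adm: "admissible \<beta> \<gamma> o' B G" and res: "reserve o' R Q" and N: "psub (kerp R) (kerp B)"
    and a: "norm R \<le> a" "\<kappa>\<^sup>2 * a\<^sup>2 \<le> \<beta>" "\<kappa>\<^sup>2 * a \<le> 1 / 2"
    and k: "k \<in> M" "k o\<^sub>L G = k" "norm k \<le> 1"
  shows "\<exists>C. unitarily_equivalent M C B \<and> psd C \<and> reserve o' (R - C) (\<lambda>n. Q (3 * n + 3)) \<and>
    kerp (R - C) = kerp R \<and>
    (\<forall>x. ssum Q x = 0 \<longrightarrow> (c - \<gamma>) / c * (\<kappa>\<^sup>2 * (norm (radj k (R x)))\<^sup>2) \<le> ip (C x) x)"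
proof -
  have B: "B \<in> M" "psd B" and small: "\<And>\<delta>. 0 < \<delta> \<Longrightarrow> large (sres B \<delta>)"
    and Bo: "\<And>x. (\<lambda>n. sres B (o' n) x) \<longlonglongrightarrow> x" and G: "prj G" "G o\<^sub>L B = B o\<^sub>L G"
    "\<And>x. G x = x \<Longrightarrow> \<beta> * (norm x)\<^sup>2 \<le> ip (B x) x" "\<And>x. G x = x \<Longrightarrow> ip (B x) x \<le> \<gamma> * (norm x)\<^sup>2"
    using adm unfolding admissible_def by blast+
  have R: "psd R" "R \<in> M" and Q: "orth Q" "\<And>n. large (Q n)" "\<And>n. R o\<^sub>L Q n = Q n o\<^sub>L R"
    and "\<And>n. \<exists>\<eta>>0. \<forall>x. Q n x = x \<longrightarrow> (o' n + \<eta>) * (norm x)\<^sup>2 \<le> ip (R x) x"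
    using res unfolding reserve_def by blast+
  then obtain \<eta> where \<eta>: "\<And>n. 0 < \<eta> n" "\<And>n x. Q n x = x \<Longrightarrow> (o' n + \<eta> n) * (norm x)\<^sup>2 \<le> ip (R x) x" by metis
  have c0: "0 < c" using c by linarith
  have o0: "0 < o' n" for n using c0 o'(2)[of n] by linarith
  have rR: "radj R = R" by (rule psd_radj[OF R(1)])
  have pQ: "proj (Q n)" "Q n \<in> M" for n using large_prj[OF Q(2)[of n]] by (auto simp: prj_def)
  define q where "q x = ip (R x) x" for x
  have q0: "0 \<le> q x" for x unfolding q_def by (rule psd_ge0[OF R(1)])
  have qQ: "(o' n + \<eta> n) * (norm (Q n x))\<^sup>2 \<le> q (Q n x)" for n x
    unfolding q_def by (rule \<eta>(2)[OF proj_apply[OF pQ(1)]])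
  have oS: "orth (\<lambda>n. Q (Suc n))" by (rule orth_reindex[OF Q(1)]) simp
  define Q1 where "Q1 = ssum (\<lambda>n. Q (Suc n))"
  have Q1: "proj Q1" "Q1 \<in> M" using prj_ssum[OF oS pQ(2)] by (auto simp: Q1_def prj_def)
  have RQ1: "R o\<^sub>L Q1 = Q1 o\<^sub>L R" unfolding Q1_def by (rule ssum_commute[OF oS Q(3)])
  have Q1Q: "Q1 o\<^sub>L Q (Suc n) = Q (Suc n)" "Q (Suc n) o\<^sub>L Q1 = Q (Suc n)" for n
    unfolding Q1_def by (rule orth_ssum(3)[OF oS], rule orth_ssum(4)[OF oS])
  have Q01: "Q 0 o\<^sub>L Q1 = 0" unfolding Q1_def by (rule ssum_zero[OF oS]) (rule orth_zero[OF Q(1)], simp)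
  have Q10: "Q1 o\<^sub>L Q 0 = 0" by (rule proj_orth_commute[OF pQ(1) Q1(1) Q01])
  have sQ: "ssum Q = Q 0 + Q1"
  proof (rule ssum_eqI, unfold sot_sums_def, rule allI)
    fix x
    have "(\<lambda>n. Q (Suc n) x) sums Q1 x" unfolding Q1_def by (rule sot_sumsD[OF orth_ssum(2)[OF oS]])
    then show "(\<lambda>n. Q n x) sums (Q 0 + Q1) x"
      using sums_Suc[of "\<lambda>n. Q n x" "Q1 x"] by (simp add: blinfun.bilinear_simps add.commute)
  qed
  \<comment> \<open>\<open>T'\<close> is where the rotated block lives; T is what lies outside the
    whole reserve.\<close>
  define T' where "T' = id_blinfun - Q1"
  define T where "T = T' - Q 0"
  have T: "proj T" "T \<in> M"
  proof -
    have "T = id_blinfun - ssum Q" by (simp add: T_def T'_def sQ diff_diff_eq add.commute)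
    then show "proj T" "T \<in> M" using proj_compl orth_ssum(1)[OF Q(1)] prj_ssum[OF Q(1) pQ(2)]
      by (auto simp: prj_def intro: in_M)
  qed
  have T': "proj T'" "T' \<in> M" unfolding T'_def using proj_compl[OF Q1(1)] Q1 by (auto intro: in_M)
  have RT: "R o\<^sub>L T = T o\<^sub>L R" by (simp add: T_def T'_def compose_simps RQ1 Q(3))
  have TQ1: "T o\<^sub>L Q1 = 0" by (simp add: T_def T'_def compose_simps proj_idem Q1 Q01)
  have TQ0: "T o\<^sub>L Q 0 = 0" by (simp add: T_def T'_def compose_simps proj_idem pQ Q10)
  have T'Q1: "T' o\<^sub>L Q1 = 0" by (simp add: T'_def compose_simps proj_idem Q1)
  obtain f F where f: "f \<in> M" "pis f G F" "Q 0 o\<^sub>L F = F"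
    using psub_large[OF G(1) Q(2)[of 0]] unfolding psub_def by blast
  have pF: "proj F" "F \<in> M" using pis_proj[OF f(2)] pis_in(2)[OF f(2,1)] by auto
  have FQ0: "F o\<^sub>L Q 0 = F" by (rule proj_le_commute[OF pF(1) pQ(1) f(3)])
  have FQ1: "F o\<^sub>L Q1 = 0" by (metis FQ0 Q01 compose_simps(1,13))
  have Qf: "Q 0 o\<^sub>L f = f" using pis_left[OF f(2)] f(3) by (metis compose_simps(1))
  \<comment> \<open>The bounds on \<kappa> make Y*Y \<le> \<beta>, as the rotation demands, and keep
    Y Y* below half of R on the range of T.\<close>
  define Y where "Y = \<kappa> *\<^sub>R (R o\<^sub>L (T o\<^sub>L k))"
  have rY: "radj Y = \<kappa> *\<^sub>R (radj k o\<^sub>L (T o\<^sub>L R))"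
    by (simp add: Y_def rR proj_radj[OF T(1)] compose_simps)
  have YM: "Y \<in> M" unfolding Y_def by (intro in_M R T k)
  have YG: "Y o\<^sub>L G = Y" by (simp add: Y_def compose_simps k)
  have Yb: "(norm (Y x))\<^sup>2 \<le> \<beta> * (norm x)\<^sup>2" for x
    unfolding Y_def by (rule norm_sq_scaled_compose_le[OF a(1) T(1) k(3) a(2)])
  have rYz: "radj Y o\<^sub>L X = 0" if "T o\<^sub>L X = 0" for X :: "'a \<Rightarrow>\<^sub>L 'a"
  proof -
    have "T o\<^sub>L (R o\<^sub>L X) = R o\<^sub>L (T o\<^sub>L X)" by (metis RT compose_simps(1))
    then show ?thesis by (simp add: rY that compose_simps)
  qed
  have Yf: "radj Y o\<^sub>L f = 0" by (rule rYz) (metis Qf TQ0 compose_simps(1,12))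
  have YQ1: "radj Y o\<^sub>L Q1 = 0" by (rule rYz[OF TQ1])
  define g where "g w x = ip ((w o\<^sub>L (B o\<^sub>L radj w)) x) x" for w x
  from rotation[OF c B G YM YG Yb f(1,2) Yf]
  obtain w Z where w: "w \<in> M" "pis w G Z" and gw: "\<And>x. g w x \<le> (norm (radj Y x))\<^sup>2 + c * (norm (F x))\<^sup>2"
    "\<And>x. \<beta> * (norm (Z x))\<^sup>2 \<le> g w x" "\<And>x. F x = 0 \<Longrightarrow> (c - \<gamma>) / c * (norm (radj Y x))\<^sup>2 \<le> g w x"
    unfolding g_def Let_def by blast
  have pZ: "proj Z" "Z \<in> M" using pis_proj[OF w(2)] pis_in(2)[OF w(2,1)] by auto
  \<comment> \<open>The form of R minus the upper bound for the rotated block; \<open>S0\<close> is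
    its operator.\<close>
  define s where "s x = q x - (norm (radj Y x))\<^sup>2 - c * (norm (F x))\<^sup>2" for x
  define S0 where "S0 = R - (Y o\<^sub>L radj Y) - c *\<^sub>R F"
  have S0s: "ip (S0 x) x = s x" for x
    using norm_gram[of "radj Y" x] by (simp add: S0_def s_def q_def blinfun.bilinear_simps ip_simps proj_ip_self pF)
  have qs: "q x = q (T' x) + q (Q1 x)" for x
    using quadratic_split[OF Q1(1) RQ1, of x] by (simp add: q_def T'_def blinfun.bilinear_simps)
  have qT': "q (T' x) = q (Q 0 x) + q (T x)" for x
  proof -
    have "Q 0 (T' x) = Q 0 x" using Q01 by (simp add: T'_def blinfun.bilinear_simps) (metis blinfun_apply_blinfun_compose zero_blinfun.rep_eq)
    moreover have "T' x - Q 0 x = T x" by (simp add: T_def blinfun.bilinear_simps)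
    ultimately show ?thesis using quadratic_split[OF pQ(1) Q(3), of "T' x" 0] by (simp add: q_def)
  qed
  have Yq: "(norm (radj Y x))\<^sup>2 \<le> 1 / 2 * q (T x)" for x
  proof -
    have "norm (radj k (T (R x))) \<le> 1 * norm (T (R x))"
      using norm_blinfun[of "radj k" "T (R x)"] k(3) mult_right_mono[of "norm k" 1 "norm (T (R x))"] by simp
    moreover have "T (R x) = R (T x)" using RT by (metis blinfun_apply_blinfun_compose)
    ultimately have "(norm (radj k (T (R x))))\<^sup>2 \<le> (norm (R (T x)))\<^sup>2" by (intro power_mono) auto
    also have "\<dots> \<le> a * q (T x)" unfolding q_def by (rule psd_norm_sq[OF R(1) a(1)])
    finally have "\<kappa>\<^sup>2 * (norm (radj k (T (R x))))\<^sup>2 \<le> \<kappa>\<^sup>2 * (a * q (T x))" by (intro mult_left_mono) auto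
    also have "\<dots> = (\<kappa>\<^sup>2 * a) * q (T x)" by simp
    also have "\<dots> \<le> 1 / 2 * q (T x)" by (intro mult_right_mono a q0)
    finally show ?thesis by (simp add: rY blinfun.bilinear_simps power_mult_distrib)
  qed
  \<comment> \<open>On \<open>Q 0\<close> the operator R exceeds \<open>o' 0 + \<eta> 0\<close> > c,
    so c F uses only a fraction l < 1 of R there.\<close>
  define l where "l = c / (o' 0 + \<eta> 0)"
  have l: "0 < l" "l < 1" using c0 o'(2)[of 0] \<eta>(1)[of 0] by (auto simp: l_def)
  have Fq: "c * (norm (F x))\<^sup>2 \<le> l * q (Q 0 x)" for x
  proof -
    have "F x = F (Q 0 x)" using FQ0 by (metis blinfun_apply_blinfun_compose)
    then have "(norm (F x))\<^sup>2 \<le> (norm (Q 0 x))\<^sup>2" by (metis proj_norm_le[OF pF(1)] norm_ge_zero power_mono)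
    then have "c * (norm (F x))\<^sup>2 \<le> c * (norm (Q 0 x))\<^sup>2" using c0 by (intro mult_left_mono) auto
    also have "\<dots> = l * ((o' 0 + \<eta> 0) * (norm (Q 0 x))\<^sup>2)" using o0[of 0] \<eta>(1)[of 0] by (simp add: l_def)
    also have "\<dots> \<le> l * q (Q 0 x)" using l by (intro mult_left_mono qQ) auto
    finally show ?thesis .
  qed
  \<comment> \<open>At least one half of R remains on T and at least 1 - l of it on
    \<open>Q 0\<close>; \<theta> is the fraction that survives on both.\<close>
  define \<theta> where "\<theta> = min (1 / 2) (1 - l)"
  have \<theta>: "0 < \<theta>" "\<theta> \<le> 1/2" "\<theta> \<le> 1 - l" using l by (auto simp: \<theta>_def min_def)
  have T'a: "radj Y (T' x) = radj Y x" "F (T' x) = F x" for x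
    using YQ1 FQ1 by (simp_all add: T'_def blinfun.bilinear_simps)
      (metis blinfun_apply_blinfun_compose zero_blinfun.rep_eq)+
  have sT': "s x = s (T' x) + q (Q1 x)" for x using qs[of x] T'a by (simp add: s_def)
  have slow: "\<theta> * q (T' x) \<le> s (T' x)" for x
  proof -
    have "\<theta> * q (T' x) = \<theta> * q (Q 0 x) + \<theta> * q (T x)" by (simp add: qT' distrib_left)
    also have "\<dots> \<le> (1 - l) * q (Q 0 x) + 1 / 2 * q (T x)" using \<theta> by (intro add_mono mult_right_mono q0) auto
    also have "\<dots> \<le> s (T' x)" using Yq[of x] Fq[of x] unfolding s_def T'a qT' by (simp add: left_diff_distrib)
    finally show ?thesis .
  qed
  have sT0: "0 \<le> s (T' x)" for x using slow[of x] \<theta>(1) q0[of "T' x"] by (meson less_imp_le mult_nonneg_nonneg order_trans)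
  have s0: "0 \<le> s x" for x using sT'[of x] sT0[of x] q0[of "Q1 x"] by linarith
  have sq: "s x \<le> q x" for x
  proof -
    have "0 \<le> c * (norm (F x))\<^sup>2" using c0 by simp
    then show ?thesis unfolding s_def using zero_le_power2[of "norm (radj Y x)"] by linarith
  qed
  have S0: "psd S0" unfolding psd_def S0s using s0
    by (simp add: S0_def rR proj_radj[OF pF(1)])
  have S0M: "S0 \<in> M" unfolding S0_def by (intro in_M R YM pF)
  have Zq: "\<beta> * (norm (Z x))\<^sup>2 \<le> q x" for x using gw(1,2)[of x] s0[of x] unfolding s_def by linarith
  \<comment> \<open>The block vanishes on vectors of \<open>Q1\<close>, yet its form is at least
    \<beta> times the squared norm of the Z component; so the rotated range avoids the rest of the
    reserve.\<close>
  have ZQ1: "Z o\<^sub>L Q1 = 0"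
  proof (rule blinfun_eqI)
    fix x
    have "radj Y (Q1 x) = 0" "F (Q1 x) = 0" using YQ1 FQ1 by (metis blinfun_apply_blinfun_compose zero_blinfun.rep_eq)+
    then have "\<beta> * (norm (Z (Q1 x)))\<^sup>2 \<le> 0" using gw(1,2)[of "Q1 x"] by simp
    then show "(Z o\<^sub>L Q1) x = blinfun_apply 0 x" using c(1) by (simp add: mult_le_0_iff)
  qed
  have Q1Z: "Q1 o\<^sub>L Z = 0" by (rule proj_orth_commute[OF pZ(1) Q1(1) ZQ1])
  have ZT': "Z (T' x) = Z x" for x
    using ZQ1 by (simp add: T'_def blinfun.bilinear_simps) (metis blinfun_apply_blinfun_compose zero_blinfun.rep_eq)
  have wQ1: "radj w o\<^sub>L Q1 = 0"
  proof -
    have "radj w o\<^sub>L Q1 = radj w o\<^sub>L (Z o\<^sub>L Q1)" using pis_right[OF pis_radj[OF w(2)]] by (metis compose_simps(1))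
    then show ?thesis by (simp add: ZQ1)
  qed
  define N where "N = kerp R"
  have pN: "proj N" "N \<in> M" unfolding N_def using kerp kerp_in[OF rR R(2)] by auto
  have NZ: "N o\<^sub>L Z = 0"
  proof -
    have "Z o\<^sub>L N = 0"
    proof (rule blinfun_eqI)
      fix x
      have "\<beta> * (norm (Z (N x)))\<^sup>2 \<le> 0" using Zq[of "N x"] by (simp add: q_def N_def apply_kerp ip_simps)
      then show "(Z o\<^sub>L N) x = blinfun_apply 0 x" using c(1) by (simp add: mult_le_0_iff)
    qed
    then show ?thesis by (rule proj_orth_commute[OF pZ(1) pN(1)])
  qed
  have QN: "Q n o\<^sub>L N = 0" for n
  proof (rule blinfun_eqI)
    fix x
    have "R (Q n (N x)) = Q n (R (N x))" using Q(3) by (metis blinfun_apply_blinfun_compose)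
    then have "R (Q n (N x)) = 0" by (simp add: N_def apply_kerp blinfun.bilinear_simps)
    then have "(o' n + \<eta> n) * (norm (Q n (N x)))\<^sup>2 \<le> 0" using qQ[of n "N x"] by (simp add: q_def ip_simps)
    then show "(Q n o\<^sub>L N) x = blinfun_apply 0 x" using o0[of n] \<eta>(1)[of n] by (simp add: mult_le_0_iff)
  qed
  have NQ: "N o\<^sub>L Q n = 0" for n by (rule proj_orth_commute[OF pQ(1) pN(1) QN])
  have NQ1: "N o\<^sub>L Q1 = 0" unfolding Q1_def by (rule ssum_zero[OF oS NQ])
  have Q1N: "Q1 o\<^sub>L N = 0" by (rule proj_orth_commute[OF pN(1) Q1(1) NQ1])
  have ZN: "Z o\<^sub>L N = 0" by (rule proj_orth_commute[OF pN(1) pZ(1) NZ])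
  \<comment> \<open>The remaining pieces must be orthogonal to Z, which need not commute with
    \<open>S0\<close>; therefore \<open>S0\<close> is compressed to the complement of
    \<open>Q1 + Z\<close> before it is cut into chunks.\<close>
  define E where "E = T' - Z"
  have rE: "radj E = E" by (simp add: E_def proj_radj T' pZ)
  define S where "S = E o\<^sub>L (S0 o\<^sub>L E)"
  have S: "psd S" unfolding S_def using psd_conj'[OF S0, of E] rE by simp
  have SM: "S \<in> M" unfolding S_def E_def by (intro in_M S0M T' pZ)
  have Sq: "ip (S x) x = s (E x)" for x
    by (simp add: S_def sa_ip[OF rE] S0s)
  \<comment> \<open>The price of the compression: s at \<open>E x\<close> is at most twice its
    values at \<open>T' x\<close> and \<open>Z x\<close> together, and the latter is controlled by
    \<open>norm S0\<close> and the lower bounds \<beta> and \<theta>.\<close>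
  define K where "K = 2 + 2 * norm S0 / (\<beta> * \<theta>)"
  have K: "0 < K" using c(1) \<theta>(1) by (simp add: K_def add_pos_nonneg)
  have SK: "ip (S x) x \<le> K * s (T' x)" for x
  proof -
    have par: "s (y - z) + s (y + z) = 2 * s y + 2 * s z" for y z
      by (simp add: blinfun.bilinear_simps ip_simps flip: S0s)
    have "s (Z x) \<le> norm S0 * (norm (Z x))\<^sup>2" using ip_apply_le[of S0 "Z x"] by (simp add: S0s)
    also have "(norm (Z x))\<^sup>2 \<le> s (T' x) / (\<beta> * \<theta>)"
    proof -
      have "\<theta> * (\<beta> * (norm (Z x))\<^sup>2) \<le> \<theta> * q (T' x)" using \<theta>(1) Zq[of "T' x"] by (simp add: ZT')
      also have "\<dots> \<le> s (T' x)" by (rule slow)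
      finally show ?thesis using c(1) \<theta>(1) by (simp add: field_simps)
    qed
    finally have "s (Z x) \<le> norm S0 * (s (T' x) / (\<beta> * \<theta>))" by (simp add: mult_left_mono)
    moreover have "s (E x) \<le> 2 * s (T' x) + 2 * s (Z x)"
      using par[of "T' x" "Z x"] s0[of "T' x + Z x"] by (simp add: E_def blinfun.bilinear_simps)
    moreover have "K * s (T' x) = 2 * s (T' x) + 2 * (norm S0 * (s (T' x) / (\<beta> * \<theta>)))"
      by (simp add: K_def distrib_right)
    ultimately show ?thesis unfolding Sq by linarith
  qed
  have E1: "T' o\<^sub>L E = E" by (simp add: E_def T'_def compose_simps proj_idem Q1 Q1Z)
  have E2: "N o\<^sub>L E = N" by (simp add: E_def T'_def compose_simps NQ1 NZ)
  have pQZ: "proj (Q1 + (Z + N))"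
    by (rule proj_add[OF Q1(1) proj_add[OF pZ(1) pN(1) ZN]]) (simp add: compose_simps Q1Z Q1N)
  \<comment> \<open>The bound \<open>slow\<close> shows that s and R have the same kernel on the
    range of E, so the chunks of S fill exactly the complement of \<open>Q1\<close>, Z and the
    kernel of R.\<close>
  have kS: "kerp S = Q1 + (Z + N)"
  proof (rule proj_eqI[OF kerp(1) pQZ])
    fix x
    have T'E: "T' (E x) = E x" using E1 by (metis blinfun_apply_blinfun_compose)
    have "kerp S x = x \<longleftrightarrow> S x = 0" by (rule kerp_apply_iff)
    also have "\<dots> \<longleftrightarrow> s (E x) = 0"
      using psd_kernel[OF S, of x] by (auto simp: Sq ip_simps simp flip: Sq)
    also have "\<dots> \<longleftrightarrow> R (E x) = 0"
    proof
      assume "s (E x) = 0"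
      then have "\<theta> * q (E x) \<le> 0" using slow[of "E x"] by (simp add: T'E)
      then have "q (E x) = 0" using \<theta>(1) q0[of "E x"] by (simp add: mult_le_0_iff)
      then show "R (E x) = 0" using psd_kernel[OF R(1)] by (simp add: q_def)
    next
      assume "R (E x) = 0"
      then show "s (E x) = 0" using sq[of "E x"] s0[of "E x"] by (simp add: q_def ip_simps)
    qed
    also have "\<dots> \<longleftrightarrow> N (E x) = E x" unfolding N_def by (rule kerp_apply_iff[symmetric])
    also have "N (E x) = N x" using E2 by (metis blinfun_apply_blinfun_compose)
    also have "N x = E x \<longleftrightarrow> (Q1 + (Z + N)) x = x"
      by (auto simp: E_def T'_def blinfun.bilinear_simps algebra_simps)
    finally show "kerp S x = x \<longleftrightarrow> (Q1 + (Z + N)) x = x" .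
  qed
  obtain L \<epsilon> where L: "orth L" "\<And>k. L k \<in> M" "ssum L = id_blinfun - kerp S" and
      \<epsilon>: "\<And>k. 0 < \<epsilon> k" "\<And>k. \<epsilon> k \<le> (1::real)" "\<And>x. (\<Sum>k. \<epsilon> k * (norm (L k x))\<^sup>2) \<le> ip (S x) x"
    using positive_chunks[OF S SM] by blast
  have LQ: "L i o\<^sub>L Q (Suc m) = 0" for i m
  proof -
    have NQm: "N o\<^sub>L Q (Suc m) = 0" by (rule NQ)
    have ZQm: "Z o\<^sub>L Q (Suc m) = 0" using ZQ1 Q1Q(1)[of m] by (metis compose_simps(1,12))
    have "ssum L o\<^sub>L Q (Suc m) = 0" by (simp add: L(3) kS compose_simps NQm ZQm Q1Q)
    moreover have "L i o\<^sub>L ssum L = L i" by (rule orth_ssum(4)[OF L(1)])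
    ultimately show ?thesis by (metis compose_simps(1,13))
  qed
  have pL: "proj (L i)" for i by (rule orth_proj[OF L(1)])
  have QL: "Q (Suc m) o\<^sub>L L i = 0" for i m by (rule proj_orth_commute[OF pL pQ(1) LQ])
  \<comment> \<open>Even members join a chunk, possibly not large, to a large
    \<open>Q (Suc (3 * m))\<close>; odd members are the projections reserved for the next
    step.\<close>
  define W where "W n = (if even n then L (n div 2) + Q (Suc (3 * (n div 2))) else Q (Suc (3 * (n div 2) + 2)))" for n
  define W' where "W' n = Q (Suc (3 * n + 1))" for n
  have W2: "W (2 * n) = L n + Q (Suc (3 * n))" "W (2 * n + 1) = Q (Suc (3 * n + 2))" for n
    by (simp_all add: W_def)
  have pLQ: "proj (L i + Q (Suc m))" for i m by (rule proj_add[OF pL pQ(1) LQ])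
  have nx: "Suc (3 * i) \<noteq> Suc (3 * j + 2)" for i j :: nat by presburger
  have oW: "orth W" unfolding orth_def
  proof (intro conjI allI impI)
    show "proj (W n)" for n by (simp add: W_def pLQ pQ)
    show "W i o\<^sub>L W j = 0" if "i \<noteq> j" for i j
    proof (cases "even i")
      case ei: True
      show ?thesis
      proof (cases "even j")
        case True
        then have ne: "i div 2 \<noteq> j div 2" using ei that by (metis dvd_mult_div_cancel)
        then have "Q (Suc (3 * (i div 2))) o\<^sub>L Q (Suc (3 * (j div 2))) = 0" by (intro orth_zero[OF Q(1)]) auto
        then show ?thesis using ei True orth_zero[OF L(1) ne] by (simp add: W_def compose_simps LQ QL)
      next
        case False
        have "Q (Suc (3 * (i div 2))) o\<^sub>L Q (Suc (3 * (j div 2) + 2)) = 0"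
          by (rule orth_zero[OF Q(1) nx])
        then show ?thesis using ei False by (simp add: W_def compose_simps LQ QL)
      qed
    next
      case oi: False
      show ?thesis
      proof (cases "even j")
        case True
        have "Q (Suc (3 * (i div 2) + 2)) o\<^sub>L Q (Suc (3 * (j div 2))) = 0"
          by (rule orth_zero[OF Q(1) nx[symmetric]])
        then show ?thesis using oi True by (simp add: W_def compose_simps LQ QL)
      next
        case False
        then have "i div 2 \<noteq> j div 2" using oi that by (metis odd_two_times_div_two_succ)
        then have "Q (Suc (3 * (i div 2) + 2)) o\<^sub>L Q (Suc (3 * (j div 2) + 2)) = 0" by (intro orth_zero[OF Q(1)]) auto
        then show ?thesis using oi False by (simp add: W_def)
      qed
    qed
  qed
  have lW: "large (W n)" for n
  proof (cases "even n")
    case True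
    have "large (L (n div 2) + Q (Suc (3 * (n div 2))))"
    proof (rule large_mono[OF Q(2)[of "Suc (3 * (n div 2))"]])
      show "prj (L (n div 2) + Q (Suc (3 * (n div 2))))" using pLQ L(2) pQ by (auto simp: prj_def intro: add_in)
      show "(L (n div 2) + Q (Suc (3 * (n div 2)))) o\<^sub>L Q (Suc (3 * (n div 2))) = Q (Suc (3 * (n div 2)))"
        by (simp add: compose_simps LQ proj_idem pQ)
    qed
    then show ?thesis using True by (simp add: W_def)
  qed (simp add: W_def Q(2))
  have oW': "orth W'" unfolding W'_def by (rule orth_reindex[OF Q(1)]) (auto simp: inj_def)
  \<comment> \<open>The weight \<open>\<epsilon> / (2 * K)\<close> spends at most half of s on the
    chunks, \<open>\<eta> / 2\<close> leaves half the slack on the new reserve, and the cap c keeps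
    every weight below \<open>o'\<close>.\<close>
  define \<omega> where "\<omega> n = (if even n then min (\<epsilon> (n div 2) / (2 * K)) c else min (\<eta> (Suc (3 * (n div 2) + 2)) / 2) c)" for n
  have \<omega>2: "\<omega> (2 * n) = min (\<epsilon> n / (2 * K)) c" "\<omega> (2 * n + 1) = min (\<eta> (Suc (3 * n + 2)) / 2) c" for n
    by (simp_all add: \<omega>_def)
  have \<omega>: "0 < \<omega> n" "\<omega> n \<le> c" for n using \<epsilon>(1) K c0 \<eta>(1) by (auto simp: \<omega>_def)
  have \<omega>k: "\<omega> n \<le> kk" for n using \<omega>(2)[of n] o'(2,3)[of 0] by linarith
  have WW0: "W i o\<^sub>L W' j = 0" for i j
  proof (cases "even i")
    case True
    have "Q (Suc (3 * (i div 2))) o\<^sub>L Q (Suc (3 * j + 1)) = 0" by (intro orth_zero[OF Q(1)]) presburger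
    then show ?thesis using True by (simp add: W_def W'_def compose_simps LQ)
  next
    case False
    have "Q (Suc (3 * (i div 2) + 2)) o\<^sub>L Q (Suc (3 * j + 1)) = 0" by (intro orth_zero[OF Q(1)]) presburger
    then show ?thesis using False by (simp add: W_def W'_def)
  qed
  have WW: "ssum W o\<^sub>L ssum W' = 0"
  proof (rule ssum_zero[OF oW'])
    fix j
    have "W' j o\<^sub>L W i = 0" for i by (rule proj_orth_commute[OF orth_proj[OF oW] orth_proj[OF oW'] WW0])
    then have "W' j o\<^sub>L ssum W = 0" by (rule ssum_zero[OF oW])
    then show "ssum W o\<^sub>L W' j = 0" by (rule proj_orth_commute[OF orth_proj[OF oW'] orth_ssum(1)[OF oW]])
  qed
  have Q1sum: "(\<lambda>n. Q (Suc (3 * n)) x + Q (Suc (3 * n + 1)) x + Q (Suc (3 * n + 2)) x) sums Q1 x" for x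
    unfolding Q1_def by (rule sums_group3[OF sot_sumsD[OF orth_ssum(2)[OF oS]]])
  have WWid: "ssum W + ssum W' = id_blinfun - (N + Z)"
  proof (rule blinfun_eqI)
    fix x
    have "(\<lambda>n. W (2 * n) x + W (2 * n + 1) x) sums ssum W x"
      by (rule sums_group2[OF sot_sumsD[OF orth_ssum(2)[OF oW]]])
    from sums_add[OF this sot_sumsD[OF orth_ssum(2)[OF oW'], of x]]
    have 1: "(\<lambda>n. (W (2 * n) x + W (2 * n + 1) x) + W' n x) sums (ssum W x + ssum W' x)" .
    have 2: "(\<lambda>n. L n x + (Q (Suc (3 * n)) x + Q (Suc (3 * n + 1)) x + Q (Suc (3 * n + 2)) x)) sums (ssum L x + Q1 x)"
      by (rule sums_add[OF sot_sumsD[OF orth_ssum(2)[OF L(1)]] Q1sum])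
    have "(W (2 * n) x + W (2 * n + 1) x) + W' n x =
        L n x + (Q (Suc (3 * n)) x + Q (Suc (3 * n + 1)) x + Q (Suc (3 * n + 2)) x)" for n
      unfolding W2 W'_def by (simp add: blinfun.bilinear_simps algebra_simps)
    then have "ssum W x + ssum W' x = ssum L x + Q1 x" using 1 2 sums_unique2 by simp
    also have "\<dots> = x - (N x + Z x)" by (simp add: L(3) kS blinfun.bilinear_simps algebra_simps)
    finally show "(ssum W + ssum W') x = (id_blinfun - (N + Z)) x" by (simp add: blinfun.bilinear_simps)
  qed
  have lW': "large (W' n)" for n unfolding W'_def by (rule Q(2))
  from unitary_cover[where \<omega> = \<omega> and o' = o' and W = W and W' = W', OF B small c(1) G(1-3) N[folded N_def] w NZ
      oW lW \<omega>(1) \<omega>k oW' lW' o0 o'(3,1) Bo WW WWid]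
  obtain C Cr where C: "unitarily_equivalent M C B" "C = (w o\<^sub>L (B o\<^sub>L radj w)) + Cr" and Cr: "Cr \<in> M" "psd Cr"
      "\<And>n. Cr o\<^sub>L W n = W n o\<^sub>L Cr"
      "\<And>x. ip (Cr x) x \<le> (\<Sum>n. \<omega> n * (norm (W n x))\<^sup>2) + (\<Sum>n. o' n * (norm (W' n x))\<^sup>2)"
    by blast
  have CM: "C \<in> M" unfolding C(2) by (intro in_M w B Cr)
  have Cp: "psd C" unfolding C(2) by (rule psd_add[OF psd_conj'[OF B(2)] Cr(2)])
  have Cq: "ip (C x) x = g w x + ip (Cr x) x" for x by (simp add: C(2) g_def blinfun.bilinear_simps ip_simps)
  define r where "r x = ip ((R - C) x) x" for x
  have rq: "r x = q x - g w x - ip (Cr x) x" for x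
    using Cq[of x] by (simp add: r_def q_def blinfun.bilinear_simps ip_simps)
  \<comment> \<open>The most that the rest of the copy can use on the n-th triple; d is what R
    provides there.\<close>
  define b where "b x n = \<omega> (2 * n) * (norm (Q (Suc (3 * n)) x))\<^sup>2 + o' n * (norm (Q (Suc (3 * n + 1)) x))\<^sup>2
      + \<omega> (2 * n + 1) * (norm (Q (Suc (3 * n + 2)) x))\<^sup>2" for x n
  define d where "d x n = q (Q (Suc (3 * n)) x) + q (Q (Suc (3 * n + 1)) x) + q (Q (Suc (3 * n + 2)) x)" for x n
  have dsum: "d x sums q (Q1 x)" for x
    unfolding d_def q_def Q1_def by (rule sums_group3[OF quadratic_sums[OF oS Q(3)]])
  \<comment> \<open>The slack of R beyond the bounds \<open>o'\<close> remains on all three members.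
    For the middle one, \<open>o' n\<close> \<le> \<open>o' (3 * n + 2)\<close> by
    monotonicity.\<close>
  have db: "b x n + (\<eta> (Suc (3 * n)) * (norm (Q (Suc (3 * n)) x))\<^sup>2 + \<eta> (Suc (3 * n + 1)) * (norm (Q (Suc (3 * n + 1)) x))\<^sup>2
      + \<eta> (Suc (3 * n + 2)) * (norm (Q (Suc (3 * n + 2)) x))\<^sup>2) \<le> d x n" for x n
  proof -
    have t: "(y + \<eta> m) * (norm (Q m x))\<^sup>2 \<le> q (Q m x)" if "y \<le> o' m" for y m
      using qQ[of m x] mult_right_mono[of "y + \<eta> m" "o' m + \<eta> m" "(norm (Q m x))\<^sup>2"] that by simp
    have 1: "\<omega> (2 * n) \<le> o' (Suc (3 * n))" "\<omega> (2 * n + 1) \<le> o' (Suc (3 * n + 2))" using \<omega>(2) o'(2) order_trans by blast+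
    have 2: "o' n \<le> o' (Suc (3 * n + 1))" by (rule incseqD[OF o'(1)]) simp
    show ?thesis unfolding b_def d_def
      using t[OF 1(1)] t[OF 1(2)] t[OF 2] by (simp add: distrib_right)
  qed
  have b0: "0 \<le> b x n" for x n unfolding b_def using \<omega>(1) o0 by (intro add_nonneg_nonneg mult_nonneg_nonneg) (auto intro: less_imp_le)
  have bd: "b x n \<le> d x n" for x n
    using db[of x n] \<eta>(1) by (smt (verit) mult_nonneg_nonneg zero_le_power2)
  have bs: "summable (b x)" for x
    by (rule summable_comparison_test'[OF sums_summable[OF dsum[of x]], of 0]) (use b0 bd in simp)
  have Cre: "ip (Cr x) x \<le> 1 / 2 * s (T' x) + suminf (b x)" for x
  proof -
    have sW: "summable (\<lambda>n. \<omega> n * (norm (W n x))\<^sup>2)" and sW': "summable (\<lambda>n. o' n * (norm (W' n x))\<^sup>2)"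
    proof -
      have a: "summable (\<lambda>n. kk * (norm (W n x))\<^sup>2)" "summable (\<lambda>n. kk * (norm (W' n x))\<^sup>2)"
        by (intro summable_mult sums_summable[OF ssum_norm_sums] oW oW')+
      show "summable (\<lambda>n. \<omega> n * (norm (W n x))\<^sup>2)"
        by (rule summable_comparison_test'[OF a(1), of 0]) (use \<omega>(1) \<omega>k in \<open>simp add: mult_right_mono less_imp_le\<close>)
      show "summable (\<lambda>n. o' n * (norm (W' n x))\<^sup>2)"
        by (rule summable_comparison_test'[OF a(2), of 0]) (use o0 o'(3) in \<open>simp add: mult_right_mono less_imp_le\<close>)
    qed
    have nW: "(norm (W (2 * n) x))\<^sup>2 = (norm (L n x))\<^sup>2 + (norm (Q (Suc (3 * n)) x))\<^sup>2" for n
    proof -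
      have "ip (L n x) (Q (Suc (3 * n)) x) = ip x (L n (Q (Suc (3 * n)) x))" by (rule proj_ip[OF pL])
      also have "L n (Q (Suc (3 * n)) x) = 0" using LQ by (metis blinfun_apply_blinfun_compose zero_blinfun.rep_eq)
      finally show ?thesis unfolding W2 blinfun.add_left norm_add_sq by (simp add: ip_simps)
    qed
    have g2: "(\<lambda>n. \<omega> (2 * n) * (norm (W (2 * n) x))\<^sup>2 + \<omega> (2 * n + 1) * (norm (W (2 * n + 1) x))\<^sup>2) sums
        (\<Sum>n. \<omega> n * (norm (W n x))\<^sup>2)"
      by (rule sums_group2[OF summable_sums[OF sW]])
    from sums_add[OF this summable_sums[OF sW']]
    have "(\<lambda>n. \<omega> (2 * n) * (norm (L n x))\<^sup>2 + b x n) sums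
        ((\<Sum>n. \<omega> n * (norm (W n x))\<^sup>2) + (\<Sum>n. o' n * (norm (W' n x))\<^sup>2))"
      unfolding nW b_def W2(2) W'_def by (simp add: distrib_left add.assoc add.commute add.left_commute)
    then have t: "(\<lambda>n. \<omega> (2 * n) * (norm (L n x))\<^sup>2) sums
        ((\<Sum>n. \<omega> n * (norm (W n x))\<^sup>2) + (\<Sum>n. o' n * (norm (W' n x))\<^sup>2) - suminf (b x))"
      using sums_diff[OF _ summable_sums[OF bs[of x]]] by fastforce
    have se: "summable (\<lambda>n. \<epsilon> n * (norm (L n x))\<^sup>2)"
      by (rule summable_comparison_test'[OF sums_summable[OF ssum_norm_sums[OF L(1), of x]], of 0])
        (use \<epsilon>(1,2) in \<open>simp add: less_imp_le mult_left_le_one_le\<close>)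
    \<comment> \<open>The chunk weights were cut so that their sum is at most the form of S divided
      by 2 K, hence at most half of s at \<open>T' x\<close>.\<close>
    have "\<omega> (2 * n) * (norm (L n x))\<^sup>2 \<le> 1 / (2 * K) * (\<epsilon> n * (norm (L n x))\<^sup>2)" for n
    proof -
      have "\<omega> (2 * n) * (norm (L n x))\<^sup>2 \<le> \<epsilon> n / (2 * K) * (norm (L n x))\<^sup>2" unfolding \<omega>2 by (intro mult_right_mono) auto
      then show ?thesis by simp
    qed
    from sums_le[OF this t sums_mult[OF summable_sums[OF se]]]
    have "(\<Sum>n. \<omega> n * (norm (W n x))\<^sup>2) + (\<Sum>n. o' n * (norm (W' n x))\<^sup>2) - suminf (b x)
        \<le> 1 / (2 * K) * (\<Sum>n. \<epsilon> n * (norm (L n x))\<^sup>2)" .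
    also have "\<dots> \<le> 1 / (2 * K) * (K * s (T' x))"
      using K by (intro mult_left_mono order_trans[OF \<epsilon>(3) SK]) auto
    also have "\<dots> = 1 / 2 * s (T' x)" using K by simp
    finally show ?thesis using Cr(4)[of x] by linarith
  qed
  have rlow: "1 / 2 * s (T' x) + (q (Q1 x) - suminf (b x)) \<le> r x" for x
  proof -
    have "g w x \<le> q x - s x" using gw(1)[of x] unfolding s_def by linarith
    then show ?thesis using Cre[of x] sT'[of x] unfolding rq by linarith
  qed
  have bq: "suminf (b x) \<le> q (Q1 x)" for x
    using sums_le[OF bd summable_sums[OF bs] dsum] .
  have r0: "0 \<le> r x" for x using rlow[of x] bq[of x] sT0[of x] by linarith
  have RC: "psd (R - C)" unfolding psd_def using r0 by (simp add: r_def rR psd_radj[OF Cp])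
  \<comment> \<open>If the new form vanishes at x, both nonnegative terms of \<open>rlow\<close>
    vanish. The slack \<eta> removes all components in \<open>Q1\<close>, and then s bounds \<theta>
    times the form of R.\<close>
  have ker: "kerp (R - C) = kerp R"
  proof (rule proj_eqI[OF kerp(1) kerp(1)])
    fix x
    have "(R - C) x = 0 \<longleftrightarrow> R x = 0"
    proof
      assume "R x = 0"
      then have "r x \<le> 0" using gw(2)[of x] psd_ge0[OF Cr(2), of x] c(1)
        by (simp add: rq q_def ip_simps) (smt (verit) mult_nonneg_nonneg zero_le_power2)
      then have "ip ((R - C) x) x = 0" using r0[of x] by (simp add: r_def)
      then show "(R - C) x = 0" by (rule psd_kernel[OF RC])
    next
      assume "(R - C) x = 0"
      then have "r x = 0" by (simp add: r_def ip_simps)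
      then have z: "s (T' x) = 0" "q (Q1 x) = suminf (b x)" using rlow[of x] bq[of x] sT0[of x] by linarith+
      have "(\<lambda>n. d x n - b x n) sums 0" using sums_diff[OF dsum summable_sums[OF bs], of x x] z(2) by simp
      then have "d x n - b x n = 0" for n
        using sums_unique[of "\<lambda>n. d x n - b x n" 0] suminf_eq_zero_iff[of "\<lambda>n. d x n - b x n"] bd sums_summable
        by (metis (no_types, lifting) diff_ge_0_iff_ge)
      then have eq: "d x n = b x n" for n by simp
      have Qz: "Q (Suc (3 * n)) x = 0 \<and> Q (Suc (3 * n + 1)) x = 0 \<and> Q (Suc (3 * n + 2)) x = 0" for n
      proof -
        have nn: "0 \<le> \<eta> m * (norm (Q m x))\<^sup>2" for m using \<eta>(1)[of m] by simp
        have "\<eta> (Suc (3 * n)) * (norm (Q (Suc (3 * n)) x))\<^sup>2 + \<eta> (Suc (3 * n + 1)) * (norm (Q (Suc (3 * n + 1)) x))\<^sup>2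
          + \<eta> (Suc (3 * n + 2)) * (norm (Q (Suc (3 * n + 2)) x))\<^sup>2 \<le> 0" using db[of x n] eq[of n] by linarith
        then have "\<eta> (Suc (3 * n)) * (norm (Q (Suc (3 * n)) x))\<^sup>2 = 0" "\<eta> (Suc (3 * n + 1)) * (norm (Q (Suc (3 * n + 1)) x))\<^sup>2 = 0"
          "\<eta> (Suc (3 * n + 2)) * (norm (Q (Suc (3 * n + 2)) x))\<^sup>2 = 0"
          using nn[of "Suc (3 * n)"] nn[of "Suc (3 * n + 1)"] nn[of "Suc (3 * n + 2)"] by linarith+
        then show ?thesis using \<eta>(1) by (metis mult_eq_0_iff norm_eq_zero order_less_irrefl power_eq_0_iff)
      qed
      have "Q1 x = 0" using Q1sum[of x] Qz sums_unique2[OF sums_zero] by simp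
      then have "T' x = x" by (simp add: T'_def blinfun.bilinear_simps)
      then have "\<theta> * q x \<le> 0" using slow[of x] z(1) by simp
      then have "q x = 0" using \<theta>(1) q0[of x] by (simp add: mult_le_0_iff)
      then show "R x = 0" using psd_kernel[OF R(1)] by (simp add: q_def)
    qed
    then show "kerp (R - C) x = x \<longleftrightarrow> kerp R x = x" by (simp add: kerp_apply_iff)
  qed
  have res': "reserve o' (R - C) (\<lambda>n. Q (3 * n + 3))"
    unfolding reserve_def
  proof (intro conjI allI)
    show "psd (R - C)" by (rule RC)
    show "R - C \<in> M" by (intro in_M R CM)
    show "orth (\<lambda>n. Q (3 * n + 3))" by (rule orth_reindex[OF Q(1)]) (auto simp: inj_def)
    fix n
    show "large (Q (3 * n + 3))" by (rule Q(2))
    have e: "3 * n + 3 = Suc (3 * n + 2)" by simp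
    have wQ: "radj w o\<^sub>L Q (3 * n + 3) = 0"
      unfolding e using wQ1 Q1Q(1)[of "3 * n + 2"] by (metis compose_simps(1,12))
    have Qw: "Q (3 * n + 3) o\<^sub>L w = 0"
      using arg_cong[OF wQ, of radj] by (simp add: proj_radj pQ)
    have "Q (3 * n + 3) o\<^sub>L (w o\<^sub>L (B o\<^sub>L radj w)) = 0" using Qw by (metis compose_simps(1,12))
    moreover have "(w o\<^sub>L (B o\<^sub>L radj w)) o\<^sub>L Q (3 * n + 3) = 0" by (simp add: compose_simps wQ)
    moreover have "Cr o\<^sub>L Q (3 * n + 3) = Q (3 * n + 3) o\<^sub>L Cr"
      using Cr(3)[of "2 * n + 1"] unfolding W2 e .
    ultimately show "(R - C) o\<^sub>L Q (3 * n + 3) = Q (3 * n + 3) o\<^sub>L (R - C)"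
      by (simp add: C(2) compose_simps Q(3))
    \<comment> \<open>On this projection the copy acts only through \<open>W (2 * n + 1)\<close>,
      with weight at most half the slack; the bound required now is \<open>o' n\<close>, not the
      larger \<open>o' (3 * n + 3)\<close>.\<close>
    show "\<exists>h>0. \<forall>x. Q (3 * n + 3) x = x \<longrightarrow> (o' n + h) * (norm x)\<^sup>2 \<le> ip ((R - C) x) x"
    proof (intro exI[of _ "\<eta> (3 * n + 3) / 2"] conjI allI impI)
      show "0 < \<eta> (3 * n + 3) / 2" using \<eta>(1) by simp
      fix x assume x: "Q (3 * n + 3) x = x"
      have Wx: "W m x = (if m = 2 * n + 1 then x else 0)" for m
      proof (cases "m = 2 * n + 1")
        case True
        have "W m = Q (3 * n + 3)" unfolding True W2 e ..
        then show ?thesis using x True by simp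
      next
        case False
        then have "W m o\<^sub>L W (2 * n + 1) = 0" by (rule orth_zero[OF oW])
        then have "W m (Q (3 * n + 3) x) = 0" unfolding W2 e by (metis blinfun_apply_blinfun_compose zero_blinfun.rep_eq)
        then show ?thesis using False x by simp
      qed
      have W'x: "W' m x = 0" for m
      proof -
        have "W' m o\<^sub>L W (2 * n + 1) = 0" by (rule proj_orth_commute[OF orth_proj[OF oW] orth_proj[OF oW'] WW0])
        then have "W' m (Q (3 * n + 3) x) = 0" unfolding W2 e by (metis blinfun_apply_blinfun_compose zero_blinfun.rep_eq)
        then show ?thesis using x by simp
      qed
      have "(\<lambda>m. \<omega> m * (norm (W m x))\<^sup>2) = (\<lambda>m. if m = 2 * n + 1 then \<omega> (2 * n + 1) * (norm x)\<^sup>2 else 0)"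
        by (auto simp: Wx)
      then have "(\<Sum>m. \<omega> m * (norm (W m x))\<^sup>2) = \<omega> (2 * n + 1) * (norm x)\<^sup>2"
        using sums_unique[OF sums_single[of "2 * n + 1" "\<lambda>_. \<omega> (2 * n + 1) * (norm x)\<^sup>2"]] by simp
      moreover have "(\<Sum>m. o' m * (norm (W' m x))\<^sup>2) = 0" by (simp add: W'x)
      moreover have "\<omega> (2 * n + 1) * (norm x)\<^sup>2 \<le> \<eta> (3 * n + 3) / 2 * (norm x)\<^sup>2"
        unfolding \<omega>2 e by (intro mult_right_mono) auto
      ultimately have 1: "ip (Cr x) x \<le> \<eta> (3 * n + 3) / 2 * (norm x)\<^sup>2"
        using Cr(4)[of x] by linarith
      have "radj w x = 0" using wQ x by (metis blinfun_apply_blinfun_compose zero_blinfun.rep_eq)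
      then have "g w x = 0" by (simp add: g_def blinfun.bilinear_simps ip_simps)
      then have "r x = q x - ip (Cr x) x" by (simp add: rq)
      moreover have "(o' (3 * n + 3) + \<eta> (3 * n + 3)) * (norm x)\<^sup>2 \<le> q x" unfolding q_def by (rule \<eta>(2)[OF x])
      moreover have "o' n * (norm x)\<^sup>2 \<le> o' (3 * n + 3) * (norm x)\<^sup>2"
        by (intro mult_right_mono incseqD[OF o'(1)]) auto
      ultimately show "(o' n + \<eta> (3 * n + 3) / 2) * (norm x)\<^sup>2 \<le> ip ((R - C) x) x"
        using 1 unfolding r_def[symmetric] by (simp add: distrib_right)
    qed
  qed
  \<comment> \<open>A vector orthogonal to the reserve has no component in F, so the lower estimate
    of the rotation applies, and T drops out of Y* because R x stays in its range.\<close>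
  have dec: "(c - \<gamma>) / c * (\<kappa>\<^sup>2 * (norm (radj k (R x)))\<^sup>2) \<le> ip (C x) x" if x: "ssum Q x = 0" for x
  proof -
    have "Q 0 x = Q 0 (ssum Q x)" using orth_ssum(4)[OF Q(1), of 0] by (metis blinfun_apply_blinfun_compose)
    then have Qx: "Q 0 x = 0" using x by (simp add: blinfun.bilinear_simps)
    then have Q1x: "Q1 x = 0" using x by (simp add: sQ blinfun.bilinear_simps)
    have Fx: "F x = 0" using FQ0 Qx by (metis blinfun_apply_blinfun_compose blinfun.zero_right)
    have "T x = x" by (simp add: T_def T'_def blinfun.bilinear_simps Qx Q1x)
    then have "T (R x) = R x" using RT by (metis blinfun_apply_blinfun_compose)
    then have "(norm (radj Y x))\<^sup>2 = \<kappa>\<^sup>2 * (norm (radj k (R x)))\<^sup>2"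
      by (simp add: rY blinfun.bilinear_simps power_mult_distrib)
    then show ?thesis using gw(3)[OF Fx] psd_ge0[OF Cr(2), of x] by (simp add: Cq)
  qed
  show ?thesis using C(1) Cp res' ker dec by blast
qed

end

section \<open>Exhausting an operator\<close>

text \<open>The position of j in an enumeration of J is decoded as a pair, whose first component is
  the label.\<close>

lemma infinitely_often_index:
  fixes J :: "nat set"
  assumes J: "infinite J"
  shows "\<exists>\<tau>::nat \<Rightarrow> nat. \<forall>i. infinite {j \<in> J. \<tau> j = i}"
proof -
  define e where "e = enumerate J"
  have e: "inj e" "e n \<in> J" for n
    using strict_mono_enumerate[OF J] strict_mono_imp_inj_on enumerate_in_set[OF J] by (auto simp: e_def)
  define \<tau> where "\<tau> j = fst (prod_decode (inv_into UNIV e j))" for j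
  have "infinite {j \<in> J. \<tau> j = i}" for i
  proof (rule infinite_super)
    show "range (\<lambda>n. e (prod_encode (i, n))) \<subseteq> {j \<in> J. \<tau> j = i}"
      using e by (auto simp: \<tau>_def)
    show "infinite (range (\<lambda>n. e (prod_encode (i, n))))"
      by (rule range_inj_infinite) (auto simp: inj_def dest: injD[OF e(1)])
  qed
  then show ?thesis by blast
qed

context lfactor begin

text \<open>At each step in J the decrease of the form of the remainder dominates a fixed multiple
  of the squared norm of one component \<open>g i (R x)\<close>, at least for x outside the current
  reserve. The decreases tend to 0 and each i occurs infinitely often.\<close>

theorem sum_of_unitary_copies:
  assumes c: "0 < \<beta>" "\<beta> \<le> \<gamma>" "\<gamma> < c" and o': "incseq o'" "\<And>n. c \<le> o' n" "\<And>n. o' n \<le> kk"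
    and adm: "\<And>j. admissible \<beta> \<gamma> o' (B j) (G j)" and res: "reserve o' A Q"
    and N: "\<And>j. psub (kerp A) (kerp (B j))" and P: "prj P" "P \<noteq> 0" and J: "infinite J"
    and PG: "\<And>j. j \<in> J \<Longrightarrow> psub P (G j)"
  shows "\<exists>C. (\<forall>j. unitarily_equivalent M (C j) (B j)) \<and> sot_sums C A"
proof -
  have A: "psd A" and oQ: "orth Q" using res by (auto simp: reserve_def)
  have pQ: "proj (Q n)" for n by (rule orth_proj[OF oQ])
  define a where "a = norm A + 1"
  have a: "0 < a" by (simp add: a_def add_nonneg_pos)
  \<comment> \<open>The two bounds meet the two conditions of \<open>exhaustion_step\<close>; since
    the remainders stay below A, one \<kappa> serves all steps.\<close>
  define \<kappa> where "\<kappa> = sqrt (min (\<beta> / a\<^sup>2) (1 / (2 * a)))"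
  have \<kappa>2: "\<kappa>\<^sup>2 = min (\<beta> / a\<^sup>2) (1 / (2 * a))" using a c(1) by (simp add: \<kappa>_def)
  have \<kappa>: "0 < \<kappa>\<^sup>2" using a c(1) by (simp add: \<kappa>2)
  have \<kappa>a: "\<kappa>\<^sup>2 * a\<^sup>2 \<le> \<beta>" "\<kappa>\<^sup>2 * a \<le> 1 / 2"
  proof -
    have "\<kappa>\<^sup>2 * a\<^sup>2 \<le> \<beta> / a\<^sup>2 * a\<^sup>2" unfolding \<kappa>2 by (intro mult_right_mono) auto
    then show "\<kappa>\<^sup>2 * a\<^sup>2 \<le> \<beta>" using a by simp
    have "\<kappa>\<^sup>2 * a \<le> 1 / (2 * a) * a" unfolding \<kappa>2 using a by (intro mult_right_mono) auto
    then show "\<kappa>\<^sup>2 * a \<le> 1 / 2" using a by simp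
  qed
  obtain g where g: "orth g" "\<And>i. psub (g i) P" "ssum g = id_blinfun" using exhaustion_by_small[OF P] by blast
  obtain \<tau> :: "nat \<Rightarrow> nat" where \<tau>: "\<And>i. infinite {j \<in> J. \<tau> j = i}" using infinitely_often_index[OF J] by blast
  \<comment> \<open>For j in J the adjoint of k embeds the piece \<open>g (\<tau> j)\<close> through
    P into \<open>G j\<close>, so it measures exactly that component. For other j, k = 0 asks for no
    progress.\<close>
  have "\<exists>k. k \<in> M \<and> k o\<^sub>L G j = k \<and> norm k \<le> 1 \<and> (j \<in> J \<longrightarrow> (\<forall>y. norm (radj k y) = norm (g (\<tau> j) y)))" for j
  proof (cases "j \<in> J")
    case True
    obtain V r where V: "V \<in> M" "pis V (g (\<tau> j)) r" "P o\<^sub>L r = r" using g(2)[of "\<tau> j"] unfolding psub_def by blast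
    obtain v s where v: "v \<in> M" "pis v P s" "G j o\<^sub>L s = s" using PG[OF True] unfolding psub_def by blast
    define k where "k = radj (v o\<^sub>L V)"
    have n: "norm (radj k y) = norm (g (\<tau> j) y)" for y
    proof -
      have "P o\<^sub>L V = V" using pis_left[OF V(2)] V(3) by (metis compose_simps(1))
      then have "norm (v (V y)) = norm (V y)" using pis_norm[OF v(2), of "V y"] by (metis blinfun_apply_blinfun_compose)
      then show ?thesis by (simp add: k_def pis_norm[OF V(2)])
    qed
    have "norm (radj k) \<le> 1"
      by (rule norm_blinfun_bound) (auto simp: n proj_norm_le[OF orth_proj[OF g(1)]])
    moreover have "k o\<^sub>L G j = k"
    proof -
      have "G j o\<^sub>L v = v" using pis_left[OF v(2)] v(3) by (metis compose_simps(1))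
      then have e: "G j o\<^sub>L (v o\<^sub>L V) = v o\<^sub>L V" by (metis compose_simps(1))
      have "radj (G j) = G j" using adm[of j] by (simp add: admissible_def prj_def proj_radj)
      then show ?thesis using arg_cong[OF e, of radj] by (simp add: k_def compose_simps)
    qed
    moreover have "k \<in> M" unfolding k_def by (intro in_M v V)
    ultimately show ?thesis using n by auto
  qed (auto intro!: exI[of _ 0] zero_in)
  then obtain k where k: "\<And>j. k j \<in> M" "\<And>j. k j o\<^sub>L G j = k j" "\<And>j. norm (k j) \<le> 1"
    "\<And>j y. j \<in> J \<Longrightarrow> norm (radj (k j) y) = norm (g (\<tau> j) y)" by metis
  \<comment> \<open>A state is a remainder with the indices of its reserve. The condition
    \<open>t + n \<le> snd Rh n\<close> makes the reserve at time t consist of \<open>Q m\<close>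
    with m \<ge> t.\<close>
  define \<Phi> where "\<Phi> t Rh \<longleftrightarrow> reserve o' (fst Rh) (\<lambda>n. Q (snd Rh n)) \<and> kerp (fst Rh) = kerp A \<and>
      (\<forall>x. ip (fst Rh x) x \<le> ip (A x) x) \<and> (\<forall>n. t + n \<le> snd Rh n) \<and> (t = 0 \<longrightarrow> fst Rh = A)"
    for t :: nat and Rh :: "('a \<Rightarrow>\<^sub>L 'a) \<times> (nat \<Rightarrow> nat)"
  define \<Psi> where "\<Psi> t Rh Rh' \<longleftrightarrow> unitarily_equivalent M (fst Rh - fst Rh') (B t) \<and> psd (fst Rh - fst Rh') \<and>
      (\<forall>x. ssum (\<lambda>n. Q (snd Rh n)) x = 0 \<longrightarrow>
        (c - \<gamma>) / c * (\<kappa>\<^sup>2 * (norm (radj (k t) (fst Rh x)))\<^sup>2) \<le> ip ((fst Rh - fst Rh') x) x)"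
    for t :: nat and Rh Rh' :: "('a \<Rightarrow>\<^sub>L 'a) \<times> (nat \<Rightarrow> nat)"
  have "\<exists>f. \<forall>t. \<Phi> t (f t) \<and> \<Psi> t (f t) (f (Suc t))"
  proof (rule dependent_nat_choice)
    show "\<exists>x. \<Phi> 0 x" using res by (intro exI[of _ "(A, id)"]) (simp add: \<Phi>_def)
  next
    fix Rh t assume \<Phi>: "\<Phi> t Rh"
    define R h where "R = fst Rh" and "h = snd Rh"
    have R: "reserve o' R (\<lambda>n. Q (h n))" "kerp R = kerp A" "\<And>x. ip (R x) x \<le> ip (A x) x" "\<And>n. t + n \<le> h n"
      using \<Phi> by (auto simp: \<Phi>_def R_def h_def)
    have Ra: "norm R \<le> a"
    proof (rule psd_norm_le)
      show "psd R" using R(1) by (simp add: reserve_def)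
      show "ip (R x) x \<le> a * (norm x)\<^sup>2" for x
        using R(3)[of x] ip_apply_le[of A x] mult_right_mono[of "norm A" a "(norm x)\<^sup>2"] by (simp add: a_def)
    qed (use a in simp)
    have "psub (kerp R) (kerp (B t))" using N R(2) by simp
    from exhaustion_step[OF c o' adm R(1) this Ra \<kappa>a k(1,2,3)]
    obtain C where C: "unitarily_equivalent M C (B t)" "psd C" "reserve o' (R - C) (\<lambda>n. Q (h (3 * n + 3)))"
      "kerp (R - C) = kerp R" "\<And>x. ssum (\<lambda>n. Q (h n)) x = 0 \<Longrightarrow>
        (c - \<gamma>) / c * (\<kappa>\<^sup>2 * (norm (radj (k t) (R x)))\<^sup>2) \<le> ip (C x) x" by blast
    have "ip ((R - C) x) x \<le> ip (A x) x" for x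
      using R(3)[of x] psd_ge0[OF C(2), of x] by (simp add: blinfun.bilinear_simps ip_simps)
    moreover have "Suc t + n \<le> h (3 * n + 3)" for n using R(4)[of "3 * n + 3"] by simp
    ultimately have "\<Phi> (Suc t) (R - C, \<lambda>n. h (3 * n + 3))" using C R by (simp add: \<Phi>_def)
    moreover have "\<Psi> t Rh (R - C, \<lambda>n. h (3 * n + 3))" using C by (simp add: \<Psi>_def R_def h_def)
    ultimately show "\<exists>y. \<Phi> (Suc t) y \<and> \<Psi> t Rh y" by blast
  qed
  then obtain f where f: "\<And>t. \<Phi> t (f t)" "\<And>t. \<Psi> t (f t) (f (Suc t))" by blast
  define R where "R t = fst (f t)" for t
  define h where "h t = snd (f t)" for t
  define C where "C t = R t - R (Suc t)" for t
  have R: "reserve o' (R t) (\<lambda>n. Q (h t n))" "\<And>x. ip (R t x) x \<le> ip (A x) x" "\<And>n. t + n \<le> h t n" for t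
    using f(1)[of t] by (auto simp: \<Phi>_def R_def h_def)
  have R0: "R 0 = A" using f(1)[of 0] by (simp add: \<Phi>_def R_def)
  have C: "unitarily_equivalent M (C t) (B t)" "psd (C t)"
    and dec: "\<And>x. ssum (\<lambda>n. Q (h t n)) x = 0 \<Longrightarrow>
        (c - \<gamma>) / c * (\<kappa>\<^sup>2 * (norm (radj (k t) (R t x)))\<^sup>2) \<le> ip (C t x) x" for t
    using f(2)[of t] by (auto simp: \<Psi>_def R_def C_def h_def)
  have Rp: "psd (R t)" and oQh: "orth (\<lambda>n. Q (h t n))" for t using R(1)[of t] by (auto simp: reserve_def)
  \<comment> \<open>The negatives of the remainders increase and are bounded by 0, so the remainders
    converge strongly.\<close>
  have "\<exists>L. radj L = L \<and> (\<forall>x. (\<lambda>t. (- R t) x) \<longlonglongrightarrow> L x)"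
  proof (rule monotone_strong_limit[where K = 0])
    show "psd (- R (Suc n) - - R n)" for n using C(2)[of n] by (simp add: C_def)
    show "ip ((- R n) x) x \<le> 0 * (norm x)\<^sup>2" for n x using psd_ge0[OF Rp, of n x] by (simp add: blinfun.bilinear_simps ip_simps)
  qed (simp_all add: psd_radj[OF Rp])
  then obtain L where L: "\<And>x. (\<lambda>t. (- R t) x) \<longlonglongrightarrow> blinfun_apply L x" by blast
  define R\<^sub>0 where "R\<^sub>0 = - L"
  have lim: "(\<lambda>t. R t x) \<longlonglongrightarrow> R\<^sub>0 x" for x
    using tendsto_minus[OF L[of x]] by (simp add: R\<^sub>0_def blinfun.bilinear_simps)
  \<comment> \<open>Such a vector is outside the reserve from time s on, because the indices of the
    reserve have moved past s.\<close>
  have zero: "R\<^sub>0 x = 0" if x: "\<And>m. m \<ge> s \<Longrightarrow> Q m x = 0" for s x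
  proof -
    define \<delta> where "\<delta> = (c - \<gamma>) / c * \<kappa>\<^sup>2"
    have \<delta>: "0 < \<delta>" using c \<kappa> by (simp add: \<delta>_def)
    have est: "\<delta> * (norm (g (\<tau> t) (R t x)))\<^sup>2 \<le> ip (R t x) x - ip (R (Suc t) x) x" if t: "t \<ge> s" "t \<in> J" for t
    proof -
      have "Q (h t n) x = 0" for n
      proof (rule x)
        have "t + n \<le> h t n" by (rule R(3))
        then show "s \<le> h t n" using t by linarith
      qed
      then have "ssum (\<lambda>n. Q (h t n)) x = 0"
        using sot_sumsD[OF orth_ssum(2)[OF oQh], of t x] sums_unique2[OF sums_zero] by simp
      from dec[OF this] show ?thesis
        by (simp add: k(4)[OF t(2)] \<delta>_def C_def blinfun.bilinear_simps ip_simps mult.assoc)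
    qed
    have "g i (R\<^sub>0 x) = 0" for i
    proof (rule ccontr)
      assume n0: "g i (R\<^sub>0 x) \<noteq> 0"
      define l where "l = (norm (g i (R\<^sub>0 x)))\<^sup>2"
      have l: "0 < l" using n0 by (simp add: l_def)
      have "(\<lambda>t. (norm (g i (R t x)))\<^sup>2) \<longlonglongrightarrow> l"
        unfolding l_def by (intro tendsto_power tendsto_norm tendsto_apply lim)
      then have "eventually (\<lambda>t. l / 2 < (norm (g i (R t x)))\<^sup>2) sequentially"
        by (rule order_tendstoD(1)) (use l in simp)
      moreover have "(\<lambda>t. ip (R t x) x - ip (R (Suc t) x) x) \<longlonglongrightarrow> ip (R\<^sub>0 x) x - ip (R\<^sub>0 x) x"
        by (intro tendsto_diff ip.tendsto lim LIMSEQ_Suc[OF lim] tendsto_const)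
      then have "eventually (\<lambda>t. ip (R t x) x - ip (R (Suc t) x) x < \<delta> * (l / 2)) sequentially"
        by (rule order_tendstoD(2)) (use l \<delta> in simp)
      moreover have "eventually (\<lambda>t. t \<ge> s) sequentially" by (rule eventually_ge_at_top)
      ultimately have "eventually (\<lambda>t. l / 2 < (norm (g i (R t x)))\<^sup>2 \<and>
          ip (R t x) x - ip (R (Suc t) x) x < \<delta> * (l / 2) \<and> t \<ge> s) sequentially"
        by eventually_elim simp
      then obtain t0 where t0: "\<And>t. t \<ge> t0 \<Longrightarrow> l / 2 < (norm (g i (R t x)))\<^sup>2 \<and>
          ip (R t x) x - ip (R (Suc t) x) x < \<delta> * (l / 2) \<and> t \<ge> s"
        by (auto simp: eventually_sequentially)
      obtain t where t: "t \<ge> t0" "t \<in> J" "\<tau> t = i"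
        using \<tau>[of i] unfolding infinite_nat_iff_unbounded_le by blast
      \<comment> \<open>At a late time with label i the decrease would be at least \<delta> l / 2,
        although the decreases tend to 0.\<close>
      have "\<delta> * (l / 2) < \<delta> * (norm (g i (R t x)))\<^sup>2" using t0[OF t(1)] \<delta> by simp
      also have "\<dots> \<le> ip (R t x) x - ip (R (Suc t) x) x" using est[of t] t t0[OF t(1)] by simp
      finally show False using t0[OF t(1)] by linarith
    qed
    then have "(\<lambda>i. g i (R\<^sub>0 x)) sums 0" by simp
    moreover have "(\<lambda>i. g i (R\<^sub>0 x)) sums (R\<^sub>0 x)" using sot_sumsD[OF orth_ssum(2)[OF g(1)], of "R\<^sub>0 x"] g(3) by simp
    ultimately show ?thesis using sums_unique2 by blast
  qed
  have "R\<^sub>0 x = 0" for x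
  proof -
    have ot: "orth (\<lambda>m. Q (m + s))" for s by (rule orth_reindex[OF oQ]) (simp add: inj_def)
    \<comment> \<open>Removing the tail of the original reserve from x gives vectors covered by
      \<open>zero\<close>; the tails tend to 0, and continuity covers all x.\<close>
    define y where "y s = ssum (\<lambda>m. Q (m + s)) x" for s
    have z: "R\<^sub>0 (x - y s) = 0" for s
    proof (rule zero[of s])
      fix m assume "m \<ge> s"
      then have "Q m (y s) = Q m x"
        using orth_ssum(4)[OF ot[of s], of "m - s"] unfolding y_def by (metis blinfun_apply_blinfun_compose le_add_diff_inverse2)
      then show "Q m (x - y s) = 0" by (simp add: blinfun.bilinear_simps)
    qed
    have "y \<longlonglongrightarrow> 0"
    proof -
      have s: "(\<lambda>m. Q m x) sums ssum Q x" by (rule sot_sumsD[OF orth_ssum(2)[OF oQ]])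
      have "y = (\<lambda>s. ssum Q x - (\<Sum>m<s. Q m x))"
        using sums_split_initial_segment[OF s] sot_sumsD[OF orth_ssum(2)[OF ot], where x = x] sums_unique2
        unfolding y_def by (intro ext) blast
      moreover have "(\<lambda>s. ssum Q x - (\<Sum>m<s. Q m x)) \<longlonglongrightarrow> ssum Q x - ssum Q x"
        using s unfolding sums_def by (intro tendsto_diff tendsto_const)
      ultimately show ?thesis by simp
    qed
    then have "(\<lambda>s. R\<^sub>0 (x - y s)) \<longlonglongrightarrow> R\<^sub>0 (x - 0)" by (intro tendsto_apply tendsto_diff tendsto_const)
    then show ?thesis using z LIMSEQ_unique[OF _ tendsto_const] by simp
  qed
  then have R0lim: "(\<lambda>t. R t x) \<longlonglongrightarrow> 0" for x using lim[of x] by simp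
  have "sot_sums C A"
    unfolding sot_sums_def sums_def
  proof
    fix x
    have "(\<Sum>j<n. C j x) = A x - R n x" for n
      by (induction n) (auto simp: C_def R0 blinfun.bilinear_simps)
    moreover have "(\<lambda>n. A x - R n x) \<longlonglongrightarrow> A x - 0" by (intro tendsto_diff tendsto_const R0lim)
    ultimately show "(\<lambda>n. \<Sum>j<n. C j x) \<longlonglongrightarrow> A x" by simp
  qed
  then show ?thesis using C(1) by blast
qed

end

section \<open>The spectral theorem\<close>

lemma borel_induct_atMost [consumes 1, case_names atMost empty compl union]:
  fixes S :: "real set"
  assumes S: "S \<in> sets borel" and "\<And>t. P {..t}" and "P {}"
    and "\<And>A. A \<in> sets borel \<Longrightarrow> P A \<Longrightarrow> P (- A)"
    and "\<And>A. disjoint_family A \<Longrightarrow> range A \<subseteq> sets borel \<Longrightarrow> (\<And>i. P (A i)) \<Longrightarrow> P (\<Union>i::nat. A i)"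
  shows "P S"
proof -
  have b: "sets borel = sigma_sets UNIV (range (\<lambda>a::real. {..a}))" unfolding borel_eq_atMost by simp
  have i: "Int_stable (range (\<lambda>a::real. {..a}))" by (auto simp: Int_stable_def)
  show ?thesis
    by (rule sigma_sets_induct_disjoint[OF i _ S[unfolded b], of P])
      (use assms(2-) in \<open>auto simp: b[symmetric] Compl_eq_Diff_UNIV[symmetric]\<close>)
qed

text \<open>At the vector \<open>Q x\<close> the term of Q already uses up the whole squared
  norm.\<close>

lemma proj_sum_orth:
  assumes P: "proj P" and Q: "proj Q" and le: "\<And>x. ip (P x) x + ip (Q x) x \<le> (norm x)\<^sup>2"
  shows "P o\<^sub>L Q = 0"
proof (rule blinfun_eqI)
  fix x
  have "(norm (P (Q x)))\<^sup>2 + (norm (Q x))\<^sup>2 \<le> (norm (Q x))\<^sup>2"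
    using le[of "Q x"] by (simp add: proj_ip_self P Q proj_apply[OF Q] ip_self)
  then show "(P o\<^sub>L Q) x = blinfun_apply 0 x" by simp
qed

lemma proj_eq_quadratic:
  assumes P: "proj P" "proj Q" "\<And>x. ip (P x) x = ip (Q x) x" shows "P = Q"
proof -
  have "psd (P - Q)" "psd (- (P - Q))"
    using P by (auto simp: psd_def proj_radj blinfun.bilinear_simps ip_simps)
  then show ?thesis using psd_antisym by fastforce
qed

text \<open>The conditions of \<open>spectral_measure_of\<close> that concern the projections alone,
  without the operator, complex linearity or bounded support.\<close>

locale pvm =
  fixes E :: "real set \<Rightarrow> ('a::complex_hilbert_space \<Rightarrow>\<^sub>L 'a)"
  assumes E_proj: "S \<in> sets borel \<Longrightarrow> proj (E S)"
    and E_UNIV: "E UNIV = id_blinfun"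
    and E_sums: "range X \<subseteq> sets borel \<Longrightarrow> disjoint_family X \<Longrightarrow> (\<lambda>n::nat. E (X n) x) sums E (\<Union>n. X n) x"
begin

lemma E_empty: "E {} = 0"
proof (rule blinfun_eqI)
  fix x
  have "(\<lambda>n::nat. E {} x) sums E (\<Union>n::nat. {}) x" by (rule E_sums) (auto simp: disjoint_family_on_def)
  then have "(\<lambda>n::nat. E {} x) \<longlonglongrightarrow> 0" by (intro summable_LIMSEQ_zero sums_summable)
  then show "E {} x = blinfun_apply 0 x" by (simp add: LIMSEQ_const_iff)
qed

lemma E_union:
  assumes "X \<in> sets borel" "Y \<in> sets borel" "X \<inter> Y = {}" shows "E (X \<union> Y) = E X + E Y"
proof (rule blinfun_eqI)
  fix x
  define S where "S n = (if n = 0 then X else if n = 1 then Y else {})" for n :: nat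
  have "(\<Union>n. S n) = X \<union> Y" by (auto simp: S_def split: if_splits)
  moreover have "(\<lambda>n. E (S n) x) sums E (\<Union>n. S n) x"
    by (rule E_sums) (use assms in \<open>auto simp: S_def disjoint_family_on_def\<close>)
  moreover have "(\<lambda>n. E (S n) x) sums (\<Sum>n\<in>{0, 1}. E (S n) x)"
    by (rule sums_finite) (auto simp: S_def E_empty)
  ultimately show "E (X \<union> Y) x = (E X + E Y) x"
    using sums_unique2 by (fastforce simp: S_def blinfun.bilinear_simps)
qed

lemma E_orth: "X \<in> sets borel \<Longrightarrow> Y \<in> sets borel \<Longrightarrow> X \<inter> Y = {} \<Longrightarrow> E X o\<^sub>L E Y = 0"
proof (rule proj_sum_orth)
  fix x assume a: "X \<in> sets borel" "Y \<in> sets borel" "X \<inter> Y = {}"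
  have "ip (E X x) x + ip (E Y x) x = ip (E (X \<union> Y) x) x"
    by (simp add: E_union[OF a] blinfun.bilinear_simps ip_simps)
  also have "\<dots> = (norm (E (X \<union> Y) x))\<^sup>2" using a by (intro proj_ip_self E_proj) auto
  also have "\<dots> \<le> (norm x)\<^sup>2" using a by (intro power_mono proj_norm_le E_proj) auto
  finally show "ip (E X x) x + ip (E Y x) x \<le> (norm x)\<^sup>2" .
qed (auto intro: E_proj)

lemma E_Int:
  assumes "X \<in> sets borel" "Y \<in> sets borel" shows "E X o\<^sub>L E Y = E (X \<inter> Y)"
proof -
  have X: "E X = E (X \<inter> Y) + E (X - Y)"
    using E_union[of "X \<inter> Y" "X - Y"] assms by (simp add: Int_Diff_Un Int_Diff_disjoint)
  have Y: "E Y = E (X \<inter> Y) + E (Y - X)"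
    using E_union[of "X \<inter> Y" "Y - X"] assms by (simp add: Int_commute[of X] Int_Diff_Un Int_Diff_disjoint)
  have 1: "E (X \<inter> Y) o\<^sub>L E (Y - X) = 0" by (rule E_orth) (use assms in auto)
  have 2: "E (X - Y) o\<^sub>L E Y = 0" by (rule E_orth) (use assms in auto)
  have "E X o\<^sub>L E Y = E (X \<inter> Y) o\<^sub>L E Y" by (subst X) (simp add: compose_simps 2)
  also have "\<dots> = E (X \<inter> Y)" by (subst Y) (use assms in \<open>simp add: compose_simps 1 proj_idem E_proj\<close>)
  finally show ?thesis .
qed

lemma E_Compl: "X \<in> sets borel \<Longrightarrow> E (- X) = id_blinfun - E X"
  using E_union[of X "- X"] E_UNIV by (simp add: Compl_partition eq_diff_eq add.commute)

lemma E_diff: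
  assumes "X \<in> sets borel" "Y \<in> sets borel" "X \<subseteq> Y" shows "E (Y - X) = E Y - E X"
  using E_union[of X "Y - X"] assms by (simp add: Un_absorb1 Un_Diff_cancel)

definition \<mu> :: "'a \<Rightarrow> real measure" where
  "\<mu> x = spectral_scalar_measure E x"

lemma sets_\<mu> [simp, measurable_cong]: "sets (\<mu> x) = sets borel" and space_\<mu> [simp]: "space (\<mu> x) = UNIV"
  by (simp_all add: \<mu>_def spectral_scalar_measure_def sets.sigma_sets_eq[of borel, simplified])

lemma emeasure_\<mu>: "S \<in> sets borel \<Longrightarrow> emeasure (\<mu> x) S = ennreal ((norm (E S x))\<^sup>2)"
proof -
  assume S: "S \<in> sets borel"
  have q: "Re (cinner (E S x) x) = (norm (E S x))\<^sup>2" if "S \<in> sets borel" for S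
    using proj_ip_self[OF E_proj[OF that], of x] by (simp add: ip_def)
  have "emeasure (\<mu> x) S = ennreal (Re (cinner (E S x) x))"
  proof (rule emeasure_measure_of[OF \<mu>_def[unfolded spectral_scalar_measure_def]])
    show "positive (sets (\<mu> x)) (\<lambda>S. ennreal (Re (cinner (E S x) x)))"
      using q[of "{}"] by (simp add: positive_def E_empty)
    show "countably_additive (sets (\<mu> x)) (\<lambda>S. ennreal (Re (cinner (E S x) x)))"
    proof (rule countably_additiveI)
      fix A :: "nat \<Rightarrow> real set" assume A: "range A \<subseteq> sets (\<mu> x)" "disjoint_family A" "\<Union> (range A) \<in> sets (\<mu> x)"
      have "(\<lambda>n. ip (E (A n) x) x) sums ip (E (\<Union>n. A n) x) x"
        by (intro bounded_linear.sums[OF ip.bounded_linear_left] E_sums) (use A in auto)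
      moreover have "0 \<le> ip (E (A n) x) x" for n using A by (subst proj_ip_self) (auto intro: E_proj)
      ultimately show "(\<Sum>i. ennreal (Re (cinner (E (A i) x) x))) = ennreal (Re (cinner (E (\<Union> (range A)) x) x))"
        unfolding ip_def by (rule suminf_ennreal_eq[rotated])
    qed
  qed (use S in auto)
  then show ?thesis using q[OF S] by simp
qed

lemma finite_\<mu>: "finite_measure (\<mu> x)"
  by (rule finite_measureI) (simp add: emeasure_\<mu>)

lemma measure_\<mu>: "S \<in> sets borel \<Longrightarrow> measure (\<mu> x) S = (norm (E S x))\<^sup>2"
  by (simp add: measure_def emeasure_\<mu>)

lemma AE_\<mu>:
  assumes "S \<in> sets borel" "E S x = x" shows "AE t in \<mu> x. t \<in> S"
proof (rule AE_I')
  have "E (- S) x = 0" using assms by (simp add: E_Compl blinfun.bilinear_simps)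
  then show "- S \<in> null_sets (\<mu> x)" using assms(1) by (simp add: null_sets_def emeasure_\<mu>)
qed auto

text \<open>Multiplicativity of E turns the projection of a vector into the restriction of its
  scalar measure.\<close>

lemma \<mu>_restrict:
  assumes A: "A \<in> sets borel" shows "\<mu> (E A x) = density (\<mu> x) (indicator A)"
proof (rule measure_eqI)
  fix S assume "S \<in> sets (\<mu> (E A x))"
  then have S: "S \<in> sets borel" by simp
  have "E S (E A x) = E (A \<inter> S) x" using E_Int[OF S A] by (metis blinfun_apply_blinfun_compose Int_commute)
  then show "emeasure (\<mu> (E A x)) S = emeasure (density (\<mu> x) (indicator A)) S"
    using A S by (simp add: emeasure_restricted emeasure_\<mu>)
qed simp

lemma integral_\<mu>_restrict:
  assumes A: "A \<in> sets borel" shows "(\<integral>t. t \<partial>\<mu> (E A x)) = (\<integral>t. indicator A t * t \<partial>\<mu> x)"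
proof -
  have "(\<integral>t. t \<partial>\<mu> (E A x)) = integral\<^sup>L (density (\<mu> x) (\<lambda>t. ennreal (indicator A t))) (\<lambda>t. t)"
    unfolding \<mu>_restrict[OF A] by (simp add: ennreal_indicator)
  also have "\<dots> = (\<integral>t. indicator A t *\<^sub>R t \<partial>\<mu> x)"
    using A by (intro integral_density) auto
  finally show ?thesis by simp
qed

lemma integrable_bounded:
  fixes f :: "real \<Rightarrow> real"
  assumes "f \<in> borel_measurable borel" "\<And>t. \<bar>f t\<bar> \<le> k" shows "integrable (\<mu> x) f"
  by (rule finite_measure.integrable_const_bound[OF finite_\<mu>, of _ k]) (use assms in auto)

lemma integrable_interval: "integrable (\<mu> x) (\<lambda>t. indicator {a<..b} t * t)"
  by (rule integrable_bounded[of _ "max \<bar>a\<bar> \<bar>b\<bar>"]) (auto simp: indicator_def)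

lemma integrable_indicator_\<mu>: "S \<in> sets borel \<Longrightarrow> integrable (\<mu> x) (indicator S :: real \<Rightarrow> real)"
  by (rule integrable_bounded[of _ 1]) (auto simp: indicator_def)

lemma integral_interval_bounds:
  "a * (norm (E {a<..b} x))\<^sup>2 \<le> (\<integral>t. indicator {a<..b} t * t \<partial>\<mu> x)"
  "(\<integral>t. indicator {a<..b} t * t \<partial>\<mu> x) \<le> b * (norm (E {a<..b} x))\<^sup>2"
proof -
  have i: "(\<integral>t. c * indicator {a<..b} t \<partial>\<mu> x) = c * (norm (E {a<..b} x))\<^sup>2" for c :: real
    by (simp add: measure_\<mu>)
  have I: "integrable (\<mu> x) (\<lambda>t. c * indicator {a<..b} t)" for c :: real
    by (rule integrable_mult_right) (simp add: integrable_indicator_\<mu>)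
  show "a * (norm (E {a<..b} x))\<^sup>2 \<le> (\<integral>t. indicator {a<..b} t * t \<partial>\<mu> x)"
    unfolding i[symmetric] by (intro integral_mono I integrable_interval) (auto simp: indicator_def)
  show "(\<integral>t. indicator {a<..b} t * t \<partial>\<mu> x) \<le> b * (norm (E {a<..b} x))\<^sup>2"
    unfolding i[symmetric] by (intro integral_mono I integrable_interval) (auto simp: indicator_def)
qed

text \<open>Both sides are additive under splitting an interval and agree up to its length times the mass
  of \<open>x\<close> on it; bisection removes the error.\<close>

lemma quadratic_form_eq_integral:
  assumes r: "E {-r..r} = id_blinfun" and comm: "\<And>t. T o\<^sub>L E {..t} = E {..t} o\<^sub>L T"
    and le: "\<And>t x. E {..t} x = x \<Longrightarrow> ip (T x) x \<le> t * (norm x)\<^sup>2"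
    and ge: "\<And>t x. E {..t} x = 0 \<Longrightarrow> t * (norm x)\<^sup>2 \<le> ip (T x) x"
  shows "ip (T x) x = (\<integral>t. t \<partial>\<mu> x)"
proof -
  define I where "I a b = (\<integral>t. indicator {a<..b} t * t \<partial>\<mu> x)" for a b
  define Q where "Q a b = ip (T (E {a<..b} x)) (E {a<..b} x)" for a b
  define m where "m a b = (norm (E {a<..b} x))\<^sup>2" for a b
  have Iab: "E {a<..b} = E {..b} - E {..a}" if "a \<le> b" for a b
  proof -
    have "{a<..b} = {..b} - {..a}" by auto
    then show ?thesis using E_diff[of "{..a}" "{..b}"] that by auto
  qed
  have TE: "T o\<^sub>L E {a<..b} = E {a<..b} o\<^sub>L T" if "a \<le> b" for a b
    by (simp add: Iab[OF that] compose_simps comm)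
  have base: "\<bar>I a b - Q a b\<bar> \<le> (b - a) * m a b" if "a \<le> b" for a b
  proof -
    define y where "y = E {a<..b} x"
    have Ey: "E S y = E (S \<inter> {a<..b}) x" if "S \<in> sets borel" for S
      using E_Int[of S "{a<..b}"] that unfolding y_def by (metis blinfun_apply_blinfun_compose greaterThanAtMost_borel)
    have "{..b} \<inter> {a<..b} = {a<..b}" "{..a} \<inter> {a<..b} = {}" by auto
    then have "E {..b} y = y" "E {..a} y = 0" using Ey[of "{..b}"] Ey[of "{..a}"] by (simp_all add: y_def E_empty)
    then have "a * m a b \<le> Q a b" "Q a b \<le> b * m a b" using le ge by (auto simp: Q_def m_def y_def)
    then show ?thesis using integral_interval_bounds(1)[where a = a and b = b and x = x] integral_interval_bounds(2)[where a = a and b = b and x = x] unfolding I_def m_def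
      by (simp add: left_diff_distrib abs_le_iff)
  qed
  have split: "I a b = I a d + I d b" "Q a b = Q a d + Q d b" "m a b = m a d + m d b"
    if "a \<le> d" "d \<le> b" for a d b
  proof -
    have i: "{a<..b} = {a<..d} \<union> {d<..b}" "{a<..d} \<inter> {d<..b} = {}" using that by auto
    have "indicator {a<..b} t * t = indicator {a<..d} t * t + indicator {d<..b} t * t" for t :: real
      using that by (auto simp: indicator_def)
    then show "I a b = I a d + I d b" unfolding I_def by (simp add: Bochner_Integration.integral_add[OF integrable_interval integrable_interval])
    have Eab: "E {a<..b} = E {a<..d} + E {d<..b}" unfolding i(1) by (rule E_union) (use i(2) in auto)
    have pd: "proj (E {a<..d})" by (rule E_proj) simp
    have z1: "E {a<..d} (E {d<..b} y) = 0" for y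
      using E_orth[of "{a<..d}" "{d<..b}"] i(2) by (metis blinfun_apply_blinfun_compose greaterThanAtMost_borel zero_blinfun.rep_eq)
    have pe: "E {a<..d} (E {a<..b} x) = E {a<..d} x" "E {a<..b} x - E {a<..d} x = E {d<..b} x"
      using z1 by (simp_all add: Eab blinfun.bilinear_simps proj_apply[OF pd])
    show "Q a b = Q a d + Q d b"
      using quadratic_split[OF pd TE[OF that(1)], of "E {a<..b} x"] by (simp add: Q_def pe)
    show "m a b = m a d + m d b"
      using proj_norm_sq[OF pd, of "E {a<..b} x"] by (simp add: m_def pe)
  qed
  have bis: "\<bar>I a b - Q a b\<bar> \<le> (b - a) / 2 ^ n * m a b" if "a \<le> b" for a b n
    using that
  proof (induction n arbitrary: a b)
    case 0 then show ?case using base by simp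
  next
    case (Suc n)
    define d where "d = (a + b) / 2"
    have d: "a \<le> d" "d \<le> b" "d - a = (b - a) / 2" "b - d = (b - a) / 2" using Suc.prems by (auto simp: d_def field_simps)
    have "\<bar>I a b - Q a b\<bar> \<le> \<bar>I a d - Q a d\<bar> + \<bar>I d b - Q d b\<bar>" using split[OF d(1,2)] by linarith
    also have "\<dots> \<le> (b - a) / 2 / 2 ^ n * m a d + (b - a) / 2 / 2 ^ n * m d b"
      using Suc.IH[OF d(1)] Suc.IH[OF d(2)] unfolding d(3,4) by linarith
    also have "\<dots> = (b - a) / 2 ^ Suc n * m a b" by (simp add: split(3)[OF d(1,2)] field_simps)
    finally show ?case .
  qed
  \<comment> \<open>The half-open interval must contain the closed one that supports E.\<close>
  define R where "R = \<bar>r\<bar> + 1"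
  have R: "- R \<le> R" "{-r..r} \<subseteq> {-R<..R}" by (auto simp: R_def)
  have EI: "E {-R<..R} = id_blinfun"
  proof -
    have "E {-R<..R} o\<^sub>L E {-r..r} = E {-r..r}" using E_Int[of "{-R<..R}" "{-r..r}"] R(2) by (simp add: Int_absorb1)
    then show ?thesis by (simp add: r compose_simps)
  qed
  have eq: "I (-R) R = Q (-R) R"
  proof -
    have "(\<lambda>n. (R - - R) / 2 ^ n * m (-R) R) \<longlonglongrightarrow> 0 * m (-R) R"
      by (intro tendsto_mult tendsto_const LIMSEQ_divide_realpow_zero) auto
    then have "\<bar>I (-R) R - Q (-R) R\<bar> \<le> 0 * m (-R) R"
      by (rule LIMSEQ_le_const) (use bis[OF R(1)] in blast)
    then show ?thesis by simp
  qed
  have "I (-R) R = (\<integral>t. t \<partial>\<mu> x)" unfolding I_def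
  proof (rule integral_cong_AE)
    have "AE t in \<mu> x. t \<in> {-R<..R}" by (rule AE_\<mu>) (simp_all add: EI)
    then show "AE t in \<mu> x. indicator {-R<..R} t * t = t" by eventually_elim simp
  qed auto
  then show ?thesis using eq by (simp add: Q_def EI)
qed

end

text \<open>For fixed x the form of \<open>sres T t\<close> is a distribution function in t and
  defines a Stieltjes measure of total mass \<open>(norm x)\<^sup>2\<close>. Induction over Borel
  sets shows that its value at S is the form of one projection for all x simultaneously.\<close>

lemma spectral_measure_exists_real:
  fixes T :: "'a::complex_hilbert_space \<Rightarrow>\<^sub>L 'a"
  assumes T: "radj T = T"
  shows "\<exists>E. pvm E \<and> (\<forall>t. E {..t} = sres T t) \<and> (\<forall>S\<in>sets borel. bicom T (E S))"
proof -
  define F where "F x t = ip (sres T t x) x" for x t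
  have Fn: "F x t = (norm (sres T t x))\<^sup>2" for x t unfolding F_def by (rule proj_ip_self[OF sres(1)[OF T]])
  have mono: "F x s \<le> F x t" if "s \<le> t" for x s t
  proof -
    have "sres T s x = sres T s (sres T t x)" using sres_mono'[OF T that] by (metis blinfun_apply_blinfun_compose)
    then show ?thesis unfolding Fn by (metis power_mono norm_ge_zero proj_norm_le[OF sres(1)[OF T]])
  qed
  have cont: "continuous (at_right a) (F x)" for a x
    unfolding continuous_within
  proof (rule tendsto_at_right_sequentially[of a "a + 1"])
    fix S assume S: "\<And>n. a < S n" "\<And>n. S n < a + 1" "decseq S" "S \<longlonglongrightarrow> a"
    show "(\<lambda>n. F x (S n)) \<longlonglongrightarrow> F x a" unfolding F_def
      by (intro ip.tendsto tendsto_const sres_right_continuous[OF T S(1,3,4)])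
  qed simp
  have lo: "sres T t = 0" if "t < - norm T" for t
  proof (rule sres_eq_0[OF T])
    fix x :: 'a assume "x \<noteq> 0"
    then have "t * (norm x)\<^sup>2 < - norm T * (norm x)\<^sup>2" using that by (intro mult_strict_right_mono) auto
    then show "t * (norm x)\<^sup>2 < ip (T x) x" using ip_apply_le[of T x] by linarith
  qed
  have hi: "sres T t = id_blinfun" if "norm T \<le> t" for t
  proof (rule sres_eq_id[OF T])
    fix x :: 'a
    show "ip (T x) x \<le> t * (norm x)\<^sup>2" using ip_apply_le[of T x] mult_right_mono[OF that, of "(norm x)\<^sup>2"] by simp
  qed
  have bot: "(F x \<longlongrightarrow> 0) at_bot" for x
  proof (rule tendsto_eventually)
    show "\<forall>\<^sub>F t in at_bot. F x t = 0"
      unfolding eventually_at_bot_linorder by (rule exI[of _ "- norm T - 1"]) (simp add: Fn lo)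
  qed
  have top: "(F x \<longlongrightarrow> (norm x)\<^sup>2) at_top" for x
  proof (rule tendsto_eventually)
    show "\<forall>\<^sub>F t in at_top. F x t = (norm x)\<^sup>2"
      unfolding eventually_at_top_linorder by (rule exI[of _ "norm T"]) (simp add: Fn hi)
  qed
  define \<nu> where "\<nu> x = interval_measure (F x)" for x
  have fin: "finite_measure (\<nu> x)" and sets\<nu>: "sets (\<nu> x) = sets borel" for x
    using finite_borel_measure_interval_measure[OF mono cont bot top, of x]
    by (auto simp: \<nu>_def finite_borel_measure_def finite_borel_measure_axioms_def)
  have space\<nu>: "space (\<nu> x) = UNIV" for x using sets_eq_imp_space_eq[OF sets\<nu>] by simp
  have \<nu>UNIV: "measure (\<nu> x) UNIV = (norm x)\<^sup>2" for x
    using interval_measure_UNIV[OF mono cont bot top, of x] by (simp add: \<nu>_def measure_def)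
  have \<nu>at: "measure (\<nu> x) {..t} = F x t" for x t
    unfolding \<nu>_def by (rule measure_interval_measure_Iic[OF mono cont bot])
  have \<nu>le: "measure (\<nu> x) S \<le> (norm x)\<^sup>2" for x S
    using finite_measure.bounded_measure[OF fin, of x S] by (simp add: space\<nu> \<nu>UNIV)
  define good where "good S P \<longleftrightarrow> proj P \<and> bicom T P \<and> (\<forall>x. ip (P x) x = measure (\<nu> x) S)" for S P
  have ex: "\<exists>P. good S P" if "S \<in> sets borel" for S
  proof -
    from that show ?thesis
    proof (induction rule: borel_induct_atMost)
      case (atMost t)
      have "good {..t} (sres T t)" using sres[OF T] \<nu>at by (simp add: good_def F_def)
      then show ?case by blast
    next
      case empty
      have "good {} 0" by (simp add: good_def bicom_0 ip_simps)
      then show ?case by blast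
    next
      case (compl A)
      then obtain P where P: "good A P" by blast
      have A: "A \<in> sets (\<nu> x)" for x using compl(1) by (simp add: sets\<nu>)
      have "good (- A) (id_blinfun - P)"
        using P finite_measure.finite_measure_compl[OF fin A]
        by (auto simp: Compl_eq_Diff_UNIV good_def bicom_id space\<nu> \<nu>UNIV blinfun.bilinear_simps ip_simps ip_self intro!: proj_compl bicom_diff)
      then show ?case by blast
    next
      case (union A)
      then obtain P where P: "\<And>i. good (A i) (P i)" by metis
      have A: "range A \<subseteq> sets (\<nu> x)" for x using union(2) by (simp add: sets\<nu>)
      \<comment> \<open>Disjoint sets have total measure at most \<open>(norm x)\<^sup>2\<close>,
        and this inequality between forms already forces orthogonality.\<close>
      have "P i o\<^sub>L P j = 0" if "i \<noteq> j" for i j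
      proof (rule proj_sum_orth)
        fix x
        have "A i \<inter> A j = {}" using union(1) that by (auto simp: disjoint_family_on_def)
        then have "measure (\<nu> x) (A i \<union> A j) = measure (\<nu> x) (A i) + measure (\<nu> x) (A j)"
          using A[of x] by (intro finite_measure.finite_measure_Union[OF fin]) auto
        then show "ip (P i x) x + ip (P j x) x \<le> (norm x)\<^sup>2"
          using P \<nu>le[of x "A i \<union> A j"] by (simp add: good_def)
      qed (use P good_def in blast)+
      then have oP: "orth P" unfolding orth_def using P good_def by blast
      have "ip (ssum P x) x = measure (\<nu> x) (\<Union>i. A i)" for x
      proof -
        have "(\<lambda>i. ip (P i x) x) sums ip (ssum P x) x"
          by (intro bounded_linear.sums[OF ip.bounded_linear_left] sot_sumsD orth_ssum oP)
        moreover have "(\<lambda>i. measure (\<nu> x) (A i)) sums measure (\<nu> x) (\<Union>i. A i)"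
          by (rule finite_measure.finite_measure_UNION[OF fin A union(1)])
        ultimately show ?thesis using P sums_unique2 by (simp add: good_def)
      qed
      moreover have "bicom T (ssum P)"
      proof (rule bicomI)
        fix X assume X: "X o\<^sub>L T = T o\<^sub>L X"
        show "X o\<^sub>L ssum P = ssum P o\<^sub>L X" by (rule ssum_commute[OF oP]) (use P X in \<open>auto simp: good_def bicom_def\<close>)
      qed
      ultimately have "good (\<Union>i. A i) (ssum P)" using orth_ssum(1)[OF oP] by (simp add: good_def)
      then show ?case by blast
    qed
  qed
  define E where "E S = (SOME P. good S P)" for S
  have E: "good S (E S)" if "S \<in> sets borel" for S unfolding E_def by (rule someI_ex[OF ex[OF that]])
  have eqI: "P = P'" if "good S P" "good S P'" for S P P'
    by (rule proj_eq_quadratic) (use that in \<open>auto simp: good_def\<close>)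
  have "pvm E"
  proof
    show "proj (E S)" if "S \<in> sets borel" for S using E[OF that] by (simp add: good_def)
    have "good UNIV id_blinfun" by (simp add: good_def bicom_id \<nu>UNIV ip_self)
    then show "E UNIV = id_blinfun" using eqI E[of UNIV] by simp
    fix S :: "nat \<Rightarrow> real set" and x assume S: "range S \<subseteq> sets borel" "disjoint_family S"
    have Sb: "S i \<in> sets borel" for i using S by blast
    have SA: "range S \<subseteq> sets (\<nu> x)" for x using S by (simp add: sets\<nu>)
    have "E (S i) o\<^sub>L E (S j) = 0" if "i \<noteq> j" for i j
    proof (rule proj_sum_orth)
      fix x
      have "S i \<inter> S j = {}" using S(2) that by (auto simp: disjoint_family_on_def)
      then have "measure (\<nu> x) (S i \<union> S j) = measure (\<nu> x) (S i) + measure (\<nu> x) (S j)"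
        using SA[of x] by (intro finite_measure.finite_measure_Union[OF fin]) auto
      then show "ip (E (S i) x) x + ip (E (S j) x) x \<le> (norm x)\<^sup>2"
        using E[OF Sb] \<nu>le[of x "S i \<union> S j"] by (simp add: good_def)
    qed (use E[OF Sb] good_def in blast)+
    then have oE: "orth (\<lambda>i. E (S i))" unfolding orth_def using E[OF Sb] good_def by blast
    have "E (\<Union>i. S i) = ssum (\<lambda>i. E (S i))"
    proof (rule proj_eq_quadratic)
      have Us: "(\<Union>i. S i) \<in> sets borel" using Sb by blast
      show "proj (E (\<Union>i. S i))" using E[OF Us] by (simp add: good_def)
      show "proj (ssum (\<lambda>i. E (S i)))" by (rule orth_ssum[OF oE])
      fix x
      have "(\<lambda>i. ip (E (S i) x) x) sums ip (ssum (\<lambda>i. E (S i)) x) x"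
        by (intro bounded_linear.sums[OF ip.bounded_linear_left] sot_sumsD orth_ssum oE)
      moreover have "(\<lambda>i. measure (\<nu> x) (S i)) sums measure (\<nu> x) (\<Union>i. S i)"
        by (rule finite_measure.finite_measure_UNION[OF fin SA S(2)])
      ultimately show "ip (E (\<Union>i. S i) x) x = ip (ssum (\<lambda>i. E (S i)) x) x"
        using E[OF Sb] E[OF Us] sums_unique2 by (fastforce simp: good_def)
    qed
    then show "(\<lambda>n. E (S n) x) sums E (\<Union>n. S n) x" using sot_sumsD[OF orth_ssum(2)[OF oE], of x] by simp
  qed
  moreover have "E {..t} = sres T t" for t
  proof (rule eqI[OF E])
    show "good {..t} (sres T t)" using sres[OF T] \<nu>at by (simp add: good_def F_def)
  qed simp
  moreover have "bicom T (E S)" if "S \<in> sets borel" for S using E[OF that] by (simp add: good_def)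
  ultimately show ?thesis by blast
qed

lemma spectral_measure_exists:
  assumes cl: "complex_linear T" and T: "radj T = T"
  shows "\<exists>E. spectral_measure_of T E \<and> pvm E \<and> (\<forall>t. E {..t} = sres T t)"
proof -
  obtain E where E: "pvm E" "\<And>t. E {..t} = sres T t" "\<And>S. S \<in> sets borel \<Longrightarrow> bicom T (E S)"
    using spectral_measure_exists_real[OF T] by blast
  interpret pvm E by (rule E(1))
  define r where "r = norm T + 1"
  have s1: "sres T r = id_blinfun"
  proof (rule sres_eq_id[OF T])
    show "ip (T x) x \<le> r * (norm x)\<^sup>2" for x
      using ip_apply_le[of T x] mult_right_mono[of "norm T" r "(norm x)\<^sup>2"] by (simp add: r_def)
  qed
  have s0: "sres T (- r) = 0"
  proof (rule sres_eq_0[OF T])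
    show "- r * (norm x)\<^sup>2 < ip (T x) x" if "x \<noteq> 0" for x
    proof -
      have "- r * (norm x)\<^sup>2 < - norm T * (norm x)\<^sup>2" using that by (intro mult_strict_right_mono) (auto simp: r_def)
      then show ?thesis using ip_apply_le[of T x] by linarith
    qed
  qed
  have r0: "0 \<le> r" by (simp add: r_def add_nonneg_nonneg)
  have "{-r<..r} = {..r} - {..-r}" by auto
  then have e1: "E {-r<..r} = id_blinfun" using E_diff[of "{..-r}" "{..r}"] r0 E(2) s0 s1 by auto
  have "E {-r..r} o\<^sub>L E {-r<..r} = E {-r<..r}" using E_Int[of "{-r..r}" "{-r<..r}"] by (simp add: Int_absorb1 greaterThanAtMost_subseteq_atLeastAtMost_iff)
  then have er: "E {-r..r} = id_blinfun" by (simp add: e1 compose_simps)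
  have q: "ip (T x) x = (\<integral>t. t \<partial>\<mu> x)" for x
  proof (rule quadratic_form_eq_integral[OF er])
    show "T o\<^sub>L E {..t} = E {..t} o\<^sub>L T" for t unfolding E(2) by (rule bicom_commute[OF sres(2)[OF T]])
    show "ip (T x) x \<le> t * (norm x)\<^sup>2" if "E {..t} x = x" for t x using that sres(3)[OF T] by (simp add: E(2))
    show "t * (norm x)\<^sup>2 \<le> ip (T x) x" if "E {..t} x = 0" for t x using that sres_ge[OF T] by (simp add: E(2))
  qed
  \<comment> \<open>The definition asks for the complex inner product; its imaginary part vanishes
    for a complex-linear self-adjoint operator.\<close>
  have im: "Im (cinner (T x) x) = 0" for x
  proof -
    have "ip (T x) (\<i> *\<^sub>C x) = ip x (\<i> *\<^sub>C T x)" using cl sa_ip[OF T, of x "\<i> *\<^sub>C x"] by (simp add: complex_linear_def)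
    also have "\<dots> = ip (cnj \<i> *\<^sub>C x) (T x)" by (rule ip_scaleC)
    also have "cnj \<i> *\<^sub>C x = - (\<i> *\<^sub>C x)" using scaleC_scaleC[of "-1" \<i> x] scaleC_of_real[of "-1" "\<i> *\<^sub>C x"] by simp
    also have "ip (- (\<i> *\<^sub>C x)) (T x) = - ip (T x) (\<i> *\<^sub>C x)" by (simp add: ip_simps ip_commute)
    finally show ?thesis by (simp add: Im_cinner)
  qed
  have "spectral_measure_of T E"
    unfolding spectral_measure_of_def
  proof (intro conjI ballI allI impI)
    show "projection (E S)" if "S \<in> sets borel" for S
      using E_proj[OF that] bicom_complex_linear[OF E(3)[OF that] cl] by (simp add: projection_iff)
    show "E UNIV = id_blinfun" by (rule E_UNIV)
    show "(\<lambda>n. E (S n) x) sums E (\<Union>n. S n) x" if "range S \<subseteq> sets borel \<and> disjoint_family S" for S x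
      using E_sums that by blast
    show "\<exists>r. E {-r..r} = id_blinfun" using er by blast
    show "cinner (T x) x = complex_of_real (\<integral>t. t \<partial>spectral_scalar_measure E x)" for x
      using q[of x] im[of x] by (simp add: complex_eq_iff ip_def \<mu>_def)
  qed
  then show ?thesis using E by blast
qed

text \<open>The definition links T to E only through the quadratic form, so commutation of T with
  \<open>E {..t}\<close> has to be derived from it. The bounds on the integral then identify the
  projection by \<open>sres_unique\<close>.\<close>

lemma spectral_measure_unique:
  assumes cl: "complex_linear T" and T: "radj T = T" and E: "spectral_measure_of T E"
  shows "pvm E" "E {..t} = sres T t"
proof -
  show "pvm E"
    by unfold_locales (use E in \<open>auto simp: spectral_measure_of_def projection_iff\<close>)
  then interpret pvm E .
  obtain r where r: "E {-r..r} = id_blinfun" using E by (auto simp: spectral_measure_of_def)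
  have q: "ip (T x) x = (\<integral>t. t \<partial>\<mu> x)" for x
    using E by (simp add: spectral_measure_of_def ip_def \<mu>_def)
  have int: "integrable (\<mu> x) (\<lambda>t. t)" for x
  proof (rule finite_measure.integrable_const_bound[OF finite_\<mu>])
    show "AE t in \<mu> x. norm t \<le> r" using AE_\<mu>[of "{-r..r}" x] by (simp add: r abs_le_iff minus_le_iff eventually_conj_iff)
  qed simp
  have mU: "measure (\<mu> x) (space (\<mu> x)) = (norm x)\<^sup>2" for x by (simp add: measure_\<mu> E_UNIV)
  define P where "P = E {..t}"
  have P: "proj P" unfolding P_def by (rule E_proj) simp
  have cP: "E {t<..} = id_blinfun - P"
  proof -
    have "{t<..} = - {..t}" by auto
    then show ?thesis using E_Compl[of "{..t}"] by (simp add: P_def)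
  qed
  \<comment> \<open>Splitting the integral at t shows that the form is additive along P and its
    complement; with self-adjointness the mixed terms vanish, hence P reduces T.\<close>
  have add: "ip (T z) z = ip (T (P z)) (P z) + ip (T (z - P z)) (z - P z)" for z
  proof -
    have c: "z - P z = E {t<..} z" by (simp add: cP blinfun.bilinear_simps)
    have i: "integrable (\<mu> z) (\<lambda>s. indicator A s * s)" if "A \<in> sets borel" for A
      using that integrable_real_mult_indicator[OF _ int, of A z] by (simp add: mult.commute)
    have "ip (T (P z)) (P z) + ip (T (z - P z)) (z - P z) =
        (\<integral>s. indicator {..t} s * s \<partial>\<mu> z) + (\<integral>s. indicator {t<..} s * s \<partial>\<mu> z)"
      unfolding c unfolding P_def q by (simp add: integral_\<mu>_restrict)
    also have "\<dots> = (\<integral>s. indicator {..t} s * s + indicator {t<..} s * s \<partial>\<mu> z)"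
      by (rule Bochner_Integration.integral_add[symmetric]) (intro i; simp)+
    also have "\<dots> = (\<integral>s. s \<partial>\<mu> z)" by (rule Bochner_Integration.integral_cong) (auto simp: indicator_def)
    finally show ?thesis by (simp add: q)
  qed
  have cross: "ip (T (P z)) (y - P y) = 0" for y z
  proof -
    define a where "a = P z"
    define b where "b = y - P y"
    have Pa: "P a = a" "P b = 0" by (simp_all add: a_def b_def proj_apply[OF P] blinfun.bilinear_simps)
    have "ip (T (a + b)) (a + b) = ip (T a) a + ip (T b) b" using add[of "a + b"] by (simp add: Pa blinfun.bilinear_simps)
    then have "ip (T a) b + ip (T b) a = 0" by (simp add: blinfun.bilinear_simps ip_simps)
    moreover have "ip (T b) a = ip (T a) b" by (metis sa_ip[OF T] ip_commute)
    ultimately show ?thesis by (simp add: a_def b_def)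
  qed
  have TP: "T o\<^sub>L P = P o\<^sub>L (T o\<^sub>L P)"
  proof (rule blinfun_eqI)
    fix z
    define y where "y = T (P z)"
    have "ip (y - P y) (y - P y) = ip y (y - P y) - ip (P y) (y - P y)" by (simp add: ip_simps)
    also have "ip y (y - P y) = 0" using cross by (simp add: y_def)
    also have "ip (P y) (y - P y) = 0" by (simp add: proj_ip[OF P] blinfun.bilinear_simps proj_apply[OF P] ip_simps)
    finally have "y = P y" by (simp add: ip_self)
    then show "(T o\<^sub>L P) z = (P o\<^sub>L (T o\<^sub>L P)) z" by (simp add: y_def)
  qed
  have comm: "T o\<^sub>L P = P o\<^sub>L T" by (rule proj_invariant_commute[OF P TP]) (simp add: T TP[symmetric])
  have "sres T t = P"
  proof (rule sres_unique[OF T P comm[symmetric]])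
    fix x assume x: "P x = x"
    have "(\<integral>s. s \<partial>\<mu> x) \<le> (\<integral>s. t \<partial>\<mu> x)"
    proof (rule integral_mono_AE[OF int])
      show "integrable (\<mu> x) (\<lambda>s. t)" by (rule integrable_bounded[of _ "\<bar>t\<bar>"]) auto
      show "AE s in \<mu> x. s \<le> t" using AE_\<mu>[of "{..t}" x] x by (simp add: P_def)
    qed
    then show "ip (T x) x \<le> t * (norm x)\<^sup>2" using mU[of x] by (simp add: q mult.commute)
  next
    fix x assume x: "P x = 0" "x \<noteq> 0"
    have ae: "AE s in \<mu> x. t < s" using AE_\<mu>[of "{t<..}" x] x by (simp add: cP blinfun.bilinear_simps)
    have it: "integrable (\<mu> x) (\<lambda>s. s - t)"
      by (intro Bochner_Integration.integrable_diff int integrable_bounded[of _ "\<bar>t\<bar>"]) auto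
    have "0 \<le> (\<integral>s. s - t \<partial>\<mu> x)" by (rule integral_nonneg_AE) (use ae in \<open>auto elim!: eventually_mono\<close>)
    \<comment> \<open>The integrand is positive almost everywhere and the measure has positive mass,
      which gives the strict inequality.\<close>
    moreover have "(\<integral>s. s - t \<partial>\<mu> x) \<noteq> 0"
    proof
      assume "(\<integral>s. s - t \<partial>\<mu> x) = 0"
      then have "AE s in \<mu> x. s - t = 0"
        using integral_nonneg_eq_0_iff_AE[OF it] eventually_mono[OF ae, of "\<lambda>s. 0 \<le> s - t"] by simp
      with ae have "AE s in \<mu> x. False" by eventually_elim simp
      then have "emeasure (\<mu> x) (space (\<mu> x)) = 0" by (simp add: trivial_limit_def[symmetric] ae_filter_eq_bot_iff)
      then show False using x(2) by (simp add: emeasure_\<mu> E_UNIV)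
    qed
    moreover have "(\<integral>s. s - t \<partial>\<mu> x) = ip (T x) x - t * (norm x)\<^sup>2"
    proof -
      have "(\<integral>s. s - t \<partial>\<mu> x) = (\<integral>s. s \<partial>\<mu> x) - (\<integral>s. t \<partial>\<mu> x)"
        by (intro Bochner_Integration.integral_diff int integrable_bounded[of _ "\<bar>t\<bar>"]) auto
      then show ?thesis using mU[of x] by (simp add: q mult.commute)
    qed
    ultimately show "t * (norm x)\<^sup>2 < ip (T x) x" by linarith
  qed
  then show "E {..t} = sres T t" by (simp add: P_def)
qed

text \<open>Both sides respect complements and disjoint countable unions, so agreement on half-lines
  extends to all Borel sets.\<close>

lemma pvm_determined:
  assumes E: "pvm E" and E': "pvm E'" and eq: "\<And>t. E {..t} = E' {..t}" and S: "S \<in> sets borel"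
  shows "E S = E' S"
proof -
  interpret E: pvm E by (rule E)
  interpret E': pvm E' by (rule E')
  show ?thesis using S
  proof (induction rule: borel_induct_atMost)
    case (atMost t) then show ?case by (rule eq)
  next
    case empty then show ?case by (simp add: E.E_empty E'.E_empty)
  next
    case (compl A)
    then show ?case by (simp add: E.E_Compl E'.E_Compl)
  next
    case (union A)
    show ?case
    proof (rule blinfun_eqI)
      fix x
      have "(\<lambda>n. E (A n) x) sums E (\<Union>n. A n) x" "(\<lambda>n. E' (A n) x) sums E' (\<Union>n. A n) x"
        using E.E_sums[OF union(2,1)] E'.E_sums[OF union(2,1)] by blast+
      then show "E (\<Union>n. A n) x = E' (\<Union>n. A n) x" using union(3) sums_unique2 by simp
    qed
  qed
qed

lemma spectral_projection_pvm:
  assumes cl: "complex_linear T" and T: "radj T = T"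
  shows "\<exists>E. pvm E \<and> (\<forall>t. E {..t} = sres T t) \<and> (\<forall>S\<in>sets borel. spectral_projection S T = E S)"
proof -
  obtain E where E: "spectral_measure_of T E" "pvm E" "\<And>t. E {..t} = sres T t"
    using spectral_measure_exists[OF cl T] by blast
  have "spectral_projection S T = E S" if S: "S \<in> sets borel" for S
    unfolding spectral_projection_def
  proof (rule the_equality)
    show "\<exists>E'. spectral_measure_of T E' \<and> E S = E' S" using E by blast
    fix P assume "\<exists>E'. spectral_measure_of T E' \<and> P = E' S"
    then obtain E' where E': "spectral_measure_of T E'" "P = E' S" by blast
    show "P = E S"
      unfolding E'(2) by (rule pvm_determined[OF spectral_measure_unique(1)[OF cl T E'(1)] E(2) _ S])
        (simp add: spectral_measure_unique(2)[OF cl T E'(1)] E(3))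
  qed
  then show ?thesis using E by blast
qed

lemma spectral_projection_greaterThan:
  assumes "complex_linear T" "radj T = T" shows "spectral_projection {t<..} T = id_blinfun - sres T t"
proof -
  obtain E where E: "pvm E" "\<And>t. E {..t} = sres T t" "\<And>S. S \<in> sets borel \<Longrightarrow> spectral_projection S T = E S"
    using spectral_projection_pvm[OF assms] by blast
  have "{t<..} = - {..t}" by auto
  then show ?thesis using E pvm.E_Compl[OF E(1), of "{..t}"] by simp
qed

lemma spectral_projection_greaterThanAtMost:
  assumes "complex_linear T" "radj T = T" "s \<le> t"
  shows "spectral_projection {s<..t} T = sres T t - sres T s"
proof -
  obtain E where E: "pvm E" "\<And>t. E {..t} = sres T t" "\<And>S. S \<in> sets borel \<Longrightarrow> spectral_projection S T = E S"
    using spectral_projection_pvm[OF assms(1,2)] by blast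
  have "{s<..t} = {..t} - {..s}" by auto
  then show ?thesis using E pvm.E_diff[OF E(1), of "{..s}" "{..t}"] assms(3) by simp
qed

text \<open>Without an atom at a, the projections for \<open>{..<a}\<close> and \<open>{..a}\<close>
  coincide, and the half-lines \<open>{..s n}\<close> increase to \<open>{..<a}\<close>.\<close>

lemma sres_tendsto_below:
  assumes "complex_linear T" "radj T = T" and z: "spectral_projection {a} T = 0"
    and s: "incseq s" "\<And>n. s n < a" "s \<longlonglongrightarrow> a"
  shows "(\<lambda>n. sres T (s n) x) \<longlonglongrightarrow> sres T a x"
proof -
  obtain E where E: "pvm E" "\<And>t. E {..t} = sres T t" "\<And>S. S \<in> sets borel \<Longrightarrow> spectral_projection S T = E S"
    using spectral_projection_pvm[OF assms(1,2)] by blast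
  interpret pvm E by (rule E(1))
  have "{..a} = {..<a} \<union> {a}" by auto
  then have Ea: "E {..<a} = sres T a" using E_union[of "{..<a}" "{a}"] z E(3)[of "{a}"] by (simp add: E(2)[symmetric])
  \<comment> \<open>Disjoint increments of the half-lines, to which countable additivity applies;
    their partial sums telescope.\<close>
  define S where "S n = {..s n} - (\<Union>i<n. {..s i})" for n
  have Sn: "S n = (case n of 0 \<Rightarrow> {..s 0} | Suc m \<Rightarrow> {s m<..s (Suc m)})" for n
  proof (cases n)
    case (Suc m)
    have "(\<Union>i<Suc m. {..s i}) = {..s m}" using s(1) by (auto simp: incseq_def less_Suc_eq_le intro: order_trans)
    then show ?thesis using Suc by (auto simp: S_def)
  qed (simp add: S_def)
  have "disjoint_family S" unfolding S_def[abs_def] using disjoint_family_disjointed[of "\<lambda>n. {..s n}"]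
    by (simp add: disjointed_def[abs_def] atLeast0LessThan)
  moreover have "(\<Union>n. S n) = {..<a}"
  proof -
    have "(\<Union>n. S n) = (\<Union>n. {..s n})" unfolding S_def[abs_def] using UN_disjointed_eq[of "\<lambda>n. {..s n}"]
      by (simp add: disjointed_def[abs_def] atLeast0LessThan)
    also have "\<dots> = {..<a}"
    proof
      show "(\<Union>n. {..s n}) \<subseteq> {..<a}" using s(2) by (auto intro: le_less_trans)
      show "{..<a} \<subseteq> (\<Union>n. {..s n})"
      proof
        fix y assume "y \<in> {..<a}"
        then have "eventually (\<lambda>n. y < s n) sequentially" by (intro order_tendstoD(1)[OF s(3)]) simp
        then obtain n where "y < s n" by (auto simp: eventually_sequentially)
        then show "y \<in> (\<Union>n. {..s n})" by (auto intro: less_imp_le)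
      qed
    qed
    finally show ?thesis .
  qed
  ultimately have su: "(\<lambda>n. E (S n) x) sums sres T a x"
    using E_sums[of S x] Ea by (simp add: S_def[abs_def] image_subset_iff)
  have "(\<Sum>i<Suc n. E (S i) x) = sres T (s n) x" for n
  proof (induction n)
    case (Suc n)
    have "{s n<..s (Suc n)} = {..s (Suc n)} - {..s n}" by auto
    then have "E (S (Suc n)) = sres T (s (Suc n)) - sres T (s n)"
      using E_diff[of "{..s n}" "{..s (Suc n)}"] s(1) by (simp add: Sn E(2) incseq_Suc_iff)
    then show ?case using Suc by (simp add: blinfun.bilinear_simps)
  qed (simp add: Sn E(2))
  then show ?thesis using LIMSEQ_Suc[OF su[unfolded sums_def]] by simp
qed

section \<open>The ideal generated by the finite projections\<close>

context vN
begin

lemma operator_ring_simps [simp]: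
  "carrier (operator_ring M) = M" "mult (operator_ring M) = (o\<^sub>L)" "one (operator_ring M) = id_blinfun"
  "zero (operator_ring M) = 0" "add (operator_ring M) = (+)"
  by (simp_all add: operator_ring_def)

lemma ring_operator_ring: "ring (operator_ring M)"
proof (rule ringI)
  show "abelian_group (operator_ring M)"
  proof (rule abelian_groupI)
    show "\<exists>y\<in>carrier (operator_ring M). y \<oplus>\<^bsub>operator_ring M\<^esub> x = \<zero>\<^bsub>operator_ring M\<^esub>"
      if "x \<in> carrier (operator_ring M)" for x
      using that scaleR_in[of x "-1"] by (auto intro!: bexI[of _ "- x"])
  qed (auto intro: in_M simp: add_ac)
  show "monoid (operator_ring M)"
    by (rule monoidI) (auto intro: in_M simp: compose_simps)
qed (auto simp: compose_simps)

text \<open>It makes M itself a member of the family of ideals whose intersection is J, so that this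
  family is nonempty.\<close>

lemma closed_M: "closed M"
  unfolding closed_sequential_limits
proof (intro allI impI)
  fix X and L :: "'a \<Rightarrow>\<^sub>L 'a" assume X: "(\<forall>n. X n \<in> M) \<and> X \<longlonglongrightarrow> L"
  show "L \<in> M"
  proof (rule strong_limit_in)
    show "X n \<in> M" for n using X by blast
    show "(\<lambda>n. X n x) \<longlonglongrightarrow> L x" for x by (intro blinfun.tendsto tendsto_const X[THEN conjunct2])
  qed
qed

abbreviation J :: "('a \<Rightarrow>\<^sub>L 'a) set" where "J \<equiv> finite_projection_ideal M"

lemma ideal_J: "ideal J (operator_ring M)"
  unfolding finite_projection_ideal_def
proof (rule ring.i_Intersect[OF ring_operator_ring])
  have "M \<in> {I. ideal I (operator_ring M) \<and> closed I \<and> {P. finite_projection M P} \<subseteq> I}"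
    using ring.oneideal[OF ring_operator_ring] closed_M by (auto simp: finite_projection_def)
  then show "{I. ideal I (operator_ring M) \<and> closed I \<and> {P. finite_projection M P} \<subseteq> I} \<noteq> {}" by blast
qed blast

lemma finite_projection_in_J: "finite_projection M P \<Longrightarrow> P \<in> J"
  by (auto simp: finite_projection_ideal_def)

lemma J_add: "S \<in> J \<Longrightarrow> T \<in> J \<Longrightarrow> S + T \<in> J"
  using additive_subgroup.a_closed[OF ideal.axioms(1)[OF ideal_J], of S T] by simp

lemma J_mult_left: "T \<in> J \<Longrightarrow> S \<in> M \<Longrightarrow> S o\<^sub>L T \<in> J"
  using ideal.I_l_closed[OF ideal_J, of T S] by simp

lemma J_mult_right: "T \<in> J \<Longrightarrow> S \<in> M \<Longrightarrow> T o\<^sub>L S \<in> J"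
  using ideal.I_r_closed[OF ideal_J, of T S] by simp

lemma uminus_in: "T \<in> M \<Longrightarrow> - T \<in> M"
  using scaleR_in[of T "-1"] by simp

lemma essential_norm_le: "H \<in> J \<Longrightarrow> essential_norm M T \<le> norm (H + T)"
  unfolding essential_norm_def quotient_norm_def quotient_map_def a_r_coset_def'
  by (rule cINF_lower) (auto intro!: bdd_belowI2[of _ 0])

lemma zero_notin_spectrum:
  assumes T: "T \<in> M" and S: "S \<in> M" "T o\<^sub>L S = id_blinfun" "S o\<^sub>L T = id_blinfun"
  shows "0 \<notin> spectrum M T"
proof -
  interpret ring "operator_ring M" by (rule ring_operator_ring)
  have "scalar_op 0 = (0 :: 'a \<Rightarrow>\<^sub>L 'a)"
    using scaleC_of_real[of 0] by (intro blinfun_eqI) (simp add: scalar_op.rep_eq)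
  moreover have "T \<ominus>\<^bsub>operator_ring M\<^esub> \<zero>\<^bsub>operator_ring M\<^esub> = T"
    using T by (simp only: minus_eq minus_zero r_zero operator_ring_simps(1))
  moreover have "T \<in> Units (operator_ring M)" using T S by (auto simp: Units_def)
  ultimately show ?thesis by (simp add: spectrum_def algebra_spectrum_def)
qed

text \<open>T and T + H have the same image in the quotient, where the image of S is its
  inverse.\<close>

lemma zero_notin_essential_spectrum:
  assumes T: "T \<in> M" and S: "S \<in> M" "(T + H) o\<^sub>L S = id_blinfun" "S o\<^sub>L (T + H) = id_blinfun" and H: "H \<in> J"
  shows "0 \<notin> essential_spectrum M T"
proof -
  interpret ideal J "operator_ring M" by (rule ideal_J)
  interpret q: ring_hom_ring "operator_ring M" "quotient_algebra M" "quotient_map M"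
    using rcos_ring_hom_ring by (simp add: quotient_algebra_def quotient_map_def[abs_def])
  have HM: "H \<in> M" using H a_subset by auto
  have z: "quotient_map M H = \<zero>\<^bsub>quotient_algebra M\<^esub>"
    using a_rcos_const[OF H] by (simp add: quotient_map_def quotient_algebra_def FactRing_def)
  have add: "quotient_map M (T + H) = quotient_map M T"
    using q.hom_add[of T H] T HM by (simp add: z)
  have "scalar_op 0 = (0 :: 'a \<Rightarrow>\<^sub>L 'a)"
    using scaleC_of_real[of 0] by (intro blinfun_eqI) (simp add: scalar_op.rep_eq)
  then have "quotient_map M (scalar_op 0) = \<zero>\<^bsub>quotient_algebra M\<^esub>" using q.hom_zero by simp
  then have "quotient_map M T \<ominus>\<^bsub>quotient_algebra M\<^esub> quotient_map M (scalar_op 0) = quotient_map M T"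
    using q.hom_closed[of T] T by (simp add: q.S.minus_eq)
  moreover have "quotient_map M T \<in> Units (quotient_algebra M)"
  proof -
    have "quotient_map M T \<otimes>\<^bsub>quotient_algebra M\<^esub> quotient_map M S = \<one>\<^bsub>quotient_algebra M\<^esub>"
      using q.hom_mult[of "T + H" S] q.hom_one S T HM by (simp add: add add_in)
    moreover have "quotient_map M S \<otimes>\<^bsub>quotient_algebra M\<^esub> quotient_map M T = \<one>\<^bsub>quotient_algebra M\<^esub>"
      using q.hom_mult[of S "T + H"] q.hom_one S T HM by (simp add: add add_in)
    ultimately show ?thesis using q.hom_closed[of T] q.hom_closed[of S] S T by (auto simp: Units_def)
  qed
  ultimately show ?thesis by (simp add: essential_spectrum_def algebra_spectrum_def)
qed

end

context sfactor
begin

text \<open>The centre of a factor is scalar, so the identity is its only nonzero central projection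
  and a single nonzero finite projection suffices.\<close>

lemma semifinite_or_type_III: "semifinite_algebra M \<or> type_III M"
proof (rule disjCI)
  assume "\<not> type_III M"
  then obtain F where F: "finite_projection M F" "F \<noteq> 0" by (auto simp: type_III_def)
  show "semifinite_algebra M"
    unfolding semifinite_algebra_def
  proof (intro ballI impI)
    fix Z assume Z: "Z \<in> M \<inter> commutant M" "projection Z \<and> Z \<noteq> 0"
    then obtain c where c: "Z = scalar_op c" using fac by (auto simp: factor_def)
    obtain x where x: "Z x \<noteq> 0" using Z(2) by (metis blinfun_eqI zero_blinfun.rep_eq)
    have "Z (Z x) = Z x" using Z(2) proj_apply by (auto simp: projection_iff)
    then have "c *\<^sub>C (c *\<^sub>C x) = c *\<^sub>C x" by (simp add: c scalar_op.rep_eq)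
    then have "norm ((c - 1) *\<^sub>C Z x) = 0"
      using scaleC_add_left[of "c - 1" 1 "Z x"] scaleC_of_real[of 1 "Z x"] by (simp add: c scalar_op.rep_eq)
    then have "c = 1" using x by (simp add: norm_scaleC)
    then have "Z = id_blinfun"
      using scaleC_of_real[of 1] by (intro blinfun_eqI) (simp add: c scalar_op.rep_eq)
    then show "\<exists>F. finite_projection M F \<and> F \<noteq> 0 \<and> subprojection F Z"
      using F Z(2) by (auto simp: subprojection_def finite_projection_def compose_simps intro!: exI[of _ F])
  qed
qed

lemma not_large_cases:
  assumes "prj p" "\<not> large p"
  obtains "semifinite_algebra M" "p \<in> J" | "type_III M" "p = 0"
proof -
  have "finite_projection M p" using not_finite_large assms by blast
  then show ?thesis using semifinite_or_type_III that finite_projection_in_J by (auto simp: type_III_def)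
qed

text \<open>If p and q are not large they are finite, so p + q lies in J. If p + q were large, a
  partial isometry would conjugate it into the identity; then J contains T and its essential norm is
  0. When there are no nonzero finite projections, p and q vanish.\<close>

lemma lfactorI:
  assumes T: "T \<in> M" "semifinite_algebra M \<Longrightarrow> 0 < essential_norm M T"
  shows "lfactor M"
proof
  fix p q :: "'a \<Rightarrow>\<^sub>L 'a" assume pq: "prj p" "prj q" "large (p + q)"
  show "large p \<or> large q"
  proof (rule ccontr)
    assume n: "\<not> (large p \<or> large q)"
    show False
    proof (cases "semifinite_algebra M")
      case True
      have fin: "r \<in> J" if "prj r" "\<not> large r" for r
        using not_finite_large finite_projection_in_J that by blast
      then have pqJ: "p + q \<in> J" using pq n by (intro J_add) auto
      obtain V r where V: "V \<in> M" "pis V id_blinfun r" "(p + q) o\<^sub>L r = r"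
        using pq(3) unfolding large_def psub_def by blast
      have "(p + q) o\<^sub>L V = V" by (metis V(2,3) pis_left compose_simps(1))
      then have "radj V o\<^sub>L ((p + q) o\<^sub>L V) = id_blinfun" using pis_eq(1)[OF V(2)] by simp
      then have "id_blinfun \<in> J"
        using J_mult_left[OF J_mult_right[OF pqJ V(1)] radj_in[OF V(1)]] by simp
      then have "- T \<in> J" using J_mult_left[of id_blinfun "- T"] T(1) uminus_in by (simp add: compose_simps)
      then show False using essential_norm_le[of "- T" T] T(2)[OF True] by simp
    next
      case False
      then have "r = 0" if "prj r" "\<not> large r" for r :: "'a \<Rightarrow>\<^sub>L 'a" using not_large_cases[OF that] by blast
      then have "p = 0" "q = 0" using pq n by blast+
      then have "p + q = 0" by simp
      then show False using large_ne_0[OF pq(3)] by blast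
    qed
  qed
qed

text \<open>If the spectral projection p up to \<delta> is not large, it is in J or zero. But B + p
  is bounded below by \<open>min \<delta> 1\<close> and hence invertible in M, so 0 would be missing
  from the spectrum in question.\<close>

lemma large_sres:
  assumes B: "B \<in> M" "psd B" and "semifinite_algebra M \<Longrightarrow> 0 \<in> essential_spectrum M B"
    and "type_III M \<Longrightarrow> 0 \<in> spectrum M B" and \<delta>: "0 < \<delta>"
  shows "large (sres B \<delta>)"
proof (rule ccontr)
  assume n: "\<not> large (sres B \<delta>)"
  note r = psd_radj[OF B(2)]
  define p where "p = sres B \<delta>"
  have p: "proj p" "p \<in> M" "B o\<^sub>L p = p o\<^sub>L B"
    using sres(1)[OF r] sres_in[OF r B(1)] bicom_commute[OF sres(2)[OF r]] by (auto simp: p_def)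
  define D where "D = B + p"
  have D: "psd D" using B(2) p(1)
    by (auto simp: D_def psd_def proj_radj blinfun.bilinear_simps ip_simps proj_ip_self)
  have ge: "min \<delta> 1 * (norm x)\<^sup>2 \<le> ip (D x) x" for x
  proof -
    have "p (x - p x) = 0" by (simp add: blinfun.bilinear_simps proj_apply[OF p(1)])
    then have "\<delta> * (norm (x - p x))\<^sup>2 \<le> ip (B (x - p x)) (x - p x)" using sres_ge[OF r] by (simp add: p_def)
    moreover have "0 \<le> ip (B (p x)) (p x)" by (rule psd_ge0[OF B(2)])
    moreover have "ip (D x) x = ip (B x) x + (norm (p x))\<^sup>2"
      by (simp add: D_def blinfun.bilinear_simps ip_simps proj_ip_self[OF p(1)])
    moreover have "min \<delta> 1 * (norm (x - p x))\<^sup>2 \<le> \<delta> * (norm (x - p x))\<^sup>2"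
      "min \<delta> 1 * (norm (p x))\<^sup>2 \<le> 1 * (norm (p x))\<^sup>2" by (intro mult_right_mono; simp)+
    moreover have "min \<delta> 1 * (norm x)\<^sup>2 = min \<delta> 1 * (norm (p x))\<^sup>2 + min \<delta> 1 * (norm (x - p x))\<^sup>2"
      by (simp only: proj_norm_sq[OF p(1), of x] distrib_left)
    ultimately show ?thesis using quadratic_split[OF p(1,3), of x] by linarith
  qed
  note i = invop[OF D _ ge]
  have S: "invop D \<in> M" "D o\<^sub>L invop D = id_blinfun" "invop D o\<^sub>L D = id_blinfun"
    using i(1,2,4) bicom_in[of D "invop D"] \<delta> B(1) p(2) add_in by (auto simp: D_def)
  have "prj p" using p by (simp add: prj_def)
  then show False using n unfolding p_def[symmetric]
  proof (cases rule: not_large_cases)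
    case 1
    then show False using zero_notin_essential_spectrum[OF B(1) S(1), of p] S assms(3) by (simp add: D_def)
  next
    case 2
    then show False using zero_notin_spectrum[OF B(1) S(1)] S assms(4) by (simp add: D_def)
  qed
qed

text \<open>If the part of A above t is not large, it is negligible modulo J or zero, and the
  (essential) norm of A is at most the norm of A on the spectral projection up to t, which is at
  most t.\<close>

lemma large_compl_sres:
  assumes A: "A \<in> M" "psd A" and "semifinite_algebra M \<Longrightarrow> \<gamma> \<le> essential_norm M A"
    and "type_III M \<Longrightarrow> \<gamma> \<le> norm A" and c: "0 < \<gamma>" "c < \<gamma>"
  shows "large (id_blinfun - sres A c)"
proof -
  note r = psd_radj[OF A(2)]
  define e where "e = sres A"
  have e: "proj (e t)" "e t \<in> M" "A o\<^sub>L e t = e t o\<^sub>L A" for t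
    using sres(1)[OF r] sres_in[OF r A(1)] bicom_commute[OF sres(2)[OF r]] by (auto simp: e_def)
  have pe: "prj (id_blinfun - e t)" for t using e proj_compl in_M by (auto simp: prj_def)
  have pos: "large (id_blinfun - e t)" if t: "0 \<le> t" "t < \<gamma>" for t
  proof (rule ccontr)
    assume n: "\<not> large (id_blinfun - e t)"
    have ip: "ip ((A o\<^sub>L e t) x) x = ip (A (e t x)) (e t x)" for x
    proof -
      have "(A o\<^sub>L e t) x = e t (A (e t x))"
        by (metis blinfun_apply_blinfun_compose e(1,3) proj_apply)
      then show ?thesis by (simp only: proj_ip[OF e(1)])
    qed
    have S: "psd (A o\<^sub>L e t)"
      unfolding psd_def
    proof (intro conjI allI)
      show "radj (A o\<^sub>L e t) = A o\<^sub>L e t" by (simp add: radj_compose r proj_radj e)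
      show "0 \<le> ip ((A o\<^sub>L e t) x) x" for x unfolding ip by (rule psd_ge0[OF A(2)])
    qed
    have "norm (A o\<^sub>L e t) \<le> t"
    proof (rule psd_norm_le[OF S t(1)])
      fix x
      have "ip ((A o\<^sub>L e t) x) x = ip (A (e t x)) (e t x)" by (rule ip)
      also have "\<dots> \<le> t * (norm (e t x))\<^sup>2"
        using sres(3)[OF r] proj_apply[OF e(1)] by (simp add: e_def)
      also have "\<dots> \<le> t * (norm x)\<^sup>2"
        using t proj_norm_le[OF e(1)] by (intro mult_left_mono power_mono) auto
      finally show "ip ((A o\<^sub>L e t) x) x \<le> t * (norm x)\<^sup>2" .
    qed
    then have nt: "norm (A o\<^sub>L e t) < \<gamma>" using t by simp
    from pe n show False
    proof (cases rule: not_large_cases)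
      case 1
      have "- A o\<^sub>L (id_blinfun - e t) \<in> J" by (rule J_mult_left[OF 1(2) uminus_in[OF A(1)]])
      from essential_norm_le[OF this, of A] have "essential_norm M A \<le> norm (A o\<^sub>L e t)"
        by (simp add: compose_simps)
      then show False using assms(3)[OF 1(1)] nt by simp
    next
      case 2
      then have "A o\<^sub>L e t = A" by (simp add: compose_simps)
      then show False using assms(4)[OF 2(1)] nt by simp
    qed
  qed
  show ?thesis
  proof (cases "0 \<le> c")
    case True then show ?thesis using pos[of c] c by (simp add: e_def)
  next
    case False
    have "e c o\<^sub>L e 0 = e c" unfolding e_def by (rule sres_mono'[OF r]) (use False in simp)
    then have "(id_blinfun - e c) o\<^sub>L (id_blinfun - e 0) = id_blinfun - e 0" by (simp add: compose_simps)
    then show ?thesis using large_mono[OF pos[of 0]] pe c by (simp add: e_def)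
  qed
qed

end

section \<open>The theorem\<close>

context lfactor
begin

text \<open>The spectral sequence is taken at the midpoints between \<open>o' n\<close> and
  \<gamma>; half the gap becomes the slack.\<close>

lemma exists_reserve:
  assumes A: "A \<in> M" "psd A" and large: "\<And>c. c < \<gamma> \<Longrightarrow> large (id_blinfun - sres A c)"
    and o': "\<And>n. o' n < \<gamma>"
  shows "\<exists>Q. reserve o' A Q"
proof -
  define c where "c n = (o' n + \<gamma>) / 2" for n
  have c: "c n < \<gamma>" "o' n < c n" for n using o'[of n] by (simp_all add: c_def)
  have "\<exists>Q. orth Q \<and> (\<forall>n. large (Q n) \<and> id_blinfun o\<^sub>L Q n = Q n \<and> A o\<^sub>L Q n = Q n o\<^sub>L A \<and>
      (\<forall>x. Q n x = x \<longrightarrow> c n * (norm x)\<^sup>2 \<le> ip (A x) x))"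
    by (rule large_spectral_sequence[OF A(1) psd_radj[OF A(2)] prj_id _ _ c(1)])
      (simp_all add: compose_simps large)
  then obtain Q where Q: "orth Q" "\<And>n. large (Q n)" "\<And>n. A o\<^sub>L Q n = Q n o\<^sub>L A"
    "\<And>n x. Q n x = x \<Longrightarrow> c n * (norm x)\<^sup>2 \<le> ip (A x) x" by blast
  have "\<exists>\<eta>>0. \<forall>x. Q n x = x \<longrightarrow> (o' n + \<eta>) * (norm x)\<^sup>2 \<le> ip (A x) x" for n
    by (rule exI[of _ "c n - o' n"]) (use c(2)[of n] Q(4)[of n] in auto)
  then show ?thesis using A Q by (auto simp: reserve_def)
qed

text \<open>The difference of the two resolution projections is the spectral projection for
  (\<beta>, \<gamma>]; a vector in its range is killed by the lower and fixed by the upper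
  one.\<close>

lemma admissible_sres:
  assumes B: "B \<in> M" "psd B" and "\<And>\<delta>. 0 < \<delta> \<Longrightarrow> large (sres B \<delta>)"
    and "\<And>x. (\<lambda>n. sres B (o' n) x) \<longlonglongrightarrow> x" and \<beta>: "\<beta> \<le> \<gamma>"
  shows "admissible \<beta> \<gamma> o' B (sres B \<gamma> - sres B \<beta>)"
proof -
  note r = psd_radj[OF B(2)]
  have p: "proj (sres B t)" for t by (rule sres(1)[OF r])
  have m: "sres B \<gamma> o\<^sub>L sres B \<beta> = sres B \<beta>" by (rule sres_mono[OF r \<beta>])
  have pd: "proj (sres B \<gamma> - sres B \<beta>)" by (rule proj_diff[OF p p m])
  have "\<beta> * (norm x)\<^sup>2 \<le> ip (B x) x \<and> ip (B x) x \<le> \<gamma> * (norm x)\<^sup>2"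
    if "(sres B \<gamma> - sres B \<beta>) x = x" for x
  proof
    have x: "sres B \<gamma> x - sres B \<beta> x = x" using that by (simp add: blinfun.bilinear_simps)
    have mm: "sres B \<beta> (sres B \<gamma> x) = sres B \<beta> x"
      using sres_mono'[OF r \<beta>] by (metis blinfun_apply_blinfun_compose)
    have "sres B \<beta> x = sres B \<beta> (sres B \<gamma> x) - sres B \<beta> (sres B \<beta> x)"
      using x by (metis blinfun.diff_right)
    then have z: "sres B \<beta> x = 0" by (simp add: mm proj_apply[OF p])
    then show "\<beta> * (norm x)\<^sup>2 \<le> ip (B x) x" by (rule sres_ge[OF r])
    show "ip (B x) x \<le> \<gamma> * (norm x)\<^sup>2" using x z by (intro sres(3)[OF r]) simp
  qed
  moreover have "prj (sres B \<gamma> - sres B \<beta>)" using pd sres_in[OF r B(1)] diff_in by (auto simp: prj_def)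
  moreover have "(sres B \<gamma> - sres B \<beta>) o\<^sub>L B = B o\<^sub>L (sres B \<gamma> - sres B \<beta>)"
    using bicom_commute[OF sres(2)[OF r]] by (simp add: compose_simps)
  ultimately show ?thesis using assms by (simp add: admissible_def)
qed

lemma sum_of_unitary_copies_spectral:
  assumes A: "A \<in> M" "psd A" and B: "\<And>j. B j \<in> M" "\<And>j. psd (B j)"
    and largeA: "\<And>c. c < \<gamma>A \<Longrightarrow> large (id_blinfun - sres A c)"
    and largeB: "\<And>j \<delta>. 0 < \<delta> \<Longrightarrow> large (sres (B j) \<delta>)"
    and conv: "\<And>j x. (\<lambda>n. sres (B j) (o' n) x) \<longlonglongrightarrow> x"
    and c: "0 < \<beta>" "\<beta> \<le> \<gamma>" "\<gamma> < c" and o': "incseq o'" "\<And>n. c \<le> o' n" "\<And>n. o' n < \<gamma>A"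
    and N: "\<And>j. psub (kerp A) (kerp (B j))" and P: "prj P" "P \<noteq> 0"
    and PG: "\<exists>\<^sub>\<infinity>j. psub P (sres (B j) \<gamma> - sres (B j) \<beta>)"
  shows "\<exists>C. (\<forall>j. unitarily_equivalent M (C j) (B j)) \<and> sot_sums C A"
proof -
  obtain Q where Q: "reserve o' A Q" using exists_reserve[where o' = o', OF A largeA o'(3)] by blast
  have "admissible \<beta> \<gamma> o' (B j) (sres (B j) \<gamma> - sres (B j) \<beta>)" for j
    by (rule admissible_sres[OF B largeB conv c(2)])
  note adm = this
  have "infinite {j. psub P (sres (B j) \<gamma> - sres (B j) \<beta>)}" using PG by (simp add: INFM_iff_infinite)
  then show ?thesis
    by (rule sum_of_unitary_copies[OF c o'(1,2) less_imp_le[OF o'(3)] adm Q N P]) simp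
qed

end

theorem theorem4p3:
  fixes M :: "('a :: complex_hilbert_space \<Rightarrow>\<^sub>L 'a) set"
    and A :: "'a \<Rightarrow>\<^sub>L 'a"
    and B :: "nat \<Rightarrow> ('a \<Rightarrow>\<^sub>L 'a)"
    and \<alpha> :: real
  assumes "factor M" and "sigma_finite_algebra M" and "infinite_algebra M"
    and "A \<in> M" and "positive_op A"
    and "\<And>j. B j \<in> M" and "\<And>j. positive_op (B j)"
    and "bdd_above (range (\<lambda>j. norm (B j)))" and "\<alpha> = (SUP j. norm (B j))"
    and "\<And>j. mvn_subequivalent M (null_projection A) (null_projection (B j))"
    and "\<And>j. semifinite_algebra M \<Longrightarrow> 0 \<in> essential_spectrum M (B j)"
    and "\<And>j. type_III M \<Longrightarrow> 0 \<in> spectrum M (B j)"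
    and "((semifinite_algebra M \<longrightarrow> essential_norm M A > \<alpha>) \<and>
          (type_III M \<longrightarrow> norm A > \<alpha>) \<and>
          (\<exists>\<beta> P. \<beta> > 0 \<and> P \<in> M \<and> projection P \<and> P \<noteq> 0 \<and>
             (\<exists>\<^sub>\<infinity>j. mvn_subequivalent M P (spectral_projection {\<beta><..} (B j)))))
       \<or> ((semifinite_algebra M \<longrightarrow> essential_norm M A \<ge> \<alpha>) \<and>
          (type_III M \<longrightarrow> norm A \<ge> \<alpha>) \<and>
          (\<forall>j. spectral_projection {\<alpha>} (B j) = 0) \<and>
          (\<exists>\<beta> \<gamma> P. 0 < \<beta> \<and> \<beta> < \<gamma> \<and> \<gamma> < \<alpha> \<and> P \<in> M \<and> projection P \<and> P \<noteq> 0 \<and>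
             (\<exists>\<^sub>\<infinity>j. mvn_subequivalent M P (spectral_projection {\<beta><..\<gamma>} (B j)))))"
  shows "\<exists>C :: nat \<Rightarrow> ('a \<Rightarrow>\<^sub>L 'a). (\<forall>j. unitarily_equivalent M (C j) (B j)) \<and> sot_sums C A"
proof -
  interpret sfactor M by unfold_locales (rule assms)+
  have cA: "complex_linear A" "psd A" using positive_op_psd[OF assms(5)] .
  have cB: "complex_linear (B j)" "psd (B j)" for j using positive_op_psd[OF assms(7)] .
  note rB = psd_radj[OF cB(2)]
  have nB: "norm (B j) \<le> \<alpha>" for j unfolding assms(9) by (rule cSUP_upper[OF _ assms(8)]) simp
  have \<alpha>0: "0 \<le> \<alpha>" using nB[of 0] norm_ge_zero[of "B 0"] by linarith
  have top: "sres (B j) t = id_blinfun" if "\<alpha> \<le> t" for j t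
  proof (rule sres_eq_id[OF rB])
    fix x :: 'a
    have "norm (B j) * (norm x)\<^sup>2 \<le> t * (norm x)\<^sup>2" using nB[of j] that by (intro mult_right_mono) auto
    then show "ip (B j x) x \<le> t * (norm x)\<^sup>2" using ip_apply_le[of "B j" x] by linarith
  qed
  have largeB: "large (sres (B j) \<delta>)" if "0 < \<delta>" for j \<delta>
    using large_sres[OF assms(6) cB(2) assms(11,12) that] .
  have N: "psub (kerp A) (kerp (B j))" for j
  proof -
    have "prj (kerp (B j))" using kerp[of "B j"] kerp_in[OF rB assms(6)] by (simp add: prj_def)
    then show ?thesis
      using assms(10)[of j] mvn_subequivalent_psub[of "kerp A" "kerp (B j)"] kerp[of A]
      by (simp add: null_projection_eq cA cB psd_radj)
  qed
  have mp: "psub P (sres (B j) t - sres (B j) s)"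
    if "projection P" "mvn_subequivalent M P (sres (B j) t - sres (B j) s)" "s \<le> t" for P :: "'a \<Rightarrow>\<^sub>L 'a" and j s t
  proof -
    have "prj (sres (B j) t - sres (B j) s)"
      using proj_diff[OF sres(1)[OF rB] sres(1)[OF rB] sres_mono[OF rB that(3)]] sres_in[OF rB assms(6)] diff_in
      by (auto simp: prj_def)
    then show ?thesis using that mvn_subequivalent_psub by (auto simp: projection_iff)
  qed
  from assms(13) show ?thesis
  proof (elim disjE conjE exE)
    fix \<beta> P assume n: "semifinite_algebra M \<longrightarrow> \<alpha> < essential_norm M A" "type_III M \<longrightarrow> \<alpha> < norm A"
      and \<beta>: "0 < \<beta>" and P: "P \<in> M" "projection P" "P \<noteq> 0"
      and inf: "\<exists>\<^sub>\<infinity>j. mvn_subequivalent M P (spectral_projection {\<beta><..} (B j))"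
    \<comment> \<open>The value \<alpha> + 1 stands in where the type imposes no bound; \<gamma>A
      exceeds \<alpha> and is at most each norm to which a hypothesis applies.\<close>
    define \<gamma>A where "\<gamma>A = min (if semifinite_algebra M then essential_norm M A else \<alpha> + 1)
      (if type_III M then norm A else \<alpha> + 1)"
    have \<gamma>A: "\<alpha> < \<gamma>A" using n by (auto simp: \<gamma>A_def)
    interpret lfactor M by (rule lfactorI[OF assms(4)]) (use n \<alpha>0 in auto)
    have prjP: "prj P" using P by (simp add: prj_def projection_iff)
    \<comment> \<open>For \<beta> > \<alpha> the spectral projection above \<beta> is zero, and the
      nonzero P embeds in it for no j.\<close>
    have \<beta>\<alpha>: "\<beta> \<le> \<alpha>"
    proof (rule ccontr)
      assume "\<not> \<beta> \<le> \<alpha>"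
      moreover obtain j where "mvn_subequivalent M P (spectral_projection {\<beta><..} (B j))"
        using inf INFM_EX by blast
      ultimately have "mvn_subequivalent M P (sres (B j) \<beta> - sres (B j) \<beta>)"
        using top[of \<beta> j] by (simp add: spectral_projection_greaterThan[OF cB(1) rB])
      then have "psub P (sres (B j) \<beta> - sres (B j) \<beta>)" by (intro mp P) auto
      then obtain V r where V: "pis V P r" "0 o\<^sub>L r = r" by (auto simp: psub_def)
      then have "V = 0" using pis_left[OF V(1)] by (simp add: compose_simps)
      then show False using pis_eq(1)[OF V(1)] P(3) by (simp add: compose_simps)
    qed
    have *: "sres (B j) \<alpha> - sres (B j) \<beta> = spectral_projection {\<beta><..} (B j)" for j
      using top[of \<alpha> j] by (simp add: spectral_projection_greaterThan[OF cB(1) rB])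
    have pinf: "\<exists>\<^sub>\<infinity>j. psub P (sres (B j) \<alpha> - sres (B j) \<beta>)"
      by (rule INFM_mono[OF inf mp[OF P(2) _ \<beta>\<alpha>]]) (simp only: *)
    \<comment> \<open>The constant sequence c serves as \<open>o'\<close>: it is above every norm of
      a summand, so its resolution projections are the identity, and below \<gamma>A, which leaves
      room for slack.\<close>
    obtain c where c: "\<alpha> < c" "c < \<gamma>A" using dense[OF \<gamma>A] by blast
    show ?thesis
    proof (rule sum_of_unitary_copies_spectral[OF assms(4) cA(2) assms(6) cB(2) _ largeB _ \<beta> \<beta>\<alpha> c(1) _ _ _ N prjP P(3) pinf])
      show "large (id_blinfun - sres A t)" if "t < \<gamma>A" for t
        by (rule large_compl_sres[OF assms(4) cA(2) _ _ _ that]) (use \<gamma>A \<alpha>0 in \<open>auto simp: \<gamma>A_def min_def\<close>)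
      show "(\<lambda>n::nat. sres (B j) c x) \<longlonglongrightarrow> x" for j x using top[of c j] c(1) by simp
      show "incseq (\<lambda>n::nat. c)" "c \<le> c" "c < \<gamma>A" using c(2) by (auto simp: incseq_def)
    qed
  next
    fix \<beta> \<gamma> P assume n: "semifinite_algebra M \<longrightarrow> \<alpha> \<le> essential_norm M A" "type_III M \<longrightarrow> \<alpha> \<le> norm A"
      and z: "\<forall>j. spectral_projection {\<alpha>} (B j) = 0"
      and \<beta>: "0 < \<beta>" "\<beta> < \<gamma>" "\<gamma> < \<alpha>" and P: "P \<in> M" "projection P" "P \<noteq> 0"
      and inf: "\<exists>\<^sub>\<infinity>j. mvn_subequivalent M P (spectral_projection {\<beta><..\<gamma>} (B j))"
    interpret lfactor M by (rule lfactorI[OF assms(4)]) (use n \<beta> in auto)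
    have prjP: "prj P" using P by (simp add: prj_def projection_iff)
    have pinf: "\<exists>\<^sub>\<infinity>j. psub P (sres (B j) \<gamma> - sres (B j) \<beta>)"
      by (rule INFM_mono[OF inf mp[OF P(2) _ less_imp_le[OF \<beta>(2)]]])
        (simp only: spectral_projection_greaterThanAtMost[OF cB(1) rB less_imp_le[OF \<beta>(2)]])
    \<comment> \<open>The offset 2 makes \<open>o' 0\<close> the midpoint of \<gamma> and \<alpha>;
      it plays the role of c and must exceed \<gamma>, while every term stays below
      \<alpha>.\<close>
    define o' where "o' n = \<alpha> - (\<alpha> - \<gamma>) / real (n + 2)" for n
    have inc: "incseq o'" unfolding incseq_def o'_def using \<beta>(3)
      by (auto intro!: divide_left_mono)
    have lt: "o' n < \<alpha>" for n using \<beta>(3) by (simp add: o'_def)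
    have lim: "o' \<longlonglongrightarrow> \<alpha>"
    proof -
      have "(\<lambda>n. (\<alpha> - \<gamma>) / real (n + 2)) \<longlonglongrightarrow> 0"
        by (rule LIMSEQ_ignore_initial_segment[OF lim_const_over_n])
      then show ?thesis using tendsto_diff[OF tendsto_const[of \<alpha>]] unfolding o'_def by fastforce
    qed
    show ?thesis
    proof (rule sum_of_unitary_copies_spectral[OF assms(4) cA(2) assms(6) cB(2) _ largeB _ \<beta>(1) less_imp_le[OF \<beta>(2)] _ inc _ lt N prjP P(3) pinf])
      show "large (id_blinfun - sres A t)" if "t < \<alpha>" for t
        by (rule large_compl_sres[OF assms(4) cA(2) _ _ _ that]) (use \<beta> n in auto)
      \<comment> \<open>Here the vanishing of the spectral projection of the point \<alpha>
        enters.\<close>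
      show "(\<lambda>n. sres (B j) (o' n) x) \<longlonglongrightarrow> x" for j x
        using sres_tendsto_below[OF cB(1) rB z[rule_format] inc lt lim, of j x] top[of \<alpha> j] by simp
      show "\<gamma> < o' 0" using \<beta>(3) by (simp add: o'_def field_simps)
      show "o' 0 \<le> o' n" for n using inc by (simp add: incseq_def)
    qed
  qed
qed

end
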